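(* Let $p\ge2$ be an even number, let $\xi(0)$ be $\mathcal F_0$-measurable with $\xi(0)\in L^p(\Omega,L^p(\mathbb T^2))$ and $\xi(0)\in\mathcal E$ a.s., and suppose $$\sum_{k\in\mathbb Z_0^2}|k|^2c_{-k}^2|e_k|_p^2<\infty.$$ Let $\{\xi_i\}_{i=0}^n$ be the numerical solution of the splitting semi-implicit Euler method with step size $\tau=T/n$ and initial value $\xi(0)$. Then for all $1\le q\le p$, $$\sup_{1\le i\le n}\|\xi_i\|_{L^q(\Omega,L^q(\mathbb T^2))}\le C(p,T,\xi(0)),$$ where the constant is independent of $\tau$. Moreover, if $\xi(0)\in L^r(\Omega,L^r(\mathbb T^2))$ for all large enough $r\in\mathbb N$, then for every $r\in\mathbb N$, $$\mathbb E\sup_{1\le i\le n}|\xi_i|_4^r\le C(r,T,\xi(0))$$ with a constant independent of $\tau$, and for any $\varepsilon>0$ there is an almost surely finite random constant $C(T,\xi(0),\omega,\varepsilon)$, independent of $\tau$, such that $$\sup_{1\le i\le n}|\xi_i|_4\le C(T,\xi(0),\omega,\varepsilon)\,\tau^{-\varepsilon}\quad\text{a.s.}$$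
   Context: Spaces. $\mathbb T^2=\mathbb R^2/\mathbb Z^2$; $|\cdot|_p$ is the $L^p(\mathbb T^2)$-norm; $\mathcal E$ is the space of square integrable periodic functions on $\mathbb T^2$ with zero mean. Constants may also depend on the noise coefficients $\{c_k\}$. Noise. $\mathbb Z_0^2=\mathbb Z^2\setminus\{0\}$, $\mathbb Z_+^2=\{k\in\mathbb Z_0^2:k_1>0\text{ or }k_1=0,k_2>0\}$, $\mathbb Z_-^2=-\mathbb Z_+^2$; $e_k(x)=\sqrt2\cos(2\pi k\cdot x)$ for $k\in\mathbb Z_+^2$, $e_k(x)=\sqrt2\sin(2\pi k\cdot x)$ for $k\in\mathbb Z_-^2$. $\{\beta_k\}_{k\in\mathbb Z_0^2}$ are independent standard real Wiener processes on a complete filtered probability space $(\Omega,\mathcal F,\{\mathcal F_t\}_{t\ge0},\mathbb P)$, $\tilde\beta_k=-\beta_{-k}$, $c_k\ge 0$ are real numbers, and $W^{curl}(t)=2\pi\sum_{k\in\mathbb Z_0^2}|k|c_{-k}\tilde\beta_k(t)e_k$. Biot–Savart operator. For $\xi\in\mathcal E$, $K*\xi$ ($K$ the Biot–Savart kernel on $\mathbb T^2$) is the unique zero-mean divergence free vector field $u$ with $\nabla^\perp\cdot u=\partial_1u_2-\partial_2u_1=\xi$. Numerical method. $T>0$ is fixed. For $n\in\mathbb N^+$ let $\tau=T/n$, $t_i=i\tau$, $\Delta W^{curl}_{i+1}=W^{curl}(t_{i+1})-W^{curl}(t_i)$. For $\xi\in\mathcal E$, $\Phi_\tau(\xi)\in\mathcal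 E$ is determined by $\Phi_\tau(\xi)=\xi-\tau(K*\xi)\cdot\nabla\Phi_\tau(\xi)$, understood in the distributional sense: $\langle\Phi_\tau(\xi),\zeta\rangle=\langle\xi,\zeta\rangle+\tau\langle(K*\xi)\cdot\nabla\zeta,\Phi_\tau(\xi)\rangle$ for all $\zeta\in W^{1,4}(\mathbb T^2)\cap\mathcal E$, with $\langle\cdot,\cdot\rangle$ the $L^2(\mathbb T^2)$ inner product. The splitting semi-implicit Euler method is $\xi_0=\xi(0)$, $\xi_{i+1}=\Phi_\tau(\xi_i)+\Delta W^{curl}_{i+1}$, $0\le i\le n-1$; the sequence $\{\xi_i\}$ is $\{\mathcal F_{t_i}\}$-adapted. *)

theory Defs
  imports "HOL-Probability.Probability"
begin

section \<open>Function spaces on the torus\<close>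

text \<open>
  A function on the torus is a \<open>\<int>\<^sup>2\<close>-periodic function on the plane; integrals over the torus are
  integrals over the fundamental domain. Elements of \<open>L\<^sup>p\<close> are represented by Borel measurable
  functions; two representatives are the same element iff they agree almost everywhere.
\<close>

type_synonym plane = "real \<times> real"

definition torus :: "plane measure" where
  "torus = restrict_space lborel ({0..<1} \<times> {0..<1})"

definition periodic :: "(plane \<Rightarrow> 'b) \<Rightarrow> bool" where
  "periodic f \<longleftrightarrow> (\<forall>x (m::int) (n::int). f (x + (of_int m, of_int n)) = f x)"

definition Lp_space :: "real \<Rightarrow> (plane \<Rightarrow> real) set" where
  "Lp_space p = {f. f \<in> borel_measurable borel \<and> periodic f \<and>
                    integrable torus (\<lambda>x. \<bar>f x\<bar> powr p)}"

definition Lp_norm :: "real \<Rightarrow> (plane \<Rightarrow> real) \<Rightarrow> real" where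
  "Lp_norm p f = (\<integral>x. \<bar>f x\<bar> powr p \<partial>torus) powr (1 / p)"

definition L2_inner :: "(plane \<Rightarrow> real) \<Rightarrow> (plane \<Rightarrow> real) \<Rightarrow> real" where
  "L2_inner f g = (\<integral>x. f x * g x \<partial>torus)"

definition zero_mean_L2 :: "(plane \<Rightarrow> real) set"  (\<open>\<E>\<close>) where
  "\<E> = {f \<in> Lp_space 2. (\<integral>x. f x \<partial>torus) = 0}"

text \<open>
  The Borel sigma-algebra of \<open>L\<^sup>p\<close>, generated by the sets that are open for the \<open>L\<^sup>p\<close>-seminorm on
  representatives. Such sets are closed under almost everywhere equality.
\<close>

definition Lp_borel :: "real \<Rightarrow> (plane \<Rightarrow> real) measure" where
  "Lp_borel p = sigma (Lp_space p)
     {U. U \<subseteq> Lp_space p \<and>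
         (\<forall>f\<in>U. \<exists>e>0. \<forall>g\<in>Lp_space p. Lp_norm p (\<lambda>x. g x - f x) < e \<longrightarrow> g \<in> U)}"

text \<open>
  Membership in and norm of the Bochner space \<open>L\<^sup>q(\<Omega>, L\<^sup>q)\<close>. As \<open>L\<^sup>q\<close> is separable for finite \<open>q\<close>, strong
  measurability is Borel measurability after modification on a null set. The real-valued norms are
  only meaningful together with membership.
\<close>

definition in_Lq_Lq :: "'w measure \<Rightarrow> real \<Rightarrow> ('w \<Rightarrow> plane \<Rightarrow> real) \<Rightarrow> bool" where
  "in_Lq_Lq M q X \<longleftrightarrow>
     (\<exists>Y \<in> M \<rightarrow>\<^sub>M Lp_borel q. AE \<omega> in M. X \<omega> = Y \<omega>) \<and>
     integrable M (\<lambda>\<omega>. Lp_norm q (X \<omega>) powr q)"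

definition Lq_Lq_norm :: "'w measure \<Rightarrow> real \<Rightarrow> ('w \<Rightarrow> plane \<Rightarrow> real) \<Rightarrow> real" where
  "Lq_Lq_norm M q X = (\<integral>\<omega>. Lp_norm q (X \<omega>) powr q \<partial>M) powr (1 / q)"


section \<open>Weak derivatives and the Biot--Savart operator\<close>

text \<open>\<open>D i j\<close> is the partial derivative of order \<open>i\<close> in the first and \<open>j\<close> in the second variable.\<close>

definition smooth :: "(plane \<Rightarrow> real) \<Rightarrow> bool" where
  "smooth f \<longleftrightarrow> (\<exists>D :: nat \<Rightarrow> nat \<Rightarrow> plane \<Rightarrow> real. D 0 0 = f \<and>
     (\<forall>i j x. (D i j has_derivative
        (\<lambda>h. fst h * D (Suc i) j x + snd h * D i (Suc j) x)) (at x)))"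

definition test_function :: "(plane \<Rightarrow> real) \<Rightarrow> bool" where
  "test_function \<phi> \<longleftrightarrow> smooth \<phi> \<and> periodic \<phi>"

definition grad :: "(plane \<Rightarrow> real) \<Rightarrow> plane \<Rightarrow> plane" where
  "grad \<phi> x = (frechet_derivative \<phi> (at x) (1, 0), frechet_derivative \<phi> (at x) (0, 1))"

definition weak_gradient :: "(plane \<Rightarrow> real) \<Rightarrow> (plane \<Rightarrow> plane) \<Rightarrow> bool" where
  "weak_gradient f g \<longleftrightarrow> (\<forall>\<phi>. test_function \<phi> \<longrightarrow>
     L2_inner f (\<lambda>x. fst (grad \<phi> x)) = - L2_inner (\<lambda>x. fst (g x)) \<phi> \<and>
     L2_inner f (\<lambda>x. snd (grad \<phi> x)) = - L2_inner (\<lambda>x. snd (g x)) \<phi>)"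

text \<open>\<open>f\<close> belongs to the Sobolev space \<open>W\<^sup>1\<^sup>,\<^sup>p\<close>, with weak gradient \<open>g\<close>.\<close>

definition in_W1p_grad :: "real \<Rightarrow> (plane \<Rightarrow> real) \<Rightarrow> (plane \<Rightarrow> plane) \<Rightarrow> bool" where
  "in_W1p_grad p f g \<longleftrightarrow> f \<in> Lp_space p \<and>
     (\<lambda>x. fst (g x)) \<in> Lp_space p \<and> (\<lambda>x. snd (g x)) \<in> Lp_space p \<and> weak_gradient f g"

text \<open>
  Zero mean, \<open>\<partial>\<^sub>1 u\<^sub>1 + \<partial>\<^sub>2 u\<^sub>2 = 0\<close> and \<open>\<partial>\<^sub>1 u\<^sub>2 - \<partial>\<^sub>2 u\<^sub>1 = \<xi>\<close>, the derivatives being distributional.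
\<close>

definition is_biot_savart :: "(plane \<Rightarrow> real) \<Rightarrow> (plane \<Rightarrow> plane) \<Rightarrow> bool" where
  "is_biot_savart \<xi> u \<longleftrightarrow> (\<lambda>x. fst (u x)) \<in> \<E> \<and> (\<lambda>x. snd (u x)) \<in> \<E> \<and>
     (\<forall>\<phi>. test_function \<phi> \<longrightarrow>
        (\<integral>x. fst (u x) * fst (grad \<phi> x) + snd (u x) * snd (grad \<phi> x) \<partial>torus) = 0 \<and>
        - (\<integral>x. snd (u x) * fst (grad \<phi> x) - fst (u x) * snd (grad \<phi> x) \<partial>torus) = L2_inner \<xi> \<phi>)"

text \<open>For \<open>\<xi> \<in> \<E>\<close> the choice is unique up to almost everywhere equality.\<close>

definition biot_savart :: "(plane \<Rightarrow> real) \<Rightarrow> plane \<Rightarrow> plane" where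
  "biot_savart \<xi> = (SOME u. is_biot_savart \<xi> u)"


section \<open>The noise\<close>

definition Z0 :: "(int \<times> int) set" where
  "Z0 = UNIV - {(0, 0)}"

definition Zplus :: "(int \<times> int) set" where
  "Zplus = {k \<in> Z0. fst k > 0 \<or> fst k = 0 \<and> snd k > 0}"

definition kvec :: "int \<times> int \<Rightarrow> plane" where
  "kvec k = (of_int (fst k), of_int (snd k))"

text \<open>Used for \<open>k \<in> Z0\<close> only, where \<open>k \<notin> Zplus\<close> means \<open>- k \<in> Zplus\<close>.\<close>

definition e_basis :: "int \<times> int \<Rightarrow> plane \<Rightarrow> real" where
  "e_basis k x = (if k \<in> Zplus then sqrt 2 * cos (2 * pi * (kvec k \<bullet> x))
                  else sqrt 2 * sin (2 * pi * (kvec k \<bullet> x)))"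

text \<open>Only the times \<open>t \<ge> 0\<close> matter; \<open>F\<close> is unconstrained at negative times.\<close>

locale complete_filtered_prob_space = prob_space M + complete_measure M
  for M :: "'w measure" and F :: "real \<Rightarrow> 'w measure" +
  assumes subalgebra_F: "0 \<le> t \<Longrightarrow> subalgebra M (F t)"
    and mono_F: "0 \<le> s \<Longrightarrow> s \<le> t \<Longrightarrow> sets (F s) \<subseteq> sets (F t)"
    and null_F: "null_sets M \<subseteq> sets (F 0)"

definition wiener_process :: "'w measure \<Rightarrow> (real \<Rightarrow> 'w measure) \<Rightarrow> (real \<Rightarrow> 'w \<Rightarrow> real) \<Rightarrow> bool" where
  "wiener_process M F B \<longleftrightarrow>
     (\<forall>t\<ge>0. B t \<in> borel_measurable (F t)) \<and>
     (AE \<omega> in M. B 0 \<omega> = 0) \<and>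
     (AE \<omega> in M. continuous_on {0..} (\<lambda>t. B t \<omega>)) \<and>
     (\<forall>s t. 0 \<le> s \<and> s < t \<longrightarrow>
        distributed M lborel (\<lambda>\<omega>. B t \<omega> - B s \<omega>) (normal_density 0 (sqrt (t - s))) \<and>
        prob_space.indep_set M (sets (F s))
          (sets (vimage_algebra (space M) (\<lambda>\<omega>. B t \<omega> - B s \<omega>) borel)))"

text \<open>Each process of the family is regarded as a random variable in the path space.\<close>

definition independent_wiener_family ::
  "'w measure \<Rightarrow> (real \<Rightarrow> 'w measure) \<Rightarrow> ('k \<Rightarrow> real \<Rightarrow> 'w \<Rightarrow> real) \<Rightarrow> 'k set \<Rightarrow> bool" where
  "independent_wiener_family M F \<beta> I \<longleftrightarrow>
     (\<forall>k\<in>I. wiener_process M F (\<beta> k)) \<and>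
     prob_space.indep_vars M (\<lambda>k. PiM {0..} (\<lambda>t. borel)) (\<lambda>k \<omega>. \<lambda>t\<in>{0..}. \<beta> k t \<omega>) I"

definition beta_tilde ::
  "(int \<times> int \<Rightarrow> real \<Rightarrow> 'w \<Rightarrow> real) \<Rightarrow> int \<times> int \<Rightarrow> real \<Rightarrow> 'w \<Rightarrow> real" where
  "beta_tilde \<beta> k t \<omega> = - \<beta> (- k) t \<omega>"

text \<open>
  \<open>W\<close> is an \<open>\<E>\<close>-valued process given by the series \<open>2\<pi> \<Sum>\<^sub>k |k| c\<^sub>-\<^sub>k (beta_tilde \<beta> k t) e\<^sub>k\<close>, which converges
  (unconditionally) in \<open>L\<^sup>2(\<Omega>, L\<^sup>2)\<close> at every time; this fixes each \<open>W(t)\<close> up to null sets.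
\<close>

definition is_W_curl ::
  "'w measure \<Rightarrow> (int \<times> int \<Rightarrow> real) \<Rightarrow> (int \<times> int \<Rightarrow> real \<Rightarrow> 'w \<Rightarrow> real) \<Rightarrow>
   (real \<Rightarrow> 'w \<Rightarrow> plane \<Rightarrow> real) \<Rightarrow> bool" where
  "is_W_curl M c \<beta> W \<longleftrightarrow> (\<forall>t\<ge>0.
     W t \<in> M \<rightarrow>\<^sub>M restrict_space (Lp_borel 2) \<E> \<and>
     ((\<lambda>K. \<integral>\<^sup>+\<omega>. ennreal ((Lp_norm 2 (\<lambda>x. W t \<omega> x -
          2 * pi * (\<Sum>k\<in>K. norm (kvec k) * c (- k) * beta_tilde \<beta> k t \<omega> * e_basis k x)))\<^sup>2) \<partial>M)
        \<longlongrightarrow> 0) (finite_subsets_at_top Z0))"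


section \<open>The splitting semi-implicit Euler method\<close>

definition is_Phi :: "real \<Rightarrow> (plane \<Rightarrow> real) \<Rightarrow> (plane \<Rightarrow> real) \<Rightarrow> bool" where
  "is_Phi \<tau> \<xi> \<eta> \<longleftrightarrow> \<eta> \<in> \<E> \<and>
     (\<forall>\<zeta> g. \<zeta> \<in> \<E> \<and> in_W1p_grad 4 \<zeta> g \<longrightarrow>
        L2_inner \<eta> \<zeta> = L2_inner \<xi> \<zeta> + \<tau> * L2_inner (\<lambda>x. biot_savart \<xi> x \<bullet> g x) \<eta>)"

text \<open>For \<open>\<xi> \<in> \<E>\<close> the choice is unique up to almost everywhere equality.\<close>

definition Phi :: "real \<Rightarrow> (plane \<Rightarrow> real) \<Rightarrow> plane \<Rightarrow> real" where
  "Phi \<tau> \<xi> = (SOME \<eta>. is_Phi \<tau> \<xi> \<eta>)"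

primrec split_euler ::
  "real \<Rightarrow> (real \<Rightarrow> 'w \<Rightarrow> plane \<Rightarrow> real) \<Rightarrow> ('w \<Rightarrow> plane \<Rightarrow> real) \<Rightarrow> nat \<Rightarrow> 'w \<Rightarrow> plane \<Rightarrow> real" where
  "split_euler \<tau> W \<xi>0 0 = \<xi>0"
| "split_euler \<tau> W \<xi>0 (Suc i) = (\<lambda>\<omega> x. Phi \<tau> (split_euler \<tau> W \<xi>0 i \<omega>) x +
     (W (real (Suc i) * \<tau>) \<omega> x - W (real i * \<tau>) \<omega> x))"

end

theory Submission
 imports Defs "HOL-Real_Asymp.Real_Asymp"
begin

text \<open>
 Mollifying the transport equation with trigonometric kernels and bounding the commutator through the square
 integrable gradient of the velocity (DiPerna and Lions) shows that every distributional solution is renormalized.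
 Hence \<open>Phi\<close> is single valued up to null sets and a contraction of \<open>L\<^sup>p\<close> for even \<open>p\<close>; existence comes from a
 Galerkin scheme. Random functions are described by their Fourier coefficients, so adaptedness of the scheme
 reduces to weak sequential continuity of \<open>Phi\<close>.

 In the expansion of the \<open>p\<close>-th power of \<open>Phi \<tau> \<xi>\<^sub>i + \<Delta>W\<close> the term linear in the increment has conditional mean zero, and
 the remainder costs \<open>\<tau>\<close> times the \<open>p\<close>-th power norm of \<open>\<xi>\<^sub>i\<close> plus a Gaussian moment of order \<open>\<tau>\<close>; the discrete Gronwall inequality
 gives the moment bound. The linear terms add up to a martingale, whose maximum is controlled by a pathwise form
 of Doob's inequality and the moments of order \<open>2p\<close>. For the almost sure rate, the \<open>r\<close>-th moments of the maxima
 weighted by \<open>n\<^sup>-\<^sup>2\<close> are summable, and \<open>2 / r \<le> \<epsilon>\<close> for large \<open>r\<close>.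
\<close>

text \<open>The velocity of a square integrable vorticity only has a square integrable gradient, and
  the solution of an implicit step need not be differentiable at all. Its equation cannot be tested
  with its own power; this is why renormalization has to carry both uniqueness and the L^p bound.
  \<open>Phi\<close> is moreover a choice whose measurability has no direct proof: uniqueness up to
  null sets makes it weakly continuous, and continuity gives measurability.

  The mollifiers are trigonometric polynomials so that a mollified function depends on finitely many
  Fourier coefficients. The same kernels then serve for the commutator, for measurability and for
  reducing the noise to finite Gaussian sums. They are products of normalised even powers of cosines
  because the integral of |z| |grad V| must stay bounded, which Wallis integrals show.

  Even exponents make \<open>x ^ p\<close> a convex polynomial without absolute values. A step
  weights the p-th power of the increment by \<open>(1 / \<tau>) ^ (p div 2 - 1)\<close>; its
  Gaussian moment is of order \<open>\<tau> ^ (p div 2)\<close>, which leaves one factor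
  \<tau>.\<close>

type_synonym tfun = "plane => real"

abbreviation torus_mean :: "tfun => real" (binder "avg " 10) where
 "torus_mean f \<equiv> integral\<^sup>L torus f"

abbreviation torus_nn_mean :: "(plane => ennreal) => ennreal" (binder "navg " 10) where
 "torus_nn_mean f \<equiv> integral\<^sup>N torus f"

abbreviation ip :: "tfun => tfun => real" where "ip \<equiv> L2_inner"

abbreviation eb :: "int \<times> int => tfun" where "eb \<equiv> e_basis"

abbreviation fsum :: "(int \<times> int) set => (int \<times> int => real) => tfun" where
 "fsum K a \<equiv> \<lambda>x. \<Sum>k\<in>K. a k * eb k x"

abbreviation torus2 :: "(plane \<times> plane) measure" where
 "torus2 \<equiv> torus \<Otimes>\<^sub>M torus"

notation LIMSEQ (infix "~~>" 60)

abbreviation fun_diff :: "('a => 'b :: minus) => ('a => 'b) => 'a => 'b" (infixl "-." 65) where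
 "f -. g \<equiv> \<lambda>x. f x - g x"

lemma null_comparison: "(\<And>n. norm (f n) \<le> g n) ==> g ~~> (0::real) ==> f ~~> (0::real)"
 by (rule Lim_null_comparison[OF always_eventually]) simp_all

lemmas bochner_cong = Bochner_Integration.integral_cong
lemmas bochner_integrable_add = Bochner_Integration.integrable_add
lemmas bochner_bound = Bochner_Integration.integrable_bound
lemmas bochner_sum = Bochner_Integration.integral_sum
lemmas bochner_add = Bochner_Integration.integral_add

section \<open>Inequalities for even powers of real numbers\<close>

lemma even_power_tangent:
 fixes a c :: real assumes "even p"
 shows "c ^ p + real p * c ^ (p - 1) * (a - c) \<le> a ^ p"
proof -
 have cv: "convex_on UNIV (\<lambda>x::real. x ^ p)" using assms by (rule convex_power_even)
 have "((\<lambda>x::real. x ^ p) has_field_derivative real p * c ^ (p - 1)) (at c within UNIV)"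
  by (auto intro!: derivative_eq_intros)
 from convex_on_imp_above_tangent[OF cv _ _ _ this, of a] show ?thesis by simp
qed

text \<open>All binomial terms of degree at least two in b are dominated by a^(p-2) b^2 + b^p, and
  their coefficients add up to at most 2^p; the mixed term is then split with a free parameter t.
  Later t is the step size, and the growth of the coefficient of b^p as t tends to 0 is matched to
  the size of the increments.\<close>

lemma even_power_add_le:
 fixes a b :: real assumes p: "even p" "2 \<le> p" and t: "0 < t"
 shows "(a + b) ^ p \<le> a ^ p + real p * (a ^ (p - 1) * b)
      + 2 ^ p * (t * a ^ p + (1 + (1 / t) ^ (p div 2 - 1)) * b ^ p)"
proof -
 obtain q where q: "p = Suc (Suc q)" using p(2) by (cases p; cases "p - 1") auto
 have ev: "even q" using p q by simp
 have ab: "\<bar>a\<bar> ^ p = a ^ p" "\<bar>b\<bar> ^ p = b ^ p" "\<bar>a\<bar> ^ q = a ^ q" using p ev by (auto simp: power_even_abs)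
 have pos: "0 \<le> a ^ p" "0 \<le> b ^ p" "0 \<le> a ^ q" using p(1) ev by (simp_all add: zero_le_even_power)
 have trm: "\<bar>a ^ (p - j) * b ^ j\<bar> \<le> a ^ q * b^2 + b ^ p" if j: "2 \<le> j" "j \<le> p" for j
 proof (cases "\<bar>b\<bar> \<le> \<bar>a\<bar>")
  case True
  have "\<bar>a\<bar> ^ (p - j) * \<bar>b\<bar> ^ j = \<bar>a\<bar> ^ (p - j) * \<bar>b\<bar> ^ (j - 2) * b^2"
  proof -
   have "\<bar>b\<bar> ^ j = \<bar>b\<bar> ^ (j - 2 + 2)" by (subst le_add_diff_inverse2[OF j(1)]) (rule refl)
   also have "\<dots> = \<bar>b\<bar> ^ (j - 2) * b^2" unfolding power_add by simp
   finally show ?thesis by simp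
  qed
  also have "\<dots> \<le> \<bar>a\<bar> ^ (p - j) * \<bar>a\<bar> ^ (j - 2) * b^2"
   using True by (intro mult_right_mono mult_left_mono power_mono) auto
  also have "\<dots> = a ^ q * b^2"
  proof -
   have "p - j + (j - 2) = q" using j q by simp
   then have "\<bar>a\<bar> ^ (p - j) * \<bar>a\<bar> ^ (j - 2) = a ^ q" unfolding ab(3)[symmetric] by (metis power_add)
   then show ?thesis by simp
  qed
  also have "\<dots> \<le> a ^ q * b^2 + b ^ p" using pos by simp
  finally show ?thesis by (simp add: abs_mult power_abs)
 next
  case False
  have "\<bar>a\<bar> ^ (p - j) * \<bar>b\<bar> ^ j \<le> \<bar>b\<bar> ^ (p - j) * \<bar>b\<bar> ^ j"
   using False by (intro mult_right_mono power_mono) auto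
  also have "\<dots> = b ^ p" unfolding ab(2)[symmetric] power_add[symmetric] using j by simp
  also have "\<dots> \<le> a ^ q * b^2 + b ^ p" using pos by simp
  finally show ?thesis by (simp add: abs_mult power_abs)
 qed
 \<comment> \<open>Comparing b^2 with t a^2 takes the place of Young's inequality and gives explicit
   constants.\<close>
 have key: "a ^ q * b^2 \<le> t * a ^ p + (1 / t) ^ (p div 2 - 1) * b ^ p"
 proof (cases "b^2 \<le> t * a^2")
  case True
  then have "a ^ q * b^2 \<le> a ^ q * (t * a^2)" using ev by (intro mult_left_mono) auto
  also have "\<dots> = t * a ^ p" using q by (simp add: power2_eq_square)
  also have "\<dots> \<le> t * a ^ p + (1 / t) ^ (p div 2 - 1) * b ^ p" using pos t by simp
  finally show ?thesis .
 next
  case False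
  then have le: "a^2 \<le> (1 / t) * b^2" using t by (simp add: field_simps)
  have hq: "p div 2 - 1 = q div 2" "2 * (q div 2) = q" using q ev by auto
  have "a ^ q = (a^2) ^ (q div 2)" using hq(2) by (metis power_mult)
  also have "\<dots> \<le> ((1 / t) * b^2) ^ (q div 2)" using le by (intro power_mono) auto
  also have "\<dots> = (1 / t) ^ (q div 2) * b ^ q"
   by (metis hq(2) power_mult power_mult_distrib)
  finally have "a ^ q * b^2 \<le> (1 / t) ^ (q div 2) * b ^ q * b^2" by (intro mult_right_mono) auto
  also have "\<dots> = (1 / t) ^ (p div 2 - 1) * b ^ p" using q hq by (simp add: power2_eq_square)
  also have "\<dots> \<le> t * a ^ p + (1 / t) ^ (p div 2 - 1) * b ^ p" using pos t by simp
  finally show ?thesis .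
 qed
 have "(a + b) ^ p = (\<Sum>j\<le>p. real (p choose j) * a ^ (p - j) * b ^ j)"
  by (subst add.commute, subst binomial_ring) (simp add: ac_simps)
 also have "\<dots> = a ^ p + real p * (a ^ (p - 1) * b) + (\<Sum>j\<in>{2..p}. real (p choose j) * a ^ (p - j) * b ^ j)"
 proof -
  have "{..p} = {0,1} \<union> {2..p}" using p by auto
  then show ?thesis by (simp add: sum.union_disjoint)
 qed
 also have "(\<Sum>j\<in>{2..p}. real (p choose j) * a ^ (p - j) * b ^ j)
   \<le> (\<Sum>j\<in>{2..p}. real (p choose j) * (a ^ q * b^2 + b ^ p))"
  by (intro sum_mono) (metis trm abs_le_D1 atLeastAtMost_iff mult.assoc mult_left_mono of_nat_0_le_iff)
 also have "\<dots> \<le> (\<Sum>j\<in>{..p}. real (p choose j) * (a ^ q * b^2 + b ^ p))"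
  using pos by (intro sum_mono2) auto
 also have "\<dots> = 2 ^ p * (a ^ q * b^2 + b ^ p)"
  by (simp add: sum_distrib_right[symmetric] choose_row_sum flip: of_nat_sum)
 also have "\<dots> \<le> 2 ^ p * (t * a ^ p + (1 + (1 / t) ^ (p div 2 - 1)) * b ^ p)"
  using key by (intro mult_left_mono) (auto simp: distrib_right)
 finally show ?thesis by simp
qed

lemma even_power_add_bound:
 fixes a b :: real assumes "even p"
 shows "(a + b) ^ p \<le> 2 ^ p * (a ^ p + b ^ p)"
proof -
 have "(a + b) ^ p = \<bar>a + b\<bar> ^ p" using assms by (simp add: power_even_abs)
 also have "\<dots> \<le> (2 * max \<bar>a\<bar> \<bar>b\<bar>) ^ p" by (intro power_mono) auto
 also have "\<dots> = 2 ^ p * (max \<bar>a\<bar> \<bar>b\<bar>) ^ p" by (simp add: power_mult_distrib)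
 also have "(max \<bar>a\<bar> \<bar>b\<bar>) ^ p \<le> \<bar>a\<bar> ^ p + \<bar>b\<bar> ^ p" by (simp add: max_def)
 finally show ?thesis using assms by (simp add: power_even_abs)
qed

section \<open>The torus as a probability space\<close>

text \<open>The one dimensional factor of \<open>torus\<close>. Shifts, reflections and integration
  by parts are proved on this fundamental domain of the integers and carried to the torus one
  variable at a time.\<close>

definition circ :: "real measure" where
 "circ = restrict_space lborel {0..<1}"

lemma space_circ: "space circ = {0..<1}" by (simp add: circ_def space_restrict_space)

lemma prob_space_circ: "prob_space circ"
 by (rule prob_spaceI) (simp add: circ_def space_restrict_space emeasure_restrict_space)

interpretation circ: prob_space circ by (rule prob_space_circ)

lemma measurable_circ: "f \<in> borel_measurable borel ==> f \<in> borel_measurable circ"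
 unfolding circ_def by (rule measurable_restrict_space1) simp

lemma sets_torus: "sets torus = sets (circ \<Otimes>\<^sub>M circ)"
proof
 let ?A = "{0..<1::real}"
 have sp: "space (circ \<Otimes>\<^sub>M circ) = ?A \<times> ?A" by (simp add: space_pair_measure space_circ)
 show "sets torus \<subseteq> sets (circ \<Otimes>\<^sub>M circ)"
 proof
  fix X assume X: "X \<in> sets torus"
  have m: "(\<lambda>x. x) \<in> measurable circ borel" by (simp add: circ_def measurable_restrict_space1)
  have "(\<lambda>x. x) \<in> measurable (circ \<Otimes>\<^sub>M circ) (borel :: plane measure)"
   unfolding borel_prod[symmetric]
   by (subst measurable_pair_iff) (auto intro: measurable_compose[OF measurable_fst m] measurable_compose[OF measurable_snd m] simp: comp_def)
  then have "(\<lambda>x. x) \<in> measurable (circ \<Otimes>\<^sub>M circ) torus"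
   unfolding torus_def by (intro measurable_restrict_space2) (auto simp: sp)
  from measurable_sets[OF this X] show "X \<in> sets (circ \<Otimes>\<^sub>M circ)"
   using sets.sets_into_space[OF X] by (simp add: sp torus_def space_restrict_space Int_absorb2)
 qed
 show "sets (circ \<Otimes>\<^sub>M circ) \<subseteq> sets torus"
  unfolding sets_pair_measure
 proof (rule sets.sigma_sets_subset', safe)
  fix a b assume a: "a \<in> sets circ" and b: "b \<in> sets circ"
  then have "a \<in> sets borel" "b \<in> sets borel" "a \<subseteq> ?A" "b \<subseteq> ?A"
   by (auto simp: circ_def sets_restrict_space_iff)
  then show "a \<times> b \<in> sets torus"
   unfolding torus_def sets_restrict_space by (intro image_eqI[of _ _ "a \<times> b"]) (auto intro!: borel_Times)
 next
  show "space circ \<times> space circ \<in> sets torus"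
   by (simp add: torus_def space_circ sets_restrict_space_iff borel_Times)
 qed
qed

lemma torus_eq: "torus = circ \<Otimes>\<^sub>M circ"
proof (rule pair_measure_eqI[symmetric])
 show "sigma_finite_measure circ" by (rule circ.sigma_finite_measure_axioms)
 show "sigma_finite_measure circ" by (rule circ.sigma_finite_measure_axioms)
 show "sets (circ \<Otimes>\<^sub>M circ) = sets torus" by (rule sets_torus[symmetric])
 fix A B assume "A \<in> sets circ" "B \<in> sets circ"
 then have AB: "A \<in> sets borel" "B \<in> sets borel" "A \<subseteq> {0..<1}" "B \<subseteq> {0..<1}"
  by (auto simp: circ_def sets_restrict_space_iff)
 have "emeasure torus (A \<times> B) = emeasure (lborel \<Otimes>\<^sub>M lborel) (A \<times> B)"
  unfolding lborel_prod torus_def using AB by (intro emeasure_restrict_space) (auto intro!: borel_Times)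
 also have "\<dots> = emeasure lborel A * emeasure lborel B"
  using AB by (intro lborel.emeasure_pair_measure_Times) auto
 also have "\<dots> = emeasure circ A * emeasure circ B"
  unfolding circ_def using AB by (simp add: emeasure_restrict_space)
 finally show "emeasure circ A * emeasure circ B = emeasure torus (A \<times> B)" by simp
qed

interpretation circ2: pair_prob_space circ circ ..

interpretation torus: prob_space torus
 unfolding torus_eq by (rule circ2.P.prob_space_axioms)

interpretation torus2: pair_prob_space torus torus ..

lemma measurable_torus: "f \<in> borel_measurable borel ==> f \<in> borel_measurable torus"
 unfolding torus_def by (rule measurable_restrict_space1) simp

lemma space_torus: "space torus = {0..<1} \<times> {0..<1}"
 by (simp add: torus_def space_restrict_space)

lemma id_torus: "(\<lambda>x. x) \<in> measurable torus (borel :: plane measure)"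
 unfolding torus_def by (rule measurable_restrict_space1) simp

lemma id_circ: "(\<lambda>x. x) \<in> measurable circ (borel :: real measure)"
 unfolding circ_def by (rule measurable_restrict_space1) simp

lemma measurable_diff_torus:
 "f \<in> borel_measurable borel ==> (\<lambda>(x, y). f (x - y)) \<in> borel_measurable torus2"
proof -
 assume f: "f \<in> borel_measurable borel"
 have "(fst -. snd) \<in> measurable torus2 (borel :: plane measure)"
  by (rule borel_measurable_diff[OF measurable_compose[OF measurable_fst id_torus] measurable_compose[OF measurable_snd id_torus]])
 from measurable_compose[OF this f] show ?thesis by (simp only: case_prod_beta')
qed

lemma nn_integral_circ:
 assumes "g \<in> borel_measurable borel"
 shows "(\<integral>\<^sup>+t. g t \<partial>circ) = (\<integral>\<^sup>+t. g t * indicator {0..<1} t \<partial>lborel)"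
 unfolding circ_def using assms by (subst nn_integral_restrict_space) auto

text \<open>Only the fractional part b of a matters. The integral then runs over [b, b+1), and the
  piece beyond 1 is moved back by one period.\<close>

lemma nn_integral_circ_shift:
 fixes g :: "real => ennreal"
 assumes g [measurable]: "g \<in> borel_measurable borel" and per: "\<And>t m. g (t + of_int m) = g t"
 shows "(\<integral>\<^sup>+t. g (t + a) \<partial>circ) = (\<integral>\<^sup>+t. g t \<partial>circ)"
proof -
 define b where "b = frac a"
 have b: "0 \<le> b" "b < 1" by (auto simp: b_def frac_lt_1)
 have "g (t + a) = g (t + b)" for t
  using per[of "t + b" "\<lfloor>a\<rfloor>"] by (simp add: b_def frac_def)
 then have "(\<integral>\<^sup>+t. g (t + a) \<partial>circ) = (\<integral>\<^sup>+t. g (t + b) * indicator {0..<1} t \<partial>lborel)"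
  by (simp add: nn_integral_circ)
 also have "\<dots> = (\<integral>\<^sup>+t. g t * indicator {b..<b+1} t \<partial>lborel)"
  by (subst nn_integral_real_affine[of _ 1 b, where f="\<lambda>t. g t * indicator {b..<b+1} t"])
    (auto intro!: nn_integral_cong simp: indicator_def add.commute)
 also have "\<dots> = (\<integral>\<^sup>+t. g t * indicator {b..<1} t + g t * indicator {1..<b+1} t \<partial>lborel)"
  using b by (intro nn_integral_cong) (auto simp: indicator_def)
 also have "\<dots> = (\<integral>\<^sup>+t. g t * indicator {b..<1} t \<partial>lborel) + (\<integral>\<^sup>+t. g t * indicator {1..<b+1} t \<partial>lborel)"
  by (rule nn_integral_add) auto
 also have "(\<integral>\<^sup>+t. g t * indicator {1..<b+1} t \<partial>lborel) = (\<integral>\<^sup>+t. g t * indicator {0..<b} t \<partial>lborel)"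
  using per[of _ 1] by (subst nn_integral_real_affine[of _ 1 1])
    (auto intro!: nn_integral_cong simp: indicator_def add.commute)
 also have "(\<integral>\<^sup>+t. g t * indicator {b..<1} t \<partial>lborel) + (\<integral>\<^sup>+t. g t * indicator {0..<b} t \<partial>lborel)
   = (\<integral>\<^sup>+t. g t * indicator {b..<1} t + g t * indicator {0..<b} t \<partial>lborel)"
  by (rule nn_integral_add[symmetric]) auto
 also have "\<dots> = (\<integral>\<^sup>+t. g t * indicator {0..<1} t \<partial>lborel)"
  using b by (intro nn_integral_cong) (auto simp: indicator_def)
 finally show ?thesis by (simp add: nn_integral_circ)
qed

lemma nn_integral_circ_reflect:
 fixes g :: "real => ennreal"
 assumes g [measurable]: "g \<in> borel_measurable borel" and per: "\<And>t m. g (t + of_int m) = g t"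
 shows "(\<integral>\<^sup>+t. g (a - t) \<partial>circ) = (\<integral>\<^sup>+t. g t \<partial>circ)"
proof -
 have "(\<integral>\<^sup>+t. g (a - t) \<partial>circ) = (\<integral>\<^sup>+t. g (a - t) * indicator {0..<1} t \<partial>lborel)"
  by (simp add: nn_integral_circ)
 also have "\<dots> = (\<integral>\<^sup>+t. g (a - 1 + t) * indicator {0<..1} t \<partial>lborel)"
  by (subst nn_integral_real_affine[of _ "-1" 1])
    (auto intro!: nn_integral_cong simp: indicator_def algebra_simps)
 \<comment> \<open>Reflection has turned [0,1) into (0,1]; the end points are null sets, and what
   remains is a shift by a - 1.\<close>
 also have "\<dots> = (\<integral>\<^sup>+t. g (a - 1 + t) * indicator {0..<1} t \<partial>lborel)"
  by (intro nn_integral_cong_AE AE_I'[of "{0, 1::real}"]) (auto simp: indicator_def intro: countable_imp_null_set_lborel)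
 also have "\<dots> = (\<integral>\<^sup>+t. g (t + (a - 1)) \<partial>circ)"
  by (simp add: nn_integral_circ add.commute)
 also have "\<dots> = (\<integral>\<^sup>+t. g t \<partial>circ)" by (rule nn_integral_circ_shift[OF g per])
 finally show ?thesis .
qed

lemma periodicD: "periodic f ==> f (x + (of_int m, of_int n)) = f x"
 unfolding periodic_def by blast

lemma periodicD1: "periodic f ==> f (s + of_int m, t) = f (s, t)"
 using periodicD[of f "(s,t)" m 0] by simp

lemma periodicD2: "periodic f ==> f (s, t + of_int m) = f (s, t)"
 using periodicD[of f "(s,t)" 0 m] by simp

lemma nn_integral_torus:
 assumes "f \<in> borel_measurable borel"
 shows "(navg x. f x) = (\<integral>\<^sup>+s. \<integral>\<^sup>+t. f (s, t) \<partial>circ \<partial>circ)"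
proof -
 have m: "f \<in> borel_measurable (circ \<Otimes>\<^sub>M circ)" using measurable_torus[OF assms] by (simp only: torus_eq)
 show ?thesis unfolding torus_eq by (rule circ.nn_integral_fst[OF m, symmetric])
qed

lemma measurable_pair_sec1: "f \<in> borel_measurable (borel :: plane measure) ==> (\<lambda>t. f (s, t)) \<in> borel_measurable borel"
 unfolding borel_prod[symmetric] by (rule measurable_Pair2) auto

lemma measurable_sec_pair:
 assumes f: "f \<in> borel_measurable (borel :: plane measure)"
 shows "(\<lambda>(s, t). f (s, t)) \<in> borel_measurable (borel \<Otimes>\<^sub>M circ)"
proof -
 have 1: "snd \<in> measurable (borel \<Otimes>\<^sub>M circ) (borel :: real measure)"
  by (rule measurable_compose[OF measurable_snd id_circ])
 have 2: "(\<lambda>z. (fst z, snd z)) \<in> measurable (borel \<Otimes>\<^sub>M circ) (borel :: plane measure)"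
  unfolding borel_prod[symmetric] by (rule measurable_Pair[OF measurable_fst 1])
 show ?thesis using measurable_compose[OF 2 f] by (simp only: case_prod_beta')
qed

lemma nn_integral_torus_reflect:
 fixes f :: "plane => ennreal"
 assumes f: "f \<in> borel_measurable borel" and per: "periodic f"
 shows "(navg x. f (a - x)) = (navg x. f x)"
proof -
 have f': "(\<lambda>x. f (a - x)) \<in> borel_measurable borel" by (rule measurable_compose[OF _ f]) simp
 obtain a1 a2 where a: "a = (a1, a2)" by force
 have m1: "(\<lambda>s. \<integral>\<^sup>+t. f (s, t) \<partial>circ) \<in> borel_measurable borel"
  by (rule circ.borel_measurable_nn_integral[OF measurable_sec_pair[OF f]])
 have "(navg x. f (a - x)) = (\<integral>\<^sup>+s. \<integral>\<^sup>+t. f (a1 - s, a2 - t) \<partial>circ \<partial>circ)"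
  using nn_integral_torus[OF f'] by (simp add: a)
 also have "\<dots> = (\<integral>\<^sup>+s. \<integral>\<^sup>+t. f (a1 - s, t) \<partial>circ \<partial>circ)"
  by (intro nn_integral_cong nn_integral_circ_reflect[where g="\<lambda>t. f (_, t)"] measurable_pair_sec1 f periodicD2 per)
 also have "\<dots> = (\<integral>\<^sup>+s. \<integral>\<^sup>+t. f (s, t) \<partial>circ \<partial>circ)"
  using m1 by (rule nn_integral_circ_reflect) (simp add: periodicD1[OF per])
 finally show ?thesis by (simp add: nn_integral_torus[OF f])
qed

text \<open>A translation is the composition of two reflections, so the reflection formula is
  enough.\<close>

lemma nn_integral_torus_shift:
 fixes f :: "plane => ennreal"
 assumes f: "f \<in> borel_measurable borel" and per: "periodic f"
 shows "(navg x. f (x + a)) = (navg x. f x)"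
proof -
 have f': "(\<lambda>x. f (- x)) \<in> borel_measurable borel" by (rule measurable_compose[OF _ f]) simp
 have per': "periodic (\<lambda>x. f (- x))"
 proof (unfold periodic_def, intro allI)
  fix x :: plane and m n :: int
  show "f (- (x + (of_int m, of_int n))) = f (- x)"
   using periodicD[OF per, of "-x" "-m" "-n"] by (cases x) simp
 qed
 have "(navg x. f (x + a)) = (navg x. (\<lambda>x. f (- x)) (- a - x))" by (simp add: add.commute)
 also have "\<dots> = (navg x. f (0 - x))" by (subst nn_integral_torus_reflect[OF f' per']) simp
 also have "\<dots> = (navg x. f x)" by (rule nn_integral_torus_reflect[OF f per])
 finally show ?thesis .
qed

lemma periodic_comp: "periodic f ==> periodic (\<lambda>x. h (f x))" by (simp add: periodic_def)

text \<open>The formulas for nonnegative integrands are applied to the absolute value of f, which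
  transfers integrability, and to f and -f, which give the two parts of the signed integral.\<close>

lemma
 fixes f :: "tfun"
 assumes f: "f \<in> borel_measurable borel" and per: "periodic f" and i: "integrable torus f"
 shows integrable_torus_shift: "integrable torus (\<lambda>x. f (x + a))"
  and integral_torus_shift: "(avg x. f (x + a)) = (avg x. f x)"
  and integrable_torus_reflect: "integrable torus (\<lambda>x. f (a - x))"
  and integral_torus_reflect: "(avg x. f (a - x)) = (avg x. f x)"
proof -
 have m: "(\<lambda>x. f (x + a)) \<in> borel_measurable borel" "(\<lambda>x. f (a - x)) \<in> borel_measurable borel"
  by (auto intro!: measurable_compose[OF _ f])
 note sh = nn_integral_torus_shift[where f="\<lambda>x. ennreal (h (f x))" and a=a for h]
 note re = nn_integral_torus_reflect[where f="\<lambda>x. ennreal (h (f x))" and a=a for h]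
 have 1: "(navg x. ennreal (h (f (x + a)))) = (navg x. ennreal (h (f x)))"
   "(navg x. ennreal (h (f (a - x)))) = (navg x. ennreal (h (f x)))"
  if "h \<in> borel_measurable borel" for h :: "real => real"
  using that f by (auto intro!: sh re periodic_comp[OF per])
 show i1: "integrable torus (\<lambda>x. f (x + a))" "integrable torus (\<lambda>x. f (a - x))"
  using i m 1[of "\<lambda>x. \<bar>x\<bar>"] by (auto simp: integrable_iff_bounded measurable_torus)
 show "(avg x. f (x + a)) = (avg x. f x)" "(avg x. f (a - x)) = (avg x. f x)"
  using 1[of "\<lambda>x. x"] 1[of "\<lambda>x. - x"] i i1 by (auto simp: real_lebesgue_integral_def)
qed

section \<open>Inequalities for integrals\<close>

lemma integrable_bounded_by:
 fixes f g :: "'a => real"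
 assumes "integrable M g" "f \<in> borel_measurable M" "\<And>x. x \<in> space M ==> \<bar>f x\<bar> \<le> g x"
 shows "integrable M f"
 using assms by (intro bochner_bound[OF assms(1,2)] AE_I2) force

lemma integrable_mult_squares:
 fixes f g :: "'a => real"
 assumes f: "f \<in> borel_measurable M" "integrable M (\<lambda>x. (f x)^2)"
  and g: "g \<in> borel_measurable M" "integrable M (\<lambda>x. (g x)^2)"
 shows "integrable M (\<lambda>x. f x * g x)"
proof (rule integrable_bounded_by)
 show "integrable M (\<lambda>x. (f x)^2 + (g x)^2)" using f g by simp
 show "(\<lambda>x. f x * g x) \<in> borel_measurable M" using f g by simp
 show "\<bar>f x * g x\<bar> \<le> (f x)^2 + (g x)^2" for x
 proof -
  have "2 * \<bar>f x\<bar> * \<bar>g x\<bar> \<le> (f x)^2 + (g x)^2" using sum_squares_bound[of "\<bar>f x\<bar>" "\<bar>g x\<bar>"] by simp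
  moreover have "0 \<le> \<bar>f x\<bar> * \<bar>g x\<bar>" by simp
  ultimately show ?thesis unfolding abs_mult by linarith
 qed
qed

text \<open>The integral of (f - t g)^2 is a nonnegative quadratic polynomial in t; its value at the
  minimiser C/B is the claim.\<close>

lemma Cauchy_Schwarz_integral:
 fixes f g :: "'a => real"
 assumes f: "f \<in> borel_measurable M" "integrable M (\<lambda>x. (f x)^2)"
  and g: "g \<in> borel_measurable M" "integrable M (\<lambda>x. (g x)^2)"
 shows "(\<integral>x. f x * g x \<partial>M)^2 \<le> (\<integral>x. (f x)^2 \<partial>M) * (\<integral>x. (g x)^2 \<partial>M)"
proof -
 let ?A = "\<integral>x. (f x)^2 \<partial>M" and ?B = "\<integral>x. (g x)^2 \<partial>M" and ?C = "\<integral>x. f x * g x \<partial>M"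
 have fg: "integrable M (\<lambda>x. f x * g x)" by (rule integrable_mult_squares[OF f g])
 have q: "0 \<le> ?A - 2 * t * ?C + t^2 * ?B" for t
 proof -
  have "0 \<le> (\<integral>x. (f x - t * g x)^2 \<partial>M)" by simp
  also have "\<dots> = (\<integral>x. (f x)^2 - 2 * t * (f x * g x) + t^2 * (g x)^2 \<partial>M)"
   by (intro bochner_cong) (auto simp: power2_eq_square algebra_simps)
  also have "\<dots> = ?A - 2 * t * ?C + t^2 * ?B" using f g fg by simp
  finally show ?thesis .
 qed
 have B: "0 \<le> ?B" by simp
 show ?thesis
 proof (cases "?B = 0")
  case True
  have "?C = 0"
  proof (rule ccontr)
   assume "?C \<noteq> 0"
   \<comment> \<open>With B = 0 the polynomial is affine in t, and at this t it would equal
     -1.\<close>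
   then have "2 * ((?A + 1) / (2 * ?C)) * ?C = ?A + 1" by simp
   with q[of "(?A + 1) / (2 * ?C)"] True show False by simp
  qed
  then show ?thesis using True by simp
 next
  case False
  have "0 \<le> ?A - 2 * (?C / ?B) * ?C + (?C / ?B)^2 * ?B" by (rule q)
  also have "\<dots> = ?A - ?C\<^sup>2 / ?B" using False by (simp add: power2_eq_square field_simps)
  finally show ?thesis using False B by (simp add: field_simps)
 qed
qed

lemma Cauchy_Schwarz_abs:
 fixes f g :: "'a => real"
 assumes f: "f \<in> borel_measurable M" "integrable M (\<lambda>x. (f x)^2)"
  and g: "g \<in> borel_measurable M" "integrable M (\<lambda>x. (g x)^2)"
 shows "(\<integral>x. \<bar>f x * g x\<bar> \<partial>M) \<le> sqrt (\<integral>x. (f x)^2 \<partial>M) * sqrt (\<integral>x. (g x)^2 \<partial>M)"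
  and "\<bar>\<integral>x. f x * g x \<partial>M\<bar> \<le> sqrt (\<integral>x. (f x)^2 \<partial>M) * sqrt (\<integral>x. (g x)^2 \<partial>M)"
proof -
 have "(\<integral>x. \<bar>f x\<bar> * \<bar>g x\<bar> \<partial>M)^2 \<le> (\<integral>x. (f x)^2 \<partial>M) * (\<integral>x. (g x)^2 \<partial>M)"
  using Cauchy_Schwarz_integral[of "\<lambda>x. \<bar>f x\<bar>" M "\<lambda>x. \<bar>g x\<bar>"] f g by simp
 then show 1: "(\<integral>x. \<bar>f x * g x\<bar> \<partial>M) \<le> sqrt (\<integral>x. (f x)^2 \<partial>M) * sqrt (\<integral>x. (g x)^2 \<partial>M)"
  unfolding real_sqrt_mult[symmetric] abs_mult by (intro real_le_rsqrt)
 show "\<bar>\<integral>x. f x * g x \<partial>M\<bar> \<le> sqrt (\<integral>x. (f x)^2 \<partial>M) * sqrt (\<integral>x. (g x)^2 \<partial>M)"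
  using integral_abs_bound[of M "\<lambda>x. f x * g x"] 1 by linarith
qed

lemma abs_power_le_one_plus:
 fixes a :: real assumes "even p" "m \<le> p"
 shows "\<bar>a\<bar> ^ m \<le> 1 + a ^ p"
proof (cases "\<bar>a\<bar> \<le> 1")
 case True
 then have "\<bar>a\<bar> ^ m \<le> 1" by (simp add: power_le_one)
 moreover have "0 \<le> a ^ p" using assms by (simp add: zero_le_even_power)
 ultimately show ?thesis by linarith
next
 case False
 then have "\<bar>a\<bar> ^ m \<le> \<bar>a\<bar> ^ p" using assms by (intro power_increasing) auto
 then show ?thesis using assms by (simp add: power_even_abs)
qed

context prob_space begin

lemma integrable_lower_power:
 fixes f :: "'a => real"
 assumes "f \<in> borel_measurable M" "even p" "m \<le> p" "integrable M (\<lambda>x. f x ^ p)"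
 shows "integrable M (\<lambda>x. f x ^ m)" "integrable M (\<lambda>x. \<bar>f x\<bar> ^ m)"
proof -
 have i: "integrable M (\<lambda>x. 1 + f x ^ p)" using assms(4) by simp
 show "integrable M (\<lambda>x. f x ^ m)"
  using assms(1) abs_power_le_one_plus[OF assms(2,3)] by (intro integrable_bounded_by[OF i]) (simp_all add: power_abs)
 show "integrable M (\<lambda>x. \<bar>f x\<bar> ^ m)"
  using assms(1) abs_power_le_one_plus[OF assms(2,3)] by (intro integrable_bounded_by[OF i]) simp_all
qed

lemma integrable_of_power:
 fixes f :: "'a => real"
 assumes "f \<in> borel_measurable M" "even p" "2 \<le> p" "integrable M (\<lambda>x. f x ^ p)"
 shows "integrable M f"
 using integrable_lower_power(1)[OF assms(1,2) _ assms(4), of 1] assms(3) by simp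

lemma power_expectation_le:
 fixes f :: "'a => real"
 assumes f: "f \<in> borel_measurable M" and p: "even p" "2 \<le> p" and i: "integrable M (\<lambda>x. f x ^ p)"
 shows "expectation f ^ p \<le> expectation (\<lambda>x. f x ^ p)"
proof -
 let ?c = "expectation f"
 have fi: "integrable M f" by (rule integrable_of_power[OF f p i])
 have "?c ^ p = expectation (\<lambda>x. ?c ^ p + real p * ?c ^ (p - 1) * (f x - ?c))"
  using fi by (simp add: prob_space)
 also have "\<dots> \<le> expectation (\<lambda>x. f x ^ p)"
  using fi i by (intro integral_mono even_power_tangent p) auto
 finally show ?thesis .
qed

lemma expectation_abs_le_sqrt:
 fixes f :: "'a => real"
 assumes f: "f \<in> borel_measurable M" and i: "integrable M (\<lambda>x. (f x)^2)"
 shows "expectation (\<lambda>x. \<bar>f x\<bar>) \<le> sqrt (expectation (\<lambda>x. (f x)^2))"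
 using power_expectation_le[of "\<lambda>x. \<bar>f x\<bar>" 2] f i by (intro real_le_rsqrt) auto

end

section \<open>Even Lebesgue spaces\<close>

text \<open>A natural exponent without absolute value keeps the integrands polynomial in f. For even
  positive exponents \<open>Lp_space_even\<close> identifies these spaces with
  \<open>Lp_space\<close>.\<close>

definition ELp :: "nat => tfun set" where
 "ELp p = {f \<in> borel_measurable borel. periodic f \<and> integrable torus (\<lambda>x. f x ^ p)}"

lemma abs_powr_even: "even p ==> 0 < p ==> \<bar>a::real\<bar> powr real p = a ^ p"
 by (cases "a = 0") (auto simp: powr_realpow power_even_abs)

lemma Lp_space_even: "even p ==> 0 < p ==> Lp_space (real p) = ELp p"
 by (auto simp: Lp_space_def ELp_def abs_powr_even)

lemma zero_mean_L2_iff: "f \<in> \<E> \<longleftrightarrow> f \<in> ELp 2 \<and> (avg x. f x) = 0"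
 using Lp_space_even[of 2] by (auto simp: zero_mean_L2_def)

lemma zero_mean_L2D: "f \<in> \<E> ==> f \<in> ELp 2" "f \<in> \<E> ==> (avg x. f x) = 0"
 by (auto simp: zero_mean_L2_iff)

lemma ELpD:
 assumes "f \<in> ELp p"
 shows "f \<in> borel_measurable borel" "periodic f" "f \<in> borel_measurable torus" "integrable torus (\<lambda>x. f x ^ p)"
 using assms by (auto simp: ELp_def intro: measurable_torus)

lemma ELpI: "f \<in> borel_measurable borel ==> periodic f ==> integrable torus (\<lambda>x. f x ^ p) ==> f \<in> ELp p"
 by (simp add: ELp_def)

lemma ELp_mono: "f \<in> ELp p ==> even p ==> q \<le> p ==> f \<in> ELp q"
 by (rule ELpI[OF ELpD(1) ELpD(2) torus.integrable_lower_power(1)[OF ELpD(3) _ _ ELpD(4)]])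

lemma ELp_integrable: "f \<in> ELp p ==> even p ==> 2 \<le> p ==> integrable torus f"
 by (rule torus.integrable_of_power[OF ELpD(3) _ _ ELpD(4)])

lemma ELp2_integrable: "f \<in> ELp 2 ==> integrable torus f"
 by (rule ELp_integrable) auto

lemma ELp_add: "f \<in> ELp p ==> g \<in> ELp p ==> even p ==> (\<lambda>x. f x + g x) \<in> ELp p"
proof -
 assume f: "f \<in> ELp p" and g: "g \<in> ELp p" and p: "even p"
 have "integrable torus (\<lambda>x. (f x + g x) ^ p)"
 proof (rule integrable_bounded_by)
  show "integrable torus (\<lambda>x. 2 ^ p * (f x ^ p + g x ^ p))" using ELpD(4)[OF f] ELpD(4)[OF g] by simp
  show "(\<lambda>x. (f x + g x) ^ p) \<in> borel_measurable torus" using ELpD(3)[OF f] ELpD(3)[OF g] by simp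
  show "\<bar>(f x + g x) ^ p\<bar> \<le> 2 ^ p * (f x ^ p + g x ^ p)" for x
   unfolding abs_of_nonneg[OF zero_le_even_power[OF p]] by (rule even_power_add_bound[OF p])
 qed
 then show ?thesis using f g by (auto simp: ELp_def periodic_def)
qed

lemma ELp_cmult: "f \<in> ELp p ==> (\<lambda>x. c * f x) \<in> ELp p"
 by (auto simp: ELp_def periodic_def power_mult_distrib)

lemma ELp_diff: "f \<in> ELp p ==> g \<in> ELp p ==> even p ==> (f -. g) \<in> ELp p"
 by (drule ELp_cmult[of g p "-1"], drule (1) ELp_add[of f p]) simp_all

lemma ELp_const: "(\<lambda>x. c) \<in> ELp p" by (auto simp: ELp_def periodic_def)

lemma periodic_mult: "periodic f ==> periodic g ==> periodic (\<lambda>x. f x * g x :: real)"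
 by (simp add: periodic_def)

lemma ELp_mult_bounded:
 assumes f: "f \<in> ELp p" and p: "even p" and h: "h \<in> borel_measurable borel" "periodic h" "\<And>x. \<bar>h x\<bar> \<le> B"
 shows "(\<lambda>x. h x * f x) \<in> ELp p"
proof -
 have "integrable torus (\<lambda>x. (h x * f x) ^ p)"
 proof (rule integrable_bounded_by)
  show "integrable torus (\<lambda>x. B ^ p * f x ^ p)" using ELpD[OF f] by simp
  show "(\<lambda>x. (h x * f x) ^ p) \<in> borel_measurable torus" using ELpD[OF f] measurable_torus[OF h(1)] by simp
  have "h x ^ p \<le> B ^ p" for x
   using power_mono[OF h(3)[of x], of p] p by (simp add: power_even_abs)
  moreover have "\<bar>(h x * f x) ^ p\<bar> = h x ^ p * f x ^ p" for x
   unfolding abs_of_nonneg[OF zero_le_even_power[OF p]] by (rule power_mult_distrib)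
  ultimately show "\<bar>(h x * f x) ^ p\<bar> \<le> B ^ p * f x ^ p" for x
   using p by (simp only: mult_right_mono zero_le_even_power)
 qed
 then show ?thesis using f h by (auto simp: ELp_def intro: periodic_mult)
qed

lemma ELp_mult4:
 assumes f: "f \<in> ELp 4" and g: "g \<in> ELp 4" shows "(\<lambda>x. f x * g x) \<in> ELp 2"
proof -
 have "(\<lambda>x. (f x)^2) \<in> borel_measurable torus" "(\<lambda>x. (g x)^2) \<in> borel_measurable torus"
  using ELpD(3)[OF f] ELpD(3)[OF g] by simp_all
 then have "integrable torus (\<lambda>x. (f x)^2 * (g x)^2)"
  using ELpD(4)[OF f] ELpD(4)[OF g] by (intro integrable_mult_squares) simp_all
 then show ?thesis using f g by (auto simp: ELp_def power_mult_distrib intro: periodic_mult)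
qed

lemma integrable_ELp2_mult: "f \<in> ELp 2 ==> g \<in> ELp 2 ==> integrable torus (\<lambda>x. f x * g x)"
 by (rule integrable_mult_squares[OF ELpD(3,4) ELpD(3,4)])

definition n2 :: "tfun => real" where "n2 f = sqrt (avg x. (f x)^2)"

lemma n2_nonneg [simp]: "0 \<le> n2 f" by (simp add: n2_def)

lemma n2_sq: "(n2 f)^2 = (avg x. (f x)^2)" by (simp add: n2_def)

lemma L2_inner_le: "f \<in> ELp 2 ==> g \<in> ELp 2 ==> \<bar>ip f g\<bar> \<le> n2 f * n2 g"
 unfolding L2_inner_def n2_def by (rule Cauchy_Schwarz_abs(2)[OF ELpD(3,4) ELpD(3,4)])

lemma L1_mult_le: "f \<in> ELp 2 ==> g \<in> ELp 2 ==> (avg x. \<bar>f x * g x\<bar>) \<le> n2 f * n2 g"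
 unfolding n2_def by (rule Cauchy_Schwarz_abs(1)[OF ELpD(3,4) ELpD(3,4)])

lemma L1_le_n2: "f \<in> ELp 2 ==> (avg x. \<bar>f x\<bar>) \<le> n2 f"
 unfolding n2_def by (rule torus.expectation_abs_le_sqrt[OF ELpD(3,4)])

lemma n2_triangle:
 assumes f: "f \<in> ELp 2" and g: "g \<in> ELp 2" shows "n2 (\<lambda>x. f x + g x) \<le> n2 f + n2 g"
proof -
 have "(n2 (\<lambda>x. f x + g x))^2 = (avg x. (f x)^2 + 2 * (f x * g x) + (g x)^2)"
  unfolding n2_sq by (intro bochner_cong) (auto simp: power2_eq_square algebra_simps)
 also have "\<dots> = (n2 f)^2 + 2 * ip f g + (n2 g)^2"
  unfolding n2_sq L2_inner_def using ELpD(4)[OF f] ELpD(4)[OF g] integrable_ELp2_mult[OF f g] by simp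
 also have "\<dots> \<le> (n2 f)^2 + 2 * (n2 f * n2 g) + (n2 g)^2" using L2_inner_le[OF f g] by simp
 also have "\<dots> = (n2 f + n2 g)^2" by (simp add: power2_eq_square algebra_simps)
 finally show ?thesis by (rule power2_le_imp_le) simp
qed

lemma n2_cmult: "n2 (\<lambda>x. c * f x) = \<bar>c\<bar> * n2 f"
 by (simp add: n2_def power_mult_distrib real_sqrt_mult)

lemma n2_diff: "f \<in> ELp 2 ==> g \<in> ELp 2 ==> n2 (f -. g) \<le> n2 f + n2 g"
 using n2_triangle[OF _ ELp_cmult[of g 2 "-1"], of f] n2_cmult[of "-1" g] by simp

lemma n2_minus_commute: "n2 (f -. g) = n2 (g -. f)"
 by (simp add: n2_def power2_commute)

lemma L2_inner_commute: "ip f g = ip g f" by (simp add: L2_inner_def mult.commute)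

lemma L2_inner_add_left:
 "f \<in> ELp 2 ==> g \<in> ELp 2 ==> h \<in> ELp 2 ==> ip (\<lambda>x. f x + g x) h = ip f h + ip g h"
 unfolding L2_inner_def by (simp add: distrib_right integrable_ELp2_mult)

lemma L2_inner_diff_left:
 "f \<in> ELp 2 ==> g \<in> ELp 2 ==> h \<in> ELp 2 ==> ip (f -. g) h = ip f h - ip g h"
 unfolding L2_inner_def by (simp add: left_diff_distrib integrable_ELp2_mult)

lemma L2_inner_cmult_left: "ip (\<lambda>x. c * f x) h = c * ip f h"
 unfolding L2_inner_def by (simp add: mult.assoc)

lemma L2_inner_sum_left:
 "finite K ==> (\<And>k. k \<in> K ==> f k \<in> ELp 2) ==> h \<in> ELp 2 ==>
  ip (\<lambda>x. \<Sum>k\<in>K. f k x) h = (\<Sum>k\<in>K. ip (f k) h)"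
 unfolding L2_inner_def by (simp add: sum_distrib_right integrable_ELp2_mult)

lemma L2_inner_self: "ip f f = (n2 f)^2"
 unfolding n2_sq L2_inner_def by (simp add: power2_eq_square)

lemma zero_mean_diff: "f \<in> \<E> ==> g \<in> \<E> ==> (f -. g) \<in> \<E>"
 by (auto simp: zero_mean_L2_iff ELp_diff ELp2_integrable)

lemma zero_mean_add: "f \<in> \<E> ==> g \<in> \<E> ==> (\<lambda>x. f x + g x) \<in> \<E>"
 by (auto simp: zero_mean_L2_iff ELp_add ELp2_integrable)

lemma zero_mean_cmult: "f \<in> \<E> ==> (\<lambda>x. c * f x) \<in> \<E>"
 by (auto simp: zero_mean_L2_iff ELp_cmult ELp2_integrable)

declare split_paired_All [simp del] split_paired_Ex [simp del]

section \<open>Trigonometric polynomials\<close>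

definition ang :: "int \<times> int => tfun" where
 "ang k x = 2 * pi * (of_int (fst k) * fst x + of_int (snd k) * snd x)"

lemma ang_inner: "2 * pi * (kvec k \<bullet> x) = ang k x"
 by (cases x) (simp add: ang_def kvec_def)

lemma ang_add: "ang (j + k) x = ang j x + ang k x" and ang_minus: "ang (- k) x = - ang k x"
 and ang_diff: "ang (j - k) x = ang j x - ang k x"
 and ang_0: "ang 0 x = 0" and ang_diff_right: "ang k (x - y) = ang k x - ang k y"
 by (auto simp: ang_def algebra_simps)

text \<open>Trigonometric polynomials, generated by cosines with an arbitrary phase. Phases absorb
  sines, reflections and derivatives (a shift of the phase by pi/2), so that closure proofs have a
  single base case.\<close>

inductive_set TP :: "tfun set" where
 cos: "(\<lambda>x. cos (ang k x + b)) \<in> TP"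
| scale: "f \<in> TP ==> (\<lambda>x. c * f x) \<in> TP"
| add: "f \<in> TP ==> g \<in> TP ==> (\<lambda>x. f x + g x) \<in> TP"

lemma TP_const: "(\<lambda>x. c) \<in> TP"
 using TP.scale[OF TP.cos[of 0 0], of c] by (simp add: ang_0)

lemma TP_sum: "finite K ==> (\<And>k. k \<in> K ==> f k \<in> TP) ==> (\<lambda>x. \<Sum>k\<in>K. f k x) \<in> TP"
 by (induction K rule: finite_induct) (auto intro: TP.add TP_const)

lemma TP_mult: "f \<in> TP ==> g \<in> TP ==> (\<lambda>x. f x * g x) \<in> TP"
proof (induction rule: TP.induct)
 case (cos k b)
 from cos show ?case
 proof (induction rule: TP.induct)
  case (cos j c)
  have "(\<lambda>x. cos (ang k x + b) * cos (ang j x + c)) =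
   (\<lambda>x. (1/2) * cos (ang (k - j) x + (b - c)) + (1/2) * cos (ang (k + j) x + (b + c)))"
   by (rule ext) (simp add: cos_times_cos ang_add ang_diff algebra_simps)
  moreover have "\<dots> \<in> TP" by (intro TP.intros)
  ultimately show ?case by (simp only:)
 next
  case (scale g c) show ?case using TP.scale[OF scale.IH, of c] by (simp add: mult_ac)
 next
  case (add g h) show ?case using TP.add[OF add.IH] by (simp add: distrib_left)
 qed
next
 case (scale f c)
 show ?case using TP.scale[OF scale.IH[OF scale.prems], of c] by (simp add: mult_ac)
next
 case (add f h)
 show ?case using TP.add[OF add.IH(1)[OF add.prems] add.IH(2)[OF add.prems]] by (simp add: distrib_right)
qed

lemma TP_power: "f \<in> TP ==> (\<lambda>x. f x ^ m) \<in> TP"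
 by (induction m) (auto intro: TP_const TP_mult)

lemma ang_periodic: "ang k (x + (of_int m, of_int n)) = ang k x + 2 * pi * of_int (fst k * m + snd k * n)"
 by (simp add: ang_def algebra_simps)

lemma cos_add_int: "cos (t + 2 * pi * of_int m) = cos t" and sin_add_int: "sin (t + 2 * pi * of_int m) = sin t"
proof -
 have "sin (of_int m * (2 * pi)) = 0" "cos (of_int m * (2 * pi)) = 1"
  using sin_int_2pin[of m] cos_int_2pin[of m] by (simp_all add: mult.commute)
 then show "cos (t + 2 * pi * of_int m) = cos t" "sin (t + 2 * pi * of_int m) = sin t"
  by (simp_all add: cos_add sin_add mult.commute mult.left_commute)
qed

lemma TP_periodic: "f \<in> TP ==> periodic f"
proof (induction rule: TP.induct)
 case (cos k b)
 show ?case unfolding periodic_def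
 proof (intro allI)
  fix x m n
  have "ang k (x + (of_int m, of_int n)) + b = (ang k x + b) + 2 * pi * of_int (fst k * m + snd k * n)"
   by (simp only: ang_periodic)
  then show "cos (ang k (x + (of_int m, of_int n)) + b) = cos (ang k x + b)" by (simp only: cos_add_int)
 qed
qed (auto simp: periodic_def)

lemma TP_bounded: "f \<in> TP ==> \<exists>B. \<forall>x. \<bar>f x\<bar> \<le> B"
proof (induction rule: TP.induct)
 case (cos k b) show ?case by (rule exI[of _ 1]) auto
next
 case (scale f c)
 then obtain B where "\<forall>x. \<bar>f x\<bar> \<le> B" by blast
 then show ?case by (intro exI[of _ "\<bar>c\<bar> * B"]) (auto simp: abs_mult mult_left_mono)
next
 case (add f g)
 then obtain B C where "\<forall>x. \<bar>f x\<bar> \<le> B" "\<forall>x. \<bar>g x\<bar> \<le> C" by blast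
 then show ?case by (intro exI[of _ "B + C"]) (meson abs_triangle_ineq add_mono order_trans)
qed

lemma ang_deriv: "(ang k has_derivative (\<lambda>h. fst h * (2 * pi * of_int (fst k)) + snd h * (2 * pi * of_int (snd k)))) (at x)"
proof -
 have "bounded_linear (ang k)"
  unfolding ang_def[abs_def]
  by (intro bounded_linear_mult_right[THEN bounded_linear_compose] bounded_linear_add bounded_linear_fst bounded_linear_snd)
 from bounded_linear_imp_has_derivative[OF this] show ?thesis
  by (rule has_derivative_eq_rhs) (auto simp: ang_def algebra_simps)
qed

lemma cos_ang_deriv:
 "((\<lambda>x. cos (ang k x + b)) has_derivative (\<lambda>h. fst h * (2 * pi * of_int (fst k) * cos (ang k x + (b + pi / 2)))
   + snd h * (2 * pi * of_int (snd k) * cos (ang k x + (b + pi / 2))))) (at x)"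
proof -
 have c: "cos (ang k x + (b + pi / 2)) = - sin (ang k x + b)"
  using cos_add[of "ang k x + b" "pi / 2"] by (simp add: add.assoc)
 show ?thesis unfolding c
  by (rule has_derivative_eq_rhs[OF has_derivative_cos[OF has_derivative_add[OF ang_deriv has_derivative_const]]])
    (auto simp: algebra_simps)
qed

lemma TP_smooth: "f \<in> TP ==> smooth f"
proof (induction rule: TP.induct)
 case (cos k b)
 \<comment> \<open>A derivative multiplies by a frequency component and advances the phase by pi/2,
   which makes all mixed derivatives explicit.\<close>
 let ?D = "\<lambda>i j x. (2 * pi * of_int (fst k)) ^ i * (2 * pi * of_int (snd k)) ^ j * cos (ang k x + (b + real (i + j) * (pi / 2)))"
 have d: "(?D i j has_derivative (\<lambda>h. fst h * ?D (Suc i) j x + snd h * ?D i (Suc j) x)) (at x)" for i j x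
 proof -
  have s: "b + real (Suc i + j) * (pi / 2) = (b + real (i + j) * (pi / 2)) + pi / 2"
   "b + real (i + Suc j) * (pi / 2) = (b + real (i + j) * (pi / 2)) + pi / 2"
   by (simp_all add: algebra_simps add_divide_distrib)
  show ?thesis unfolding s
   by (rule has_derivative_eq_rhs[OF has_derivative_mult_right[OF cos_ang_deriv]]) (auto simp: algebra_simps)
 qed
 show ?case unfolding smooth_def by (rule exI[of _ ?D]) (intro conjI allI d, simp)
next
 case (scale f c)
 then obtain D where D: "D 0 0 = f" "\<And>i j x. (D i j has_derivative
    (\<lambda>h. fst h * D (Suc i) j x + snd h * D i (Suc j) x)) (at x)" unfolding smooth_def by blast
 show ?case unfolding smooth_def
 proof (rule exI[of _ "\<lambda>i j x. c * D i j x"], intro conjI allI)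
  show "((\<lambda>x. c * D i j x) has_derivative (\<lambda>h. fst h * (c * D (Suc i) j x) + snd h * (c * D i (Suc j) x))) (at x)" for i j x
   by (rule has_derivative_eq_rhs[OF has_derivative_mult_right[OF D(2)]]) (auto simp: algebra_simps)
 qed (simp add: D)
next
 case (add f g)
 then obtain D E where D: "D 0 0 = f" "\<And>i j x. (D i j has_derivative
    (\<lambda>h. fst h * D (Suc i) j x + snd h * D i (Suc j) x)) (at x)"
   and E: "E 0 0 = g" "\<And>i j x. (E i j has_derivative
    (\<lambda>h. fst h * E (Suc i) j x + snd h * E i (Suc j) x)) (at x)" unfolding smooth_def by blast
 show ?case unfolding smooth_def
 proof (rule exI[of _ "\<lambda>i j x. D i j x + E i j x"], intro conjI allI)
  show "((\<lambda>x. D i j x + E i j x) has_derivative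
   (\<lambda>h. fst h * (D (Suc i) j x + E (Suc i) j x) + snd h * (D i (Suc j) x + E i (Suc j) x))) (at x)" for i j x
   by (rule has_derivative_eq_rhs[OF has_derivative_add[OF D(2) E(2)]]) (auto simp: algebra_simps)
 qed (simp add: D E)
qed

lemma TP_test: "f \<in> TP ==> test_function f"
 by (simp add: test_function_def TP_smooth TP_periodic)

text \<open>A relation instead of a chosen derivative: gradients of sums and products are composed
  by rules, and \<open>gradient_grad\<close> recovers \<open>grad\<close> from the result.\<close>

definition gradient :: "tfun => tfun => tfun => bool" where
 "gradient f g1 g2 \<longleftrightarrow> (\<forall>x. (f has_derivative (\<lambda>h. fst h * g1 x + snd h * g2 x)) (at x))"

lemma gradientD: "gradient f g1 g2 ==> (f has_derivative (\<lambda>h. fst h * g1 x + snd h * g2 x)) (at x)"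
 by (simp add: gradient_def)

lemma gradient_grad:
 assumes "gradient f g1 g2" shows "grad f = (\<lambda>x. (g1 x, g2 x))"
proof
 fix x
 show "grad f x = (g1 x, g2 x)"
  unfolding grad_def frechet_derivative_at[OF gradientD[OF assms, of x], symmetric] by simp
qed

definition pd1 :: "tfun => tfun" where "pd1 f x = fst (grad f x)"
definition pd2 :: "tfun => tfun" where "pd2 f x = snd (grad f x)"

lemma gradient_pd: "gradient f g1 g2 ==> pd1 f = g1" "gradient f g1 g2 ==> pd2 f = g2"
 by (simp_all add: pd1_def[abs_def] pd2_def[abs_def] gradient_grad)

lemma gradient_continuous: "gradient f g1 g2 ==> continuous_on UNIV f"
 by (rule continuous_at_imp_continuous_on, rule ballI, rule has_derivative_continuous, rule gradientD)

lemma gradient_add: "gradient f f1 f2 ==> gradient g g1 g2 ==>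
  gradient (\<lambda>x. f x + g x) (\<lambda>x. f1 x + g1 x) (\<lambda>x. f2 x + g2 x)"
 unfolding gradient_def
 by (intro allI) (rule has_derivative_eq_rhs[OF has_derivative_add], blast, blast, auto simp: algebra_simps)

lemma gradient_scale: "gradient f f1 f2 ==> gradient (\<lambda>x. c * f x) (\<lambda>x. c * f1 x) (\<lambda>x. c * f2 x)"
 unfolding gradient_def
 by (intro allI) (rule has_derivative_eq_rhs[OF has_derivative_mult_right], blast, auto simp: algebra_simps)

lemma gradient_mult: "gradient f f1 f2 ==> gradient g g1 g2 ==>
  gradient (\<lambda>x. f x * g x) (\<lambda>x. f1 x * g x + f x * g1 x) (\<lambda>x. f2 x * g x + f x * g2 x)"
 unfolding gradient_def
 by (intro allI) (rule has_derivative_eq_rhs[OF has_derivative_mult], blast, blast, auto simp: algebra_simps)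

lemma TP_gradient_ex: "f \<in> TP ==> \<exists>g1\<in>TP. \<exists>g2\<in>TP. gradient f g1 g2"
proof (induction rule: TP.induct)
 case (cos k b)
 show ?case
  by (rule bexI[of _ "\<lambda>x. 2 * pi * of_int (fst k) * cos (ang k x + (b + pi / 2))"],
    rule bexI[of _ "\<lambda>x. 2 * pi * of_int (snd k) * cos (ang k x + (b + pi / 2))"])
    (auto simp: gradient_def cos_ang_deriv intro!: TP.intros)
next
 case (scale f c)
 then obtain g1 g2 where "g1 \<in> TP" "g2 \<in> TP" "gradient f g1 g2" by blast
 then show ?case by (intro bexI[of _ "\<lambda>x. c * g1 x"] bexI[of _ "\<lambda>x. c * g2 x"] gradient_scale TP.scale)
next
 case (add f g)
 then obtain g1 g2 h1 h2 where "g1 \<in> TP" "g2 \<in> TP" "gradient f g1 g2" "h1 \<in> TP" "h2 \<in> TP" "gradient g h1 h2" by blast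
 then show ?case by (intro bexI[of _ "\<lambda>x. g1 x + h1 x"] bexI[of _ "\<lambda>x. g2 x + h2 x"] gradient_add TP.add)
qed

lemma TP_gradient: "gradient f (pd1 f) (pd2 f)" and TP_pd1: "pd1 f \<in> TP" and TP_pd2: "pd2 f \<in> TP" if f: "f \<in> TP"
proof -
 obtain g1 g2 where g: "g1 \<in> TP" "g2 \<in> TP" "gradient f g1 g2" using TP_gradient_ex[OF f] by blast
 show "gradient f (pd1 f) (pd2 f)" "pd1 f \<in> TP" "pd2 f \<in> TP" using g by (simp_all add: gradient_pd[OF g(3)])
qed

lemma pd_add: "f \<in> TP ==> g \<in> TP ==> pd1 (\<lambda>x. f x + g x) = (\<lambda>x. pd1 f x + pd1 g x)"
  "f \<in> TP ==> g \<in> TP ==> pd2 (\<lambda>x. f x + g x) = (\<lambda>x. pd2 f x + pd2 g x)"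
 by (rule gradient_pd[OF gradient_add[OF TP_gradient TP_gradient]], assumption+)+

lemma pd_scale: "f \<in> TP ==> pd1 (\<lambda>x. c * f x) = (\<lambda>x. c * pd1 f x)"
  "f \<in> TP ==> pd2 (\<lambda>x. c * f x) = (\<lambda>x. c * pd2 f x)"
 by (rule gradient_pd[OF gradient_scale[OF TP_gradient]], assumption)+

lemma pd_mult: "f \<in> TP ==> g \<in> TP ==> pd1 (\<lambda>x. f x * g x) = (\<lambda>x. pd1 f x * g x + f x * pd1 g x)"
  "f \<in> TP ==> g \<in> TP ==> pd2 (\<lambda>x. f x * g x) = (\<lambda>x. pd2 f x * g x + f x * pd2 g x)"
 by (rule gradient_pd[OF gradient_mult[OF TP_gradient TP_gradient]], assumption+)+

lemma pd_const: "pd1 (\<lambda>x. c) = (\<lambda>x. 0)" "pd2 (\<lambda>x. c) = (\<lambda>x. 0)"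
proof -
 have "gradient (\<lambda>x. c) (\<lambda>x. 0) (\<lambda>x. 0)" by (simp add: gradient_def)
 then show "pd1 (\<lambda>x. c) = (\<lambda>x. 0)" "pd2 (\<lambda>x. c) = (\<lambda>x. 0)" by (simp_all add: gradient_pd)
qed

lemma pd_sum: "finite K ==> (\<And>k. k \<in> K ==> f k \<in> TP) ==>
  pd1 (\<lambda>x. \<Sum>k\<in>K. f k x) = (\<lambda>x. \<Sum>k\<in>K. pd1 (f k) x) \<and> pd2 (\<lambda>x. \<Sum>k\<in>K. f k x) = (\<lambda>x. \<Sum>k\<in>K. pd2 (f k) x)"
proof (induction K rule: finite_induct)
 case (insert k K)
 then show ?case using pd_add[of "f k" "\<lambda>x. \<Sum>k\<in>K. f k x"] TP_sum[of K f] by auto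
qed (simp add: pd_const)

lemma TP_continuous: "f \<in> TP ==> continuous_on UNIV f"
 by (rule gradient_continuous[OF TP_gradient])

lemma TP_measurable: "f \<in> TP ==> f \<in> borel_measurable borel"
 by (rule borel_measurable_continuous_onI[OF TP_continuous])

lemma TP_ELp: "f \<in> TP ==> f \<in> ELp p"
proof -
 assume f: "f \<in> TP"
 obtain B where B: "\<And>x. \<bar>f x ^ p\<bar> \<le> B" using TP_bounded[OF TP_power[OF f, of p]] by blast
 have m: "(\<lambda>x. f x ^ p) \<in> borel_measurable torus"
  by (rule measurable_torus[OF TP_measurable[OF TP_power[OF f]]])
 have "integrable torus (\<lambda>x. f x ^ p)"
  by (rule integrable_bounded_by[of torus "\<lambda>x. B"]) (use B m in auto)
 then show ?thesis by (rule ELpI[OF TP_measurable[OF f] TP_periodic[OF f]])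
qed

lemma TP_integrable: "f \<in> TP ==> integrable torus f"
 using ELpD(4)[OF TP_ELp[of f 1]] by simp

section \<open>Integration by parts\<close>

lemma integral_circ_derivative:
 assumes d: "\<And>t. (F has_real_derivative f t) (at t)" and c: "continuous_on UNIV f"
 shows "(\<integral>t. f t \<partial>circ) = F 1 - F 0"
proof -
 have "has_bochner_integral lborel (\<lambda>x. f x * indicator {0..1} x) (F 1 - F 0)"
  by (rule has_bochner_integral_FTC_Icc_real)
    (use d c in \<open>simp_all add: continuous_on_eq_continuous_at\<close>)
 then have "(\<integral>x. f x * indicator {0..1} x \<partial>lborel) = F 1 - F 0" by (rule has_bochner_integral_integral_eq)
 moreover have "(\<integral>x. f x * indicator {0..1} x \<partial>lborel) = (\<integral>x. indicator {0..<1} x *\<^sub>R f x \<partial>lborel)"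
  using borel_measurable_continuous_onI[OF c]
  by (intro integral_cong_AE AE_I'[of "{1::real}"]) (auto simp: indicator_def)
 moreover have "(\<integral>t. f t \<partial>circ) = (\<integral>x. indicator {0..<1} x *\<^sub>R f x \<partial>lborel)"
  unfolding circ_def by (subst integral_restrict_space) auto
 ultimately show ?thesis by simp
qed

lemma integrable_torus_continuous:
 fixes f :: "tfun"
 assumes c: "continuous_on UNIV f" shows "integrable torus f"
proof -
 have "compact (f ` ({0..1} \<times> {0..1}))"
  by (intro compact_continuous_image continuous_on_subset[OF c] compact_Times) auto
 then have "bounded (f ` ({0..1} \<times> {0..1}))" by (rule compact_imp_bounded)
 then obtain B where B: "\<forall>y\<in>f ` ({0..1} \<times> {0..1}). norm y \<le> B" unfolding bounded_iff by blast
 have "\<bar>f x\<bar> \<le> B" if "x \<in> space torus" for x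
 proof -
  have "x \<in> {0..1} \<times> {0..1}" using that by (auto simp: space_torus)
  from bspec[OF B imageI[OF this]] show ?thesis by simp
 qed
 then show ?thesis
  using measurable_torus[OF borel_measurable_continuous_onI[OF c]]
  by - (rule integrable_bounded_by[of torus "\<lambda>x. B"], simp_all)
qed

text \<open>On every line parallel to an axis the partial derivative integrates over one period to a
  difference of equal values of f; Fubini does the rest.\<close>

lemma integral_gradient_zero:
 assumes g: "gradient f f1 f2" and c: "continuous_on UNIV f1" "continuous_on UNIV f2" and per: "periodic f"
 shows "(avg x. f1 x) = 0" "(avg x. f2 x) = 0"
proof -
 have i1: "integrable (circ \<Otimes>\<^sub>M circ) (\<lambda>(s, t). f1 (s, t))" "integrable (circ \<Otimes>\<^sub>M circ) (\<lambda>(s, t). f2 (s, t))"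
  using integrable_torus_continuous[OF c(1)] integrable_torus_continuous[OF c(2)] by (simp_all add: torus_eq)
 have d1: "((\<lambda>s. f (s, t)) has_real_derivative f1 (s, t)) (at s)" for s t
 proof -
  have "((\<lambda>s. (s, t)) has_derivative (\<lambda>h. (h, 0))) (at s)" by (auto intro!: derivative_eq_intros)
  from has_derivative_compose[OF this gradientD[OF g]] show ?thesis by (simp add: has_field_derivative_def mult.commute[of _ "f1 _"])
 qed
 have d2: "((\<lambda>t. f (s, t)) has_real_derivative f2 (s, t)) (at t)" for s t
 proof -
  have "((\<lambda>t. (s, t)) has_derivative (\<lambda>h. (0, h))) (at t)" by (auto intro!: derivative_eq_intros)
  from has_derivative_compose[OF this gradientD[OF g]] show ?thesis by (simp add: has_field_derivative_def mult.commute[of _ "f2 _"])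
 qed
 have c1: "continuous_on UNIV (\<lambda>s. f1 (s, t))" for t
  by (rule continuous_on_compose2[OF c(1)]) (auto intro!: continuous_intros)
 have c2: "continuous_on UNIV (\<lambda>t. f2 (s, t))" for s
  by (rule continuous_on_compose2[OF c(2)]) (auto intro!: continuous_intros)
 have z1: "(\<integral>s. f1 (s, t) \<partial>circ) = 0" for t
  using integral_circ_derivative[OF d1 c1] periodicD1[OF per, of 0 1 t] by simp
 have z2: "(\<integral>t. f2 (s, t) \<partial>circ) = 0" for s
  using integral_circ_derivative[OF d2 c2] periodicD2[OF per, of s 0 1] by simp
 show "(avg x. f1 x) = 0" "(avg x. f2 x) = 0"
  using circ2.integral_snd[OF i1(1)] circ2.integral_fst'[OF i1(2)] by (simp_all add: z1 z2 torus_eq case_prod_beta')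
qed

lemma test_function_gradient:
 assumes "test_function \<phi>"
 shows "gradient \<phi> (pd1 \<phi>) (pd2 \<phi>)" "continuous_on UNIV \<phi>" "continuous_on UNIV (pd1 \<phi>)" "continuous_on UNIV (pd2 \<phi>)"
proof -
 from assms obtain D where D: "D 0 0 = \<phi>" "\<And>i j x. (D i j has_derivative
    (\<lambda>h. fst h * D (Suc i) j x + snd h * D i (Suc j) x)) (at x)" unfolding smooth_def test_function_def by blast
 have g: "gradient (D i j) (D (Suc i) j) (D i (Suc j))" for i j by (simp add: gradient_def D)
 have "gradient \<phi> (D (Suc 0) 0) (D 0 (Suc 0))" using g[of 0 0] by (simp add: D)
 moreover from this have "pd1 \<phi> = D (Suc 0) 0" "pd2 \<phi> = D 0 (Suc 0)" by (simp_all add: gradient_pd)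
 ultimately show "gradient \<phi> (pd1 \<phi>) (pd2 \<phi>)" "continuous_on UNIV \<phi>" "continuous_on UNIV (pd1 \<phi>)" "continuous_on UNIV (pd2 \<phi>)"
  using gradient_continuous[OF g] by (auto intro: gradient_continuous)
qed

text \<open>The product of f and the test function is periodic, so its partial derivatives have mean
  zero.\<close>

lemma integration_by_parts:
 assumes f: "f \<in> TP" and \<phi>: "test_function \<phi>"
 shows "ip f (pd1 \<phi>) = - ip (pd1 f) \<phi>" "ip f (pd2 \<phi>) = - ip (pd2 f) \<phi>"
proof -
 note g = test_function_gradient[OF \<phi>]
 note cf = TP_continuous[OF f] TP_continuous[OF TP_pd1[OF f]] TP_continuous[OF TP_pd2[OF f]]
 have c: "continuous_on UNIV (\<lambda>x. pd1 f x * \<phi> x)" "continuous_on UNIV (\<lambda>x. f x * pd1 \<phi> x)"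
   "continuous_on UNIV (\<lambda>x. pd2 f x * \<phi> x)" "continuous_on UNIV (\<lambda>x. f x * pd2 \<phi> x)"
  using g cf by (auto intro!: continuous_on_mult)
 have p: "periodic (\<lambda>x. f x * \<phi> x)" using \<phi> TP_periodic[OF f] by (auto simp: test_function_def intro: periodic_mult)
 have "(avg x. pd1 f x * \<phi> x + f x * pd1 \<phi> x) = 0" "(avg x. pd2 f x * \<phi> x + f x * pd2 \<phi> x) = 0"
  using integral_gradient_zero[OF gradient_mult[OF TP_gradient[OF f] g(1)] _ _ p] c by (simp_all add: continuous_on_add)
 then show "ip f (pd1 \<phi>) = - ip (pd1 f) \<phi>" "ip f (pd2 \<phi>) = - ip (pd2 f) \<phi>"
  using c[THEN integrable_torus_continuous] by (simp_all add: L2_inner_def)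
qed

section \<open>The trigonometric basis\<close>

lemma minus_Zplus: "k \<in> Z0 ==> - k \<in> Zplus \<longleftrightarrow> k \<notin> Zplus"
 by (cases k) (auto simp: Zplus_def Z0_def)

lemma minus_Z0: "- k \<in> Z0 \<longleftrightarrow> k \<in> Z0"
 by (cases k) (auto simp: Z0_def)

lemma Z0_iff: "k \<in> Z0 \<longleftrightarrow> k \<noteq> 0"
 by (cases k) (simp add: Z0_def zero_prod_def)

text \<open>Since cos (s - pi/2) = sin s, both kinds of basis functions become cosines with a
  phase.\<close>

definition ph :: "int \<times> int => real" where "ph k = (if k \<in> Zplus then 0 else - (pi / 2))"

lemma e_basis_eq: "eb k = (\<lambda>x. sqrt 2 * cos (ang k x + ph k))"
 by (rule ext) (simp add: e_basis_def ang_inner ph_def cos_diff)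

lemma e_basis_TP [simp]: "eb k \<in> TP"
 unfolding e_basis_eq by (intro TP.intros)

lemma e_basis_bounded: "\<bar>eb k x\<bar> \<le> sqrt 2"
 by (simp add: e_basis_eq abs_mult)

text \<open>Some component of k is nonzero, so up to a factor the integrand is a partial derivative
  of a periodic function.\<close>

lemma integral_cos_ang:
 assumes "k \<noteq> 0" shows "(avg x. cos (ang k x + b)) = 0"
proof -
 have g: "gradient (\<lambda>x. cos (ang k x + (b - pi / 2))) (\<lambda>x. 2 * pi * of_int (fst k) * cos (ang k x + b))
   (\<lambda>x. 2 * pi * of_int (snd k) * cos (ang k x + b))"
  using cos_ang_deriv[of k "b - pi / 2"] by (simp add: gradient_def)
 have c: "continuous_on UNIV (\<lambda>x. a * cos (ang k x + b))" for a
  by (rule TP_continuous) (intro TP.intros)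
 have "(avg x. 2 * pi * of_int (fst k) * cos (ang k x + b)) = 0"
  "(avg x. 2 * pi * of_int (snd k) * cos (ang k x + b)) = 0"
  using integral_gradient_zero[OF g c c TP_periodic[OF TP.cos]] by auto
 moreover have "fst k \<noteq> 0 \<or> snd k \<noteq> 0" using assms by (cases k) (simp add: zero_prod_def)
 ultimately show ?thesis by auto
qed

lemma e_basis_zero_mean: "k \<in> Z0 ==> (avg x. eb k x) = 0"
 by (simp add: e_basis_eq integral_cos_ang Z0_iff)

lemma e_basis_orthonormal:
 assumes j: "j \<in> Z0" and k: "k \<in> Z0"
 shows "ip (eb j) (eb k) = (if j = k then 1 else 0)"
proof -
 have I: "(avg x. cos (ang l x + b)) = (if l = 0 then cos b else 0)" for l b
  using integral_cos_ang[of l b] by (simp add: ang_0 torus.prob_space)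
 have "ip (eb j) (eb k)
   = (avg x. cos (ang (j - k) x + (ph j - ph k)) + cos (ang (j + k) x + (ph j + ph k)))"
  unfolding L2_inner_def
 proof (intro bochner_cong refl)
  fix x
  have "eb j x * eb k x = 2 * (cos (ang j x + ph j) * cos (ang k x + ph k))"
   by (simp add: e_basis_eq)
  then show "eb j x * eb k x = cos (ang (j - k) x + (ph j - ph k)) + cos (ang (j + k) x + (ph j + ph k))"
   by (simp add: cos_times_cos ang_add ang_diff algebra_simps)
 qed
 also have "\<dots> = (avg x. cos (ang (j - k) x + (ph j - ph k))) + (avg x. cos (ang (j + k) x + (ph j + ph k)))"
  by (intro bochner_add TP_integrable TP.intros)
 also have "\<dots> = (if j = k then 1 else 0)"
 proof -
  \<comment> \<open>Of two opposite modes one is a cosine and the other a sine; their phases add up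
    to -pi/2.\<close>
  have "cos (ph j + ph k) = 0" if "j + k = 0"
  proof -
   have "j = - k" using that by (simp add: eq_neg_iff_add_eq_0)
   then show ?thesis using minus_Zplus[OF k] by (auto simp: ph_def)
  qed
  moreover have "j + k \<noteq> 0" if "j = k" using k that by (cases k) (auto simp: Z0_def zero_prod_def)
  ultimately show ?thesis by (auto simp: I)
 qed
 finally show ?thesis .
qed

text \<open>Differentiation exchanges cosine and sine, hence the modes k and -k. The minus sign in
  the derivative of the cosine is absorbed because the sine is taken at the opposite
  frequency.\<close>

lemma e_basis_gradient:
 assumes k: "k \<in> Z0"
 shows "pd1 (eb k) = (\<lambda>x. 2 * pi * of_int (fst k) * eb (- k) x)"
  "pd2 (eb k) = (\<lambda>x. 2 * pi * of_int (snd k) * eb (- k) x)"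
proof -
 have e: "sqrt 2 * cos (ang k x + (ph k + pi / 2)) = eb (- k) x" for x
  using minus_Zplus[OF k] by (auto simp: e_basis_eq ang_minus ph_def cos_add cos_diff)
 have g: "gradient (\<lambda>x. cos (ang k x + ph k)) (\<lambda>x. 2 * pi * of_int (fst k) * cos (ang k x + (ph k + pi / 2)))
   (\<lambda>x. 2 * pi * of_int (snd k) * cos (ang k x + (ph k + pi / 2)))"
  using cos_ang_deriv[of k "ph k"] by (simp add: gradient_def)
 have "gradient (eb k) (\<lambda>x. 2 * pi * of_int (fst k) * eb (- k) x) (\<lambda>x. 2 * pi * of_int (snd k) * eb (- k) x)"
  using gradient_scale[OF g, of "sqrt 2"] unfolding e[symmetric] e_basis_eq[of k] by (simp add: mult_ac)
 then show "pd1 (eb k) = (\<lambda>x. 2 * pi * of_int (fst k) * eb (- k) x)"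
  "pd2 (eb k) = (\<lambda>x. 2 * pi * of_int (snd k) * eb (- k) x)" by (simp_all add: gradient_pd)
qed

lemma e_sum_TP: "finite K ==> (fsum K a) \<in> TP"
 by (intro TP_sum TP.scale) auto

lemma L2_inner_e_sum:
 assumes K: "finite K" "K \<subseteq> Z0" and j: "j \<in> Z0"
 shows "ip (fsum K a) (eb j) = (if j \<in> K then a j else 0)"
proof -
 have "ip (fsum K a) (eb j) = (\<Sum>k\<in>K. ip (\<lambda>x. a k * eb k x) (eb j))"
  by (intro L2_inner_sum_left K TP_ELp TP.scale e_basis_TP)
 also have "\<dots> = (\<Sum>k\<in>K. if j = k then a k else 0)"
  using K j by (intro sum.cong) (auto simp: L2_inner_cmult_left e_basis_orthonormal)
 finally show ?thesis using K by simp
qed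

lemma L2_inner_e_sum2:
 assumes K: "finite K" "K \<subseteq> Z0" and f: "f \<in> ELp 2"
 shows "ip (fsum K a) f = (\<Sum>k\<in>K. a k * ip f (eb k))"
 by (subst L2_inner_sum_left[OF K(1) _ f])
   (simp_all add: L2_inner_cmult_left L2_inner_commute[of f] TP_ELp TP.scale)

lemma e_sum_norm:
 assumes K: "finite K" "K \<subseteq> Z0"
 shows "(n2 (fsum K a))^2 = (\<Sum>k\<in>K. (a k)^2)"
proof -
 have "ip (fsum K a) (fsum K a) =
   (\<Sum>k\<in>K. a k * ip (fsum K a) (eb k))"
  by (rule L2_inner_e_sum2[OF K TP_ELp[OF e_sum_TP[OF K(1)]]])
 also have "\<dots> = (\<Sum>k\<in>K. (a k)^2)"
  using K by (intro sum.cong refl) (subst L2_inner_e_sum[OF K], auto simp: power2_eq_square)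
 finally show ?thesis by (simp add: L2_inner_self)
qed

lemma e_sum_zero_mean:
 assumes K: "finite K" "K \<subseteq> Z0" shows "(fsum K a) \<in> \<E>"
proof -
 have "(avg x. (\<Sum>k\<in>K. a k * eb k x)) = (\<Sum>k\<in>K. (avg x. a k * eb k x))"
  by (intro bochner_sum TP_integrable TP.scale e_basis_TP)
 also have "\<dots> = 0" using K by (intro sum.neutral) (auto simp: e_basis_zero_mean)
 finally show ?thesis by (simp add: zero_mean_L2_iff TP_ELp[OF e_sum_TP[OF K(1)]])
qed

text \<open>The addition theorem writes a cosine with arbitrary phase as a combination of the modes
  k and -k; the constant comes from k = 0.\<close>

lemma TP_representation:
 assumes "f \<in> TP" shows "\<exists>K a c. finite K \<and> K \<subseteq> Z0 \<and> f = (\<lambda>x. c + (\<Sum>k\<in>K. a k * eb k x))"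
 using assms
proof (induction rule: TP.induct)
 case (cos k b)
 show ?case
 proof (cases "k = 0")
  case True
  then show ?thesis by (intro exI[of _ "{}"] exI[of _ "\<lambda>_. 0"] exI[of _ "cos b"]) (simp add: ang_0)
 next
  case False
  then have k: "k \<in> Z0" by (simp add: Z0_iff)
  have ne: "k \<noteq> - k" using minus_Zplus[OF k] by metis
  have "\<exists>u v. \<forall>x. cos (ang k x + b) = u * eb k x + v * eb (- k) x"
  proof (cases "k \<in> Zplus")
   case True
   then show ?thesis
    using minus_Zplus[OF k]
    by (intro exI[of _ "cos b / sqrt 2"] exI[of _ "sin b / sqrt 2"])
      (simp add: e_basis_eq ph_def ang_minus cos_add cos_diff)
  next
   case False
   then show ?thesis
    using minus_Zplus[OF k]
    by (intro exI[of _ "- sin b / sqrt 2"] exI[of _ "cos b / sqrt 2"])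
      (simp add: e_basis_eq ph_def ang_minus cos_add cos_diff)
  qed
  then obtain u v where uv: "\<And>x. cos (ang k x + b) = u * eb k x + v * eb (- k) x" by blast
  show ?thesis
   using k ne by (intro exI[of _ "{k, - k}"] exI[of _ "\<lambda>j. if j = k then u else v"] exI[of _ 0])
     (simp add: uv minus_Z0)
 qed
next
 case (scale f r)
 then obtain K a c where "finite K" "K \<subseteq> Z0" "f = (\<lambda>x. c + (\<Sum>k\<in>K. a k * eb k x))" by blast
 then show ?case by (intro exI[of _ K] exI[of _ "\<lambda>k. r * a k"] exI[of _ "r * c"])
   (simp add: distrib_left sum_distrib_left mult.assoc)
next
 case (add f g)
 then obtain K a c L b d where f: "finite K" "K \<subseteq> Z0" "f = (\<lambda>x. c + (\<Sum>k\<in>K. a k * eb k x))"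
  and g: "finite L" "L \<subseteq> Z0" "g = (\<lambda>x. d + (\<Sum>k\<in>L. b k * eb k x))" by blast
 have "(\<Sum>k\<in>K. a k * eb k x) = (\<Sum>k\<in>K\<union>L. (if k \<in> K then a k else 0) * eb k x)"
  "(\<Sum>k\<in>L. b k * eb k x) = (\<Sum>k\<in>K\<union>L. (if k \<in> L then b k else 0) * eb k x)" for x
  using f(1) g(1) by (intro sum.mono_neutral_cong_left; auto)+
 then have "(\<lambda>x. f x + g x) = (\<lambda>x. (c + d) + (\<Sum>k\<in>K \<union> L. ((if k \<in> K then a k else 0) + (if k \<in> L then b k else 0)) * eb k x))"
  unfolding f(3) g(3) by (intro ext) (simp only: distrib_right sum.distrib add_ac)
 then show ?case
  using f(1,2) g(1,2) by (intro exI[of _ "K \<union> L"] exI[of _ "\<lambda>k. (if k \<in> K then a k else 0) + (if k \<in> L then b k else 0)"] exI[of _ "c + d"]) blast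
qed

lemma TP_expansion:
 assumes "f \<in> TP"
 obtains K where "finite K" "K \<subseteq> Z0"
  "\<And>x. f x = (avg x. f x) + (\<Sum>k\<in>K. ip f (eb k) * eb k x)"
  "\<And>k. k \<in> Z0 ==> k \<notin> K ==> ip f (eb k) = 0"
proof -
 obtain K a c where K: "finite K" "K \<subseteq> Z0" and f: "f = (\<lambda>x. c + (\<Sum>k\<in>K. a k * eb k x))"
  using TP_representation[OF assms] by blast
 note E = e_sum_zero_mean[OF K, of a]
 have c: "(avg x. f x) = c"
  unfolding f using zero_mean_L2D(2)[OF E] ELp2_integrable[OF zero_mean_L2D(1)[OF E]] by (simp add: torus.prob_space)
 have a: "ip f (eb j) = (if j \<in> K then a j else 0)" if j: "j \<in> Z0" for j
 proof -
  have "ip f (eb j) = ip (\<lambda>x. c) (eb j) + ip (fsum K a) (eb j)"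
   unfolding f by (intro L2_inner_add_left ELp_const TP_ELp e_sum_TP K e_basis_TP)
  moreover have "ip (\<lambda>x. c) (eb j) = 0"
   by (simp add: L2_inner_def e_basis_zero_mean[OF j])
  ultimately show ?thesis by (simp add: L2_inner_e_sum[OF K j])
 qed
 show thesis
 proof (rule that[OF K])
  show "f x = (avg x. f x) + (\<Sum>k\<in>K. ip f (eb k) * eb k x)" for x
  proof -
   have "(\<Sum>k\<in>K. ip f (eb k) * eb k x) = (\<Sum>k\<in>K. a k * eb k x)"
    using K a by (intro sum.cong) (auto simp: subset_iff)
   then show ?thesis unfolding c by (simp add: f)
  qed
  show "ip f (eb k) = 0" if "k \<in> Z0" "k \<notin> K" for k using a[OF that(1)] that by simp
 qed
qed

section \<open>Convolution with trigonometric polynomials\<close>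

lemma integrable_TP_mult: "V \<in> TP ==> integrable torus f ==> integrable torus (\<lambda>y. V y * f y)"
proof -
 assume V: "V \<in> TP" and f: "integrable torus f"
 obtain B where B: "\<forall>x. \<bar>V x\<bar> \<le> B" using TP_bounded[OF V] by blast
 have i: "integrable torus (\<lambda>y. B * \<bar>f y\<bar>)" using f by simp
 show "integrable torus (\<lambda>y. V y * f y)"
  by (rule integrable_bounded_by[OF i])
    (use f B measurable_torus[OF TP_measurable[OF V]] in \<open>auto simp: abs_mult mult_right_mono\<close>)
qed

definition conv :: "tfun => tfun => tfun" where
 "conv V f x = (avg y. V (x - y) * f y)"

lemma TP_reflect: "V \<in> TP ==> (\<lambda>y. V (x - y)) \<in> TP"
proof (induction rule: TP.induct)
 case (cos k b)
 have "(\<lambda>y. cos (ang k (x - y) + b)) = (\<lambda>y. cos (ang (- k) y + (ang k x + b)))"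
  by (rule ext) (simp add: ang_diff_right ang_minus algebra_simps)
 then show ?case by (simp only: TP.cos)
qed (auto intro: TP.intros)

lemma gradient_reflect:
 assumes "V \<in> TP"
 shows "gradient (\<lambda>y. V (x - y)) (\<lambda>y. - pd1 V (x - y)) (\<lambda>y. - pd2 V (x - y))"
 unfolding gradient_def
proof
 fix y
 have "((\<lambda>y. x - y) has_derivative (\<lambda>h. - h)) (at y)" by (auto intro!: derivative_eq_intros)
 from has_derivative_compose[OF this gradientD[OF TP_gradient[OF assms]]]
 show "((\<lambda>y. V (x - y)) has_derivative (\<lambda>h. fst h * - pd1 V (x - y) + snd h * - pd2 V (x - y))) (at y)" by simp
qed

lemma pd_reflect: "V \<in> TP ==> pd1 (\<lambda>y. V (x - y)) = (\<lambda>y. - pd1 V (x - y))"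
  "V \<in> TP ==> pd2 (\<lambda>y. V (x - y)) = (\<lambda>y. - pd2 V (x - y))"
 by (rule gradient_pd[OF gradient_reflect], assumption)+

lemma integrable_conv: "V \<in> TP ==> integrable torus f ==> integrable torus (\<lambda>y. V (x - y) * f y)"
 by (rule integrable_TP_mult[OF TP_reflect])

text \<open>A and B are the cosine and sine coefficients of f at the frequency k and do not depend
  on the phase b. The gradient of a convolution uses this for b and for b advanced by pi/2.\<close>

lemma conv_cos:
 assumes f: "integrable torus f"
 obtains A B where "\<And>b. conv (\<lambda>x. cos (ang k x + b)) f = (\<lambda>x. A * cos (ang k x + b) + B * cos (ang k x + (b - pi / 2)))"
proof
 fix b
 have i: "integrable torus (\<lambda>y. cos (ang k y) * f y)" "integrable torus (\<lambda>y. sin (ang k y) * f y)"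
  using integrable_TP_mult[OF TP.cos f, of k 0] integrable_TP_mult[OF TP.cos f, of k "- (pi / 2)"] by (simp_all add: cos_diff)
 show "conv (\<lambda>x. cos (ang k x + b)) f = (\<lambda>x. (avg y. cos (ang k y) * f y) * cos (ang k x + b)
   + (avg y. sin (ang k y) * f y) * cos (ang k x + (b - pi / 2)))"
 proof
  fix x
  have "conv (\<lambda>x. cos (ang k x + b)) f x =
    (avg y. cos (ang k x + b) * (cos (ang k y) * f y) + sin (ang k x + b) * (sin (ang k y) * f y))"
   unfolding conv_def
  proof (intro bochner_cong refl)
   fix y
   have "cos (ang k (x - y) + b) = cos ((ang k x + b) - ang k y)" by (simp add: ang_diff_right algebra_simps)
   then show "cos (ang k (x - y) + b) * f y = cos (ang k x + b) * (cos (ang k y) * f y) + sin (ang k x + b) * (sin (ang k y) * f y)"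
    by (simp add: cos_diff distrib_right mult.assoc)
  qed
  also have "\<dots> = (avg y. cos (ang k y) * f y) * cos (ang k x + b)
   + (avg y. sin (ang k y) * f y) * sin (ang k x + b)" using i by simp
  also have "sin (ang k x + b) = cos (ang k x + (b - pi / 2))"
   using cos_diff[of "ang k x + b" "pi / 2"] by (simp add: add_diff_eq)
  finally show "conv (\<lambda>x. cos (ang k x + b)) f x = (avg y. cos (ang k y) * f y) * cos (ang k x + b)
   + (avg y. sin (ang k y) * f y) * cos (ang k x + (b - pi / 2))" .
 qed
qed

lemma conv_scale_left: "conv (\<lambda>x. c * V x) f = (\<lambda>x. c * conv V f x)"
 by (rule ext) (simp add: conv_def mult.assoc)

lemma conv_add_left: "V \<in> TP ==> U \<in> TP ==> integrable torus f ==> conv (\<lambda>x. V x + U x) f = (\<lambda>x. conv V f x + conv U f x)"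
 by (rule ext) (simp add: conv_def distrib_right integrable_conv)

lemma conv_diff_right: "V \<in> TP ==> integrable torus f ==> integrable torus g ==>
  conv V (f -. g) x = conv V f x - conv V g x"
 by (simp add: conv_def right_diff_distrib integrable_conv)

lemma conv_TP_gradient:
 assumes f: "integrable torus f"
 shows "V \<in> TP ==> conv V f \<in> TP \<and> gradient (conv V f) (conv (pd1 V) f) (conv (pd2 V) f)"
proof (induction rule: TP.induct)
 case (cos k b)
 obtain A B where AB: "\<And>b. conv (\<lambda>x. cos (ang k x + b)) f = (\<lambda>x. A * cos (ang k x + b) + B * cos (ang k x + (b - pi / 2)))"
  using conv_cos[OF f, of k] by blast
 have g: "gradient (\<lambda>x. cos (ang k x + c)) (\<lambda>x. 2 * pi * of_int (fst k) * cos (ang k x + (c + pi / 2)))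
   (\<lambda>x. 2 * pi * of_int (snd k) * cos (ang k x + (c + pi / 2)))" for c
  using cos_ang_deriv[of k c] by (simp add: gradient_def)
 have "gradient (conv (\<lambda>x. cos (ang k x + b)) f)
   (\<lambda>x. A * (2 * pi * of_int (fst k) * cos (ang k x + (b + pi / 2))) + B * (2 * pi * of_int (fst k) * cos (ang k x + (b - pi / 2 + pi / 2))))
   (\<lambda>x. A * (2 * pi * of_int (snd k) * cos (ang k x + (b + pi / 2))) + B * (2 * pi * of_int (snd k) * cos (ang k x + (b - pi / 2 + pi / 2))))"
  unfolding AB by (intro gradient_add gradient_scale g)
 moreover have "conv (\<lambda>x. cos (ang k x + b)) f \<in> TP" unfolding AB by (intro TP.intros)
 moreover have e: "conv (\<lambda>x. 2 * pi * r * cos (ang k x + (b + pi / 2))) f =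
   (\<lambda>x. A * (2 * pi * r * cos (ang k x + (b + pi / 2))) + B * (2 * pi * r * cos (ang k x + (b - pi / 2 + pi / 2))))" for r
  unfolding conv_scale_left AB by (rule ext) (simp add: distrib_left)
 ultimately show ?case by (simp only: gradient_pd[OF g] e)
next
 case (scale V c)
 then show ?case by (simp add: conv_scale_left pd_scale gradient_scale TP.scale)
next
 case (add V U)
 then show ?case by (simp add: conv_add_left f pd_add gradient_add TP.add TP_pd1 TP_pd2)
qed

lemma conv_TP: "V \<in> TP ==> integrable torus f ==> conv V f \<in> TP"
 and pd_conv: "V \<in> TP ==> integrable torus f ==> pd1 (conv V f) = conv (pd1 V) f"
  "V \<in> TP ==> integrable torus f ==> pd2 (conv V f) = conv (pd2 V) f"
 using conv_TP_gradient gradient_pd by blast+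

lemma conv_reflect:
 assumes V: "V \<in> TP" and f: "f \<in> borel_measurable borel" "periodic f" "integrable torus f"
 shows "conv V f x = (avg z. V z * f (x - z))"
proof -
 have m: "(\<lambda>y. V (x - y) * f y) \<in> borel_measurable borel"
  using TP_measurable[OF TP_reflect[OF V]] f(1) by (rule borel_measurable_times)
 have "(avg z. V (x - (x - z)) * f (x - z)) = (avg y. V (x - y) * f y)"
  by (rule integral_torus_reflect[OF m periodic_mult[OF TP_periodic[OF TP_reflect[OF V]] f(2)] integrable_conv[OF V f(3)]])
 then show ?thesis by (simp add: conv_def)
qed

lemma integrable_torus2_mult:
 fixes h :: "plane \<times> plane => real"
 assumes h: "h \<in> borel_measurable torus2" "\<And>z. \<bar>h z\<bar> \<le> B" and f: "integrable torus f"
 shows "integrable torus2 (\<lambda>z. h z * f (snd z))" "integrable torus2 (\<lambda>z. h z * f (fst z))"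
proof -
 have mf: "f \<in> borel_measurable torus" using f by auto
 have m: "(\<lambda>z. f (snd z)) \<in> borel_measurable torus2" "(\<lambda>z. f (fst z)) \<in> borel_measurable torus2"
  by (rule measurable_compose[OF measurable_snd mf], rule measurable_compose[OF measurable_fst mf])
 have "integrable torus2 (\<lambda>(x, y). f y)"
  by (rule torus2.Fubini_integrable) (use m f in \<open>auto simp: case_prod_beta'\<close>)
 then have 1: "integrable torus2 (\<lambda>z. B * \<bar>f (snd z)\<bar>)" by (simp add: case_prod_beta')
 have "integrable torus2 (\<lambda>(x, y). f x)"
  by (rule torus2.Fubini_integrable) (use m f in \<open>auto simp: case_prod_beta'\<close>)
 then have 2: "integrable torus2 (\<lambda>z. B * \<bar>f (fst z)\<bar>)" by (simp add: case_prod_beta')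
 show "integrable torus2 (\<lambda>z. h z * f (snd z))"
  by (rule integrable_bounded_by[OF 1]) (use m h in \<open>simp_all add: abs_mult mult_right_mono\<close>)
 show "integrable torus2 (\<lambda>z. h z * f (fst z))"
  by (rule integrable_bounded_by[OF 2]) (use m h in \<open>simp_all add: abs_mult mult_right_mono\<close>)
qed

text \<open>Nonnegativity and unit mass make the convolution an average, so that Jensen's inequality
  applies to it.\<close>

definition prob_kernel :: "tfun => bool" where
 "prob_kernel V \<longleftrightarrow> V \<in> TP \<and> (\<forall>x. 0 \<le> V x) \<and> (avg x. V x) = 1"

lemma prob_kernelD: "prob_kernel V ==> V \<in> TP" "prob_kernel V ==> 0 \<le> V x"
  "prob_kernel V ==> (avg x. V x) = 1" by (auto simp: prob_kernel_def)

lemma prob_kernel_reflect: "prob_kernel V ==> (avg y. V (x - y)) = 1" "prob_kernel V ==> (avg x. V (x - y)) = 1"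
proof -
 assume V: "prob_kernel V"
 note t = TP_measurable[OF prob_kernelD(1)[OF V]] TP_periodic[OF prob_kernelD(1)[OF V]] TP_integrable[OF prob_kernelD(1)[OF V]]
 show "(avg y. V (x - y)) = 1" using integral_torus_reflect[OF t] prob_kernelD(3)[OF V] by simp
 show "(avg x. V (x - y)) = 1" using integral_torus_shift[OF t, of "- y"] prob_kernelD(3)[OF V] by simp
qed

lemma integral_conv:
 assumes V: "prob_kernel V" and f: "integrable torus f"
 shows "(avg x. conv V f x) = (avg x. f x)"
proof -
 obtain B where B: "\<forall>x. \<bar>V x\<bar> \<le> B" using TP_bounded[OF prob_kernelD(1)[OF V]] by blast
 have "integrable torus2 (\<lambda>z. (case z of (x, y) => V (x - y)) * f (snd z))"
  by (rule integrable_torus2_mult(1)[OF measurable_diff_torus[OF TP_measurable[OF prob_kernelD(1)[OF V]]] _ f]) (use B in auto)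
 then have "integrable torus2 (\<lambda>(x, y). V (x - y) * f y)" by (simp add: case_prod_beta')
 from torus2.Fubini_integral[OF this] show ?thesis
  by (simp add: conv_def prob_kernel_reflect[OF V])
qed

text \<open>Jensen for the probability density V (x - y), with the tangent of z^p taken at the value
  of the convolution itself. Integration over x then uses that averaging preserves the mean.\<close>

lemma conv_power_le:
 assumes V: "prob_kernel V" and f: "f \<in> ELp p" and p: "even p" "2 \<le> p"
 shows "(avg x. conv V f x ^ p) \<le> (avg x. f x ^ p)"
proof -
 note VT = prob_kernelD(1)[OF V]
 note fi = ELp_integrable[OF f p] and fp = ELpD(4)[OF f]
 have pt: "conv V f x ^ p \<le> conv V (\<lambda>y. f y ^ p) x" for x
 proof -
  let ?c = "conv V f x"
  have i: "integrable torus (\<lambda>y. V (x - y) * f y)" "integrable torus (\<lambda>y. V (x - y) * f y ^ p)" "integrable torus (\<lambda>y. V (x - y))"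
   using integrable_conv[OF VT fi] integrable_conv[OF VT fp] TP_integrable[OF TP_reflect[OF VT]] by auto
  have "?c ^ p = (?c ^ p - real p * ?c ^ (p - 1) * ?c) * 1 + real p * ?c ^ (p - 1) * conv V f x" by simp
  also have "\<dots> = (avg y. (?c ^ p - real p * ?c ^ (p - 1) * ?c) * V (x - y) + real p * ?c ^ (p - 1) * (V (x - y) * f y))"
   using i prob_kernel_reflect(1)[OF V, of x] by (simp add: conv_def)
  also have "\<dots> \<le> (avg y. V (x - y) * f y ^ p)"
  proof (intro integral_mono)
   fix y
   have "V (x - y) * (?c ^ p + real p * ?c ^ (p - 1) * (f y - ?c)) \<le> V (x - y) * f y ^ p"
    by (intro mult_left_mono even_power_tangent p prob_kernelD(2)[OF V])
   then show "(?c ^ p - real p * ?c ^ (p - 1) * ?c) * V (x - y) + real p * ?c ^ (p - 1) * (V (x - y) * f y) \<le> V (x - y) * f y ^ p"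
    by (simp add: algebra_simps)
  qed (use i in auto)
  finally show ?thesis by (simp add: conv_def)
 qed
 have "(avg x. conv V f x ^ p) \<le> (avg x. conv V (\<lambda>y. f y ^ p) x)"
  by (intro integral_mono pt TP_integrable TP_power conv_TP VT fi fp)
 then show ?thesis by (simp add: integral_conv[OF V fp])
qed

section \<open>The de la Vallee Poussin kernel\<close>

lemma integrable_circ_continuous:
 fixes f :: "real => real"
 assumes c: "continuous_on UNIV f" shows "integrable circ f"
proof -
 have "compact (f ` {0..1})"
  by (intro compact_continuous_image continuous_on_subset[OF c]) auto
 then have "bounded (f ` {0..1})" by (rule compact_imp_bounded)
 then obtain B where B: "\<forall>y\<in>f ` {0..1}. norm y \<le> B" unfolding bounded_iff by blast
 show ?thesis
 proof (rule integrable_bounded_by)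
  show "integrable circ (\<lambda>x. B)" by simp
  show "f \<in> borel_measurable circ" by (rule measurable_circ[OF borel_measurable_continuous_onI[OF c]])
  show "\<bar>f x\<bar> \<le> B" if "x \<in> space circ" for x using that B by (auto simp: space_circ)
 qed
qed

text \<open>The Wallis integrals, which normalise the even powers of the cosine.\<close>

definition cosint :: "nat => real" where "cosint n = (\<integral>t. cos (pi * t) ^ (2 * n) \<partial>circ)"

lemma integrable_cos_power: "integrable circ (\<lambda>t. cos (pi * t) ^ m)"
 by (rule integrable_circ_continuous) (intro continuous_intros)

lemma cos_pi_power_deriv:
 "((\<lambda>t. cos (pi * t) ^ m) has_real_derivative - (real m * pi * cos (pi * t) ^ (m - 1) * sin (pi * t))) (at t)"
 by (auto intro!: derivative_eq_intros)

text \<open>The difference of the two sides is the integral of the derivative of cos^(2n+1) sin /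
  pi, a function that vanishes at both end points.\<close>

lemma cosint_Suc: "(2 * real n + 2) * cosint (Suc n) = (2 * real n + 1) * cosint n"
proof -
 have d: "((\<lambda>t. cos (pi * t) ^ (2 * n + 1) * sin (pi * t) / pi) has_real_derivative
   (2 * real n + 2) * cos (pi * t) ^ (2 * Suc n) - (2 * real n + 1) * cos (pi * t) ^ (2 * n)) (at t)" for t
 proof -
  have s: "sin (pi * t) * sin (pi * t) = 1 - cos (pi * t) * cos (pi * t)"
   using sin_cos_squared_add3[of "pi * t"] by (simp add: algebra_simps)
  have "((\<lambda>t. sin (pi * t)) has_real_derivative cos (pi * t) * pi) (at t)"
   by (auto intro!: derivative_eq_intros)
  from DERIV_cdivide[OF DERIV_mult[OF cos_pi_power_deriv[of "2 * n + 1"] this], of pi]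
  show ?thesis
  proof (rule DERIV_cong)
   let ?c = "cos (pi * t)"
   have e: "?c ^ (2 * n + 1) = ?c * ?c ^ (2 * n)" "?c ^ (2 * Suc n) = ?c * ?c * ?c ^ (2 * n)" "2 * n + 1 - 1 = 2 * n" by simp_all
   have "(- (real (2 * n + 1) * pi * ?c ^ (2 * n + 1 - 1) * sin (pi * t)) * sin (pi * t) + cos (pi * t) * pi * ?c ^ (2 * n + 1)) / pi
    = - (2 * real n + 1) * ?c ^ (2 * n) * (sin (pi * t) * sin (pi * t)) + ?c * ?c * ?c ^ (2 * n)"
    unfolding e by (simp add: field_simps)
   also have "\<dots> = (2 * real n + 2) * ?c ^ (2 * Suc n) - (2 * real n + 1) * ?c ^ (2 * n)"
    unfolding e s by (simp add: algebra_simps)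
   finally show "(- (real (2 * n + 1) * pi * ?c ^ (2 * n + 1 - 1) * sin (pi * t)) * sin (pi * t) + cos (pi * t) * pi * ?c ^ (2 * n + 1)) / pi
    = (2 * real n + 2) * ?c ^ (2 * Suc n) - (2 * real n + 1) * ?c ^ (2 * n)" .
  qed
 qed
 have "(\<integral>t. (2 * real n + 2) * cos (pi * t) ^ (2 * Suc n) - (2 * real n + 1) * cos (pi * t) ^ (2 * n) \<partial>circ) = 0"
  by (subst integral_circ_derivative[OF d]) (auto intro!: continuous_intros)
 then show ?thesis
  using integrable_cos_power unfolding cosint_def by (simp del: power_Suc mult_Suc_right)
qed

lemma cosint_pos: "0 < cosint n"
proof (induction n)
 case 0 then show ?case by (simp add: cosint_def circ.prob_space)
next
 case (Suc n)
 have "0 < (2 * real n + 2) * cosint (Suc n)" unfolding cosint_Suc using Suc by simp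
 then show ?case by (simp add: zero_less_mult_iff)
qed

lemma integral_cos_power_sin2:
 "(\<integral>t. cos (pi * t) ^ (2 * n) * (sin (pi * t))^2 \<partial>circ) = cosint n - cosint (Suc n)"
proof -
 have "(\<integral>t. cos (pi * t) ^ (2 * n) * (sin (pi * t))^2 \<partial>circ)
   = (\<integral>t. cos (pi * t) ^ (2 * n) - cos (pi * t) ^ (2 * Suc n) \<partial>circ)"
  unfolding sin_squared_eq by (intro bochner_cong) (simp_all add: algebra_simps power2_eq_square)
 then show ?thesis using integrable_cos_power unfolding cosint_def by (simp del: power_Suc mult_Suc_right)
qed

text \<open>An even power of cos (pi t) has period one, is nonnegative, is a trigonometric
  polynomial and concentrates at the integers with width of order n^(-1/2).\<close>

definition vk :: "nat => real => real" where
 "vk n t = cos (pi * t) ^ (2 * Suc n) / cosint (Suc n)"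

definition cn :: "nat => real" where "cn n = 2 * real (Suc n) * pi / cosint (Suc n)"

lemma cn_nonneg: "0 \<le> cn n" unfolding cn_def using cosint_pos[of "Suc n"] by simp

definition dvk :: "nat => real => real" where
 "dvk n t = - cn n * (cos (pi * t) ^ (2 * n + 1) * sin (pi * t))"

lemma vk_deriv: "(vk n has_real_derivative dvk n t) (at t)"
 unfolding vk_def[abs_def] dvk_def cn_def
 by (rule DERIV_cong[OF DERIV_cdivide[OF cos_pi_power_deriv]]) simp

lemma vk_continuous: "continuous_on UNIV (vk n)" "continuous_on UNIV (dvk n)"
 unfolding vk_def[abs_def] dvk_def[abs_def] by (auto intro!: continuous_intros simp: less_imp_neq[OF cosint_pos, symmetric])

lemma vk_nonneg: "0 \<le> vk n t"
 unfolding vk_def by (intro divide_nonneg_pos zero_le_even_power cosint_pos) simp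

lemma vk_integral: "(\<integral>t. vk n t \<partial>circ) = 1"
proof -
 have "(\<integral>t. vk n t \<partial>circ) = cosint (Suc n) / cosint (Suc n)"
  unfolding vk_def cosint_def by (rule integral_divide_zero)
 then show ?thesis using cosint_pos[of "Suc n"] by simp
qed

lemma circ_CS:
 fixes f g :: "real => real"
 assumes f: "continuous_on UNIV f" and g: "continuous_on UNIV g"
 shows "(\<integral>t. \<bar>f t * g t\<bar> \<partial>circ) \<le> sqrt (\<integral>t. (f t)^2 \<partial>circ) * sqrt (\<integral>t. (g t)^2 \<partial>circ)"
 by (rule Cauchy_Schwarz_abs(1))
   (auto intro!: integrable_circ_continuous continuous_on_power f g measurable_circ borel_measurable_continuous_onI)

text \<open>Cauchy-Schwarz with the factors cos^N sin and cos^N, N = n + 1; the Wallis recursion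
  evaluates both integrals and yields the decay n^(-1/2).\<close>

lemma vk_sin: "(\<integral>t. \<bar>sin (pi * t)\<bar> * vk n t \<partial>circ) \<le> 1 / sqrt (2 * real n + 4)"
proof -
 let ?N = "Suc n"
 let ?J = "\<integral>t. \<bar>(cos (pi * t) ^ ?N * sin (pi * t)) * cos (pi * t) ^ ?N\<bar> \<partial>circ"
 have e: "cosint ?N - cosint (Suc ?N) = cosint ?N / (2 * real n + 4)"
  using cosint_Suc[of ?N] by (simp add: field_simps)
 have "(\<integral>t. \<bar>sin (pi * t)\<bar> * vk n t \<partial>circ)
   = (\<integral>t. (1 / cosint ?N) * \<bar>(cos (pi * t) ^ ?N * sin (pi * t)) * cos (pi * t) ^ ?N\<bar> \<partial>circ)"
 proof (intro bochner_cong refl)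
  fix t
  have "\<bar>x * s * x\<bar> = \<bar>s\<bar> * x^2" for x s :: real by (simp add: abs_mult power2_eq_square)
  then show "\<bar>sin (pi * t)\<bar> * vk n t = (1 / cosint ?N) * \<bar>(cos (pi * t) ^ ?N * sin (pi * t)) * cos (pi * t) ^ ?N\<bar>"
   by (simp only: vk_def power_even_eq) simp
 qed
 then have 1: "(\<integral>t. \<bar>sin (pi * t)\<bar> * vk n t \<partial>circ) = ?J / cosint ?N" by simp
 have "?J \<le> sqrt (\<integral>t. (cos (pi * t) ^ ?N * sin (pi * t))^2 \<partial>circ) * sqrt (\<integral>t. (cos (pi * t) ^ ?N)^2 \<partial>circ)"
  by (rule circ_CS) (intro continuous_intros)+
 also have "(\<integral>t. (cos (pi * t) ^ ?N * sin (pi * t))^2 \<partial>circ) = cosint ?N / (2 * real n + 4)"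
  using integral_cos_power_sin2[of ?N] e unfolding power_mult_distrib power_mult[symmetric] mult.commute[of ?N 2] by simp
 also have "(\<integral>t. (cos (pi * t) ^ ?N)^2 \<partial>circ) = cosint ?N"
  unfolding cosint_def power_mult[symmetric] mult.commute[of ?N 2] by simp
 also have "sqrt (cosint ?N / (2 * real n + 4)) * sqrt (cosint ?N) = (1 / sqrt (2 * real n + 4)) * cosint ?N"
  using cosint_pos[of ?N] by (simp add: real_sqrt_divide)
 finally show ?thesis using cosint_pos[of ?N] unfolding 1 by (simp only: pos_divide_le_eq)
qed

lemma cosint_diff: "cosint n - cosint (Suc n) = cosint (Suc n) / (2 * real n + 1)"
 using cosint_Suc[of n] by (simp add: field_simps)

text \<open>The derivative costs a factor n but contains a sine. With the sine of the weight this
  gives cos^(2n) sin^2, whose integral is a difference of Wallis integrals and gains the factor 1/n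
  back.\<close>

lemma dvk_sin: "(\<integral>t. \<bar>sin (pi * t)\<bar> * \<bar>dvk n t\<bar> \<partial>circ) \<le> 4 * pi"
proof -
 let ?c = "cn n"
 note c = cn_nonneg[of n]
 have "(\<integral>t. \<bar>sin (pi * t)\<bar> * \<bar>dvk n t\<bar> \<partial>circ) \<le> (\<integral>t. ?c * (cos (pi * t) ^ (2 * n) * (sin (pi * t))^2) \<partial>circ)"
 proof (rule integral_mono)
  show "integrable circ (\<lambda>t. \<bar>sin (pi * t)\<bar> * \<bar>dvk n t\<bar>)"
   by (rule integrable_circ_continuous) (intro continuous_intros vk_continuous)
  show "integrable circ (\<lambda>t. ?c * (cos (pi * t) ^ (2 * n) * (sin (pi * t))^2))"
   by (rule integrable_circ_continuous) (intro continuous_intros)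
  fix t
  have "\<bar>sin (pi * t)\<bar> * \<bar>dvk n t\<bar> = ?c * ((\<bar>cos (pi * t)\<bar> * \<bar>cos (pi * t) ^ (2 * n)\<bar>) * (\<bar>sin (pi * t)\<bar> * \<bar>sin (pi * t)\<bar>))"
   unfolding dvk_def abs_mult abs_minus_cancel abs_of_nonneg[OF c] by (simp add: abs_mult)
  also have "\<dots> \<le> ?c * ((1 * \<bar>cos (pi * t) ^ (2 * n)\<bar>) * (\<bar>sin (pi * t)\<bar> * \<bar>sin (pi * t)\<bar>))"
   by (intro mult_left_mono mult_right_mono c) auto
  also have "\<dots> = ?c * (cos (pi * t) ^ (2 * n) * (sin (pi * t))^2)"
   by (simp add: power2_eq_square)
  finally show "\<bar>sin (pi * t)\<bar> * \<bar>dvk n t\<bar> \<le> ?c * (cos (pi * t) ^ (2 * n) * (sin (pi * t))^2)" .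
 qed
 also have "\<dots> = ?c * (cosint (Suc n) / (2 * real n + 1))"
  by (simp add: integral_cos_power_sin2 cosint_diff)
 also have "\<dots> = (2 * real n + 2) / (2 * real n + 1) * pi"
 proof -
  have "cn n * cosint (Suc n) = (2 * real n + 2) * pi"
  proof -
   have "cn n * cosint (Suc n) = 2 * real (Suc n) * pi"
    unfolding cn_def using cosint_pos[of "Suc n"] by (simp del: of_nat_Suc)
   then show ?thesis by simp
  qed
  then show ?thesis by simp
 qed
 also have "\<dots> \<le> 4 * pi"
  by (intro mult_right_mono) (auto simp: field_simps)
 finally show ?thesis .
qed

text \<open>Without the weight only one sine is present, and Cauchy-Schwarz leaves growth of order
  n^(1/2); in mixed products the decay of \<open>vk_sin\<close> compensates it.\<close>

lemma dvk_abs: "(\<integral>t. \<bar>dvk n t\<bar> \<partial>circ) \<le> (2 * real n + 2) * pi / sqrt (2 * real n + 1)"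
proof -
 let ?c = "cn n"
 note c = cn_nonneg[of n]
 have "(\<integral>t. \<bar>dvk n t\<bar> \<partial>circ) = (\<integral>t. ?c * \<bar>(cos (pi * t) ^ n * sin (pi * t)) * cos (pi * t) ^ Suc n\<bar> \<partial>circ)"
 proof (intro bochner_cong refl)
  fix t
  have "cos (pi * t) ^ (2 * n + 1) * sin (pi * t) = (cos (pi * t) ^ n * sin (pi * t)) * cos (pi * t) ^ Suc n"
   by (simp add: mult_2 power_add)
  then show "\<bar>dvk n t\<bar> = ?c * \<bar>(cos (pi * t) ^ n * sin (pi * t)) * cos (pi * t) ^ Suc n\<bar>"
   using c by (simp only: dvk_def abs_mult abs_minus_cancel abs_of_nonneg)
 qed
 also have "\<dots> = ?c * (\<integral>t. \<bar>(cos (pi * t) ^ n * sin (pi * t)) * cos (pi * t) ^ Suc n\<bar> \<partial>circ)"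
  by simp
 also have "(\<integral>t. \<bar>(cos (pi * t) ^ n * sin (pi * t)) * cos (pi * t) ^ Suc n\<bar> \<partial>circ)
   \<le> sqrt (\<integral>t. (cos (pi * t) ^ n * sin (pi * t))^2 \<partial>circ) * sqrt (\<integral>t. (cos (pi * t) ^ Suc n)^2 \<partial>circ)"
  by (rule circ_CS) (intro continuous_intros)+
 also have "(\<integral>t. (cos (pi * t) ^ n * sin (pi * t))^2 \<partial>circ) = cosint (Suc n) / (2 * real n + 1)"
  using integral_cos_power_sin2[of n] cosint_diff[of n] unfolding power_mult_distrib power_mult[symmetric] mult.commute[of n 2] by simp
 also have "(\<integral>t. (cos (pi * t) ^ Suc n)^2 \<partial>circ) = cosint (Suc n)"
  unfolding cosint_def power_mult[symmetric] mult.commute[of "Suc n" 2] by simp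
 also have "?c * (sqrt (cosint (Suc n) / (2 * real n + 1)) * sqrt (cosint (Suc n))) = (2 * real n + 2) * pi / sqrt (2 * real n + 1)"
 proof -
  have "sqrt (cosint (Suc n) / (2 * real n + 1)) * sqrt (cosint (Suc n)) = cosint (Suc n) / sqrt (2 * real n + 1)"
   using cosint_pos[of "Suc n"] by (simp add: real_sqrt_divide)
  then show ?thesis using cosint_pos[of "Suc n"] by (simp add: field_simps cn_def)
 qed
 finally show ?thesis using c by (simp add: mult_left_mono)
qed

definition ker :: "nat => tfun" where "ker n x = vk n (fst x) * vk n (snd x)"

text \<open>A periodic substitute for |z_1| + |z_2|: it controls the size of a representative modulo
  the lattice (\<open>reduce_mod_lattice\<close>), and its integrals against the kernel split into
  one dimensional factors.\<close>

definition sabs :: "tfun" where "sabs z = \<bar>sin (pi * fst z)\<bar> + \<bar>sin (pi * snd z)\<bar>"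

text \<open>The double angle formula writes cos^2 (pi t) with frequency one, so an even power is a
  polynomial in a generator of \<open>TP\<close>.\<close>

lemma ker_TP: "ker n \<in> TP"
proof -
 have c: "(cos (pi * t))^2 = 1/2 + 1/2 * cos (2 * pi * t)" for t
  using cos_double_cos[of "pi * t"] unfolding mult.assoc by linarith
 have "(\<lambda>x. (1/2 + 1/2 * cos (ang (1, 0) x + 0)) ^ Suc n) \<in> TP" "(\<lambda>x. (1/2 + 1/2 * cos (ang (0, 1) x + 0)) ^ Suc n) \<in> TP"
  by (intro TP_power TP.add TP_const TP.scale TP.cos)+
 from TP.scale[OF TP_mult[OF this], of "1 / (cosint (Suc n) * cosint (Suc n))"]
 show ?thesis unfolding ker_def[abs_def] vk_def power_mult c by (simp add: ang_def)
qed

lemma ker_gradient: "gradient (ker n) (\<lambda>x. dvk n (fst x) * vk n (snd x)) (\<lambda>x. vk n (fst x) * dvk n (snd x))"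
proof -
 have "gradient (\<lambda>x. vk n (fst x)) (\<lambda>x. dvk n (fst x)) (\<lambda>x. 0)"
  unfolding gradient_def
 proof
  fix x :: plane
  have "(fst has_derivative (\<lambda>h. fst h)) (at x)" by (auto intro!: derivative_eq_intros)
  from has_derivative_compose[OF this vk_deriv[THEN has_field_derivative_imp_has_derivative]]
  show "((\<lambda>x. vk n (fst x)) has_derivative (\<lambda>h. fst h * dvk n (fst x) + snd h * 0)) (at x)"
   by (simp add: mult.commute)
 qed
 moreover have "gradient (\<lambda>x. vk n (snd x)) (\<lambda>x. 0) (\<lambda>x. dvk n (snd x))"
  unfolding gradient_def
 proof
  fix x :: plane
  have "(snd has_derivative (\<lambda>h. snd h)) (at x)" by (auto intro!: derivative_eq_intros)
  from has_derivative_compose[OF this vk_deriv[THEN has_field_derivative_imp_has_derivative]]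
  show "((\<lambda>x. vk n (snd x)) has_derivative (\<lambda>h. fst h * 0 + snd h * dvk n (snd x))) (at x)"
   by (simp add: mult.commute)
 qed
 ultimately have "gradient (\<lambda>x. vk n (fst x) * vk n (snd x)) (\<lambda>x. dvk n (fst x) * vk n (snd x) + vk n (fst x) * 0)
   (\<lambda>x. 0 * vk n (snd x) + vk n (fst x) * dvk n (snd x))" by (rule gradient_mult)
 then show ?thesis unfolding ker_def[abs_def] by simp
qed

lemma integral_torus_product:
 fixes f g :: "real => real"
 assumes f: "continuous_on UNIV f" and g: "continuous_on UNIV g"
 shows "integrable torus (\<lambda>x. f (fst x) * g (snd x))"
  "(avg x. f (fst x) * g (snd x)) = (\<integral>t. f t \<partial>circ) * (\<integral>t. g t \<partial>circ)"
proof -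
 show i: "integrable torus (\<lambda>x. f (fst x) * g (snd x))"
  by (intro integrable_torus_continuous continuous_on_mult continuous_on_compose2[OF f] continuous_on_compose2[OF g] continuous_on_fst continuous_on_snd continuous_on_id) auto
 show "(avg x. f (fst x) * g (snd x)) = (\<integral>t. f t \<partial>circ) * (\<integral>t. g t \<partial>circ)"
  using circ2.integral_fst'[OF i[unfolded torus_eq]] by (simp add: torus_eq)
qed

lemma ker_prob: "prob_kernel (ker n)"
 unfolding prob_kernel_def
proof (intro conjI allI ker_TP)
 show "0 \<le> ker n x" for x by (simp add: ker_def vk_nonneg)
 show "(avg x. ker n x) = 1"
  using integral_torus_product(2)[OF vk_continuous(1) vk_continuous(1), of n n] by (simp add: ker_def vk_integral)
qed

lemma sabs_vk_continuous: "continuous_on UNIV (\<lambda>t. \<bar>sin (pi * t)\<bar> * vk n t)" "continuous_on UNIV (\<lambda>t. \<bar>sin (pi * t)\<bar> * \<bar>dvk n t\<bar>)"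
 "continuous_on UNIV (\<lambda>t. \<bar>dvk n t\<bar>)"
 by (intro continuous_intros vk_continuous)+

lemma ker_moment: "(avg z. ker n z * sabs z) \<le> 2 / sqrt (2 * real n + 4)"
proof -
 note P = integral_torus_product[OF sabs_vk_continuous(1) vk_continuous(1), of n n] integral_torus_product[OF vk_continuous(1) sabs_vk_continuous(1), of n n]
 have "(avg z. ker n z * sabs z) = (avg z. (\<bar>sin (pi * fst z)\<bar> * vk n (fst z)) * vk n (snd z) + vk n (fst z) * (\<bar>sin (pi * snd z)\<bar> * vk n (snd z)))"
  by (intro bochner_cong) (simp_all add: ker_def sabs_def algebra_simps)
 also have "\<dots> = 2 * (\<integral>t. \<bar>sin (pi * t)\<bar> * vk n t \<partial>circ)" using P by (simp add: vk_integral)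
 finally show ?thesis using vk_sin[of n] by simp
qed

lemma ker_moment_tendsto: "(\<lambda>n. (avg z. ker n z * sabs z)) ~~> 0"
proof (rule tendsto_sandwich[of "\<lambda>_. 0" _ _ "\<lambda>n. 2 / sqrt (2 * real n + 4)"])
 show "\<forall>\<^sub>F n in sequentially. 0 \<le> (avg z. ker n z * sabs z)"
  by (intro always_eventually allI integral_nonneg_AE AE_I2 mult_nonneg_nonneg prob_kernelD(2)[OF ker_prob]) (simp add: sabs_def)
 show "(\<lambda>n. 2 / sqrt (2 * real n + 4)) ~~> 0"
  by (rule real_tendsto_divide_at_top[OF tendsto_const filterlim_compose[OF sqrt_at_top]])
    real_asymp
qed (auto simp: ker_moment)

text \<open>The bounds needed for the commutator, uniform in n. In one summand the weight meets the
  differentiated factor, where \<open>dvk_sin\<close> applies; in the other it meets the second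
  factor, and growth n^(1/2) meets decay n^(-1/2).\<close>

lemma ker_grad_moment:
 "(avg z. \<bar>pd1 (ker n) z\<bar> * sabs z) \<le> 8 * pi" "(avg z. \<bar>pd2 (ker n) z\<bar> * sabs z) \<le> 8 * pi"
proof -
 note c = vk_continuous(1) sabs_vk_continuous
 have b: "(\<integral>t. \<bar>dvk n t\<bar> \<partial>circ) * (\<integral>t. \<bar>sin (pi * t)\<bar> * vk n t \<partial>circ) \<le> 4 * pi"
 proof -
  have "(\<integral>t. \<bar>dvk n t\<bar> \<partial>circ) * (\<integral>t. \<bar>sin (pi * t)\<bar> * vk n t \<partial>circ)
    \<le> ((2 * real n + 2) * pi / sqrt (2 * real n + 1)) * (1 / sqrt (2 * real n + 4))"
   by (intro mult_mono dvk_abs vk_sin integral_nonneg_AE AE_I2 mult_nonneg_nonneg vk_nonneg) auto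
  also have "\<dots> \<le> 4 * pi"
  proof -
   have "2 * real n + 2 \<le> 4 * sqrt ((2 * real n + 1) * (2 * real n + 4))"
   proof -
    have "(real n + 1)^2 \<le> (2 * real n + 1) * (2 * real n + 4)"
     by (simp add: power2_eq_square algebra_simps)
    then have "real n + 1 \<le> sqrt ((2 * real n + 1) * (2 * real n + 4))" by (rule real_le_rsqrt)
    then show ?thesis by linarith
   qed
   then have "(2 * real n + 2) / sqrt ((2 * real n + 1) * (2 * real n + 4)) \<le> 4"
    by (subst pos_divide_le_eq) (auto simp: real_sqrt_gt_0_iff mult_pos_pos)
   then have "(2 * real n + 2) / sqrt ((2 * real n + 1) * (2 * real n + 4)) * pi \<le> 4 * pi"
    by (intro mult_right_mono) auto
   then show ?thesis by (simp add: real_sqrt_mult)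
  qed
  finally show ?thesis .
 qed
 note P1 = integral_torus_product[OF c(3) c(1), of n n] integral_torus_product[OF c(4) c(2), of n n]
 note P2 = integral_torus_product[OF c(1) c(3), of n n] integral_torus_product[OF c(2) c(4), of n n]
 have "(avg z. \<bar>pd1 (ker n) z\<bar> * sabs z) = (avg z. (\<bar>sin (pi * fst z)\<bar> * \<bar>dvk n (fst z)\<bar>) * vk n (snd z)
    + \<bar>dvk n (fst z)\<bar> * (\<bar>sin (pi * snd z)\<bar> * vk n (snd z)))"
  by (intro bochner_cong) (simp_all add: gradient_pd[OF ker_gradient] sabs_def algebra_simps abs_mult vk_nonneg)
 also have "\<dots> \<le> 8 * pi" using P1 b dvk_sin[of n] by (simp add: vk_integral)
 finally show "(avg z. \<bar>pd1 (ker n) z\<bar> * sabs z) \<le> 8 * pi" .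
 have "(avg z. \<bar>pd2 (ker n) z\<bar> * sabs z) = (avg z. vk n (fst z) * (\<bar>sin (pi * snd z)\<bar> * \<bar>dvk n (snd z)\<bar>)
    + (\<bar>sin (pi * fst z)\<bar> * vk n (fst z)) * \<bar>dvk n (snd z)\<bar>)"
  by (intro bochner_cong) (simp_all add: gradient_pd[OF ker_gradient] sabs_def algebra_simps abs_mult vk_nonneg)
 also have "\<dots> \<le> 8 * pi" using P2 b dvk_sin[of n] by (simp add: vk_integral mult.commute)
 finally show "(avg z. \<bar>pd2 (ker n) z\<bar> * sabs z) \<le> 8 * pi" .
qed

section \<open>Approximation of the identity\<close>

definition Lipf :: "real => tfun => bool" where
 "Lipf L f \<longleftrightarrow> 0 \<le> L \<and> periodic f \<and> (\<forall>x y. \<bar>f x - f y\<bar> \<le> L * (\<bar>fst x - fst y\<bar> + \<bar>snd x - snd y\<bar>))"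

text \<open>For positive t: up to 1/3 the mean value theorem with cosine at least 1/2 and pi at
  least 2, above 1/3 monotonicity and sin (pi/6) = 1/2.\<close>

lemma abs_le_abs_sin:
 assumes "\<bar>t\<bar> \<le> 1 / 2" shows "\<bar>t\<bar> \<le> \<bar>sin (pi * t)\<bar>"
proof -
 have pos: "t \<le> sin (pi * t)" if t: "0 \<le> t" "t \<le> 1 / 2" for t :: real
 proof (cases "t \<le> 1 / 3")
  case True
  show ?thesis
  proof (cases "t = 0")
   case False
   have "\<exists>z. 0 < z \<and> z < pi * t \<and> sin (pi * t) - sin 0 = (pi * t - 0) * cos z"
    using t False by (intro MVT2) auto
   then obtain z where z: "0 < z" "z < pi * t" "sin (pi * t) = pi * t * cos z" by auto
   have "pi * t \<le> pi * (1 / 3)" using True by (intro mult_left_mono) auto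
   then have "z \<le> pi / 3" using z(2) by linarith
   then have "cos (pi / 3) \<le> cos z" using z by (intro cos_monotone_0_pi_le) auto
   then have "pi * t * (1 / 2) \<le> pi * t * cos z" using t by (intro mult_left_mono) (auto simp: cos_60)
   moreover have "2 * t \<le> pi * t" using t pi_ge_two by (intro mult_right_mono) auto
   ultimately show ?thesis using z(3) by linarith
  qed simp
 next
  case False
  have "sin (pi / 6) \<le> sin (pi * t)"
   using t False mult_left_mono[of t "1/2" pi] mult_left_mono[of "1/3" t pi] pi_gt_zero
   by (intro sin_monotone_2pi_le) auto
  then show ?thesis using t by (simp add: sin_30)
 qed
 show ?thesis
 proof (cases "0 \<le> t")
  case True then show ?thesis using pos[of t] assms by auto
 next
  case False then show ?thesis using pos[of "- t"] assms by auto
 qed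
qed

lemma reduce_mod_1: "\<exists>m. \<bar>t - of_int m\<bar> \<le> \<bar>sin (pi * t)\<bar>"
proof
 let ?m = "round t"
 have a: "\<bar>t - of_int ?m\<bar> \<le> 1 / 2" using of_int_round_abs_le[of t] by (simp add: abs_minus_commute)
 have "sin (pi * of_int ?m) = 0" by (simp add: sin_zero_iff_int2 mult.commute)
 then have "\<bar>cos (pi * of_int ?m)\<bar> = 1" using sin_cos_squared_add[of "pi * of_int ?m"] by (simp add: power2_eq_1_iff abs_if split: if_splits)
 then have "\<bar>sin (pi * (t - of_int ?m))\<bar> = \<bar>sin (pi * t)\<bar>"
  using \<open>sin (pi * of_int ?m) = 0\<close> by (simp add: right_diff_distrib sin_diff abs_mult)
 then show "\<bar>t - of_int ?m\<bar> \<le> \<bar>sin (pi * t)\<bar>" using abs_le_abs_sin[OF a] by simp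
qed

lemma reduce_mod_lattice:
 obtains m n :: int and w where "z = w + (of_int m, of_int n)" "\<bar>fst w\<bar> + \<bar>snd w\<bar> \<le> sabs z"
proof -
 obtain m n where mn: "\<bar>fst z - of_int m\<bar> \<le> \<bar>sin (pi * fst z)\<bar>" "\<bar>snd z - of_int n\<bar> \<le> \<bar>sin (pi * snd z)\<bar>"
  using reduce_mod_1 by blast
 show thesis
  by (rule that[of "(fst z - of_int m, snd z - of_int n)" m n]) (use mn in \<open>auto simp: sabs_def prod_eq_iff\<close>)
qed

text \<open>Periodicity allows the shift to be replaced by a representative modulo the lattice whose
  size \<open>sabs\<close> controls.\<close>

lemma Lipf_shift:
 assumes "Lipf L f" shows "\<bar>f (x - z) - f x\<bar> \<le> L * sabs z"
proof -
 obtain m n w where z: "z = w + (of_int m, of_int n)" and w: "\<bar>fst w\<bar> + \<bar>snd w\<bar> \<le> sabs z" by (rule reduce_mod_lattice)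
 have per: "periodic f" and L: "0 \<le> L" using assms by (auto simp: Lipf_def)
 have "x - z = (x - w) + (of_int (- m), of_int (- n))" by (simp add: z prod_eq_iff)
 then have "f (x - z) = f (x - w)" by (simp only: periodicD[OF per])
 then have "\<bar>f (x - z) - f x\<bar> \<le> L * (\<bar>fst (x - w) - fst x\<bar> + \<bar>snd (x - w) - snd x\<bar>)"
  using assms unfolding Lipf_def by metis
 also have "\<dots> = L * (\<bar>fst w\<bar> + \<bar>snd w\<bar>)" by simp
 also have "\<dots> \<le> L * sabs z" using w L by (intro mult_left_mono)
 finally show ?thesis .
qed

lemma abs_coord_le_dist: "dist x y \<le> \<bar>fst x - fst y\<bar> + \<bar>snd x - snd y\<bar>" for x y :: plane
 unfolding dist_prod_def dist_real_def by (rule sqrt_sum_squares_le_sum_abs[THEN order_trans]) simp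

lemma coord_le_dist2: "\<bar>fst x - fst y\<bar> + \<bar>snd x - snd y\<bar> \<le> 2 * dist x y" for x y :: plane
 using dist_fst_le[of x y] dist_snd_le[of x y] by (simp add: dist_real_def)

lemma Lipf_continuous: "Lipf L f ==> continuous_on UNIV f"
proof -
 assume "Lipf L f"
 then have L: "0 \<le> L" and f: "\<And>x y. \<bar>f x - f y\<bar> \<le> L * (\<bar>fst x - fst y\<bar> + \<bar>snd x - snd y\<bar>)" by (auto simp: Lipf_def)
 have "(2 * L)-lipschitz_on UNIV f"
 proof (rule lipschitz_onI)
  fix x y
  have "L * (\<bar>fst x - fst y\<bar> + \<bar>snd x - snd y\<bar>) \<le> L * (2 * dist x y)"
   by (intro mult_left_mono coord_le_dist2 L)
  then show "dist (f x) (f y) \<le> 2 * L * dist x y" using f[of x y] by (simp add: dist_real_def)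
 qed (use L in simp)
 then show ?thesis by (rule lipschitz_on_continuous_on)
qed

lemma Lipf_ELp: "Lipf L f ==> f \<in> ELp p"
 by (rule ELpI[OF borel_measurable_continuous_onI[OF Lipf_continuous] _ integrable_torus_continuous[OF continuous_on_power[OF Lipf_continuous]]])
   (auto simp: Lipf_def)

text \<open>A shift by z costs \<open>L * sabs z\<close>, and the convolution averages this cost
  against the kernel; the result is a rate uniform in x.\<close>

lemma conv_Lipf:
 assumes f: "Lipf L f"
 shows "\<bar>conv (ker n) f x - f x\<bar> \<le> L * (avg z. ker n z * sabs z)"
proof -
 note K = prob_kernelD[OF ker_prob]
 have fe: "f \<in> ELp 2" by (rule Lipf_ELp[OF f])
 note fi = ELp2_integrable[OF fe]
 have i1: "integrable torus (\<lambda>z. ker n z * f (x - z))"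
  by (rule integrable_TP_mult[OF K(1) integrable_torus_reflect[OF ELpD(1,2)[OF fe] fi]])
 have i2: "integrable torus (\<lambda>z. ker n z * f x)" using TP_integrable[OF K(1)] by simp
 have cs: "continuous_on UNIV sabs" unfolding sabs_def[abs_def] by (intro continuous_intros)
 have i3: "integrable torus (\<lambda>z. ker n z * sabs z)"
  by (rule integrable_TP_mult[OF K(1) integrable_torus_continuous[OF cs]])
 have "conv (ker n) f x - f x = (avg z. ker n z * f (x - z)) - (avg z. ker n z * f x)"
  unfolding conv_reflect[OF K(1) ELpD(1,2)[OF fe] fi] by (simp add: K(3))
 also have "\<dots> = (avg z. ker n z * (f (x - z) - f x))"
  using i1 i2 by (simp add: right_diff_distrib)
 finally have "\<bar>conv (ker n) f x - f x\<bar> \<le> (avg z. \<bar>ker n z * (f (x - z) - f x)\<bar>)"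
  using integral_abs_bound by simp
 also have "\<dots> \<le> (avg z. L * (ker n z * sabs z))"
 proof (rule integral_mono)
  show "integrable torus (\<lambda>z. \<bar>ker n z * (f (x - z) - f x)\<bar>)"
   using i1 i2 by (simp add: right_diff_distrib)
  show "integrable torus (\<lambda>z. L * (ker n z * sabs z))" using i3 by simp
  fix z
  have "ker n z * \<bar>f (x - z) - f x\<bar> \<le> ker n z * (L * sabs z)"
   by (intro mult_left_mono Lipf_shift[OF f] K(2))
  then show "\<bar>ker n z * (f (x - z) - f x)\<bar> \<le> L * (ker n z * sabs z)"
   using K(2)[of n z] by (simp add: abs_mult mult.left_commute)
 qed
 finally show ?thesis by simp
qed

text \<open>The approximation class is described with lower integrals so that no integrability has to be tracked.\<close>

definition Lp_approx :: "nat => tfun => bool" where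
 "Lp_approx p f \<longleftrightarrow> f \<in> borel_measurable borel \<and>
   (\<forall>\<epsilon>>0. \<exists>L g. Lipf L g \<and> (navg x. ennreal ((f x - g x) ^ p)) < ennreal \<epsilon>)"

lemma nn_power_add_le:
 assumes p: "even p" and f: "f \<in> borel_measurable borel" and g: "g \<in> borel_measurable borel"
 shows "(navg x. ennreal ((f x + g x) ^ p))
   \<le> ennreal (2 ^ p) * ((navg x. ennreal (f x ^ p)) + (navg x. ennreal (g x ^ p)))"
proof -
 note m = measurable_torus[OF f] measurable_torus[OF g]
 have "(navg x. ennreal ((f x + g x) ^ p)) \<le> (navg x. ennreal (2 ^ p) * (ennreal (f x ^ p) + ennreal (g x ^ p)))"
 proof (rule nn_integral_mono)
  fix x
  have "ennreal ((f x + g x) ^ p) \<le> ennreal (2 ^ p * (f x ^ p + g x ^ p))"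
   by (intro ennreal_leI even_power_add_bound p)
  also have "\<dots> = ennreal (2 ^ p) * (ennreal (f x ^ p) + ennreal (g x ^ p))"
   using p by (subst ennreal_mult') (auto simp: zero_le_even_power)
  finally show "ennreal ((f x + g x) ^ p) \<le> ennreal (2 ^ p) * (ennreal (f x ^ p) + ennreal (g x ^ p))" .
 qed
 also have "\<dots> = ennreal (2 ^ p) * ((navg x. ennreal (f x ^ p)) + (navg x. ennreal (g x ^ p)))"
  using m by (subst nn_integral_cmult, simp, subst nn_integral_add) auto
 finally show ?thesis .
qed

lemma Lipf_add: "Lipf L f ==> Lipf M g ==> Lipf (L + M) (\<lambda>x. f x + g x)"
 unfolding Lipf_def periodic_def
proof (intro conjI allI)
 fix x y
 assume a: "0 \<le> L \<and> (\<forall>x m n. f (x + (real_of_int m, real_of_int n)) = f x) \<and> (\<forall>x y. \<bar>f x - f y\<bar> \<le> L * (\<bar>fst x - fst y\<bar> + \<bar>snd x - snd y\<bar>))"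
  "0 \<le> M \<and> (\<forall>x m n. g (x + (real_of_int m, real_of_int n)) = g x) \<and> (\<forall>x y. \<bar>g x - g y\<bar> \<le> M * (\<bar>fst x - fst y\<bar> + \<bar>snd x - snd y\<bar>))"
 then have "\<bar>f x - f y\<bar> \<le> L * (\<bar>fst x - fst y\<bar> + \<bar>snd x - snd y\<bar>)" "\<bar>g x - g y\<bar> \<le> M * (\<bar>fst x - fst y\<bar> + \<bar>snd x - snd y\<bar>)" by blast+
 then show "\<bar>f x + g x - (f y + g y)\<bar> \<le> (L + M) * (\<bar>fst x - fst y\<bar> + \<bar>snd x - snd y\<bar>)"
  unfolding distrib_right by linarith
qed auto

lemma Lipf_cmult: assumes "Lipf L f" shows "Lipf (\<bar>c\<bar> * L) (\<lambda>x. c * f x)"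
 unfolding Lipf_def
proof (intro conjI allI)
 show "0 \<le> \<bar>c\<bar> * L" using assms by (simp add: Lipf_def)
 show "periodic (\<lambda>x. c * f x)" using assms by (simp add: Lipf_def periodic_def)
 fix x y
 have "\<bar>f x - f y\<bar> \<le> L * (\<bar>fst x - fst y\<bar> + \<bar>snd x - snd y\<bar>)" using assms by (simp only: Lipf_def)
 then have "\<bar>c\<bar> * \<bar>f x - f y\<bar> \<le> \<bar>c\<bar> * (L * (\<bar>fst x - fst y\<bar> + \<bar>snd x - snd y\<bar>))" by (intro mult_left_mono) auto
 then show "\<bar>c * f x - c * f y\<bar> \<le> \<bar>c\<bar> * L * (\<bar>fst x - fst y\<bar> + \<bar>snd x - snd y\<bar>)"
  by (simp only: abs_mult[symmetric] right_diff_distrib[symmetric] mult.assoc)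
qed

lemma Lipf_measurable: "Lipf L f ==> f \<in> borel_measurable borel"
 by (rule borel_measurable_continuous_onI[OF Lipf_continuous])

lemma Lp_approxE:
 assumes "Lp_approx p f" "0 < \<epsilon>"
 obtains L g where "Lipf L g" "(navg x. ennreal ((f x - g x) ^ p)) < ennreal \<epsilon>"
 using assms unfolding Lp_approx_def by blast

lemma Lp_approx_add:
 assumes p: "even p" and f: "Lp_approx p f" and g: "Lp_approx p g" shows "Lp_approx p (\<lambda>x. f x + g x)"
 unfolding Lp_approx_def
proof (intro conjI allI impI)
 have m: "f \<in> borel_measurable borel" "g \<in> borel_measurable borel" using f g by (auto simp: Lp_approx_def)
 then show "(\<lambda>x. f x + g x) \<in> borel_measurable borel" by simp
 fix \<epsilon> :: real assume e: "0 < \<epsilon>"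
 let ?d = "\<epsilon> / (2 ^ p * 2)"
 have d: "0 < ?d" using e by simp
 obtain L f' where f': "Lipf L f'" "(navg x. ennreal ((f x - f' x) ^ p)) < ennreal ?d" by (rule Lp_approxE[OF f d])
 obtain M g' where g': "Lipf M g'" "(navg x. ennreal ((g x - g' x) ^ p)) < ennreal ?d" by (rule Lp_approxE[OF g d])
 have "(navg x. ennreal ((f x + g x - (f' x + g' x)) ^ p)) = (navg x. ennreal (((f x - f' x) + (g x - g' x)) ^ p))"
  by (simp add: algebra_simps)
 also have "\<dots> \<le> ennreal (2 ^ p) * ((navg x. ennreal ((f x - f' x) ^ p)) + (navg x. ennreal ((g x - g' x) ^ p)))"
  by (rule nn_power_add_le[OF p borel_measurable_diff borel_measurable_diff]) (rule m Lipf_measurable f' g')+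
 also have "\<dots> < ennreal (2 ^ p) * ennreal (?d + ?d)"
  by (rule ennreal_mult_strict_left_mono[OF add_mono_ennreal[OF f'(2) g'(2)]]) auto
 also have "\<dots> = ennreal (2 ^ p * (?d + ?d))" by (rule ennreal_mult'[symmetric]) simp
 also have "2 ^ p * (?d + ?d) = \<epsilon>" by simp
 finally show "\<exists>L h. Lipf L h \<and> (navg x. ennreal ((f x + g x - h x) ^ p)) < ennreal \<epsilon>"
  using Lipf_add[OF f'(1) g'(1)] by (intro exI[of _ "L + M"] exI[of _ "\<lambda>x. f' x + g' x"]) auto
qed

lemma Lp_approx_cmult:
 assumes p: "even p" and f: "Lp_approx p f" shows "Lp_approx p (\<lambda>x. c * f x)"
 unfolding Lp_approx_def
proof (intro conjI allI impI)
 have m: "f \<in> borel_measurable borel" using f by (auto simp: Lp_approx_def)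
 then show "(\<lambda>x. c * f x) \<in> borel_measurable borel" by simp
 fix \<epsilon> :: real assume e: "0 < \<epsilon>"
 have c: "0 \<le> c ^ p" using p by (simp add: zero_le_even_power)
 have d: "0 < \<epsilon> / (c ^ p + 1)" using e c by (intro divide_pos_pos) linarith+
 obtain L f' where f': "Lipf L f'" "(navg x. ennreal ((f x - f' x) ^ p)) < ennreal (\<epsilon> / (c ^ p + 1))" by (rule Lp_approxE[OF f d])
 have mm: "(\<lambda>x. ennreal ((f x - f' x) ^ p)) \<in> borel_measurable torus"
  using measurable_torus[OF m] measurable_torus[OF Lipf_measurable[OF f'(1)]] by simp
 have "(navg x. ennreal ((c * f x - c * f' x) ^ p)) = (navg x. ennreal (c ^ p) * ennreal ((f x - f' x) ^ p))"
  using p c by (intro nn_integral_cong) (simp add: ennreal_mult'[symmetric] power_mult_distrib[symmetric] right_diff_distrib)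
 also have "\<dots> = ennreal (c ^ p) * (navg x. ennreal ((f x - f' x) ^ p))"
  by (rule nn_integral_cmult[OF mm])
 also have "\<dots> \<le> ennreal (c ^ p) * ennreal (\<epsilon> / (c ^ p + 1))"
  using f'(2) by (intro mult_left_mono) auto
 also have "\<dots> = ennreal (c ^ p * (\<epsilon> / (c ^ p + 1)))" using c by (rule ennreal_mult'[symmetric])
 also have "\<dots> < ennreal \<epsilon>"
  using c e by (intro ennreal_lessI) (auto simp: field_simps)
 finally show "\<exists>L h. Lipf L h \<and> (navg x. ennreal ((c * f x - h x) ^ p)) < ennreal \<epsilon>"
  using Lipf_cmult[OF f'(1)] by (intro exI[of _ "\<bar>c\<bar> * L"] exI[of _ "\<lambda>x. c * f' x"]) auto
qed

lemma Lp_approx_const: "0 < p ==> Lp_approx p (\<lambda>x. c)"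
 unfolding Lp_approx_def
 by (intro conjI allI impI exI[of _ 0] exI[of _ "\<lambda>x. c"]) (auto simp: Lipf_def periodic_def zero_power)

lemma Lp_approx_limit:
 assumes p: "even p" and f: "f \<in> borel_measurable borel" and F: "\<And>n. Lp_approx p (F n)"
  and lim: "(\<lambda>n. (navg x. ennreal ((f x - F n x) ^ p))) ~~> 0"
 shows "Lp_approx p f"
 unfolding Lp_approx_def
proof (intro conjI allI impI f)
 fix \<epsilon> :: real assume e: "0 < \<epsilon>"
 let ?d = "\<epsilon> / (2 ^ p * 2)"
 have d: "0 < ?d" using e by simp
 obtain n where n: "(navg x. ennreal ((f x - F n x) ^ p)) < ennreal ?d"
  using order_tendstoD(2)[OF lim, of "ennreal ?d"] d by (auto simp: eventually_sequentially)
 obtain L g where g: "Lipf L g" "(navg x. ennreal ((F n x - g x) ^ p)) < ennreal ?d" by (rule Lp_approxE[OF F d])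
 have m: "F n \<in> borel_measurable borel" using F by (auto simp: Lp_approx_def)
 have "(navg x. ennreal ((f x - g x) ^ p)) = (navg x. ennreal (((f x - F n x) + (F n x - g x)) ^ p))"
  by (simp add: algebra_simps)
 also have "\<dots> \<le> ennreal (2 ^ p) * ((navg x. ennreal ((f x - F n x) ^ p)) + (navg x. ennreal ((F n x - g x) ^ p)))"
  by (rule nn_power_add_le[OF p borel_measurable_diff borel_measurable_diff]) (rule m f Lipf_measurable g)+
 also have "\<dots> < ennreal (2 ^ p) * ennreal (?d + ?d)"
  by (rule ennreal_mult_strict_left_mono[OF add_mono_ennreal[OF n g(2)]]) auto
 also have "\<dots> = ennreal (2 ^ p * (?d + ?d))" by (rule ennreal_mult'[symmetric]) simp
 also have "2 ^ p * (?d + ?d) = \<epsilon>" by simp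
 finally show "\<exists>L h. Lipf L h \<and> (navg x. ennreal ((f x - h x) ^ p)) < ennreal \<epsilon>"
  using g(1) by blast
qed

lemma Lp_approx_dominated:
 assumes p: "even p" "0 < p" and f: "f \<in> borel_measurable borel" and F: "\<And>n. Lp_approx p (F n)"
  and w: "w \<in> borel_measurable borel" "integrable torus (\<lambda>x. w x ^ p)" and le: "\<And>n x. \<bar>f x - F n x\<bar> \<le> w x"
  and lim: "AE x in torus. (\<lambda>n. F n x) ~~> f x"
 shows "Lp_approx p f"
proof (rule Lp_approx_limit[OF p(1) f F])
 have m: "F n \<in> borel_measurable torus" for n using F[of n] by (auto simp: Lp_approx_def intro: measurable_torus)
 note mf = measurable_torus[OF f] measurable_torus[OF w(1)]
 have "(\<lambda>n. (navg x. ennreal ((f x - F n x) ^ p))) ~~> (navg x. 0)"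
 proof (rule nn_integral_dominated_convergence[where w="\<lambda>x. ennreal (w x ^ p)"])
  show "(navg x. ennreal (w x ^ p)) < \<infinity>"
   using w(2) p by (subst nn_integral_eq_integral) (auto simp: zero_le_even_power)
  show "AE x in torus. ennreal ((f x - F n x) ^ p) \<le> ennreal (w x ^ p)" for n
  proof (intro AE_I2 ennreal_leI)
   fix x
   have "\<bar>f x - F n x\<bar> ^ p \<le> w x ^ p" by (intro power_mono le) auto
   then show "(f x - F n x) ^ p \<le> w x ^ p" using p by (simp add: power_even_abs)
  qed
  show "AE x in torus. (\<lambda>n. ennreal ((f x - F n x) ^ p)) ~~> 0"
   using lim
  proof eventually_elim
   case (elim x)
   have "(\<lambda>n. ennreal ((f x - F n x) ^ p)) ~~> ennreal ((f x - f x) ^ p)"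
    by (intro tendsto_intros elim)
   then show ?case using p by (simp add: zero_power)
  qed
 qed (use m mf in auto)
 then show "(\<lambda>n. (navg x. ennreal ((f x - F n x) ^ p))) ~~> 0" by simp
qed

lemma AE_torus_interior: "AE x in torus. x \<in> {0<..<1} \<times> {0<..<1}"
proof -
 have c: "AE t in circ. 0 < t \<and> t < 1"
 proof -
  have "AE t in lborel. t \<noteq> (0::real)" by (rule AE_lborel_singleton)
  then have "AE t in circ. t \<noteq> 0" unfolding circ_def by (subst AE_restrict_space_iff) auto
  then show ?thesis using AE_space by eventually_elim (auto simp: space_circ)
 qed
 have "AE x in circ \<Otimes>\<^sub>M circ. (0 < fst x \<and> fst x < 1) \<and> (0 < snd x \<and> snd x < 1)"
 proof (rule circ2.AE_pair_measure)
  have "{0<..<1::real} \<times> {0<..<1::real} \<in> sets (borel :: plane measure)" by (intro borel_open open_Times) auto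
  then have "{0<..<1::real} \<times> {0<..<1::real} \<in> sets torus"
   unfolding torus_def sets_restrict_space by (intro image_eqI[of _ _ "{0<..<1} \<times> {0<..<1}"]) auto
  moreover have "{x \<in> space (circ \<Otimes>\<^sub>M circ). (0 < fst x \<and> fst x < 1) \<and> (0 < snd x \<and> snd x < 1)} = {0<..<1::real} \<times> {0<..<1::real}"
   by (auto simp: space_pair_measure space_circ)
  ultimately show "{x \<in> space (circ \<Otimes>\<^sub>M circ). (0 < fst x \<and> fst x < 1) \<and> (0 < snd x \<and> snd x < 1)} \<in> sets (circ \<Otimes>\<^sub>M circ)"
   by (simp add: torus_eq)
  show "AE x in circ. AE y in circ. (0 < fst (x, y) \<and> fst (x, y) < 1) \<and> (0 < snd (x, y) \<and> snd (x, y) < 1)"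
   using c by eventually_elim (use c in auto)
 qed
 then show ?thesis unfolding torus_eq by (rule eventually_mono) (auto simp: mem_Times_iff)
qed

text \<open>The approximants are min 1 (n d) with d the distance to the complement of an open set.
  Since they have to be periodic, U is first cut to the open unit square and repeated periodically;
  the boundary lost in this way is a null set.\<close>

lemma Lp_approx_open:
 assumes U: "open U" and p: "even p" "0 < p" shows "Lp_approx p (indicator U)"
proof -
 let ?fr = "\<lambda>x :: plane. (frac (fst x), frac (snd x))"
 define Q where "Q = U \<inter> {0<..<1::real} \<times> {0<..<1::real}"
 define P where "P = - {x. ?fr x \<in> Q}"
 let ?W = "\<Union>m n :: int. (\<lambda>x. x - (of_int m, of_int n)) -` Q"
 have fr: "?fr x = x" if "x \<in> {0<..<1} \<times> {0<..<1}" for x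
  using that by (auto simp: mem_Times_iff prod_eq_iff frac_eq)
 have "{x. ?fr x \<in> Q} = ?W"
 proof (intro equalityI subsetI)
  fix x assume "x \<in> {x. ?fr x \<in> Q}"
  then have "x - (of_int \<lfloor>fst x\<rfloor>, of_int \<lfloor>snd x\<rfloor>) \<in> Q" by (cases x) (simp add: frac_def)
  then show "x \<in> ?W" by blast
 next
  fix x assume "x \<in> ?W"
  then obtain m n :: int where q: "x - (of_int m, of_int n) \<in> Q" by blast
  then have "?fr (x - (of_int m, of_int n)) = x - (of_int m, of_int n)" by (intro fr) (simp add: Q_def)
  with q show "x \<in> {x. ?fr x \<in> Q}" by (simp add: frac_def)
 qed
 moreover have "open Q" unfolding Q_def by (intro open_Int U open_Times) auto
 then have "open ?W"
  by (intro open_UN ballI open_vimage continuous_intros)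
 ultimately have Pc: "closed P" unfolding P_def closed_def by simp
 \<comment> \<open>Lattice points have fractional parts 0, which the open square omits. So P is
   nonempty and distances to it are meaningful.\<close>
 have P0: "0 \<in> P" by (simp add: P_def Q_def)
 have Pshift: "x + v \<in> P \<longleftrightarrow> x \<in> P" if "v = (of_int m, of_int n)" for x v m n
  by (simp add: that P_def frac_def)
 have inf_le: "infdist (x + v) P \<le> infdist x P" if v: "v = (of_int m, of_int n)" for x v m n
 proof -
  have "infdist (x + v) P \<le> dist x a" if "a \<in> P" for a
   using infdist_le[OF Pshift[OF v, THEN iffD2, OF that], of "x + v"] by (simp add: dist_norm)
  then show ?thesis unfolding infdist_def[of x] using P0 by (auto intro!: cINF_greatest)
 qed
 have inf_per: "infdist (x + (of_int m, of_int n)) P = infdist x P" for x m n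
 proof -
  have "x + (real_of_int m, real_of_int n) + (- real_of_int m, - real_of_int n) = x" by (simp add: prod_eq_iff)
  with inf_le[of "(of_int m, of_int n)" m n x] inf_le[of "(- of_int m, - of_int n)" "- m" "- n" "x + (of_int m, of_int n)"]
  show ?thesis by simp
 qed
 define g where "g n x = min 1 (real n * infdist x P)" for n x
 have gL: "Lipf (real n) (g n)" for n
  unfolding Lipf_def
 proof (intro conjI allI)
  show "periodic (g n)" unfolding periodic_def g_def by (simp add: inf_per)
  fix x y
  have "\<bar>g n x - g n y\<bar> \<le> \<bar>real n * infdist x P - real n * infdist y P\<bar>" unfolding g_def by linarith
  also have "\<dots> = real n * \<bar>infdist x P - infdist y P\<bar>" by (simp add: abs_mult flip: right_diff_distrib)
  also have "\<dots> \<le> real n * dist x y" by (intro mult_left_mono infdist_triangle_abs) auto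
  also have "\<dots> \<le> real n * (\<bar>fst x - fst y\<bar> + \<bar>snd x - snd y\<bar>)" by (intro mult_left_mono abs_coord_le_dist) auto
  finally show "\<bar>g n x - g n y\<bar> \<le> real n * (\<bar>fst x - fst y\<bar> + \<bar>snd x - snd y\<bar>)" .
 qed simp
 have g01: "0 \<le> g n x" "g n x \<le> 1" for n x unfolding g_def by (auto simp: infdist_nonneg)
 show ?thesis
 proof (rule Lp_approx_dominated[OF p, where F=g and w="\<lambda>x. 1"])
  show "(indicator U :: plane => real) \<in> borel_measurable borel" using U by (intro borel_measurable_indicator) auto
  show "Lp_approx p (g n)" for n
   unfolding Lp_approx_def
  proof (intro conjI allI impI)
   show "g n \<in> borel_measurable borel" by (rule Lipf_measurable[OF gL])
   show "\<exists>L h. Lipf L h \<and> (navg x. ennreal ((g n x - h x) ^ p)) < ennreal \<epsilon>" if "0 < \<epsilon>" for \<epsilon>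
    using that p by (intro exI[of _ "real n"] exI[of _ "g n"]) (simp add: gL zero_power)
  qed
  show "\<bar>indicator U x - g n x\<bar> \<le> 1" for n x using g01[of n x] by (auto simp: indicator_def)
  show "AE x in torus. (\<lambda>n. g n x) ~~> indicator U x"
   using AE_torus_interior
  proof eventually_elim
   case (elim x)
   show ?case
   proof (cases "x \<in> U")
    case True
    then have "x \<notin> P" using elim unfolding P_def Q_def Compl_iff mem_Collect_eq fr[OF elim] by blast
    then have pos: "0 < infdist x P" using infdist_pos_not_in_closed[OF Pc _ ] P0 by blast
    obtain N where N: "1 / infdist x P < real N" using reals_Archimedean2 by blast
    have "\<forall>\<^sub>F n in sequentially. g n x = indicator U x"
     using eventually_ge_at_top[of N]
    proof eventually_elim
     case (elim n)
     then have "1 / infdist x P \<le> real n" using N by linarith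
     then show ?case using pos True by (simp add: g_def field_simps)
    qed
    then show ?thesis by (rule tendsto_eventually)
   next
    case False
    then have "x \<in> P" unfolding P_def Q_def Compl_iff mem_Collect_eq fr[OF elim] by blast
    then have "infdist x P = 0" by (rule infdist_zero)
    then show ?thesis using False by (simp add: g_def)
   qed
  qed
 qed auto
qed

text \<open>The sets with approximable indicator form a Dynkin system that contains the open sets,
  and these are stable under intersection.\<close>

lemma Lp_approx_indicator:
 assumes p: "even p" "0 < p" and A: "A \<in> sets (borel :: plane measure)"
 shows "Lp_approx p (indicator A)"
proof -
 have "A \<in> sigma_sets UNIV {S :: plane set. open S}" using A by (simp add: borel_def)
 moreover have "Int_stable {S :: plane set. open S}" by (auto simp: Int_stable_def)
 moreover have "{S :: plane set. open S} \<subseteq> Pow UNIV" by simp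
 ultimately have "Int_stable {S :: plane set. open S}" "{S :: plane set. open S} \<subseteq> Pow UNIV" "A \<in> sigma_sets UNIV {S :: plane set. open S}" by simp_all
 then show ?thesis
 proof (induction rule: sigma_sets_induct_disjoint)
  case (basic A) then show ?case using Lp_approx_open p by auto
 next
  case empty
  then show ?case using Lp_approx_const[OF p(2), of 0] by (simp add: indicator_def)
 next
  case (compl A)
  have "indicator (UNIV - A) = (\<lambda>x. 1 + (-1) * indicator A x :: real)" by (auto simp: indicator_def)
  then show ?case using Lp_approx_add[OF p(1) Lp_approx_const[OF p(2), of 1] Lp_approx_cmult[OF p(1) compl(2), of "-1"]] by (simp only:)
 next
  case (union A)
  have mA: "A i \<in> sets borel" for i using union(2) by (auto simp: borel_def)
  show ?case
  proof (rule Lp_approx_dominated[OF p, where F="\<lambda>n x. \<Sum>i<n. indicator (A i) x" and w="\<lambda>x. 1"])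
   show "(indicator (\<Union> (range A)) :: plane => real) \<in> borel_measurable borel" using mA by (intro borel_measurable_indicator) auto
   show "Lp_approx p (\<lambda>x. \<Sum>i<n. indicator (A i) x)" for n
    by (induction n) (auto intro!: Lp_approx_add p union(3) simp: Lp_approx_const[OF p(2)])
   have ind: "(\<Sum>i<n. indicator (A i) x) = (indicator (\<Union>i<n. A i) x :: real)" for n x
    using union(1) by (subst indicator_UN_disjoint) (auto simp: disjoint_family_on_def)
   have b: "\<bar>indicator B x - indicator C x :: real\<bar> \<le> 1" for B C and x :: plane by (simp add: indicator_def)
   show "\<bar>indicator (\<Union> (range A)) x - (\<Sum>i<n. indicator (A i) x)\<bar> \<le> (1::real)" for n x unfolding ind by (rule b)
   show "AE x in torus. (\<lambda>n. \<Sum>i<n. indicator (A i) x) ~~> (indicator (\<Union> (range A)) x :: real)"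
   proof (rule AE_I2)
    fix x
    show "(\<lambda>n. \<Sum>i<n. indicator (A i) x) ~~> (indicator (\<Union> (range A)) x :: real)"
     unfolding ind by (rule LIMSEQ_indicator_UN)
   qed
  qed auto
 qed
qed

text \<open>Simple functions bounded by 2 |f| converge pointwise to f, so 3 |f| dominates the
  errors.\<close>

lemma ELp_Lp_approx:
 assumes p: "even p" "2 \<le> p" and f: "f \<in> ELp p" shows "Lp_approx p f"
proof -
 have p0: "0 < p" using p by simp
 note mf = ELpD(1)[OF f]
 obtain F where F0: "\<forall>i. simple_function borel (F i)" "\<forall>x\<in>space borel. (\<lambda>i. F i x) ~~> f x"
   "\<forall>i. \<forall>x\<in>space borel. dist (F i x) 0 \<le> 2 * dist (f x) 0"
  using borel_measurable_implies_sequence_metric[OF mf, of 0] by blast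
 then have F: "\<And>i. simple_function borel (F i)" "\<And>x. (\<lambda>i. F i x) ~~> f x" "\<And>i x. norm (F i x) \<le> 2 * norm (f x)"
  unfolding space_borel dist_norm diff_0_right by (blast intro: UNIV_I)+
 show ?thesis
 proof (rule Lp_approx_dominated[OF p(1) p0 mf, where F=F and w="\<lambda>x. 3 * \<bar>f x\<bar>"])
  show "Lp_approx p (F i)" for i
  proof -
   have fin: "finite (range (F i))" using simple_functionD(1)[OF F(1)[of i]] by simp
   have s: "F i -` {y} \<in> sets borel" for y using simple_functionD(2)[OF F(1)[of i], of "{y}"] by simp
   have K: "Lp_approx p (\<lambda>x. \<Sum>y\<in>K. y * indicator (F i -` {y}) x)" if "finite K" for K
    using that
   proof (induction K rule: finite_induct)
    case empty
    show ?case using Lp_approx_const[OF p0, of 0] by simp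
   next
    case (insert y K)
    show ?case
     using Lp_approx_add[OF p(1) Lp_approx_cmult[OF p(1) Lp_approx_indicator[OF p(1) p0 s[of y]], of y] insert.IH] insert.hyps
     by (simp only: sum.insert not_False_eq_True)
   qed
   have "F i = (\<lambda>x. \<Sum>y\<in>range (F i). y * indicator (F i -` {y}) x)"
   proof
    fix x
    have "(\<Sum>y\<in>range (F i). y * indicator (F i -` {y}) x) = (\<Sum>y\<in>{F i x}. y * indicator (F i -` {y}) x)"
     using fin by (intro sum.mono_neutral_right) (auto simp: indicator_def)
    then show "F i x = (\<Sum>y\<in>range (F i). y * indicator (F i -` {y}) x)" by simp
   qed
   then show ?thesis using K[OF fin] by (simp only:)
  qed
  show "(\<lambda>x. 3 * \<bar>f x\<bar>) \<in> borel_measurable borel" using mf by simp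
  show "integrable torus (\<lambda>x. (3 * \<bar>f x\<bar>) ^ p)" using ELpD(4)[OF f] p by (simp add: power_mult_distrib power_even_abs)
  show "\<bar>f x - F n x\<bar> \<le> 3 * \<bar>f x\<bar>" for n x using F(3)[of n x] unfolding real_norm_def by linarith
  show "AE x in torus. (\<lambda>n. F n x) ~~> f x" using F(2) by simp
 qed
qed

text \<open>A Lipschitz g close to f splits the error into the mollified difference, controlled by
  Jensen, the mollification error of g, which has an explicit rate, and g - f. Splitting twice costs
  the factor 2^p twice, which explains the size of d.\<close>

lemma conv_ker_tendsto:
 assumes p: "even p" "2 \<le> p" and f: "f \<in> ELp p"
 shows "(\<lambda>n. (avg x. (conv (ker n) f x - f x) ^ p)) ~~> 0"
proof (rule LIMSEQ_I)
 fix \<epsilon> :: real assume e: "0 < \<epsilon>"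
 define A where "A = (2::real) ^ p"
 have A1: "1 \<le> A" by (simp add: A_def)
 define d where "d = \<epsilon> / (4 * (A * A))"
 have d: "0 < d" using e A1 by (auto simp: d_def intro!: divide_pos_pos mult_pos_pos)
 obtain L g where g: "Lipf L g" and gn: "(navg x. ennreal ((f x - g x) ^ p)) < ennreal d"
  by (rule Lp_approxE[OF ELp_Lp_approx[OF p f] d])
 have gE: "g \<in> ELp p" by (rule Lipf_ELp[OF g])
 have fg: "(f -. g) \<in> ELp p" by (rule ELp_diff[OF f gE p(1)])
 have fgd: "(avg x. (f x - g x) ^ p) < d"
 proof -
  have "(navg x. ennreal ((f x - g x) ^ p)) = ennreal (avg x. (f x - g x) ^ p)"
   using ELpD(4)[OF fg] p by (intro nn_integral_eq_integral) (auto simp: zero_le_even_power)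
  then show ?thesis using gn d by (simp add: ennreal_less_iff zero_le_even_power p)
 qed
 have "(\<lambda>n. (L * (avg z. ker n z * sabs z)) ^ p) ~~> (L * 0) ^ p"
  by (intro tendsto_intros ker_moment_tendsto)
 moreover have "(L * 0) ^ p = 0" using p by (simp add: zero_power)
 ultimately have "(\<lambda>n. (L * (avg z. ker n z * sabs z)) ^ p) ~~> 0" by (simp only:)
 from order_tendstoD(2)[OF this d] obtain N where N: "\<And>n. N \<le> n ==> (L * (avg z. ker n z * sabs z)) ^ p < d"
  by (auto simp: eventually_sequentially)
 show "\<exists>no. \<forall>n\<ge>no. norm ((avg x. (conv (ker n) f x - f x) ^ p) - 0) < \<epsilon>"
 proof (intro exI[of _ N] allI impI)
  fix n assume n: "N \<le> n"
  note K = ker_TP[of n]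
  note fi = ELp_integrable[OF f p] ELp_integrable[OF gE p] ELp_integrable[OF fg p]
  let ?a = "\<lambda>x. conv (ker n) (f -. g) x" and ?b = "\<lambda>x. conv (ker n) g x - g x" and ?c = "\<lambda>x. g x - f x"
  have aE: "?a \<in> ELp p" by (rule TP_ELp[OF conv_TP[OF K fi(3)]])
  have bE: "?b \<in> ELp p" by (rule ELp_diff[OF TP_ELp[OF conv_TP[OF K fi(2)]] gE p(1)])
  have cE: "?c \<in> ELp p" by (rule ELp_diff[OF gE f p(1)])
  note I = ELpD(4)[OF aE] ELpD(4)[OF bE] ELpD(4)[OF cE]
  have "(avg x. (conv (ker n) f x - f x) ^ p) \<le> (avg x. A * (?a x ^ p) + A * A * (?b x ^ p) + A * A * (?c x ^ p))"
  proof (rule integral_mono)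
   show "integrable torus (\<lambda>x. (conv (ker n) f x - f x) ^ p)"
    by (rule ELpD(4)[OF ELp_diff[OF TP_ELp[OF conv_TP[OF K fi(1)]] f p(1)]])
   show "integrable torus (\<lambda>x. A * (?a x ^ p) + A * A * (?b x ^ p) + A * A * (?c x ^ p))" using I by simp
   fix x
   have "conv (ker n) f x - f x = ?a x + (?b x + ?c x)" by (simp add: conv_diff_right[OF K fi(1) fi(2)])
   then have "(conv (ker n) f x - f x) ^ p \<le> A * (?a x ^ p + (?b x + ?c x) ^ p)"
    unfolding A_def by (simp only: even_power_add_bound[OF p(1)])
   also have "\<dots> \<le> A * (?a x ^ p + A * (?b x ^ p + ?c x ^ p))"
    using A1 even_power_add_bound[OF p(1), of "?b x" "?c x"] by (intro mult_left_mono add_left_mono) (auto simp: A_def)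
   finally show "(conv (ker n) f x - f x) ^ p \<le> A * (?a x ^ p) + A * A * (?b x ^ p) + A * A * (?c x ^ p)"
    by (simp add: algebra_simps)
  qed
  also have "\<dots> = A * (avg x. ?a x ^ p) + A * A * (avg x. ?b x ^ p) + A * A * (avg x. ?c x ^ p)"
   using I by simp
  also have "\<dots> \<le> A * d + A * A * d + A * A * d"
  proof (intro add_mono mult_left_mono)
   show "(avg x. ?a x ^ p) \<le> d" using conv_power_le[OF ker_prob fg p, of n] fgd by linarith
   have "(avg x. ?b x ^ p) \<le> (avg x. (L * (avg z. ker n z * sabs z)) ^ p)"
   proof (rule integral_mono[OF I(2)])
    fix x
    have "\<bar>?b x\<bar> ^ p \<le> (L * (avg z. ker n z * sabs z)) ^ p" by (intro power_mono conv_Lipf g) auto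
    then show "?b x ^ p \<le> (L * (avg z. ker n z * sabs z)) ^ p" using p by (simp add: power_even_abs)
   qed simp
   then show "(avg x. ?b x ^ p) \<le> d" using N[OF n] by (simp add: torus.prob_space)
   have "(avg x. ?c x ^ p) = (avg x. (f x - g x) ^ p)"
   proof (intro bochner_cong refl)
    show "(g x - f x) ^ p = (f x - g x) ^ p" for x
     using power_minus_even[OF p(1), of "f x - g x"] by simp
   qed
   then show "(avg x. ?c x ^ p) \<le> d" using fgd by linarith
  qed (use A1 in auto)
  also have "\<dots> \<le> 3 * (A * A * d)"
  proof -
   have "A * d \<le> A * A * d" using A1 d mult_right_mono[of 1 A "A * d"] by (simp add: mult.assoc)
   then show ?thesis by simp
  qed
  also have "\<dots> < \<epsilon>" using A1 e by (simp add: d_def field_simps)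
  finally show "norm ((avg x. (conv (ker n) f x - f x) ^ p) - 0) < \<epsilon>"
   using p by (simp add: zero_le_even_power)
 qed
qed

lemma conv_ker_n2: "f \<in> ELp 2 ==> (\<lambda>n. n2 (conv (ker n) f -. f)) ~~> 0"
 unfolding n2_def using tendsto_real_sqrt[OF conv_ker_tendsto[of 2 f]] by simp

section \<open>Fourier series of square integrable functions\<close>

text \<open>Lower semicontinuity including integrability of the limit: approximations by truncation
  or projection are bounded in L^p before their limit is known to lie there.\<close>

lemma even_power_Fatou:
 fixes F :: "nat => 'a => real"
 assumes p: "even p" and F: "\<And>n. F n \<in> borel_measurable M" "\<And>n. integrable M (\<lambda>x. F n x ^ p)"
  and f: "f \<in> borel_measurable M" and lim: "AE x in M. (\<lambda>n. F n x) ~~> f x"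
  and C: "\<And>n. (\<integral>x. F n x ^ p \<partial>M) \<le> C"
 shows "integrable M (\<lambda>x. f x ^ p)" "(\<integral>x. f x ^ p \<partial>M) \<le> C"
proof -
 have nn: "0 \<le> a ^ p" for a :: real using p by (simp add: zero_le_even_power)
 have "0 \<le> (\<integral>x. F 0 x ^ p \<partial>M)" by (intro integral_nonneg_AE AE_I2 nn)
 then have C0: "0 \<le> C" using C[of 0] by linarith
 have "(\<integral>\<^sup>+x. ennreal (f x ^ p) \<partial>M) = (\<integral>\<^sup>+x. liminf (\<lambda>n. ennreal (F n x ^ p)) \<partial>M)"
 proof (rule nn_integral_cong_AE, use lim in eventually_elim)
  case (elim x)
  have "(\<lambda>n. ennreal (F n x ^ p)) ~~> ennreal (f x ^ p)" by (intro tendsto_intros elim)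
  then show "ennreal (f x ^ p) = liminf (\<lambda>n. ennreal (F n x ^ p))" by (intro lim_imp_Liminf[symmetric]) auto
 qed
 also have "\<dots> \<le> liminf (\<lambda>n. \<integral>\<^sup>+x. ennreal (F n x ^ p) \<partial>M)"
  using F by (intro nn_integral_liminf) auto
 also have "\<dots> \<le> liminf (\<lambda>n. ennreal C)"
 proof (intro Liminf_mono always_eventually allI)
  fix n
  have "(\<integral>\<^sup>+x. ennreal (F n x ^ p) \<partial>M) = ennreal (\<integral>x. F n x ^ p \<partial>M)"
   using F(2) nn by (intro nn_integral_eq_integral) auto
  then show "(\<integral>\<^sup>+x. ennreal (F n x ^ p) \<partial>M) \<le> ennreal C" using C[of n] by (simp add: ennreal_leI)
 qed
 also have "\<dots> = ennreal C" by (simp add: Liminf_const)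
 finally have le: "(\<integral>\<^sup>+x. ennreal (f x ^ p) \<partial>M) \<le> ennreal C" .
 show i: "integrable M (\<lambda>x. f x ^ p)"
  using f le nn by (intro integrableI_bounded) (auto simp: less_top[symmetric] top_unique abs_of_nonneg)
 have "ennreal (\<integral>x. f x ^ p \<partial>M) \<le> ennreal C"
  using le nn_integral_eq_integral[OF i] nn by simp
 then show "(\<integral>x. f x ^ p \<partial>M) \<le> C" using C0 by simp
qed

lemma L2_AE_subseq:
 assumes F: "\<And>n. F n \<in> ELp 2" and f: "f \<in> ELp 2" and lim: "(\<lambda>n. n2 (F n -. f)) ~~> 0"
 obtains r where "strict_mono r" "AE x in torus. (\<lambda>n. F (r n) x) ~~> f x"
proof -
 have d: "(F n -. f) \<in> ELp 2" for n by (rule ELp_diff[OF F f]) simp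
 have "(\<lambda>n. (avg x. norm (F n x - f x))) ~~> 0"
  by (rule tendsto_sandwich[OF _ _ tendsto_const lim])
    (use L1_le_n2[OF d] in \<open>auto intro!: always_eventually\<close>)
 then have "\<exists>r. strict_mono r \<and> (AE x in torus. (\<lambda>n. F (r n) x - f x) ~~> 0)"
  using ELp2_integrable[OF d] by (intro tendsto_L1_AE_subseq) auto
 then obtain r where r: "strict_mono r" "AE x in torus. (\<lambda>n. F (r n) x - f x) ~~> 0" by blast
 have "AE x in torus. (\<lambda>n. F (r n) x) ~~> f x"
  using r(2) by eventually_elim (simp add: LIM_zero_iff)
 with r(1) show thesis by (rule that)
qed

lemma ELp_Fatou_subseq:
 assumes F: "\<And>n. F n \<in> ELp 2" and f: "f \<in> ELp 2" and lim: "(\<lambda>n. n2 (F n -. f)) ~~> 0"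
  and p: "even p" and Fp: "\<And>n. F n \<in> ELp p" and C: "\<And>n. (avg x. F n x ^ p) \<le> C"
 shows "f \<in> ELp p" "(avg x. f x ^ p) \<le> C"
proof -
 obtain r where r: "strict_mono r" "AE x in torus. (\<lambda>n. F (r n) x) ~~> f x"
  by (rule L2_AE_subseq[OF F f lim])
 note Fatou = even_power_Fatou[OF p ELpD(3)[OF Fp] ELpD(4)[OF Fp] ELpD(3)[OF f] r(2) C]
 show "f \<in> ELp p" by (rule ELpI[OF ELpD(1,2)[OF f] Fatou(1)])
 show "(avg x. f x ^ p) \<le> C" by (rule Fatou(2))
qed

definition fbox :: "nat => (int \<times> int) set" where
 "fbox N = {k \<in> Z0. \<bar>fst k\<bar> \<le> int N \<and> \<bar>snd k\<bar> \<le> int N}"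

lemma fbox_finite: "finite (fbox N)"
proof (rule finite_subset)
 show "fbox N \<subseteq> {- int N..int N} \<times> {- int N..int N}" by (auto simp: fbox_def)
qed simp

lemma fbox_Z0: "fbox N \<subseteq> Z0" by (auto simp: fbox_def)

lemma fbox_mono: "m \<le> n ==> fbox m \<subseteq> fbox n" by (auto simp: fbox_def)

lemma fbox_minus: "k \<in> fbox N ==> - k \<in> fbox N" by (auto simp: fbox_def minus_Z0)

lemma fbox_exhaust:
 assumes "finite K" "K \<subseteq> Z0" obtains N where "K \<subseteq> fbox N"
proof -
 have "\<exists>N. K \<subseteq> fbox N"
  using assms
 proof (induction K rule: finite_induct)
  case (insert k K)
  then obtain N where N: "K \<subseteq> fbox N" by auto
  let ?M = "N + nat \<bar>fst k\<bar> + nat \<bar>snd k\<bar>"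
  have "k \<in> fbox ?M" using insert.prems by (simp add: fbox_def)
  then show ?case using N fbox_mono[of N ?M] by (intro exI[of _ ?M]) simp
 qed simp
 then show thesis using that by blast
qed

text \<open>The orthogonal projection onto the span of the modes in K.\<close>

definition PK :: "(int \<times> int) set => tfun => tfun" where
 "PK K f x = (\<Sum>k\<in>K. ip f (eb k) * eb k x)"

lemma PK_TP: "finite K ==> PK K f \<in> TP"
 unfolding PK_def[abs_def] by (rule e_sum_TP)

lemma PK_n2: "finite K ==> K \<subseteq> Z0 ==> (n2 (PK K f))^2 = (\<Sum>k\<in>K. (ip f (eb k))^2)"
 unfolding PK_def[abs_def] by (rule e_sum_norm)

lemma n2_diff_sq:
 assumes f: "f \<in> ELp 2" and g: "g \<in> ELp 2"
 shows "(n2 (f -. g))^2 = (n2 f)^2 - 2 * ip g f + (n2 g)^2"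
proof -
 have "(n2 (f -. g))^2 = (avg x. (f x)^2 - 2 * (g x * f x) + (g x)^2)"
  unfolding n2_sq by (intro bochner_cong) (auto simp: power2_eq_square algebra_simps)
 then show ?thesis
  unfolding n2_sq L2_inner_def using ELpD(4)[OF f] ELpD(4)[OF g] integrable_ELp2_mult[OF g f] by simp
qed

lemma n2_diff_e_sum:
 assumes K: "finite K" "K \<subseteq> Z0" and f: "f \<in> ELp 2"
 shows "(n2 (\<lambda>x. f x - (\<Sum>k\<in>K. a k * eb k x)))^2 = (n2 f)^2 - 2 * (\<Sum>k\<in>K. a k * ip f (eb k)) + (\<Sum>k\<in>K. (a k)^2)"
 unfolding n2_diff_sq[OF f TP_ELp[OF e_sum_TP[OF K(1)]]] L2_inner_e_sum2[OF K f] e_sum_norm[OF K] by simp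

lemma n2_diff_PK:
 assumes K: "finite K" "K \<subseteq> Z0" and f: "f \<in> ELp 2"
 shows "(n2 (f -. PK K f))^2 = (n2 f)^2 - (\<Sum>k\<in>K. (ip f (eb k))^2)"
 unfolding PK_def n2_diff_e_sum[OF K f] by (simp add: power2_eq_square)

lemma Bessel: "finite K ==> K \<subseteq> Z0 ==> f \<in> ELp 2 ==> (\<Sum>k\<in>K. (ip f (eb k))^2) \<le> (n2 f)^2"
 using n2_diff_PK[of K f] zero_le_power2[of "n2 (f -. PK K f)"] by linarith

text \<open>Completing the square in each coefficient, with y the Fourier coefficient of f: 2 a y is
  at most y^2 + a^2.\<close>

lemma PK_best:
 assumes K: "finite K" "K \<subseteq> Z0" and f: "f \<in> ELp 2"
 shows "n2 (f -. PK K f) \<le> n2 (\<lambda>x. f x - (\<Sum>k\<in>K. a k * eb k x))"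
proof (rule power2_le_imp_le)
 have "(\<Sum>k\<in>K. 2 * (a k * ip f (eb k))) \<le> (\<Sum>k\<in>K. (ip f (eb k))^2 + (a k)^2)"
 proof (rule sum_mono)
  fix k
  show "2 * (a k * ip f (eb k)) \<le> (ip f (eb k))^2 + (a k)^2"
   using sum_squares_bound[of "ip f (eb k)" "a k"] by (simp add: mult_ac)
 qed
 then show "(n2 (f -. PK K f))^2 \<le> (n2 (\<lambda>x. f x - (\<Sum>k\<in>K. a k * eb k x)))^2"
  unfolding n2_diff_PK[OF K f] n2_diff_e_sum[OF K f] sum.distrib sum_distrib_left[symmetric] by linarith
qed simp

lemma TP_inner_expansion:
 assumes h: "h \<in> TP"
 obtains K where "finite K" "K \<subseteq> Z0" "\<And>g. g \<in> \<E> ==> ip g h = (\<Sum>k\<in>K. ip h (eb k) * ip g (eb k))"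
  "\<And>k. k \<in> Z0 ==> k \<notin> K ==> ip h (eb k) = 0"
proof -
 let ?S = "\<lambda>K x. \<Sum>k\<in>K. ip h (eb k) * eb k x"
 obtain K where K: "finite K" "K \<subseteq> Z0" "\<And>x. h x = (avg x. h x) + ?S K x"
  "\<And>k. k \<in> Z0 ==> k \<notin> K ==> ip h (eb k) = 0" by (rule TP_expansion[OF h]) blast
 show thesis
 proof (rule that[OF K(1,2) _ K(4)])
  fix g assume "g \<in> \<E>"
  note g2 = zero_mean_L2D[OF this]
  have "h = (\<lambda>x. (avg x. h x) + ?S K x)" by (rule ext) (rule K(3))
  then have "ip h g = ip (\<lambda>x. (avg x. h x) + ?S K x) g" by (rule arg_cong[where f="\<lambda>h. ip h g"])
  also have "\<dots> = ip (\<lambda>x. (avg x. h x)) g + ip (?S K) g"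
   by (intro L2_inner_add_left ELp_const TP_ELp e_sum_TP K g2)
  also have "ip (\<lambda>x. (avg x. h x)) g = 0" using g2 by (simp add: L2_inner_def)
  finally show "ip g h = (\<Sum>k\<in>K. ip h (eb k) * ip g (eb k))"
   by (simp add: L2_inner_commute[of g h] L2_inner_e_sum2[OF K(1,2) g2(1)])
 qed
qed

lemma zero_mean_TP_expansion:
 assumes "f \<in> TP" "(avg x. f x) = 0"
 obtains K where "finite K" "K \<subseteq> Z0" "\<And>L. finite L ==> K \<subseteq> L ==> L \<subseteq> Z0 ==> PK L f = f"
proof -
 obtain K where K: "finite K" "K \<subseteq> Z0"
  "\<And>x. f x = (avg x. f x) + (\<Sum>k\<in>K. ip f (eb k) * eb k x)"
  "\<And>k. k \<in> Z0 ==> k \<notin> K ==> ip f (eb k) = 0" by (rule TP_expansion[OF assms(1)]) blast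
 show thesis
 proof (rule that[OF K(1,2)], rule ext)
  fix L x assume L: "finite L" "K \<subseteq> L" "L \<subseteq> Z0"
  have "PK L f x = (\<Sum>k\<in>K. ip f (eb k) * eb k x)"
   unfolding PK_def using L K(4) by (intro sum.mono_neutral_right) auto
  then show "PK L f x = f x" using K(3)[of x] assms(2) by simp
 qed
qed

text \<open>A mollification of f is a trigonometric polynomial of mean zero and is fixed by all
  large projections. Best approximation then bounds the projection error of f by its mollification
  error.\<close>

lemma PK_tendsto:
 assumes f: "f \<in> \<E>" shows "(\<lambda>N. n2 (f -. PK (fbox N) f)) ~~> 0"
proof (rule LIMSEQ_I)
 note f2 = zero_mean_L2D[OF f]
 note fi = ELp2_integrable[OF f2(1)]
 fix \<epsilon> :: real assume e: "0 < \<epsilon>"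
 from order_tendstoD(2)[OF conv_ker_n2[OF f2(1)] e] obtain n where n: "n2 (conv (ker n) f -. f) < \<epsilon>"
  by (auto simp: eventually_sequentially)
 let ?h = "conv (ker n) f"
 have h: "?h \<in> TP" by (rule conv_TP[OF ker_TP fi])
 have "(avg x. ?h x) = 0" using integral_conv[OF ker_prob fi] f2(2) by simp
 from zero_mean_TP_expansion[OF h this] obtain K where K: "finite K" "K \<subseteq> Z0"
  "\<And>L. finite L ==> K \<subseteq> L ==> L \<subseteq> Z0 ==> PK L ?h = ?h" by blast
 obtain N where N: "K \<subseteq> fbox N" by (rule fbox_exhaust[OF K(1,2)])
 show "\<exists>no. \<forall>N\<ge>no. norm (n2 (f -. PK (fbox N) f) - 0) < \<epsilon>"
 proof (intro exI[of _ N] allI impI)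
  fix M assume "N \<le> M"
  then have eq: "PK (fbox M) ?h = ?h" using N fbox_mono[of N M] by (intro K(3) fbox_finite fbox_Z0) auto
  have "n2 (f -. PK (fbox M) f) \<le> n2 (f -. ?h)"
   using PK_best[OF fbox_finite fbox_Z0 f2(1), of M "\<lambda>k. ip ?h (eb k)"] unfolding PK_def[symmetric] eq .
  then show "norm (n2 (f -. PK (fbox M) f) - 0) < \<epsilon>" using n by (simp add: n2_minus_commute)
 qed
qed

lemma n2_le_if_coefs:
 assumes f: "f \<in> \<E>" and C: "0 \<le> C" "\<And>N. (\<Sum>k\<in>fbox N. (ip f (eb k))^2) \<le> C^2"
 shows "n2 f \<le> C"
proof (rule LIMSEQ_le_const)
 note f2 = zero_mean_L2D[OF f]
 show "(\<lambda>N. C + n2 (f -. PK (fbox N) f)) ~~> C"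
  using tendsto_add[OF tendsto_const PK_tendsto[OF f], of C] by simp
 show "\<exists>N. \<forall>n\<ge>N. n2 f \<le> C + n2 (f -. PK (fbox n) f)"
 proof (intro exI[of _ 0] allI impI)
  fix N
  have P: "PK (fbox N) f \<in> ELp 2" by (rule TP_ELp[OF PK_TP[OF fbox_finite]])
  have "n2 f \<le> n2 (f -. PK (fbox N) f) + n2 (PK (fbox N) f)"
   using n2_triangle[OF ELp_diff[OF f2(1) P] P] by simp
  moreover have "n2 (PK (fbox N) f) \<le> C"
   by (rule power2_le_imp_le) (simp_all add: PK_n2[OF fbox_finite fbox_Z0] C)
  ultimately show "n2 f \<le> C + n2 (f -. PK (fbox N) f)" by linarith
 qed
qed

text \<open>The Cauchy condition is expressed through a bounded S, the form in which partial sums of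
  squared coefficients provide it. Along a subsequence the increments are summable in L^1, which
  gives convergence almost everywhere, and Fatou turns it into convergence in L^2.\<close>

lemma L2_complete:
 assumes G: "\<And>n. G n \<in> ELp 2" and d: "\<And>m n. m \<le> n ==> (n2 (G n -. G m))^2 \<le> S n - S m"
  and S: "\<And>n. S n \<le> C"
 obtains f where "f \<in> ELp 2" "(\<lambda>n. n2 (G n -. f)) ~~> 0"
proof -
 have mono: "S m \<le> S n" if "m \<le> n" for m n
  using d[OF that] zero_le_power2[of "n2 (G n -. G m)"] by linarith
 obtain s where s: "S ~~> s" and "\<forall>i. S i \<le> s"
  by (rule incseq_convergent[of S C]) (use mono S in \<open>auto simp: incseq_def\<close>)
 then have Ss: "S n \<le> s" for n by blast
 \<comment> \<open>The powers of 1/4 bound squared norms, so the norms of the increments are at most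
   (1/2)^j.\<close>
 have "\<exists>r. \<forall>j. s - S (r j) < (1/4) ^ j \<and> r j < r (Suc j)"
 proof (rule dependent_nat_choice)
  obtain N where "\<forall>n\<ge>N. s - 1 < S n" using order_tendstoD(1)[OF s, of "s - 1"] by (auto simp: eventually_sequentially)
  then have "s - 1 < S N" by blast
  then show "\<exists>x. s - S x < (1/4) ^ 0" by (intro exI[of _ N]) simp
  fix x :: nat and j :: nat
  have "\<forall>\<^sub>F n in sequentially. s - (1/4) ^ Suc j < S n" by (rule order_tendstoD(1)[OF s]) simp
  then obtain N where N: "\<And>n. N \<le> n ==> s - (1/4) ^ Suc j < S n" by (auto simp: eventually_sequentially)
  show "\<exists>y. s - S y < (1/4) ^ Suc j \<and> x < y" by (rule exI[of _ "max N (Suc x)"]) (use N[of "max N (Suc x)"] in auto)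
 qed
 then obtain r where r: "\<And>j. s - S (r j) < (1/4) ^ j" "\<And>j. r j < r (Suc j)" by blast
 have rm: "strict_mono r" using r(2) by (rule strict_monoI_Suc)
 let ?d = "\<lambda>j x. \<bar>G (r (Suc j)) x - G (r j) x\<bar>"
 have D: "(G (r (Suc j)) -. G (r j)) \<in> ELp 2" for j by (rule ELp_diff[OF G G]) simp
 have dj: "(avg x. ?d j x) \<le> (1/2) ^ j" for j
 proof -
  have "(n2 (G (r (Suc j)) -. G (r j)))^2 \<le> ((1/2) ^ j)^2"
   using d[of "r j" "r (Suc j)"] r(2)[of j] r(1)[of j] Ss[of "r (Suc j)"]
   by (simp add: power_mult_distrib[symmetric] power2_eq_square[of "_ ^ j"])
  then have "n2 (G (r (Suc j)) -. G (r j)) \<le> (1/2) ^ j" by (rule power2_le_imp_le) simp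
  then show ?thesis using L1_le_n2[OF D[of j]] by linarith
 qed
 have mD: "(\<lambda>x. ennreal (?d j x)) \<in> borel_measurable torus" for j using ELpD(3)[OF D[of j]] by simp
 have "(navg x. (\<Sum>j. ennreal (?d j x))) = (\<Sum>j. (navg x. ennreal (?d j x)))"
  by (rule nn_integral_suminf[OF mD])
 also have "\<dots> \<le> (\<Sum>j. ennreal ((1/2) ^ j))"
 proof (intro suminf_le allI)
  fix j
  have "(navg x. ennreal (?d j x)) = ennreal (avg x. ?d j x)"
   using ELp2_integrable[OF D[of j]] by (intro nn_integral_eq_integral) auto
  then show "(navg x. ennreal (?d j x)) \<le> ennreal ((1/2) ^ j)" using dj[of j] by (simp add: ennreal_leI)
 qed auto
 also have "\<dots> < \<infinity>" by (subst suminf_ennreal2) (auto intro: summable_geometric)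
 finally have fin: "(navg x. (\<Sum>j. ennreal (?d j x))) \<noteq> \<infinity>" by simp
 have "AE x in torus. (\<Sum>j. ennreal (?d j x)) \<noteq> \<infinity>"
  by (rule nn_integral_PInf_AE[OF borel_measurable_suminf_order[OF mD] fin])
 then have conv: "AE x in torus. convergent (\<lambda>j. G (r j) x)"
 proof eventually_elim
  case (elim x)
  then have "summable (\<lambda>j. ?d j x)" by (intro summable_suminf_not_top) auto
  then have "summable (\<lambda>j. G (r (Suc j)) x - G (r j) x)" by (rule summable_rabs_cancel)
  then have "convergent (\<lambda>n. G (r n) x - G (r 0) x)"
   unfolding summable_iff_convergent sum_lessThan_telescope[of "\<lambda>j. G (r j) x"] .
  then show ?case by (simp only: convergent_diff_const_right_iff)
 qed
 \<comment> \<open>Taking \<open>lim\<close> at every point, also where nothing converges, makes f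
   Borel and periodic without modification on a null set.\<close>
 define f where "f x = lim (\<lambda>j. G (r j) x)" for x
 have fm: "f \<in> borel_measurable borel"
  unfolding f_def[abs_def] by (intro borel_measurable_lim_metric ELpD(1)[OF G])
 have fp: "periodic f"
  unfolding periodic_def f_def using periodicD[OF ELpD(2)[OF G]] by simp
 have lim: "AE x in torus. (\<lambda>j. G (r j) x) ~~> f x"
  using conv by eventually_elim (simp add: f_def convergent_LIMSEQ_iff)
 have key: "integrable torus (\<lambda>x. (f x - G m x)^2) \<and> (avg x. (f x - G m x)^2) \<le> s - S m" for m
 proof -
  have D': "(G (r (j + m)) -. G m) \<in> ELp 2" for j by (rule ELp_diff[OF G G]) simp
  have le: "(avg x. (G (r (j + m)) x - G m x)^2) \<le> s - S m" for j
  proof -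
   have "m \<le> r (j + m)" using seq_suble[OF rm, of "j + m"] by simp
   from d[OF this] Ss[of "r (j + m)"] show ?thesis unfolding n2_sq by linarith
  qed
  have "AE x in torus. (\<lambda>j. G (r (j + m)) x - G m x) ~~> f x - G m x"
   using lim by eventually_elim (intro tendsto_diff tendsto_const LIMSEQ_ignore_initial_segment)
  from even_power_Fatou[OF _ ELpD(3)[OF D'] ELpD(4)[OF D'] _ this le]
  show ?thesis using measurable_torus[OF fm] ELpD(3)[OF G] by auto
 qed
 have "(f -. G 0) \<in> ELp 2"
  using fm fp key[of 0] G[of 0] by (auto simp: ELp_def periodic_def)
 from ELp_add[OF this G[of 0]] have f2: "f \<in> ELp 2" by simp
 have "(\<lambda>n. n2 (G n -. f)) ~~> 0"
 proof (rule tendsto_sandwich[OF _ _ tendsto_const])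
  show "\<forall>\<^sub>F n in sequentially. 0 \<le> n2 (G n -. f)" by simp
  show "\<forall>\<^sub>F n in sequentially. n2 (G n -. f) \<le> sqrt (s - S n)"
   unfolding n2_minus_commute[of "G _"] n2_def using key by (intro always_eventually allI real_sqrt_le_mono) blast
  show "(\<lambda>n. sqrt (s - S n)) ~~> 0"
   using tendsto_real_sqrt[OF tendsto_diff[OF tendsto_const s, of s]] by simp
 qed
 with f2 show thesis by (rule that)
qed

lemma tendsto_L2_inner:
 assumes "\<And>n. F n \<in> ELp 2" "f \<in> ELp 2" "(\<lambda>n. n2 (F n -. f)) ~~> 0" "g \<in> ELp 2"
 shows "(\<lambda>n. ip (F n) g) ~~> ip f g"
proof -
 have "(\<lambda>n. ip (F n) g - ip f g) ~~> 0"
 proof (rule Lim_null_comparison)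
  show "(\<lambda>n. n2 (F n -. f) * n2 g) ~~> 0" using tendsto_mult_right[OF assms(3), of "n2 g"] by simp
  show "\<forall>\<^sub>F n in sequentially. norm (ip (F n) g - ip f g) \<le> n2 (F n -. f) * n2 g"
   using L2_inner_le[OF ELp_diff[OF assms(1,2)] assms(4)] by (simp add: L2_inner_diff_left[OF assms(1,2,4)])
 qed
 then show ?thesis by (simp add: LIM_zero_iff)
qed

lemma Riesz_Fischer:
 assumes C: "\<And>N. (\<Sum>k\<in>fbox N. (a k)^2) \<le> C"
 obtains f where "f \<in> \<E>" "\<And>k. k \<in> Z0 ==> ip f (eb k) = a k"
proof -
 let ?G = "\<lambda>N x. \<Sum>k\<in>fbox N. a k * eb k x"
 have G: "?G N \<in> ELp 2" for N by (rule TP_ELp[OF e_sum_TP[OF fbox_finite]])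
 have d: "(n2 (?G n -. ?G m))^2 \<le> (\<Sum>k\<in>fbox n. (a k)^2) - (\<Sum>k\<in>fbox m. (a k)^2)" if mn: "m \<le> n" for m n
 proof -
  have "?G n x - ?G m x = (\<Sum>k\<in>fbox n - fbox m. a k * eb k x)" for x
   using fbox_mono[OF mn] fbox_finite by (simp add: sum_diff)
  then have "(n2 (?G n -. ?G m))^2 = (\<Sum>k\<in>fbox n - fbox m. (a k)^2)"
   using e_sum_norm[of "fbox n - fbox m" a] finite_Diff[OF fbox_finite] order_trans[OF Diff_subset fbox_Z0] by (simp only:)
  then show ?thesis using fbox_mono[OF mn] fbox_finite by (simp add: sum_diff)
 qed
 obtain f where f: "f \<in> ELp 2" "(\<lambda>n. n2 (?G n -. f)) ~~> 0" by (rule L2_complete[OF G d C])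
 have lim: "(\<lambda>n. ip (?G n) g) ~~> ip f g" if "g \<in> ELp 2" for g
  by (rule tendsto_L2_inner[OF G f that])
 \<comment> \<open>Testing with the constant 1 shows that the limit keeps mean zero.\<close>
 have "(\<lambda>n. ip (?G n) (\<lambda>x. 1)) ~~> ip f (\<lambda>x. 1)" by (rule lim[OF ELp_const])
 moreover have "ip (?G n) (\<lambda>x. 1) = 0" for n
  using zero_mean_L2D(2)[OF e_sum_zero_mean[OF fbox_finite fbox_Z0]] by (simp add: L2_inner_def)
 ultimately have "(avg x. f x) = 0" by (simp add: L2_inner_def LIMSEQ_const_iff)
 then have fE: "f \<in> \<E>" using f(1) by (simp add: zero_mean_L2_iff)
 show thesis
 proof (rule that[OF fE])
  fix k assume k: "k \<in> Z0"
  obtain N where N: "{k} \<subseteq> fbox N" using fbox_exhaust[of "{k}"] k by auto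
  have "\<forall>\<^sub>F n in sequentially. ip (?G n) (eb k) = a k"
   using eventually_ge_at_top[of N]
  proof eventually_elim
   case (elim n)
   then have "k \<in> fbox n" using N fbox_mono[OF elim] by auto
   then show ?case by (simp add: L2_inner_e_sum[OF fbox_finite fbox_Z0 k])
  qed
  then have "(\<lambda>n. ip (?G n) (eb k)) ~~> a k" by (rule tendsto_eventually)
  from LIMSEQ_unique[OF lim[OF TP_ELp[OF e_basis_TP]] this] show "ip f (eb k) = a k" .
 qed
qed

section \<open>Weak compactness of bounded sets\<close>

lemma compact_cube: "compact {y :: (int \<times> int) => real. \<forall>k. y k \<in> {- C..C}}"
proof -
 have "compactin (product_topology (\<lambda>k::int \<times> int. euclideanreal) UNIV) (PiE UNIV (\<lambda>k. {- C..C}))"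
  by (subst compactin_PiE) auto
 moreover have "PiE UNIV (\<lambda>k. {- C..C}) = {y :: (int \<times> int) => real. \<forall>k. y k \<in> {- C..C}}" by (auto simp: PiE_def Pi_def)
 ultimately show ?thesis by (simp add: euclidean_product_topology)
qed

text \<open>Tychonoff's theorem makes all Fourier coefficients converge along one subsequence;
  Bessel's bound passes to the limit, and Riesz-Fischer supplies the function with the limiting
  coefficients. Convergence against arbitrary g follows from trigonometric polynomials by mollifying
  g.\<close>

lemma weak_compactness:
 assumes F: "\<And>n. F n \<in> \<E>" and C: "\<And>n. n2 (F n) \<le> C"
 obtains r f where "strict_mono (r :: nat => nat)" "f \<in> \<E>" "n2 f \<le> C"
  "\<And>g. g \<in> ELp 2 ==> (\<lambda>n. ip (F (r n)) g) ~~> ip f g"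
proof -
 note F2 = zero_mean_L2D(1)[OF F]
 have C0: "0 \<le> C" using C[of 0] n2_nonneg[of "F 0"] by linarith
 define y where "y n k = (if k \<in> Z0 then ip (F n) (eb k) else 0)" for n k
 have e1: "n2 (eb k) = 1" if "k \<in> Z0" for k
 proof -
  have "(n2 (eb k))^2 = 1^2" using e_basis_orthonormal[OF that that] by (simp add: L2_inner_self)
  then show ?thesis by (rule power2_eq_imp_eq) simp_all
 qed
 have "\<bar>y n k\<bar> \<le> C" for n k
  using L2_inner_le[OF F2 TP_ELp[OF e_basis_TP], of n k] C[of n] e1[of k] C0 by (auto simp: y_def)
 then have "y n \<in> {y. \<forall>k. y k \<in> {- C..C}}" for n by (simp add: abs_le_iff minus_le_iff)
 then obtain l r where l: "strict_mono (r :: nat => nat)" "(y \<circ> r) ~~> l"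
  using compact_imp_seq_compact[OF compact_cube[of C], unfolded seq_compact_def, rule_format, of y] by blast
 have lk: "(\<lambda>n. y (r n) k) ~~> l k" for k
 proof -
  have "continuous_on UNIV (\<lambda>y :: (int \<times> int) => real. y k)" by (rule continuous_on_product_coordinates)
  from continuous_on_tendsto_compose[OF this l(2)] show ?thesis by simp
 qed
 have S: "(\<Sum>k\<in>fbox N. (l k)^2) \<le> C^2" for N
 proof (rule LIMSEQ_le_const2)
  show "(\<lambda>n. \<Sum>k\<in>fbox N. (y (r n) k)^2) ~~> (\<Sum>k\<in>fbox N. (l k)^2)" by (intro tendsto_intros lk)
  have "(\<Sum>k\<in>fbox N. (y n k)^2) \<le> C^2" for n
  proof -
   have "(\<Sum>k\<in>fbox N. (y n k)^2) = (\<Sum>k\<in>fbox N. (ip (F n) (eb k))^2)"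
    using fbox_Z0 by (intro sum.cong) (auto simp: y_def)
   also have "\<dots> \<le> (n2 (F n))^2" by (rule Bessel[OF fbox_finite fbox_Z0 F2])
   also have "\<dots> \<le> C^2" by (intro power_mono C) simp
   finally show ?thesis .
  qed
  then show "\<exists>N'. \<forall>n\<ge>N'. (\<Sum>k\<in>fbox N. (y (r n) k)^2) \<le> C^2" by blast
 qed
 obtain f where f: "f \<in> \<E>" "\<And>k. k \<in> Z0 ==> ip f (eb k) = l k" by (rule Riesz_Fischer[OF S]) blast
 have fC: "n2 f \<le> C"
 proof (rule n2_le_if_coefs[OF f(1) C0])
  fix N
  have "(\<Sum>k\<in>fbox N. (ip f (eb k))^2) = (\<Sum>k\<in>fbox N. (l k)^2)"
   by (intro sum.cong refl) (simp only: f(2)[OF subsetD[OF fbox_Z0[of N]]])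
  then show "(\<Sum>k\<in>fbox N. (ip f (eb k))^2) \<le> C^2" using S by simp
 qed
 note f2 = zero_mean_L2D(1)[OF f(1)]
 have TPlim: "(\<lambda>n. ip (F (r n)) h) ~~> ip f h" if h: "h \<in> TP" for h
 proof -
  obtain K where K: "finite K" "K \<subseteq> Z0"
   "\<And>g. g \<in> \<E> ==> ip g h = (\<Sum>k\<in>K. ip h (eb k) * ip g (eb k))"
   by (rule TP_inner_expansion[OF h]) blast
  have "(\<lambda>n. \<Sum>k\<in>K. ip h (eb k) * y (r n) k) ~~> (\<Sum>k\<in>K. ip h (eb k) * l k)"
   by (intro tendsto_intros lk)
  moreover have "(\<Sum>k\<in>K. ip h (eb k) * y n k) = ip (F n) h" for n
   unfolding K(3)[OF F] using K(2) by (intro sum.cong) (auto simp: y_def)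
  moreover have "(\<Sum>k\<in>K. ip h (eb k) * l k) = ip f h"
   unfolding K(3)[OF f(1)] by (intro sum.cong refl) (simp only: f(2)[OF subsetD[OF K(2)]])
  ultimately show ?thesis by simp
 qed
 show thesis
 proof (rule that[OF l(1) f(1) fC])
  fix g assume g: "g \<in> ELp 2"
  show "(\<lambda>n. ip (F (r n)) g) ~~> ip f g"
  proof (rule LIMSEQ_I)
   fix \<epsilon> :: real assume e: "0 < \<epsilon>"
   \<comment> \<open>With this \<delta> each of the two replacement errors C \<delta> is at most
     \<epsilon>/4.\<close>
   let ?\<delta> = "\<epsilon> / (2 * (2 * C + 1))"
   have \<delta>: "0 < ?\<delta>" using e C0 by simp
   from order_tendstoD(2)[OF conv_ker_n2[OF g] \<delta>] obtain m where m: "n2 (conv (ker m) g -. g) < ?\<delta>"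
    by (auto simp: eventually_sequentially)
   let ?h = "conv (ker m) g"
   have h: "?h \<in> TP" by (rule conv_TP[OF ker_TP ELp2_integrable[OF g]])
   note h2 = TP_ELp[OF h, of 2]
   from LIMSEQ_D[OF TPlim[OF h], of "\<epsilon> / 2"] e obtain N where
    N: "\<And>n. N \<le> n ==> \<bar>ip (F (r n)) ?h - ip f ?h\<bar> < \<epsilon> / 2" by auto
   have b: "\<bar>ip u g - ip u ?h\<bar> \<le> C * ?\<delta>" if u: "u \<in> \<E>" "n2 u \<le> C" for u
   proof -
    note u2 = zero_mean_L2D(1)[OF u(1)]
    have "ip u ?h - ip u g = ip (?h -. g) u"
     unfolding L2_inner_commute[of u] by (rule L2_inner_diff_left[symmetric, OF h2 g u2])
    then have "\<bar>ip u g - ip u ?h\<bar> \<le> n2 (?h -. g) * n2 u"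
     using L2_inner_le[OF ELp_diff[OF h2 g] u2] by (simp add: abs_minus_commute)
    also have "\<dots> \<le> ?\<delta> * C" using m u less_imp_le[OF \<delta>] by (intro mult_mono) (simp_all only: n2_nonneg less_imp_le)
    finally show ?thesis by (simp add: mult.commute)
   qed
   show "\<exists>no. \<forall>n\<ge>no. norm (ip (F (r n)) g - ip f g) < \<epsilon>"
   proof (intro exI[of _ N] allI impI)
    fix n assume "N \<le> n"
    have "\<bar>ip (F (r n)) g - ip f g\<bar> < C * ?\<delta> + \<epsilon> / 2 + C * ?\<delta>"
     using N[OF \<open>N \<le> n\<close>] b[OF F C, of "r n"] b[OF f(1) fC] by linarith
    also have "C * ?\<delta> + \<epsilon> / 2 + C * ?\<delta> \<le> \<epsilon>"
    proof -
     have "C * ?\<delta> \<le> \<epsilon> / 4"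
      unfolding times_divide_eq_right by (subst pos_divide_le_eq) (use C0 e in \<open>auto simp: algebra_simps\<close>)
     then show ?thesis by linarith
    qed
    finally show "norm (ip (F (r n)) g - ip f g) < \<epsilon>" by simp
   qed
  qed
 qed
qed

section \<open>Functions with square integrable gradient\<close>

text \<open>H^1 is encoded by uniform bounds on the gradients of the Fourier projections. Weak
  derivatives are avoided, and estimates are proved for trigonometric polynomials and passed to the
  limit.\<close>

definition H1_bound :: "tfun => real => bool" where
 "H1_bound u C \<longleftrightarrow> u \<in> \<E> \<and> 0 \<le> C \<and> n2 u \<le> C \<and>
   (\<forall>N. n2 (pd1 (PK (fbox N) u)) \<le> C \<and> n2 (pd2 (PK (fbox N) u)) \<le> C)"

text \<open>The values at s and t differ by at most the integral of |G'| between them; this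
  comparison is averaged over t.\<close>

lemma C1_le_average:
 fixes G G' :: "real => real"
 assumes d: "\<And>t. (G has_real_derivative G' t) (at t)" and c: "continuous_on UNIV G'" and s: "0 \<le> s" "s < 1"
 shows "G s \<le> (\<integral>t. G t \<partial>circ) + (\<integral>t. \<bar>G' t\<bar> \<partial>circ)"
proof -
 let ?L = "(\<integral>t. \<bar>G' t\<bar> \<partial>circ)"
 have cG: "continuous_on UNIV G"
  by (rule DERIV_continuous_on) (use d in \<open>auto intro: has_field_derivative_at_within\<close>)
 have iG: "integrable circ G" by (rule integrable_circ_continuous[OF cG])
 have iG': "integrable circ (\<lambda>t. \<bar>G' t\<bar>)" by (rule integrable_circ_continuous) (intro continuous_intros c)
 have le: "\<bar>G b - G a\<bar> \<le> ?L" if ab: "0 \<le> a" "a \<le> b" "b < 1" for a b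
 proof -
  have hb: "has_bochner_integral lborel (\<lambda>x. G' x * indicator {a..b} x) (G b - G a)"
   by (rule has_bochner_integral_FTC_Icc_real) (use d c ab in \<open>simp_all add: continuous_on_eq_continuous_at\<close>)
  then have i: "integrable lborel (\<lambda>x. G' x * indicator {a..b} x)" and e: "(\<integral>x. G' x * indicator {a..b} x \<partial>lborel) = G b - G a"
   by (auto simp: has_bochner_integral_iff)
  have i2: "integrable lborel (\<lambda>x. indicator {0..<1} x *\<^sub>R \<bar>G' x\<bar>)"
   using iG' unfolding circ_def by (subst (asm) integrable_restrict_space) (auto simp: set_integrable_def)
  have "\<bar>G b - G a\<bar> \<le> (\<integral>x. \<bar>G' x * indicator {a..b} x\<bar> \<partial>lborel)"
   unfolding e[symmetric] by (rule integral_abs_bound)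
  also have "\<dots> \<le> (\<integral>x. indicator {0..<1} x *\<^sub>R \<bar>G' x\<bar> \<partial>lborel)"
   by (rule integral_mono[OF integrable_abs[OF i] i2]) (use ab in \<open>auto simp: indicator_def\<close>)
  also have "\<dots> = ?L" unfolding circ_def by (subst integral_restrict_space) auto
  finally show ?thesis .
 qed
 have "G s = (\<integral>t. G s \<partial>circ)" by (simp add: circ.prob_space)
 also have "\<dots> \<le> (\<integral>t. G t + ?L \<partial>circ)"
 proof (rule integral_mono)
  fix t assume "t \<in> space circ"
  then have t: "0 \<le> t" "t < 1" by (auto simp: space_circ)
  have "\<bar>G s - G t\<bar> \<le> ?L"
   using le[of t s] le[of s t] t s by (cases "t \<le> s") (auto simp: abs_minus_commute)
  then show "G s \<le> G t + ?L" by linarith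
 qed (use iG in auto)
 also have "\<dots> = (\<integral>t. G t \<partial>circ) + ?L" using iG by (simp add: circ.prob_space)
 finally show ?thesis .
qed

lemma gradient_sections:
 assumes g: "gradient f f1 f2"
 shows "((\<lambda>s. f (s, t)) has_real_derivative f1 (s, t)) (at s)" "((\<lambda>t. f (s, t)) has_real_derivative f2 (s, t)) (at t)"
proof -
 have "((\<lambda>s. (s, t)) has_derivative (\<lambda>h. (h, 0))) (at s)" by (auto intro!: derivative_eq_intros)
 from has_derivative_compose[OF this gradientD[OF g]]
 show "((\<lambda>s. f (s, t)) has_real_derivative f1 (s, t)) (at s)" by (simp add: has_field_derivative_def mult.commute[of _ "f1 _"])
 have "((\<lambda>t. (s, t)) has_derivative (\<lambda>h. (0, h))) (at t)" by (auto intro!: derivative_eq_intros)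
 from has_derivative_compose[OF this gradientD[OF g]]
 show "((\<lambda>t. f (s, t)) has_real_derivative f2 (s, t)) (at t)" by (simp add: has_field_derivative_def mult.commute[of _ "f2 _"])
qed

text \<open>On each line parallel to an axis the square of f is bounded by its average plus the
  integral of its absolute derivative. The two bounds depend on one coordinate each, so the integral
  of their product, which dominates f^4, factorises.\<close>

lemma Ladyzhenskaya:
 assumes f: "f \<in> TP"
 shows "(avg x. f x ^ 4) \<le> ((n2 f)^2 + 2 * (n2 f * n2 (pd1 f))) * ((n2 f)^2 + 2 * (n2 f * n2 (pd2 f)))"
proof -
 note g = TP_gradient[OF f]
 note T = f TP_pd1[OF f] TP_pd2[OF f]
 note c = TP_continuous[OF f] TP_continuous[OF T(2)] TP_continuous[OF T(3)]
 let ?a = "\<lambda>x. (f x)^2 + 2 * \<bar>f x * pd1 f x\<bar>" and ?b = "\<lambda>x. (f x)^2 + 2 * \<bar>f x * pd2 f x\<bar>"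
 have ca: "continuous_on UNIV ?a" "continuous_on UNIV ?b" by (intro continuous_intros c)+
 note i = integrable_torus_continuous[OF ca(1)] integrable_torus_continuous[OF ca(2)]
 have i': "integrable (circ \<Otimes>\<^sub>M circ) (\<lambda>(s, t). ?a (s, t))" "integrable (circ \<Otimes>\<^sub>M circ) (\<lambda>(s, t). ?b (s, t))"
  using i by (simp_all add: torus_eq case_prod_beta')
 define A where "A t = (\<integral>s. ?a (s, t) \<partial>circ)" for t
 define B where "B s = (\<integral>t. ?b (s, t) \<partial>circ)" for s
 have iA: "integrable circ A" and iB: "integrable circ B"
  unfolding A_def[abs_def] B_def[abs_def] using circ2.integrable_snd[OF i'(1)] circ2.integrable_fst[OF i'(2)] by auto
 have IA: "(\<integral>t. A t \<partial>circ) = (avg x. ?a x)" and IB: "(\<integral>s. B s \<partial>circ) = (avg x. ?b x)"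
  unfolding A_def B_def using circ2.integral_snd[OF i'(1)] circ2.integral_fst[OF i'(2)] by (simp_all add: torus_eq case_prod_beta')
 have A0: "0 \<le> A t" "0 \<le> B s" for s t unfolding A_def B_def by (intro integral_nonneg_AE AE_I2; simp)+
 have sqA: "(f (s, t))^2 \<le> A t" if s: "0 \<le> s" "s < 1" for s t
 proof -
  have d: "((\<lambda>s. (f (s, t))^2) has_real_derivative 2 * (f (s, t) * pd1 f (s, t))) (at s)" for s
   using DERIV_power[OF gradient_sections(1)[OF g], where n=2] by (simp add: mult_ac)
  have cc: "continuous_on UNIV (\<lambda>s. 2 * (f (s, t) * pd1 f (s, t)))"
   by (intro continuous_intros continuous_on_compose2[OF c(1)] continuous_on_compose2[OF c(2)]) auto
  have ci: "continuous_on UNIV (\<lambda>s. (f (s, t))^2)" "continuous_on UNIV (\<lambda>s. \<bar>2 * (f (s, t) * pd1 f (s, t))\<bar>)"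
   by (intro continuous_intros continuous_on_compose2[OF c(1)] continuous_on_compose2[OF c(2)]; auto)+
  show ?thesis using C1_le_average[OF d cc s] integrable_circ_continuous[OF ci(1)] integrable_circ_continuous[OF ci(2)]
   by (simp add: A_def abs_mult)
 qed
 have sqB: "(f (s, t))^2 \<le> B s" if t: "0 \<le> t" "t < 1" for s t
 proof -
  have d: "((\<lambda>t. (f (s, t))^2) has_real_derivative 2 * (f (s, t) * pd2 f (s, t))) (at t)" for t
   using DERIV_power[OF gradient_sections(2)[OF g], where n=2] by (simp add: mult_ac)
  have cc: "continuous_on UNIV (\<lambda>t. 2 * (f (s, t) * pd2 f (s, t)))"
   by (intro continuous_intros continuous_on_compose2[OF c(1)] continuous_on_compose2[OF c(3)]) auto
  have ci: "continuous_on UNIV (\<lambda>t. (f (s, t))^2)" "continuous_on UNIV (\<lambda>t. \<bar>2 * (f (s, t) * pd2 f (s, t))\<bar>)"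
   by (intro continuous_intros continuous_on_compose2[OF c(1)] continuous_on_compose2[OF c(3)]; auto)+
  show ?thesis using C1_le_average[OF d cc t] integrable_circ_continuous[OF ci(1)] integrable_circ_continuous[OF ci(2)]
   by (simp add: B_def abs_mult)
 qed
 have mAB: "(\<lambda>z. B (fst z) * A (snd z)) \<in> borel_measurable (circ \<Otimes>\<^sub>M circ)"
  using iA iB by (intro borel_measurable_times measurable_compose[OF measurable_fst] measurable_compose[OF measurable_snd]) auto
 have iAB: "integrable (circ \<Otimes>\<^sub>M circ) (\<lambda>z. B (fst z) * A (snd z))"
  using circ2.Fubini_integrable[of "\<lambda>(s, t). B s * A t"] mAB iA iB A0 by (simp add: case_prod_beta' abs_mult)
 have "(avg x. f x ^ 4) \<le> (avg x. B (fst x) * A (snd x))"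
 proof (rule integral_mono)
  show "integrable torus (\<lambda>x. f x ^ 4)" by (rule TP_integrable[OF TP_power[OF f]])
  show "integrable torus (\<lambda>x. B (fst x) * A (snd x))" using iAB by (simp add: torus_eq)
  fix x assume "x \<in> space torus"
  then have "0 \<le> fst x" "fst x < 1" "0 \<le> snd x" "snd x < 1" by (auto simp: space_torus)
  then have "(f x)^2 * (f x)^2 \<le> B (fst x) * A (snd x)"
   using sqA[of "fst x" "snd x"] sqB[of "snd x" "fst x"] A0 by (intro mult_mono) auto
  then show "f x ^ 4 \<le> B (fst x) * A (snd x)" by (simp add: power2_eq_square power4_eq_xxxx mult.assoc)
 qed
 also have "\<dots> = (\<integral>s. B s \<partial>circ) * (\<integral>t. A t \<partial>circ)"
  unfolding torus_eq using circ2.integral_fst'[OF iAB] by simp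
 also have "\<dots> \<le> ((n2 f)^2 + 2 * (n2 f * n2 (pd2 f))) * ((n2 f)^2 + 2 * (n2 f * n2 (pd1 f)))"
 proof (rule mult_mono)
  have e: "(avg x. (f x)^2 + 2 * \<bar>f x * h x\<bar>) \<le> (n2 f)^2 + 2 * (n2 f * n2 h)" if h: "h \<in> TP" for h
   using L1_mult_le[OF TP_ELp[OF f] TP_ELp[OF h]] TP_integrable[OF TP_power[OF f, of 2]] TP_integrable[OF TP_mult[OF f h]]
   by (simp add: n2_sq)
  show "(\<integral>s. B s \<partial>circ) \<le> (n2 f)^2 + 2 * (n2 f * n2 (pd2 f))" unfolding IB by (rule e[OF T(3)])
  show "(\<integral>t. A t \<partial>circ) \<le> (n2 f)^2 + 2 * (n2 f * n2 (pd1 f))" unfolding IA by (rule e[OF T(2)])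
  show "0 \<le> (\<integral>t. A t \<partial>circ)" by (intro integral_nonneg_AE AE_I2 A0)
 qed simp
 finally show ?thesis by (simp add: mult.commute)
qed

lemma PK_n2_le: "finite K ==> K \<subseteq> Z0 ==> f \<in> ELp 2 ==> n2 (PK K f) \<le> n2 f"
 by (rule power2_le_imp_le) (simp_all add: PK_n2 Bessel)

lemma PK_tendsto': "f \<in> \<E> ==> (\<lambda>N. n2 (PK (fbox N) f -. f)) ~~> 0"
 using PK_tendsto[of f] by (simp add: n2_minus_commute)

text \<open>In two dimensions a square integrable gradient gives L^4. This makes the product of the
  velocity with the gradient of a test function from W^{1,4} square integrable.\<close>

lemma H1_bound_ELp4: assumes "H1_bound u C" shows "u \<in> ELp 4"
proof -
 have u: "u \<in> \<E>" "0 \<le> C" "n2 u \<le> C" "\<And>N. n2 (pd1 (PK (fbox N) u)) \<le> C" "\<And>N. n2 (pd2 (PK (fbox N) u)) \<le> C"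
  using assms by (auto simp: H1_bound_def)
 note u2 = zero_mean_L2D(1)[OF u(1)]
 note P = PK_TP[OF fbox_finite, of _ u]
 have Pn: "n2 (PK (fbox N) u) \<le> C" for N
  using PK_n2_le[OF fbox_finite fbox_Z0 u2, of N] u(3) by linarith
 have "(avg x. PK (fbox N) u x ^ 4) \<le> (C^2 + 2 * (C * C)) * (C^2 + 2 * (C * C))" for N
 proof (rule order_trans[OF Ladyzhenskaya[OF P]])
  show "((n2 (PK (fbox N) u))^2 + 2 * (n2 (PK (fbox N) u) * n2 (pd1 (PK (fbox N) u)))) *
   ((n2 (PK (fbox N) u))^2 + 2 * (n2 (PK (fbox N) u) * n2 (pd2 (PK (fbox N) u)))) \<le> (C^2 + 2 * (C * C)) * (C^2 + 2 * (C * C))"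
   by (intro mult_mono add_mono power_mono mult_left_mono Pn u(2,4,5)) (auto intro!: add_nonneg_nonneg mult_nonneg_nonneg u(2))
 qed
 from ELp_Fatou_subseq(1)[OF TP_ELp[OF P] u2 PK_tendsto'[OF u(1)] _ TP_ELp[OF P] this] show ?thesis by simp
qed

lemma ELp_shift: "f \<in> ELp p ==> (\<lambda>x. f (x + z)) \<in> ELp p"
proof -
 assume f: "f \<in> ELp p"
 have m: "(\<lambda>x. f x ^ p) \<in> borel_measurable borel" using ELpD(1)[OF f] by simp
 have p: "periodic (\<lambda>x. f x ^ p)" using ELpD(2)[OF f] by (rule periodic_comp)
 have "periodic (\<lambda>x. f (x + z))"
  unfolding periodic_def
 proof (intro allI)
  fix x :: plane and m n :: int
  show "f (x + (of_int m, of_int n) + z) = f (x + z)"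
   using periodicD[OF ELpD(2)[OF f], of "x + z" m n] by (simp add: add_ac)
 qed
 moreover have "(\<lambda>x. f (x + z)) \<in> borel_measurable borel"
  by (rule measurable_compose[OF _ ELpD(1)[OF f]]) simp
 ultimately show ?thesis by (intro ELpI integrable_torus_shift[OF m p ELpD(4)[OF f]])
qed

lemma n2_shift: "f \<in> ELp 2 ==> n2 (\<lambda>x. f (x + z)) = n2 f"
proof -
 assume f: "f \<in> ELp 2"
 have m: "(\<lambda>x. (f x)^2) \<in> borel_measurable borel" using ELpD(1)[OF f] by simp
 have p: "periodic (\<lambda>x. (f x)^2)" using ELpD(2)[OF f] by (rule periodic_comp)
 show ?thesis unfolding n2_def using integral_torus_shift[OF m p ELpD(4)[OF f]] by simp
qed

interpretation tc: pair_prob_space torus circ ..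

text \<open>The shift is reduced modulo the lattice to w. The difference f (x + w) - f x is the
  integral of a directional derivative along the segment; Jensen, Fubini and translation invariance
  bound its L^2 norm by that of the derivative.\<close>

lemma TP_translation:
 assumes f: "f \<in> TP" and C: "n2 (pd1 f) \<le> C" "n2 (pd2 f) \<le> C"
 shows "n2 (\<lambda>x. f (x + z) - f x) \<le> sabs z * C"
proof -
 obtain m n w where z: "z = w + (of_int m, of_int n)" and w: "\<bar>fst w\<bar> + \<bar>snd w\<bar> \<le> sabs z" by (rule reduce_mod_lattice)
 have fz: "f (x + z) = f (x + w)" for x
  using periodicD[OF TP_periodic[OF f], of "x + w" m n] by (simp add: z add.assoc)
 define D where "D x = fst w * pd1 f x + snd w * pd2 f x" for x
 have D: "D \<in> TP" unfolding D_def[abs_def] by (intro TP.intros TP_pd1 TP_pd2 f)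
 have C0: "0 \<le> C" using C(1) n2_nonneg[of "pd1 f"] by linarith
 have nD: "n2 D \<le> sabs z * C"
 proof -
  have "n2 D \<le> n2 (\<lambda>x. fst w * pd1 f x) + n2 (\<lambda>x. snd w * pd2 f x)"
   unfolding D_def[abs_def] by (intro n2_triangle TP_ELp TP.scale TP_pd1 TP_pd2 f)
  also have "\<dots> \<le> \<bar>fst w\<bar> * C + \<bar>snd w\<bar> * C" unfolding n2_cmult by (intro add_mono mult_left_mono C) auto
  also have "\<dots> \<le> sabs z * C" using mult_right_mono[OF w C0] by (simp add: distrib_right)
  finally show ?thesis .
 qed
 have pt: "(f (x + w) - f x)^2 \<le> (\<integral>\<theta>. (D (x + \<theta> *\<^sub>R w))^2 \<partial>circ)" for x
 proof -
  have d: "((\<lambda>\<theta>. f (x + \<theta> *\<^sub>R w)) has_real_derivative D (x + \<theta> *\<^sub>R w)) (at \<theta>)" for \<theta>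
  proof -
   have "((\<lambda>\<theta>. x + \<theta> *\<^sub>R w) has_derivative (\<lambda>h. h *\<^sub>R w)) (at \<theta>)" by (auto intro!: derivative_eq_intros)
   from has_derivative_compose[OF this gradientD[OF TP_gradient[OF f]]]
   show ?thesis by (rule has_derivative_imp_has_field_derivative) (simp add: D_def algebra_simps)
  qed
  have c: "continuous_on UNIV (\<lambda>\<theta>. D (x + \<theta> *\<^sub>R w))"
   by (rule continuous_on_compose2[OF TP_continuous[OF D]]) (auto intro!: continuous_intros)
  have "f (x + w) - f x = (\<integral>\<theta>. D (x + \<theta> *\<^sub>R w) \<partial>circ)"
   using integral_circ_derivative[OF d c] by simp
  then show ?thesis
   using circ.power_expectation_le[of "\<lambda>\<theta>. D (x + \<theta> *\<^sub>R w)" 2] measurable_circ[OF borel_measurable_continuous_onI[OF c]]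
    integrable_circ_continuous[OF continuous_on_power[OF c, of 2]] by simp
 qed
 have D2: "(\<lambda>x. (D x)^2) \<in> TP" by (rule TP_power[OF D])
 obtain B where B: "\<And>x. \<bar>(D x)^2\<bar> \<le> B" using TP_bounded[OF D2] by blast
 have mp: "(\<lambda>q. (D (fst q + snd q *\<^sub>R w))^2) \<in> borel_measurable (torus \<Otimes>\<^sub>M circ)"
 proof (rule measurable_compose[OF _ TP_measurable[OF D2]])
  show "(\<lambda>q. fst q + snd q *\<^sub>R w) \<in> measurable (torus \<Otimes>\<^sub>M circ) borel"
   by (intro borel_measurable_add borel_measurable_scaleR measurable_compose[OF measurable_fst id_torus] measurable_compose[OF measurable_snd id_circ]) simp
 qed
 have ip: "integrable (torus \<Otimes>\<^sub>M circ) (\<lambda>q. (D (fst q + snd q *\<^sub>R w))^2)"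
  by (rule integrable_bounded_by[OF _ mp, of "\<lambda>q. B"]) (use B in auto)
 have ip': "integrable (torus \<Otimes>\<^sub>M circ) (\<lambda>(x, \<theta>). (D (x + \<theta> *\<^sub>R w))^2)"
  using ip by (simp add: case_prod_beta')
 have inn: "(avg x. (D (x + v))^2) = (n2 D)^2" for v
  unfolding n2_sq using integral_torus_shift[OF TP_measurable[OF D2] TP_periodic[OF D2] TP_integrable[OF D2]] .
 have dT: "(\<lambda>x. f (x + w) - f x) \<in> ELp 2" by (rule ELp_diff[OF ELp_shift[OF TP_ELp[OF f]] TP_ELp[OF f]]) simp
 have "(n2 (\<lambda>x. f (x + w) - f x))^2 \<le> (avg x. (\<integral>\<theta>. (D (x + \<theta> *\<^sub>R w))^2 \<partial>circ))"
  unfolding n2_sq by (rule integral_mono[OF ELpD(4)[OF dT] tc.integrable_fst[OF ip'] pt])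
 also have "\<dots> = (\<integral>\<theta>. (avg x. (D (x + \<theta> *\<^sub>R w))^2) \<partial>circ)"
  by (rule tc.Fubini_integral[OF ip', symmetric])
 also have "\<dots> = (n2 D)^2" by (simp add: inn circ.prob_space)
 finally have "n2 (\<lambda>x. f (x + w) - f x) \<le> n2 D" by (rule power2_le_imp_le) simp
 then show ?thesis using nD by (simp add: fz)
qed

lemma H1_bound_translation:
 assumes "H1_bound u C" shows "n2 (\<lambda>x. u (x + z) - u x) \<le> sabs z * C"
proof (rule LIMSEQ_le_const)
 have u: "u \<in> \<E>" "\<And>N. n2 (pd1 (PK (fbox N) u)) \<le> C" "\<And>N. n2 (pd2 (PK (fbox N) u)) \<le> C"
  using assms by (auto simp: H1_bound_def)
 note u2 = zero_mean_L2D(1)[OF u(1)]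
 let ?P = "\<lambda>N. PK (fbox N) u"
 have P: "?P N \<in> TP" for N by (rule PK_TP[OF fbox_finite])
 have "(\<lambda>N. n2 (u -. ?P N) + sabs z * C + n2 (u -. ?P N)) ~~> 0 + sabs z * C + 0"
  by (intro tendsto_intros PK_tendsto u)
 then show "(\<lambda>N. n2 (u -. ?P N) + sabs z * C + n2 (u -. ?P N)) ~~> sabs z * C" by simp
 show "\<exists>N. \<forall>n\<ge>N. n2 (\<lambda>x. u (x + z) - u x) \<le> n2 (u -. ?P n) + sabs z * C + n2 (u -. ?P n)"
 proof (intro exI[of _ 0] allI impI)
  fix N
  have d: "(u -. ?P N) \<in> ELp 2" by (rule ELp_diff[OF u2 TP_ELp[OF P]]) simp
  have t: "(\<lambda>x. ?P N (x + z) - ?P N x) \<in> ELp 2" by (rule ELp_diff[OF ELp_shift[OF TP_ELp[OF P]] TP_ELp[OF P]]) simp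
  have "n2 (\<lambda>x. ((u (x + z) - ?P N (x + z)) + (?P N (x + z) - ?P N x)) - (u x - ?P N x))
   \<le> n2 (\<lambda>x. (u (x + z) - ?P N (x + z)) + (?P N (x + z) - ?P N x)) + n2 (u -. ?P N)"
   by (rule n2_diff[OF ELp_add[OF ELp_shift[OF d] t] d]) simp
  also have "\<dots> \<le> (n2 (\<lambda>x. u (x + z) - ?P N (x + z)) + n2 (\<lambda>x. ?P N (x + z) - ?P N x)) + n2 (u -. ?P N)"
   by (rule add_right_mono[OF n2_triangle[OF ELp_shift[OF d] t]])
  also have "\<dots> \<le> n2 (u -. ?P N) + sabs z * C + n2 (u -. ?P N)"
   using n2_shift[OF d, of z] TP_translation[OF P u(2,3), of N z] by simp
  finally show "n2 (\<lambda>x. u (x + z) - u x) \<le> n2 (u -. ?P N) + sabs z * C + n2 (u -. ?P N)"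
   by simp
 qed
qed

section \<open>The Biot--Savart operator\<close>

definition nk :: "int \<times> int => real" where "nk k = (of_int (fst k))^2 + (of_int (snd k))^2"

lemma nk_ge_1: assumes "k \<in> Z0" shows "1 \<le> nk k"
proof -
 have "0 < (fst k)^2 + (snd k)^2" using assms by (cases k) (auto simp: Z0_def sum_power2_gt_zero_iff)
 then have "1 \<le> (fst k)^2 + (snd k)^2" by linarith
 then have "real_of_int 1 \<le> real_of_int ((fst k)^2 + (snd k)^2)" by (simp only: of_int_le_iff)
 then show ?thesis by (simp add: nk_def)
qed

text \<open>The Fourier coefficients of the velocity, solved from the divergence and curl equations
  tested with the mode -k (see \<open>bs_coefs\<close>). The opposite index arises because
  differentiation maps the mode k to -k.\<close>

definition bsc1 :: "tfun => int \<times> int => real" where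
 "bsc1 \<xi> k = - of_int (snd k) * ip \<xi> (eb (- k)) / (2 * pi * nk k)"

definition bsc2 :: "tfun => int \<times> int => real" where
 "bsc2 \<xi> k = of_int (fst k) * ip \<xi> (eb (- k)) / (2 * pi * nk k)"

lemma bsc_le:
 assumes k: "k \<in> Z0"
 shows "(2 * pi)^2 * nk k * (bsc1 \<xi> k)^2 \<le> (ip \<xi> (eb (- k)))^2"
  "(2 * pi)^2 * nk k * (bsc2 \<xi> k)^2 \<le> (ip \<xi> (eb (- k)))^2"
proof -
 have n: "1 \<le> nk k" by (rule nk_ge_1[OF k])
 have *: "(2 * pi)^2 * nk k * (a * y / (2 * pi * nk k))^2 \<le> y^2" if "a^2 \<le> nk k" for a y :: real
 proof -
  have "(2 * pi)^2 * nk k * (a * y / (2 * pi * nk k))^2 = (a^2 / nk k) * y^2"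
   using n by (simp add: power2_eq_square field_simps)
  also have "\<dots> \<le> 1 * y^2" using that n by (intro mult_right_mono) auto
  finally show ?thesis by simp
 qed
 show "(2 * pi)^2 * nk k * (bsc1 \<xi> k)^2 \<le> (ip \<xi> (eb (- k)))^2"
  unfolding bsc1_def by (rule *) (simp add: nk_def)
 show "(2 * pi)^2 * nk k * (bsc2 \<xi> k)^2 \<le> (ip \<xi> (eb (- k)))^2"
  unfolding bsc2_def by (rule *) (simp add: nk_def)
qed

lemma fbox_reflect: "(\<Sum>k\<in>fbox N. g (- k)) = (\<Sum>k\<in>fbox N. g k)" for g :: "int \<times> int => 'a::comm_monoid_add"
 by (rule sum.reindex_bij_witness[of _ uminus uminus]) (auto simp: fbox_minus)

lemma Bessel_reflect:
 assumes "f \<in> ELp 2" and le: "\<And>k. k \<in> Z0 ==> c k \<le> (ip f (eb (- k)))^2"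
 shows "(\<Sum>k\<in>fbox N. c k) \<le> (n2 f)^2"
proof -
 have "(\<Sum>k\<in>fbox N. c k) \<le> (\<Sum>k\<in>fbox N. (ip f (eb (- k)))^2)"
  by (intro sum_mono le subsetD[OF fbox_Z0])
 also have "\<dots> = (\<Sum>k\<in>fbox N. (ip f (eb k))^2)"
  by (rule fbox_reflect[where g="\<lambda>k. (ip f (eb k))^2"])
 also have "\<dots> \<le> (n2 f)^2" by (rule Bessel[OF fbox_finite fbox_Z0 assms(1)])
 finally show ?thesis .
qed

lemma pd_e_sum:
 assumes K: "finite K" "K \<subseteq> Z0"
 shows "pd1 (fsum K a) = (\<lambda>x. \<Sum>k\<in>K. (2 * pi * of_int (fst k) * a k) * eb (- k) x)"
  "pd2 (fsum K a) = (\<lambda>x. \<Sum>k\<in>K. (2 * pi * of_int (snd k) * a k) * eb (- k) x)"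
proof -
 have "(\<lambda>x. a k * eb k x) \<in> TP" for k by (intro TP.scale e_basis_TP)
 from pd_sum[OF K(1), of "\<lambda>k x. a k * eb k x", OF this]
 show "pd1 (fsum K a) = (\<lambda>x. \<Sum>k\<in>K. (2 * pi * of_int (fst k) * a k) * eb (- k) x)"
  "pd2 (fsum K a) = (\<lambda>x. \<Sum>k\<in>K. (2 * pi * of_int (snd k) * a k) * eb (- k) x)"
  using K(2) by (auto intro!: sum.cong simp: pd_scale e_basis_gradient subset_iff fun_eq_iff)
qed

lemma fbox_e_sum_reflect: "(\<lambda>x. \<Sum>k\<in>fbox N. a k * eb (- k) x) = (\<lambda>x. \<Sum>k\<in>fbox N. a (- k) * eb k x)"
 using fbox_reflect[where g="\<lambda>k. a (- k) * eb k _"] by simp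

text \<open>The hypothesis says that u gains one derivative over f. Since \<open>nk\<close> is at
  least 1, it bounds u itself as well, so one constant serves for the function and its
  gradient.\<close>

lemma H1_boundI:
 assumes u: "u \<in> \<E>" and f: "f \<in> ELp 2"
  and le: "\<And>k. k \<in> Z0 ==> (2 * pi)^2 * nk k * (ip u (eb k))^2 \<le> (ip f (eb (- k)))^2"
 shows "H1_bound u (n2 f)"
 unfolding H1_bound_def
proof (intro conjI allI u n2_nonneg)
 have p: "1 \<le> (2 * pi)^2" using one_le_power[of "2 * pi" 2] pi_ge_two by simp
 show "n2 u \<le> n2 f"
 proof (rule n2_le_if_coefs[OF u n2_nonneg Bessel_reflect[OF f]])
  fix k assume k: "k \<in> Z0"
  have "1 * (ip u (eb k))^2 \<le> (2 * pi)^2 * nk k * (ip u (eb k))^2"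
   using mult_mono[OF p nk_ge_1[OF k]] by (intro mult_right_mono) auto
  then show "(ip u (eb k))^2 \<le> (ip f (eb (- k)))^2" using le[OF k] by simp
 qed
 fix N
 have a: "(2 * pi * of_int c * y)^2 \<le> (2 * pi)^2 * nk k * y^2" if "(of_int c)^2 \<le> nk k" for c k y
  using that by (simp add: power_mult_distrib mult_left_mono mult_right_mono)
 show "n2 (pd1 (PK (fbox N) u)) \<le> n2 f"
 proof (rule power2_le_imp_le)
  show "(n2 (pd1 (PK (fbox N) u)))^2 \<le> (n2 f)^2"
   unfolding PK_def[abs_def] pd_e_sum[OF fbox_finite fbox_Z0] fbox_e_sum_reflect e_sum_norm[OF fbox_finite fbox_Z0]
    fbox_reflect[where g="\<lambda>k. (2 * pi * of_int (fst k) * ip u (eb k))^2"]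
   by (rule Bessel_reflect[OF f order_trans[OF a le]]) (auto simp: nk_def)
 qed simp
 show "n2 (pd2 (PK (fbox N) u)) \<le> n2 f"
 proof (rule power2_le_imp_le)
  show "(n2 (pd2 (PK (fbox N) u)))^2 \<le> (n2 f)^2"
   unfolding PK_def[abs_def] pd_e_sum[OF fbox_finite fbox_Z0] fbox_e_sum_reflect e_sum_norm[OF fbox_finite fbox_Z0]
    fbox_reflect[where g="\<lambda>k. (2 * pi * of_int (snd k) * ip u (eb k))^2"]
   by (rule Bessel_reflect[OF f order_trans[OF a le]]) (auto simp: nk_def)
 qed simp
qed

text \<open>The derivative at a lattice translate of x is also a derivative at x, and derivatives
  are unique.\<close>

lemma gradient_periodic:
 assumes g: "gradient f g1 g2" and p: "periodic f" shows "periodic g1" "periodic g2"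
proof -
 have s: "gradient f (\<lambda>x. g1 (x + v)) (\<lambda>x. g2 (x + v))" if v: "\<And>x. f (x + v) = f x" for v
  unfolding gradient_def
 proof
  fix x
  have "((\<lambda>x. x + v) has_derivative (\<lambda>h. h)) (at x)" by (auto intro!: derivative_eq_intros)
  from has_derivative_compose[OF this gradientD[OF g]]
  show "(f has_derivative (\<lambda>h. fst h * g1 (x + v) + snd h * g2 (x + v))) (at x)" by (simp add: v)
 qed
 have "g1 (x + (of_int m, of_int n)) = g1 x" for x m n
  using gradient_pd(1)[OF s[OF periodicD[OF p, of _ m n]], THEN fun_cong, of x] unfolding gradient_pd(1)[OF g] ..
 then show "periodic g1" by (simp add: periodic_def)
 have "g2 (x + (of_int m, of_int n)) = g2 x" for x m n
  using gradient_pd(2)[OF s[OF periodicD[OF p, of _ m n]], THEN fun_cong, of x] unfolding gradient_pd(2)[OF g] ..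
 then show "periodic g2" by (simp add: periodic_def)
qed

lemma test_function_ELp:
 assumes "test_function \<phi>" shows "\<phi> \<in> ELp p" "pd1 \<phi> \<in> ELp p" "pd2 \<phi> \<in> ELp p"
proof -
 note g = test_function_gradient[OF assms]
 have p: "periodic \<phi>" using assms by (simp add: test_function_def)
 have e: "f \<in> ELp p" if "continuous_on UNIV f" "periodic f" for f
  by (rule ELpI[OF borel_measurable_continuous_onI[OF that(1)] that(2) integrable_torus_continuous[OF continuous_on_power[OF that(1)]]])
 show "\<phi> \<in> ELp p" "pd1 \<phi> \<in> ELp p" "pd2 \<phi> \<in> ELp p"
  using g p gradient_periodic[OF g(1) p] by (auto intro: e)
qed

lemma is_biot_savart_iff:
 assumes u: "(\<lambda>x. fst (u x)) \<in> \<E>" "(\<lambda>x. snd (u x)) \<in> \<E>" and \<phi>: "test_function \<phi>"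
 shows "(avg x. fst (u x) * fst (grad \<phi> x) + snd (u x) * snd (grad \<phi> x))
   = ip (\<lambda>x. fst (u x)) (pd1 \<phi>) + ip (\<lambda>x. snd (u x)) (pd2 \<phi>)"
  "(avg x. snd (u x) * fst (grad \<phi> x) - fst (u x) * snd (grad \<phi> x))
   = ip (\<lambda>x. snd (u x)) (pd1 \<phi>) - ip (\<lambda>x. fst (u x)) (pd2 \<phi>)"
proof -
 note i = integrable_ELp2_mult[OF zero_mean_L2D(1)[OF u(1)]] integrable_ELp2_mult[OF zero_mean_L2D(1)[OF u(2)]]
 note t = test_function_ELp[OF \<phi>, of 2]
 show "(avg x. fst (u x) * fst (grad \<phi> x) + snd (u x) * snd (grad \<phi> x))
   = ip (\<lambda>x. fst (u x)) (pd1 \<phi>) + ip (\<lambda>x. snd (u x)) (pd2 \<phi>)"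
  "(avg x. snd (u x) * fst (grad \<phi> x) - fst (u x) * snd (grad \<phi> x))
   = ip (\<lambda>x. snd (u x)) (pd1 \<phi>) - ip (\<lambda>x. fst (u x)) (pd2 \<phi>)"
  unfolding L2_inner_def pd1_def[symmetric] pd2_def[symmetric] using i t by simp_all
qed

text \<open>The truncated series satisfy the divergence equation exactly and the curl equation with
  the projection of \<xi>. After integration by parts all derivatives rest on the test function, so
  L^2 convergence suffices for the limit.\<close>

lemma biot_savart_exists:
 assumes \<xi>: "\<xi> \<in> \<E>" shows "\<exists>u. is_biot_savart \<xi> u"
proof -
 note \<xi>2 = zero_mean_L2D(1)[OF \<xi>]
 have le: "a^2 \<le> y" if "(2 * pi)^2 * nk k * a^2 \<le> y" "k \<in> Z0" for a y k
 proof -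
  have "1 \<le> (2 * pi)^2" using one_le_power[of "2 * pi" 2] pi_ge_two by simp
  then have "1 * a^2 \<le> (2 * pi)^2 * nk k * a^2" using mult_mono[OF _ nk_ge_1[OF that(2)], of 1 "(2*pi)^2"] by (intro mult_right_mono) auto
  then show ?thesis using that(1) by simp
 qed
 obtain u1 where u1: "u1 \<in> \<E>" "\<And>k. k \<in> Z0 ==> ip u1 (eb k) = bsc1 \<xi> k"
  by (rule Riesz_Fischer[OF Bessel_reflect[OF \<xi>2 le[OF bsc_le(1)]]]) blast+
 obtain u2 where u2: "u2 \<in> \<E>" "\<And>k. k \<in> Z0 ==> ip u2 (eb k) = bsc2 \<xi> k"
  by (rule Riesz_Fischer[OF Bessel_reflect[OF \<xi>2 le[OF bsc_le(2)]]]) blast+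
 let ?u = "\<lambda>x. (u1 x, u2 x)"
 have "is_biot_savart \<xi> ?u"
  unfolding is_biot_savart_def
 proof (intro conjI allI impI)
  show E: "(\<lambda>x. fst (?u x)) \<in> \<E>" "(\<lambda>x. snd (?u x)) \<in> \<E>" using u1 u2 by simp_all
  fix \<phi> assume \<phi>: "test_function \<phi>"
  note t = test_function_ELp[OF \<phi>, of 2]
  let ?P = "\<lambda>N f. PK (fbox N) f"
  have T: "?P N f \<in> TP" for N f by (rule PK_TP[OF fbox_finite])
  have lim: "(\<lambda>N. ip (?P N f) g) ~~> ip f g" if "f \<in> \<E>" "g \<in> ELp 2" for f g
   by (rule tendsto_L2_inner[OF TP_ELp[OF T] zero_mean_L2D(1)[OF that(1)] PK_tendsto'[OF that(1)] that(2)])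
  have P1: "?P N u1 = (\<lambda>x. \<Sum>k\<in>fbox N. bsc1 \<xi> k * eb k x)" and P2: "?P N u2 = (\<lambda>x. \<Sum>k\<in>fbox N. bsc2 \<xi> k * eb k x)" for N
   unfolding PK_def[abs_def] using u1(2)[OF subsetD[OF fbox_Z0]] u2(2)[OF subsetD[OF fbox_Z0]] by (auto intro!: sum.cong)
  have div: "pd1 (?P N u1) x + pd2 (?P N u2) x = 0" for N x
   unfolding P1 P2 pd_e_sum[OF fbox_finite fbox_Z0] sum.distrib[symmetric]
   by (rule sum.neutral) (auto simp: bsc1_def bsc2_def field_simps)
  have curl: "pd1 (?P N u2) x - pd2 (?P N u1) x = ?P N \<xi> x" for N x
  proof -
   have "pd1 (?P N u2) x - pd2 (?P N u1) x = (\<Sum>k\<in>fbox N. ip \<xi> (eb (- k)) * eb (- k) x)"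
    unfolding P1 P2 pd_e_sum[OF fbox_finite fbox_Z0] sum_subtractf[symmetric]
   proof (intro sum.cong refl)
    fix k assume "k \<in> fbox N"
    then have n: "1 \<le> nk k" by (rule nk_ge_1[OF subsetD[OF fbox_Z0]])
    have "2 * pi * of_int (fst k) * bsc2 \<xi> k - 2 * pi * of_int (snd k) * bsc1 \<xi> k
     = ((of_int (fst k))^2 + (of_int (snd k))^2) * ip \<xi> (eb (- k)) / nk k"
     unfolding bsc1_def bsc2_def using n by (simp add: field_simps power2_eq_square)
    also have "\<dots> = ip \<xi> (eb (- k))" using n by (simp flip: nk_def)
    finally show "2 * pi * of_int (fst k) * bsc2 \<xi> k * eb (- k) x - 2 * pi * of_int (snd k) * bsc1 \<xi> k * eb (- k) x
      = ip \<xi> (eb (- k)) * eb (- k) x" by (simp only: left_diff_distrib[symmetric])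
   qed
   also have "\<dots> = ?P N \<xi> x" unfolding PK_def by (rule fbox_reflect)
   finally show ?thesis .
  qed
  have "(\<lambda>N. ip (?P N u1) (pd1 \<phi>) + ip (?P N u2) (pd2 \<phi>)) ~~> ip u1 (pd1 \<phi>) + ip u2 (pd2 \<phi>)"
   by (intro tendsto_add lim u1 u2 t)
  moreover have "ip (?P N u1) (pd1 \<phi>) + ip (?P N u2) (pd2 \<phi>) = 0" for N
  proof -
   have "ip (pd1 (?P N u1)) \<phi> + ip (pd2 (?P N u2)) \<phi> = ip (\<lambda>x. pd1 (?P N u1) x + pd2 (?P N u2) x) \<phi>"
    by (intro L2_inner_add_left[symmetric] TP_ELp TP_pd1 TP_pd2 T t)
   also have "\<dots> = 0" unfolding div by (simp add: L2_inner_def)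
   finally show ?thesis unfolding integration_by_parts[OF T \<phi>] by linarith
  qed
  ultimately have "ip u1 (pd1 \<phi>) + ip u2 (pd2 \<phi>) = 0" by (simp add: LIMSEQ_const_iff)
  then show "(avg x. fst (?u x) * fst (grad \<phi> x) + snd (?u x) * snd (grad \<phi> x)) = 0"
   unfolding is_biot_savart_iff[OF E \<phi>] by simp
  have "(\<lambda>N. ip (?P N u2) (pd1 \<phi>) - ip (?P N u1) (pd2 \<phi>)) ~~> ip u2 (pd1 \<phi>) - ip u1 (pd2 \<phi>)"
   by (intro tendsto_diff lim u1 u2 t)
  moreover have "ip (?P N u2) (pd1 \<phi>) - ip (?P N u1) (pd2 \<phi>) = - ip (?P N \<xi>) \<phi>" for N
  proof -
   have "ip (pd1 (?P N u2)) \<phi> - ip (pd2 (?P N u1)) \<phi> = ip (pd1 (?P N u2) -. pd2 (?P N u1)) \<phi>"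
    by (intro L2_inner_diff_left[symmetric] TP_ELp TP_pd1 TP_pd2 T t)
   also have "\<dots> = ip (?P N \<xi>) \<phi>" unfolding curl ..
   finally show ?thesis unfolding integration_by_parts[OF T \<phi>] by linarith
  qed
  ultimately have "(\<lambda>N. - ip (?P N \<xi>) \<phi>) ~~> ip u2 (pd1 \<phi>) - ip u1 (pd2 \<phi>)" by simp
  from LIMSEQ_unique[OF this tendsto_minus[OF lim[OF \<xi> t(1)]]]
  show "- (avg x. snd (?u x) * fst (grad \<phi> x) - fst (?u x) * snd (grad \<phi> x)) = ip \<xi> \<phi>"
   unfolding is_biot_savart_iff[OF E \<phi>] by simp
 qed
 then show ?thesis by blast
qed

definition bs1 :: "tfun => tfun" where "bs1 \<xi> x = fst (biot_savart \<xi> x)"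
definition bs2 :: "tfun => tfun" where "bs2 \<xi> x = snd (biot_savart \<xi> x)"

context
 fixes \<xi> assumes \<xi>: "\<xi> \<in> \<E>"
begin

lemma is_biot_savart: "is_biot_savart \<xi> (biot_savart \<xi>)"
 unfolding biot_savart_def using biot_savart_exists[OF \<xi>] by (rule someI_ex)

lemma bs_zero_mean: "bs1 \<xi> \<in> \<E>" "bs2 \<xi> \<in> \<E>"
 using is_biot_savart unfolding is_biot_savart_def bs1_def[abs_def] bs2_def[abs_def] by blast+

lemma bs_div:
 assumes "\<phi> \<in> TP" shows "ip (bs1 \<xi>) (pd1 \<phi>) + ip (bs2 \<xi>) (pd2 \<phi>) = 0"
proof -
 have "(avg x. fst (biot_savart \<xi> x) * fst (grad \<phi> x) + snd (biot_savart \<xi> x) * snd (grad \<phi> x)) = 0"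
  using is_biot_savart TP_test[OF assms] unfolding is_biot_savart_def by blast
 then show ?thesis
  unfolding is_biot_savart_iff(1)[OF bs_zero_mean[unfolded bs1_def[abs_def] bs2_def[abs_def]] TP_test[OF assms]]
   bs1_def[abs_def] bs2_def[abs_def] .
qed

lemma bs_curl:
 assumes "\<phi> \<in> TP" shows "ip (bs2 \<xi>) (pd1 \<phi>) - ip (bs1 \<xi>) (pd2 \<phi>) = - ip \<xi> \<phi>"
proof -
 have "- (avg x. snd (biot_savart \<xi> x) * fst (grad \<phi> x) - fst (biot_savart \<xi> x) * snd (grad \<phi> x)) = ip \<xi> \<phi>"
  using is_biot_savart TP_test[OF assms] unfolding is_biot_savart_def by blast
 then show ?thesis
  unfolding is_biot_savart_iff(2)[OF bs_zero_mean[unfolded bs1_def[abs_def] bs2_def[abs_def]] TP_test[OF assms]]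
   bs1_def[abs_def] bs2_def[abs_def] by linarith
qed

text \<open>Testing with \<open>eb (- k)\<close> gives two linear equations for the two
  coefficients, with determinant proportional to \<open>nk k\<close>. The coefficients are thus the
  same for every admissible choice of the velocity.\<close>

lemma bs_coefs:
 assumes k: "k \<in> Z0"
 shows "ip (bs1 \<xi>) (eb k) = bsc1 \<xi> k" "ip (bs2 \<xi>) (eb k) = bsc2 \<xi> k"
proof -
 let ?a = "ip (bs1 \<xi>) (eb k)" and ?b = "ip (bs2 \<xi>) (eb k)" and ?x = "ip \<xi> (eb (- k))"
 let ?p = "real_of_int (fst k)" and ?q = "real_of_int (snd k)"
 have mk: "- k \<in> Z0" using k by (simp add: minus_Z0)
 have r: "ip f (\<lambda>x. c * g x) = c * ip f g" for f g c
  unfolding L2_inner_commute[of f] by (rule L2_inner_cmult_left)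
 have 1: "?p * ?a + ?q * ?b = 0"
 proof -
  have "2 * pi * (- ?p) * ?a + 2 * pi * (- ?q) * ?b = 0"
   using bs_div[OF e_basis_TP[of "- k"]] unfolding e_basis_gradient[OF mk] r
   by (simp only: fst_uminus snd_uminus of_int_minus minus_minus)
  then have "2 * pi * (?p * ?a + ?q * ?b) = 0" by algebra
  then show ?thesis by simp
 qed
 have 2: "2 * pi * (?p * ?b - ?q * ?a) = ?x"
 proof -
  have "2 * pi * (- ?p) * ?b - 2 * pi * (- ?q) * ?a = - ?x"
   using bs_curl[OF e_basis_TP[of "- k"]] unfolding e_basis_gradient[OF mk] r
   by (simp only: fst_uminus snd_uminus of_int_minus minus_minus)
  then show ?thesis by algebra
 qed
 have n: "1 \<le> nk k" by (rule nk_ge_1[OF k])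
 have "2 * pi * nk k * ?a = - ?q * (2 * pi * (?p * ?b - ?q * ?a)) + 2 * pi * ?p * (?p * ?a + ?q * ?b)"
  by (simp add: nk_def power2_eq_square algebra_simps)
 then have "2 * pi * nk k * ?a = - ?q * ?x" unfolding 1 2 by simp
 moreover have "2 * pi * nk k \<noteq> 0" using n by simp
 ultimately show "?a = bsc1 \<xi> k" unfolding bsc1_def by (simp only: eq_divide_eq if_True not_False_eq_True mult.commute)
 have "2 * pi * nk k * ?b = ?p * (2 * pi * (?p * ?b - ?q * ?a)) + 2 * pi * ?q * (?p * ?a + ?q * ?b)"
  by (simp add: nk_def power2_eq_square algebra_simps)
 then have "2 * pi * nk k * ?b = ?p * ?x" unfolding 1 2 by simp
 moreover have "2 * pi * nk k \<noteq> 0" using n by simp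
 ultimately show "?b = bsc2 \<xi> k" unfolding bsc2_def by (simp only: eq_divide_eq if_True not_False_eq_True mult.commute)
qed

lemma bs_H1: "H1_bound (bs1 \<xi>) (n2 \<xi>)" "H1_bound (bs2 \<xi>) (n2 \<xi>)"
 by (rule H1_boundI[OF bs_zero_mean(1) zero_mean_L2D(1)[OF \<xi>]], simp only: bs_coefs bsc_le)
   (rule H1_boundI[OF bs_zero_mean(2) zero_mean_L2D(1)[OF \<xi>]], simp only: bs_coefs bsc_le)

lemma bs_ELp4: "bs1 \<xi> \<in> ELp 4" "bs2 \<xi> \<in> ELp 4"
 by (rule H1_bound_ELp4[OF bs_H1(1)], rule H1_bound_ELp4[OF bs_H1(2)])

lemma bs_ELp2: "bs1 \<xi> \<in> ELp 2" "bs2 \<xi> \<in> ELp 2"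
 by (rule zero_mean_L2D(1)[OF bs_zero_mean(1)], rule zero_mean_L2D(1)[OF bs_zero_mean(2)])

end

text \<open>\<open>biot_savart\<close> is a choice of representatives and not literally linear, but
  its Fourier coefficients are linear in the vorticity; the estimate is read off from them.\<close>

lemma bs_diff_n2:
 assumes \<xi>: "\<xi> \<in> \<E>" and \<zeta>: "\<zeta> \<in> \<E>"
 shows "n2 (bs1 \<xi> -. bs1 \<zeta>) \<le> n2 (\<xi> -. \<zeta>)" "n2 (bs2 \<xi> -. bs2 \<zeta>) \<le> n2 (\<xi> -. \<zeta>)"
proof -
 let ?d = "\<lambda>x. \<xi> x - \<zeta> x"
 have d: "?d \<in> \<E>" by (rule zero_mean_diff[OF \<xi> \<zeta>])
 note E = TP_ELp[OF e_basis_TP]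
 have dc: "ip ?d (eb j) = ip \<xi> (eb j) - ip \<zeta> (eb j)" for j
  by (intro L2_inner_diff_left zero_mean_L2D \<xi> \<zeta> E)
 have c: "bsc1 \<xi> k - bsc1 \<zeta> k = bsc1 ?d k" "bsc2 \<xi> k - bsc2 \<zeta> k = bsc2 ?d k" for k
  unfolding bsc1_def bsc2_def dc by (simp_all add: diff_divide_distrib algebra_simps)
 have "H1_bound (bs1 \<xi> -. bs1 \<zeta>) (n2 ?d)"
 proof (rule H1_boundI[OF zero_mean_diff[OF bs_zero_mean(1)[OF \<xi>] bs_zero_mean(1)[OF \<zeta>]] zero_mean_L2D(1)[OF d]])
  fix k assume k: "k \<in> Z0"
  show "(2 * pi)^2 * nk k * (ip (bs1 \<xi> -. bs1 \<zeta>) (eb k))^2 \<le> (ip ?d (eb (- k)))^2"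
   unfolding L2_inner_diff_left[OF bs_ELp2(1)[OF \<xi>] bs_ELp2(1)[OF \<zeta>] E] bs_coefs[OF \<xi> k] bs_coefs[OF \<zeta> k] c by (rule bsc_le[OF k])
 qed
 then show "n2 (bs1 \<xi> -. bs1 \<zeta>) \<le> n2 ?d" by (simp add: H1_bound_def)
 have "H1_bound (bs2 \<xi> -. bs2 \<zeta>) (n2 ?d)"
 proof (rule H1_boundI[OF zero_mean_diff[OF bs_zero_mean(2)[OF \<xi>] bs_zero_mean(2)[OF \<zeta>]] zero_mean_L2D(1)[OF d]])
  fix k assume k: "k \<in> Z0"
  show "(2 * pi)^2 * nk k * (ip (bs2 \<xi> -. bs2 \<zeta>) (eb k))^2 \<le> (ip ?d (eb (- k)))^2"
   unfolding L2_inner_diff_left[OF bs_ELp2(2)[OF \<xi>] bs_ELp2(2)[OF \<zeta>] E] bs_coefs[OF \<xi> k] bs_coefs[OF \<zeta> k] c by (rule bsc_le[OF k])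
 qed
 then show "n2 (bs2 \<xi> -. bs2 \<zeta>) \<le> n2 ?d" by (simp add: H1_bound_def)
qed

section \<open>Renormalization of the transport equation\<close>

lemma measurable_add_torus:
 "f \<in> borel_measurable borel ==> (\<lambda>q. f (fst q + snd q)) \<in> borel_measurable torus2"
 by (rule measurable_compose[OF borel_measurable_add[OF measurable_compose[OF measurable_fst id_torus] measurable_compose[OF measurable_snd id_torus]]])

lemma measurable_fst_torus: "f \<in> borel_measurable borel ==> (\<lambda>q. f (fst q)) \<in> borel_measurable torus2"
 by (rule measurable_compose[OF measurable_fst measurable_torus])

lemma measurable_snd_torus: "f \<in> borel_measurable borel ==> (\<lambda>q. f (snd q)) \<in> borel_measurable torus2"
 by (rule measurable_compose[OF measurable_snd measurable_torus])

lemma ELp_TP_mult: "W \<in> TP ==> f \<in> ELp p ==> even p ==> (\<lambda>x. W x * f x) \<in> ELp p"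
proof -
 assume W: "W \<in> TP" and f: "f \<in> ELp p" and p: "even p"
 obtain B where B: "\<forall>x. \<bar>W x\<bar> \<le> B" using TP_bounded[OF W] by blast
 show ?thesis by (rule ELp_mult_bounded[OF f p TP_measurable[OF W] TP_periodic[OF W], of B]) (use B in blast)
qed

lemma ELp2_mult_TP: "f \<in> ELp 2 ==> W \<in> TP ==> (\<lambda>x. f x * W x) \<in> ELp 2"
 using ELp_TP_mult[of W f 2] by (simp add: mult.commute)

text \<open>The difference is the integral of (u x - u y) W (x - y) \<eta> y over y. After the
  substitution x = y + z the translation estimate for u contributes \<open>sabs z\<close>, exactly
  the weight under which the gradient of the kernel stays bounded in L^1.\<close>

lemma commutator_component:
 assumes u: "u \<in> ELp 2" and \<eta>: "\<eta> \<in> ELp 2" and W: "W \<in> TP" and C: "\<And>z. n2 (\<lambda>x. u (x + z) - u x) \<le> sabs z * C"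
 shows "(avg x. \<bar>u x * conv W \<eta> x - conv W (\<lambda>y. u y * \<eta> y) x\<bar>) \<le> (avg z. \<bar>W z\<bar> * sabs z) * C * n2 \<eta>"
proof -
 have iu: "integrable torus (\<lambda>y. u y * \<eta> y)" by (rule integrable_ELp2_mult[OF u \<eta>])
 let ?c = "\<lambda>x. u x * conv W \<eta> x - conv W (\<lambda>y. u y * \<eta> y) x"
 have ic: "integrable torus ?c"
  by (intro Bochner_Integration.integrable_diff integrable_ELp2_mult[OF u] TP_ELp TP_integrable conv_TP[OF W] iu ELp2_integrable[OF \<eta>])
 \<comment> \<open>Values in \<open>ennreal\<close> allow both exchanges of integration without
   integrability on the product space.\<close>
 define G where "G x y = ennreal (\<bar>u x - u y\<bar> * \<bar>W (x - y)\<bar> * \<bar>\<eta> y\<bar>)" for x y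
 note m = ELpD(1)[OF u] ELpD(1)[OF \<eta>] TP_measurable[OF W]
 have mG: "(\<lambda>(x, y). G x y) \<in> borel_measurable torus2"
  unfolding G_def case_prod_beta'
  by (intro measurable_compose[OF _ measurable_ennreal] borel_measurable_times borel_measurable_abs borel_measurable_diff
     measurable_fst_torus measurable_snd_torus m measurable_diff_torus[unfolded case_prod_beta'])
 have mG2: "(\<lambda>(y, z). G (y + z) y) \<in> borel_measurable torus2"
  unfolding G_def case_prod_beta' add_diff_cancel_left'
  by (intro measurable_compose[OF _ measurable_ennreal] borel_measurable_times borel_measurable_abs borel_measurable_diff
     measurable_fst_torus measurable_snd_torus measurable_add_torus m)
 have cs: "continuous_on UNIV sabs" unfolding sabs_def[abs_def] by (intro continuous_intros)
 have iW: "integrable torus (\<lambda>z. \<bar>W z\<bar> * sabs z)"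
  by (rule integrable_torus_continuous) (intro continuous_intros TP_continuous W cs)
 have C0: "0 \<le> sabs z * C" for z by (rule order_trans[OF n2_nonneg C])
 have "ennreal (avg x. \<bar>?c x\<bar>) = (navg x. ennreal \<bar>?c x\<bar>)"
  using ic by (intro nn_integral_eq_integral[symmetric]) auto
 also have "\<dots> \<le> (navg x. (navg y. G x y))"
 proof (rule nn_integral_mono)
  fix x
  have i1: "integrable torus (\<lambda>y. W (x - y) * \<eta> y)" "integrable torus (\<lambda>y. W (x - y) * (u y * \<eta> y))"
   by (intro integrable_conv W ELp2_integrable[OF \<eta>] iu)+
  have "?c x = (avg y. u x * (W (x - y) * \<eta> y) - W (x - y) * (u y * \<eta> y))"
   unfolding conv_def using i1 by simp
  also have "\<dots> = (avg y. (u x - u y) * W (x - y) * \<eta> y)"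
   by (intro bochner_cong) (auto simp: algebra_simps)
  finally have e: "?c x = (avg y. (u x - u y) * W (x - y) * \<eta> y)" .
  have "integrable torus (\<lambda>y. u x * (W (x - y) * \<eta> y) - W (x - y) * (u y * \<eta> y))" using i1 by simp
  then have i: "integrable torus (\<lambda>y. (u x - u y) * W (x - y) * \<eta> y)" by (simp add: algebra_simps)
  have "ennreal (norm (avg y. (u x - u y) * W (x - y) * \<eta> y)) \<le> (navg y. ennreal (norm ((u x - u y) * W (x - y) * \<eta> y)))"
   by (rule integral_norm_bound_ennreal[OF i])
  then show "ennreal \<bar>?c x\<bar> \<le> (navg y. G x y)" unfolding e G_def by (simp add: abs_mult)
 qed
 also have "\<dots> = (navg y. (navg x. G x y))" by (rule torus2.Fubini'[OF mG, symmetric])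
 also have "\<dots> = (navg y. (navg z. G (y + z) y))"
 proof (rule nn_integral_cong)
  fix y
  have "(\<lambda>x. G x y) \<in> borel_measurable borel"
   unfolding G_def by (intro measurable_compose[OF _ measurable_ennreal] borel_measurable_times borel_measurable_abs borel_measurable_diff m measurable_compose[OF _ m(3)]) auto
  moreover have "periodic (\<lambda>x. G x y)"
   unfolding periodic_def
  proof (intro allI)
   fix x :: plane and k l :: int
   have "u (x + (of_int k, of_int l)) = u x" by (rule periodicD[OF ELpD(2)[OF u]])
   moreover have "W (x + (of_int k, of_int l) - y) = W (x - y)"
    using periodicD[OF TP_periodic[OF W], of "x - y" k l] by (simp add: algebra_simps)
   ultimately show "G (x + (of_int k, of_int l)) y = G x y" unfolding G_def by (simp only:)
  qed
  ultimately show "(navg x. G x y) = (navg z. G (y + z) y)"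
   using nn_integral_torus_shift[of "\<lambda>x. G x y" y] by (simp add: add.commute)
 qed
 also have "\<dots> = (navg z. (navg y. G (y + z) y))"
  by (rule torus2.Fubini'[OF mG2, symmetric])
 also have "\<dots> \<le> (navg z. ennreal (\<bar>W z\<bar> * sabs z * (C * n2 \<eta>)))"
 proof (rule nn_integral_mono)
  fix z
  have d: "(\<lambda>y. u (y + z) - u y) \<in> ELp 2" by (rule ELp_diff[OF ELp_shift[OF u] u]) simp
  have "(navg y. G (y + z) y) = (navg y. ennreal (\<bar>W z\<bar> * \<bar>(u (y + z) - u y) * \<eta> y\<bar>))"
   unfolding G_def by (intro nn_integral_cong) (simp add: abs_mult mult_ac)
  also have "\<dots> = ennreal (avg y. \<bar>W z\<bar> * \<bar>(u (y + z) - u y) * \<eta> y\<bar>)"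
   using integrable_ELp2_mult[OF d \<eta>] by (intro nn_integral_eq_integral) auto
  also have "\<dots> \<le> ennreal (\<bar>W z\<bar> * (sabs z * C * n2 \<eta>))"
  proof (rule ennreal_leI)
   have "(avg y. \<bar>(u (y + z) - u y) * \<eta> y\<bar>) \<le> n2 (\<lambda>y. u (y + z) - u y) * n2 \<eta>" by (rule L1_mult_le[OF d \<eta>])
   also have "\<dots> \<le> sabs z * C * n2 \<eta>" by (intro mult_right_mono C) simp
   finally show "(avg y. \<bar>W z\<bar> * \<bar>(u (y + z) - u y) * \<eta> y\<bar>) \<le> \<bar>W z\<bar> * (sabs z * C * n2 \<eta>)"
    by (simp add: mult_left_mono)
  qed
  finally show "(navg y. G (y + z) y) \<le> ennreal (\<bar>W z\<bar> * sabs z * (C * n2 \<eta>))" by (simp add: mult.assoc)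
 qed
 also have "\<dots> = ennreal (avg z. \<bar>W z\<bar> * sabs z * (C * n2 \<eta>))"
 proof (rule nn_integral_eq_integral)
  show "integrable torus (\<lambda>z. \<bar>W z\<bar> * sabs z * (C * n2 \<eta>))" using iW by simp
  have "0 \<le> \<bar>W z\<bar> * (sabs z * C) * n2 \<eta>" for z by (intro mult_nonneg_nonneg C0) auto
  then show "AE z in torus. 0 \<le> \<bar>W z\<bar> * sabs z * (C * n2 \<eta>)" by (simp add: mult.assoc)
 qed
 also have "(avg z. \<bar>W z\<bar> * sabs z * (C * n2 \<eta>)) = (avg z. \<bar>W z\<bar> * sabs z) * C * n2 \<eta>"
  by simp
 finally have "ennreal (avg x. \<bar>?c x\<bar>) \<le> ennreal ((avg z. \<bar>W z\<bar> * sabs z) * C * n2 \<eta>)" .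
 moreover have "0 \<le> (avg z. \<bar>W z\<bar> * sabs z) * C * n2 \<eta>"
 proof -
  have "0 \<le> (avg z. \<bar>W z\<bar> * (sabs z * C))"
   by (intro integral_nonneg_AE AE_I2 mult_nonneg_nonneg C0) simp
  then show ?thesis by (simp add: mult.assoc[symmetric])
 qed
 ultimately show ?thesis by (simp add: ennreal_le_iff)
qed

text \<open>What is used of a Biot-Savart velocity: a square integrable gradient and vanishing
  divergence against trigonometric polynomials. A fixed velocity makes the step equation
  linear.\<close>

locale vfield =
 fixes u1 u2 :: "tfun" and C :: real
 assumes H1: "H1_bound u1 C" "H1_bound u2 C"
  and div_free: "\<And>\<phi>. \<phi> \<in> TP ==> ip u1 (pd1 \<phi>) + ip u2 (pd2 \<phi>) = 0"
begin

lemma u_zero_mean: "u1 \<in> \<E>" "u2 \<in> \<E>" using H1 by (auto simp: H1_bound_def)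

lemma u_ELp2: "u1 \<in> ELp 2" "u2 \<in> ELp 2" by (intro zero_mean_L2D u_zero_mean)+

definition adv :: "tfun => tfun" where
 "adv \<phi> x = u1 x * pd1 \<phi> x + u2 x * pd2 \<phi> x"

lemma adv_ELp2: "\<phi> \<in> TP ==> adv \<phi> \<in> ELp 2"
 unfolding adv_def[abs_def] by (intro ELp_add ELp2_mult_TP u_ELp2 TP_pd1 TP_pd2) simp_all

lemma integral_adv: "\<phi> \<in> TP ==> (avg x. adv \<phi> x) = 0"
proof -
 assume f: "\<phi> \<in> TP"
 note i = integrable_ELp2_mult[OF u_ELp2(1) TP_ELp[OF TP_pd1[OF f]]] integrable_ELp2_mult[OF u_ELp2(2) TP_ELp[OF TP_pd2[OF f]]]
 show ?thesis using div_free[OF f] i unfolding adv_def L2_inner_def by simp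
qed

lemma adv_mult: "f \<in> TP ==> g \<in> TP ==> adv (\<lambda>x. f x * g x) x = adv f x * g x + f x * adv g x"
 unfolding adv_def by (simp add: pd_mult algebra_simps)

text \<open>The advection of the product f g has mean zero. Skewness is what makes the Galerkin
  system solvable for every step size.\<close>

lemma adv_antisym:
 assumes f: "f \<in> TP" and g: "g \<in> TP" shows "ip (adv f) g = - ip (adv g) f"
proof -
 have "(avg x. adv f x * g x + f x * adv g x) = 0"
  using integral_adv[OF TP_mult[OF f g]] by (simp add: adv_mult[OF f g])
 then show ?thesis
  using integrable_ELp2_mult[OF adv_ELp2[OF f] TP_ELp[OF g]] integrable_ELp2_mult[OF TP_ELp[OF f] adv_ELp2[OF g]]
  by (simp add: L2_inner_def mult.commute)
qed

lemma adv_add: "f \<in> TP ==> g \<in> TP ==> adv (\<lambda>x. f x + g x) x = adv f x + adv g x"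
 unfolding adv_def by (simp add: pd_add algebra_simps)

lemma adv_scale: "f \<in> TP ==> adv (\<lambda>x. c * f x) x = c * adv f x"
 unfolding adv_def by (simp add: pd_scale algebra_simps)

lemma adv_const: "adv (\<lambda>x. c) x = 0" unfolding adv_def by (simp add: pd_const)

lemma adv_sum: "finite K ==> (\<And>k. k \<in> K ==> f k \<in> TP) ==> adv (\<lambda>x. \<Sum>k\<in>K. f k x) x = (\<Sum>k\<in>K. adv (f k) x)"
proof (induction K rule: finite_induct)
 case (insert k K)
 then have "(\<lambda>x. \<Sum>k\<in>K. f k x) \<in> TP" by (intro TP_sum) auto
 with insert show ?case by (simp add: adv_add)
qed (simp add: adv_const)

lemma adv_power: "f \<in> TP ==> adv (\<lambda>x. f x ^ Suc m) x = real (Suc m) * (f x ^ m * adv f x)"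
proof (induction m)
 case (Suc m)
 have "adv (\<lambda>x. f x ^ Suc (Suc m)) x = adv f x * f x ^ Suc m + f x * adv (\<lambda>x. f x ^ Suc m) x"
  using adv_mult[OF Suc.prems TP_power[OF Suc.prems, of "Suc m"]] by simp
 also have "\<dots> = real (Suc (Suc m)) * (f x ^ Suc m * adv f x)"
  unfolding Suc.IH[OF Suc.prems] by (simp add: algebra_simps)
 finally show ?case .
qed simp

text \<open>The integrand is formally the advection of a primitive of g composed with f, but that
  composition is in general no trigonometric polynomial. Powers are covered by
  \<open>adv_power\<close>; Weierstrass approximation on the bounded range of f extends the identity
  to continuous g.\<close>

lemma integral_continuous_adv:
 assumes f: "f \<in> TP" and g: "continuous_on UNIV g"
 shows "(avg x. g (f x) * adv f x) = 0"
proof -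
 obtain B where B: "\<And>x. \<bar>f x\<bar> \<le> B" using TP_bounded[OF f] by blast
 note ia = ELp2_integrable[OF adv_ELp2[OF f]]
 have gc: "continuous_on {-B..B} g" by (rule continuous_on_subset[OF g]) simp
 obtain D where D: "\<And>s. s \<in> {-B..B} ==> \<bar>g s\<bar> \<le> D"
  using compact_imp_bounded[OF compact_continuous_image[OF gc compact_Icc]] unfolding bounded_iff by (metis imageI real_norm_def)
 have gm: "(\<lambda>x. g (f x)) \<in> borel_measurable torus"
  by (rule measurable_torus[OF measurable_compose[OF TP_measurable[OF f] borel_measurable_continuous_onI[OF g]]])
 have ig: "integrable torus (\<lambda>x. g (f x) * adv f x)"
 proof (rule integrable_bounded_by)
  show "integrable torus (\<lambda>x. D * \<bar>adv f x\<bar>)" using ia by simp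
  show "(\<lambda>x. g (f x) * adv f x) \<in> borel_measurable torus" using gm ELpD(3)[OF adv_ELp2[OF f]] by simp
  have "\<bar>g (f x)\<bar> \<le> D" for x using B[of x] by (intro D) auto
  then show "\<bar>g (f x) * adv f x\<bar> \<le> D * \<bar>adv f x\<bar>" for x unfolding abs_mult by (intro mult_right_mono) auto
 qed
 have z: "(avg x. f x ^ m * adv f x) = 0" "integrable torus (\<lambda>x. f x ^ m * adv f x)" for m
 proof -
  show "integrable torus (\<lambda>x. f x ^ m * adv f x)" by (rule integrable_TP_mult[OF TP_power[OF f] ia])
  show "(avg x. f x ^ m * adv f x) = 0"
   using integral_adv[OF TP_power[OF f, of "Suc m"]] unfolding adv_power[OF f] by simp
 qed
 have le: "\<bar>(avg x. g (f x) * adv f x)\<bar> \<le> e * (avg x. \<bar>adv f x\<bar>)" if e: "0 < e" for e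
 proof -
  obtain P where P: "real_polynomial_function P" "\<And>s. s \<in> {-B..B} ==> \<bar>g s - P s\<bar> < e"
   using Stone_Weierstrass_real_polynomial_function[OF compact_Icc gc e] by blast
  obtain c n where P': "P = (\<lambda>x. \<Sum>i\<le>n. c i * x ^ i)" using P(1) unfolding real_polynomial_function_iff_sum by blast
  have Pe: "P (f x) * adv f x = (\<Sum>i\<le>n. c i * (f x ^ i * adv f x))" for x
   unfolding P' by (simp add: sum_distrib_right mult.assoc)
  have iP: "integrable torus (\<lambda>x. P (f x) * adv f x)" unfolding Pe using z(2) by simp
  have "(avg x. P (f x) * adv f x) = 0" unfolding Pe using z by simp
  then have "\<bar>(avg x. g (f x) * adv f x)\<bar> = \<bar>(avg x. g (f x) * adv f x - P (f x) * adv f x)\<bar>" using ig iP by simp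
  also have "\<dots> \<le> (avg x. \<bar>g (f x) * adv f x - P (f x) * adv f x\<bar>)" by (rule integral_abs_bound)
  also have "\<dots> \<le> (avg x. e * \<bar>adv f x\<bar>)"
  proof (rule integral_mono)
   show "integrable torus (\<lambda>x. \<bar>g (f x) * adv f x - P (f x) * adv f x\<bar>)" using ig iP by simp
   show "integrable torus (\<lambda>x. e * \<bar>adv f x\<bar>)" using ia by simp
   fix x
   have "\<bar>g (f x) - P (f x)\<bar> \<le> e" using P(2)[of "f x"] B[of x] by (auto simp: abs_le_iff)
   then show "\<bar>g (f x) * adv f x - P (f x) * adv f x\<bar> \<le> e * \<bar>adv f x\<bar>"
    unfolding left_diff_distrib[symmetric] abs_mult by (intro mult_right_mono) auto
  qed
  finally show ?thesis by simp
 qed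
 have "\<bar>(avg x. g (f x) * adv f x)\<bar> \<le> 0"
 proof (rule LIMSEQ_le_const[of "\<lambda>n. inverse (real (Suc n)) * (avg x. \<bar>adv f x\<bar>)"])
  show "(\<lambda>n. inverse (real (Suc n)) * (avg x. \<bar>adv f x\<bar>)) ~~> 0"
   using tendsto_mult_right[OF LIMSEQ_inverse_real_of_nat, of "(avg x. \<bar>adv f x\<bar>)"] by simp
 qed (use le in auto)
 then show ?thesis by simp
qed

text \<open>The commutator of mollification and advection. The advection inside the mollification is
  in divergence form with its derivative moved to the kernel, because \<eta> has no
  derivative.\<close>

definition comm :: "nat => tfun => tfun" where
 "comm n \<eta> x = adv (conv (ker n) \<eta>) x - (conv (pd1 (ker n)) (\<lambda>y. u1 y * \<eta> y) x + conv (pd2 (ker n)) (\<lambda>y. u2 y * \<eta> y) x)"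

lemma comm_split:
 assumes \<eta>: "\<eta> \<in> ELp 2"
 shows "comm n \<eta> x = (u1 x * conv (pd1 (ker n)) \<eta> x - conv (pd1 (ker n)) (\<lambda>y. u1 y * \<eta> y) x)
   + (u2 x * conv (pd2 (ker n)) \<eta> x - conv (pd2 (ker n)) (\<lambda>y. u2 y * \<eta> y) x)"
 unfolding comm_def adv_def by (simp add: pd_conv[OF ker_TP ELp2_integrable[OF \<eta>]])

lemma integrable_comm_component:
 "\<eta> \<in> ELp 2 ==> W \<in> TP ==> u \<in> ELp 2 ==> integrable torus (\<lambda>x. u x * conv W \<eta> x - conv W (\<lambda>y. u y * \<eta> y) x)"
 by (rule Bochner_Integration.integrable_diff[OF integrable_ELp2_mult[OF _ TP_ELp[OF conv_TP[OF _ ELp2_integrable]]]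
    TP_integrable[OF conv_TP[OF _ integrable_ELp2_mult]]])

lemma integrable_comm:
 assumes \<eta>: "\<eta> \<in> ELp 2" shows "integrable torus (comm n \<eta>)"
proof -
 have "comm n \<eta> = (\<lambda>x. (u1 x * conv (pd1 (ker n)) \<eta> x - conv (pd1 (ker n)) (\<lambda>y. u1 y * \<eta> y) x)
   + (u2 x * conv (pd2 (ker n)) \<eta> x - conv (pd2 (ker n)) (\<lambda>y. u2 y * \<eta> y) x))"
  by (rule ext) (rule comm_split[OF \<eta>])
 then show ?thesis
  by (simp only:) (intro bochner_integrable_add integrable_comm_component TP_pd1 TP_pd2 ker_TP u_ELp2 \<eta>)
qed

lemma comm_bound:
 assumes \<eta>: "\<eta> \<in> ELp 2" shows "(avg x. \<bar>comm n \<eta> x\<bar>) \<le> 16 * pi * C * n2 \<eta>"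
proof -
 have C0: "0 \<le> C" using H1 by (simp add: H1_bound_def)
 let ?a = "\<lambda>x. u1 x * conv (pd1 (ker n)) \<eta> x - conv (pd1 (ker n)) (\<lambda>y. u1 y * \<eta> y) x"
 let ?b = "\<lambda>x. u2 x * conv (pd2 (ker n)) \<eta> x - conv (pd2 (ker n)) (\<lambda>y. u2 y * \<eta> y) x"
 have i: "integrable torus ?a" "integrable torus ?b"
  by (intro integrable_comm_component TP_pd1 TP_pd2 ker_TP u_ELp2 \<eta>)+
 have "(avg x. \<bar>comm n \<eta> x\<bar>) \<le> (avg x. \<bar>?a x\<bar> + \<bar>?b x\<bar>)"
  using i integrable_comm[OF \<eta>] by (intro integral_mono) (auto simp: comm_split[OF \<eta>])
 also have "\<dots> = (avg x. \<bar>?a x\<bar>) + (avg x. \<bar>?b x\<bar>)" using i by simp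
 also have "\<dots> \<le> (avg z. \<bar>pd1 (ker n) z\<bar> * sabs z) * C * n2 \<eta> + (avg z. \<bar>pd2 (ker n) z\<bar> * sabs z) * C * n2 \<eta>"
  by (intro add_mono commutator_component u_ELp2 \<eta> TP_pd1 TP_pd2 ker_TP H1_bound_translation H1)
 also have "\<dots> \<le> 8 * pi * C * n2 \<eta> + 8 * pi * C * n2 \<eta>"
  by (intro add_mono mult_right_mono ker_grad_moment C0 n2_nonneg)
 finally show ?thesis by linarith
qed

text \<open>For a trigonometric polynomial the derivative can be moved back to \<zeta>. What remains
  are the mollification errors of its gradient, multiplied by the velocity, and of its
  advection.\<close>

lemma comm_TP_tendsto:
 assumes \<zeta>: "\<zeta> \<in> TP" shows "(\<lambda>n. (avg x. \<bar>comm n \<zeta> x\<bar>)) ~~> 0"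
proof -
 note z2 = TP_ELp[OF \<zeta>, of 2] and zi = TP_integrable[OF \<zeta>]
 note p = TP_pd1[OF \<zeta>] TP_pd2[OF \<zeta>]
 note pE = TP_ELp[OF p(1), of 2] TP_ELp[OF p(2), of 2]
 note aE = adv_ELp2[OF \<zeta>]
 have cp: "conv (pd1 (ker n)) \<zeta> x = conv (ker n) (pd1 \<zeta>) x" "conv (pd2 (ker n)) \<zeta> x = conv (ker n) (pd2 \<zeta>) x" for n x
 proof -
  note ip = integration_by_parts[OF \<zeta> TP_test[OF TP_reflect[OF ker_TP[of n]]], of x, unfolded pd_reflect[OF ker_TP]]
  show "conv (pd1 (ker n)) \<zeta> x = conv (ker n) (pd1 \<zeta>) x" using ip(1) by (simp add: conv_def L2_inner_def mult.commute)
  show "conv (pd2 (ker n)) \<zeta> x = conv (ker n) (pd2 \<zeta>) x" using ip(2) by (simp add: conv_def L2_inner_def mult.commute)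
 qed
 \<comment> \<open>Vanishing divergence enters here: the advection of the product of the reflected
   kernel and \<zeta> has mean zero.\<close>
 have dv: "conv (pd1 (ker n)) (\<lambda>y. u1 y * \<zeta> y) x + conv (pd2 (ker n)) (\<lambda>y. u2 y * \<zeta> y) x = conv (ker n) (adv \<zeta>) x" for n x
 proof -
  let ?V = "\<lambda>y. ker n (x - y)"
  have V: "?V \<in> TP" by (rule TP_reflect[OF ker_TP])
  have i: "integrable torus (\<lambda>y. pd1 (ker n) (x - y) * (u1 y * \<zeta> y))" "integrable torus (\<lambda>y. pd2 (ker n) (x - y) * (u2 y * \<zeta> y))"
    "integrable torus (\<lambda>y. ?V y * adv \<zeta> y)"
   by (intro integrable_conv TP_pd1 TP_pd2 ker_TP integrable_ELp2_mult u_ELp2 z2 ELp2_integrable aE)+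
  have "(avg y. adv (\<lambda>y. ?V y * \<zeta> y) y) = 0" by (rule integral_adv[OF TP_mult[OF V \<zeta>]])
  moreover have "adv (\<lambda>y. ?V y * \<zeta> y) y = ?V y * adv \<zeta> y - (pd1 (ker n) (x - y) * (u1 y * \<zeta> y) + pd2 (ker n) (x - y) * (u2 y * \<zeta> y))" for y
   unfolding adv_mult[OF V \<zeta>] by (simp add: adv_def pd_reflect[OF ker_TP] algebra_simps)
  ultimately show ?thesis using i by (simp add: conv_def)
 qed
 let ?d1 = "\<lambda>n x. conv (ker n) (pd1 \<zeta>) x - pd1 \<zeta> x" and ?d2 = "\<lambda>n x. conv (ker n) (pd2 \<zeta>) x - pd2 \<zeta> x"
 let ?d3 = "\<lambda>n x. conv (ker n) (adv \<zeta>) x - adv \<zeta> x"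
 have eq: "comm n \<zeta> x = u1 x * ?d1 n x + u2 x * ?d2 n x - ?d3 n x" for n x
  unfolding comm_def dv unfolding adv_def[of "conv _ _"] pd_conv[OF ker_TP zi] cp by (simp add: adv_def algebra_simps)
 have cE: "conv (ker n) f \<in> ELp 2" if "f \<in> ELp 2" for n f by (rule TP_ELp[OF conv_TP[OF ker_TP ELp2_integrable[OF that]]])
 have dE: "?d1 n \<in> ELp 2" "?d2 n \<in> ELp 2" "?d3 n \<in> ELp 2" for n by (intro ELp_diff cE pE aE; simp)+
 show ?thesis
 proof (rule tendsto_sandwich[OF _ _ tendsto_const])
  have "(\<lambda>n. n2 u1 * n2 (?d1 n) + n2 u2 * n2 (?d2 n) + n2 (?d3 n)) ~~> n2 u1 * 0 + n2 u2 * 0 + 0"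
   by (intro tendsto_intros conv_ker_n2 pE aE)
  then show "(\<lambda>n. n2 u1 * n2 (?d1 n) + n2 u2 * n2 (?d2 n) + n2 (?d3 n)) ~~> 0" by simp
  show "\<forall>\<^sub>F n in sequentially. (avg x. \<bar>comm n \<zeta> x\<bar>) \<le> n2 u1 * n2 (?d1 n) + n2 u2 * n2 (?d2 n) + n2 (?d3 n)"
  proof (intro always_eventually allI)
   fix n
   note i = integrable_ELp2_mult[OF u_ELp2(1) dE(1)[of n]] integrable_ELp2_mult[OF u_ELp2(2) dE(2)[of n]] ELp2_integrable[OF dE(3)[of n]]
   have "(avg x. \<bar>comm n \<zeta> x\<bar>) \<le> (avg x. \<bar>u1 x * ?d1 n x\<bar> + \<bar>u2 x * ?d2 n x\<bar> + \<bar>?d3 n x\<bar>)"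
   proof (rule integral_mono)
    show "integrable torus (\<lambda>x. \<bar>comm n \<zeta> x\<bar>)" using integrable_comm[OF z2] by simp
    show "integrable torus (\<lambda>x. \<bar>u1 x * ?d1 n x\<bar> + \<bar>u2 x * ?d2 n x\<bar> + \<bar>?d3 n x\<bar>)"
     by (intro bochner_integrable_add integrable_abs i)
    show "\<bar>comm n \<zeta> x\<bar> \<le> \<bar>u1 x * ?d1 n x\<bar> + \<bar>u2 x * ?d2 n x\<bar> + \<bar>?d3 n x\<bar>" for x unfolding eq by linarith
   qed
   also have "\<dots> = (avg x. \<bar>u1 x * ?d1 n x\<bar>) + (avg x. \<bar>u2 x * ?d2 n x\<bar>) + (avg x. \<bar>?d3 n x\<bar>)"
    using i[THEN integrable_abs] by (simp only: bochner_add bochner_integrable_add)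
   also have "\<dots> \<le> n2 u1 * n2 (?d1 n) + n2 u2 * n2 (?d2 n) + n2 (?d3 n)"
    by (intro add_mono L1_mult_le L1_le_n2 u_ELp2 dE)
   finally show "(avg x. \<bar>comm n \<zeta> x\<bar>) \<le> n2 u1 * n2 (?d1 n) + n2 u2 * n2 (?d2 n) + n2 (?d3 n)" .
  qed
 qed simp
qed

lemma comm_diff:
 assumes f: "f \<in> ELp 2" and g: "g \<in> ELp 2"
 shows "comm n (f -. g) x = comm n f x - comm n g x"
proof -
 note i = ELp2_integrable[OF f] ELp2_integrable[OF g]
 note j = integrable_ELp2_mult[OF u_ELp2(1) f] integrable_ELp2_mult[OF u_ELp2(1) g] integrable_ELp2_mult[OF u_ELp2(2) f] integrable_ELp2_mult[OF u_ELp2(2) g]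
 note p = TP_pd1[OF ker_TP[of n]] TP_pd2[OF ker_TP[of n]]
 have fg: "(f -. g) \<in> ELp 2" by (rule ELp_diff[OF f g]) simp
 show ?thesis
  unfolding comm_split[OF f] comm_split[OF g] comm_split[OF fg] right_diff_distrib
   conv_diff_right[OF p(1) i] conv_diff_right[OF p(2) i] conv_diff_right[OF p(1) j(1,2)] conv_diff_right[OF p(2) j(3,4)]
  by simp
qed

text \<open>Density: the bound \<open>comm_bound\<close> is uniform in n, so the limit need only be
  known for a trigonometric polynomial close to \<eta>, namely a mollification of it.\<close>

lemma comm_tendsto:
 assumes \<eta>: "\<eta> \<in> ELp 2" shows "(\<lambda>n. (avg x. \<bar>comm n \<eta> x\<bar>)) ~~> 0"
proof (rule LIMSEQ_I)
 fix \<epsilon> :: real assume e: "0 < \<epsilon>"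
 have C0: "0 \<le> C" using H1 by (simp add: H1_bound_def)
 \<comment> \<open>The summand 1 keeps D positive when C is 0.\<close>
 define D where "D = 16 * pi * C + 1"
 have D: "0 < D" using C0 by (simp add: D_def add_nonneg_pos)
 have \<delta>: "0 < \<epsilon> / 2 / D" using e D by simp
 from order_tendstoD(2)[OF conv_ker_n2[OF \<eta>] \<delta>] obtain m where m: "n2 (conv (ker m) \<eta> -. \<eta>) < \<epsilon> / 2 / D"
  by (auto simp: eventually_sequentially)
 let ?\<zeta> = "conv (ker m) \<eta>"
 have \<zeta>: "?\<zeta> \<in> TP" by (rule conv_TP[OF ker_TP ELp2_integrable[OF \<eta>]])
 note z2 = TP_ELp[OF \<zeta>, of 2]
 have d: "(?\<zeta> -. \<eta>) \<in> ELp 2" by (rule ELp_diff[OF z2 \<eta>]) simp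
 from order_tendstoD(2)[OF comm_TP_tendsto[OF \<zeta>], of "\<epsilon> / 2"] e
 obtain N where N: "\<And>n. N \<le> n ==> (avg x. \<bar>comm n ?\<zeta> x\<bar>) < \<epsilon> / 2" by (auto simp: eventually_sequentially)
 show "\<exists>no. \<forall>n\<ge>no. norm ((avg x. \<bar>comm n \<eta> x\<bar>) - 0) < \<epsilon>"
 proof (intro exI[of _ N] allI impI)
  fix n assume n: "N \<le> n"
  note i = integrable_comm[OF z2, of n] integrable_comm[OF d, of n] integrable_comm[OF \<eta>, of n]
  have "(avg x. \<bar>comm n \<eta> x\<bar>) \<le> (avg x. \<bar>comm n ?\<zeta> x\<bar> + \<bar>comm n (?\<zeta> -. \<eta>) x\<bar>)"
  proof (rule integral_mono)
   show "\<bar>comm n \<eta> x\<bar> \<le> \<bar>comm n ?\<zeta> x\<bar> + \<bar>comm n (?\<zeta> -. \<eta>) x\<bar>" for x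
    unfolding comm_diff[OF z2 \<eta>] by linarith
  qed (use i in auto)
  also have "\<dots> = (avg x. \<bar>comm n ?\<zeta> x\<bar>) + (avg x. \<bar>comm n (?\<zeta> -. \<eta>) x\<bar>)" using i by simp
  also have "(avg x. \<bar>comm n (?\<zeta> -. \<eta>) x\<bar>) \<le> D * n2 (?\<zeta> -. \<eta>)"
   using comm_bound[OF d, of n] n2_nonneg[of "\<lambda>x. ?\<zeta> x - \<eta> x"] unfolding D_def distrib_right by linarith
  also have "D * n2 (?\<zeta> -. \<eta>) \<le> D * (\<epsilon> / 2 / D)" using m D by (intro mult_left_mono) auto
  also have "\<dots> = \<epsilon> / 2" using D by simp
  finally have "(avg x. \<bar>comm n \<eta> x\<bar>) < \<epsilon>" using N[OF n] by linarith
  then show "norm ((avg x. \<bar>comm n \<eta> x\<bar>) - 0) < \<epsilon>" by (simp add: integral_nonneg_AE)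
 qed
qed

text \<open>Testing with the nonconstant modes is enough: both functions will have mean zero and the
  advection of a constant vanishes, so constants add nothing.\<close>

definition weak_eq :: "real => tfun => tfun => bool" where
 "weak_eq \<tau> \<xi> \<eta> \<longleftrightarrow> (\<forall>j\<in>Z0. ip \<eta> (eb j) = ip \<xi> (eb j) + \<tau> * ip (adv (eb j)) \<eta>)"

lemma weak_eq_TP:
 assumes w: "weak_eq \<tau> \<xi> \<eta>" and \<xi>: "\<xi> \<in> \<E>" and \<eta>: "\<eta> \<in> \<E>" and \<phi>: "\<phi> \<in> TP"
 shows "ip \<eta> \<phi> = ip \<xi> \<phi> + \<tau> * ip (adv \<phi>) \<eta>"
proof -
 obtain K a c where K: "finite K" "K \<subseteq> Z0" and f: "\<phi> = (\<lambda>x. c + (\<Sum>k\<in>K. a k * eb k x))"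
  using TP_representation[OF \<phi>] by blast
 have T: "(\<lambda>x. a k * eb k x) \<in> TP" for k by (intro TP.scale e_basis_TP)
 have in_\<phi>: "ip g \<phi> = (\<Sum>k\<in>K. a k * ip g (eb k))" if g: "g \<in> \<E>" for g
 proof -
  note g2 = zero_mean_L2D[OF g]
  have "ip g \<phi> = ip (\<lambda>x. c) g + ip (fsum K a) g"
   unfolding L2_inner_commute[of g] f by (intro L2_inner_add_left ELp_const TP_ELp e_sum_TP K g2)
  moreover have "ip (\<lambda>x. c) g = 0" using g2 by (simp add: L2_inner_def)
  ultimately show ?thesis by (simp add: L2_inner_e_sum2[OF K g2(1)])
 qed
 have "adv \<phi> = (\<lambda>x. \<Sum>k\<in>K. a k * adv (eb k) x)"
  unfolding f by (rule ext) (simp add: adv_add[OF TP_const TP_sum[OF K(1) T]] adv_const adv_sum[OF K(1) T] adv_scale)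
 then have "ip (adv \<phi>) \<eta> = (\<Sum>k\<in>K. a k * ip (adv (eb k)) \<eta>)"
  using L2_inner_sum_left[OF K(1) ELp_cmult[OF adv_ELp2[OF e_basis_TP]] zero_mean_L2D(1)[OF \<eta>], of a] by (simp add: L2_inner_cmult_left)
 moreover have "(\<Sum>k\<in>K. a k * ip \<eta> (eb k)) = (\<Sum>k\<in>K. a k * (ip \<xi> (eb k) + \<tau> * ip (adv (eb k)) \<eta>))"
  using w K(2) unfolding weak_eq_def by (intro sum.cong) (auto simp: subset_iff)
 ultimately show ?thesis unfolding in_\<phi>[OF \<xi>] in_\<phi>[OF \<eta>] by (simp add: distrib_left sum.distrib sum_distrib_left mult_ac)
qed

text \<open>The weak equation is tested with \<open>ker n (x - y)\<close> as a function of y. It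
  becomes an equation at the point x, at the price of the commutator.\<close>

lemma mollified_equation:
 assumes w: "weak_eq \<tau> \<xi> \<eta>" and \<xi>: "\<xi> \<in> \<E>" and \<eta>: "\<eta> \<in> \<E>"
 shows "conv (ker n) \<eta> x - conv (ker n) \<xi> x = - \<tau> * adv (conv (ker n) \<eta>) x + \<tau> * comm n \<eta> x"
proof -
 let ?V = "\<lambda>y. ker n (x - y)"
 have V: "?V \<in> TP" by (rule TP_reflect[OF ker_TP])
 note e2 = zero_mean_L2D(1)[OF \<eta>]
 have i: "integrable torus (\<lambda>y. pd1 (ker n) (x - y) * (u1 y * \<eta> y))" "integrable torus (\<lambda>y. pd2 (ker n) (x - y) * (u2 y * \<eta> y))"
  by (intro integrable_conv TP_pd1 TP_pd2 ker_TP integrable_ELp2_mult u_ELp2 e2)+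
 have "ip (adv ?V) \<eta> = (avg y. - (pd1 (ker n) (x - y) * (u1 y * \<eta> y) + pd2 (ker n) (x - y) * (u2 y * \<eta> y)))"
  unfolding L2_inner_def adv_def pd_reflect[OF ker_TP]
  by (intro bochner_cong refl) (simp add: algebra_simps)
 also have "\<dots> = - (conv (pd1 (ker n)) (\<lambda>y. u1 y * \<eta> y) x + conv (pd2 (ker n)) (\<lambda>y. u2 y * \<eta> y) x)"
  unfolding conv_def using i by simp
 also have "\<dots> = comm n \<eta> x - adv (conv (ker n) \<eta>) x" unfolding comm_def by simp
 finally have "ip (adv ?V) \<eta> = comm n \<eta> x - adv (conv (ker n) \<eta>) x" .
 moreover have "ip f ?V = conv (ker n) f x" for f
  unfolding L2_inner_def conv_def by (simp add: mult.commute)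
 ultimately have "conv (ker n) \<eta> x = conv (ker n) \<xi> x + \<tau> * (comm n \<eta> x - adv (conv (ker n) \<eta>) x)"
  using weak_eq_TP[OF w \<xi> \<eta> V] by simp
 then show ?thesis by algebra
qed

text \<open>The mollified equation is multiplied by g of the mollified solution: the transport term
  integrates to zero for every n, and the commutator vanishes in L^1 while g is bounded. The
  Lipschitz condition carries the remaining integral to the limit.\<close>

lemma renormalized:
 assumes w: "weak_eq \<tau> \<xi> \<eta>" and \<xi>: "\<xi> \<in> \<E>" and \<eta>: "\<eta> \<in> \<E>"
  and G: "\<And>s. \<bar>g s\<bar> \<le> G" and L: "\<And>s t. \<bar>g s - g t\<bar> \<le> L * \<bar>s - t\<bar>" "0 \<le> L"
 shows "(avg x. g (\<eta> x) * (\<eta> x - \<xi> x)) = 0"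
proof -
 note x2 = zero_mean_L2D(1)[OF \<xi>] and e2 = zero_mean_L2D(1)[OF \<eta>]
 let ?a = "\<lambda>n. conv (ker n) \<eta>" and ?b = "\<lambda>n. conv (ker n) \<xi>"
 let ?I = "\<lambda>n. (avg x. g (?a n x) * (?a n x - ?b n x))" and ?J = "(avg x. g (\<eta> x) * (\<eta> x - \<xi> x))"
  and ?k = "\<lambda>n x. (g (?a n x) - g (\<eta> x)) * (\<eta> x - \<xi> x)"
 have T: "?a n \<in> TP" "?b n \<in> TP" for n by (intro conv_TP ker_TP ELp2_integrable x2 e2)+
 note E = TP_ELp[OF T(1), where p=2] TP_ELp[OF T(2), where p=2]
 have gc: "continuous_on UNIV g"
 proof -
  have "L-lipschitz_on UNIV g" by (rule lipschitz_onI) (use L in \<open>auto simp: dist_real_def\<close>)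
  then show ?thesis by (rule lipschitz_on_continuous_on)
 qed
 have gm: "(\<lambda>x. g (f x)) \<in> borel_measurable torus" if "f \<in> ELp 2" for f
  by (rule measurable_torus[OF measurable_compose[OF ELpD(1)[OF that] borel_measurable_continuous_onI[OF gc]]])
 have G0: "0 \<le> G" using G[of 0] by linarith
 have gi: "integrable torus (\<lambda>x. g (f x) * h x)" if f: "f \<in> ELp 2" and h: "integrable torus h" for f h
 proof (rule integrable_bounded_by)
  show "integrable torus (\<lambda>x. G * \<bar>h x\<bar>)" using h by simp
  show "(\<lambda>x. g (f x) * h x) \<in> borel_measurable torus" using gm[OF f] h by auto
  show "\<bar>g (f x) * h x\<bar> \<le> G * \<bar>h x\<bar>" for x unfolding abs_mult by (intro mult_right_mono G) simp
 qed
 have gabs: "\<bar>(avg x. g (f x) * h x)\<bar> \<le> G * (avg x. \<bar>h x\<bar>)" if f: "f \<in> ELp 2" and h: "integrable torus h" for f h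
 proof -
  have "\<bar>(avg x. g (f x) * h x)\<bar> \<le> (avg x. \<bar>g (f x) * h x\<bar>)" by (rule integral_abs_bound)
  also have "\<dots> \<le> (avg x. G * \<bar>h x\<bar>)"
  proof (rule integral_mono)
   show "integrable torus (\<lambda>x. \<bar>g (f x) * h x\<bar>)" using gi[OF f h] by (rule integrable_abs)
   show "\<bar>g (f x) * h x\<bar> \<le> G * \<bar>h x\<bar>" for x unfolding abs_mult by (intro mult_right_mono G) simp
  qed (use h in simp)
  finally show ?thesis by simp
 qed
 have 1: "(\<lambda>n. (?I n)) ~~> 0"
 proof (rule null_comparison)
  show "(\<lambda>n. \<bar>\<tau>\<bar> * (G * (avg x. \<bar>comm n \<eta> x\<bar>))) ~~> 0"
   using tendsto_mult_left[OF tendsto_mult_left[OF comm_tendsto[OF e2], of G], of "\<bar>\<tau>\<bar>"] by simp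
  show "norm (?I n) \<le> \<bar>\<tau>\<bar> * (G * (avg x. \<bar>comm n \<eta> x\<bar>))" for n
  proof -
   have "(?I n)
     = (avg x. - \<tau> * (g (?a n x) * adv (?a n) x) + \<tau> * (g (?a n x) * comm n \<eta> x))"
    unfolding mollified_equation[OF w \<xi> \<eta>] by (intro bochner_cong refl) (simp add: algebra_simps)
   also have "\<dots> = - \<tau> * (avg x. g (?a n x) * adv (?a n) x) + \<tau> * (avg x. g (?a n x) * comm n \<eta> x)"
    using gi[OF E(1)[of n] ELp2_integrable[OF adv_ELp2[OF T(1)[of n]]]] gi[OF E(1)[of n] integrable_comm[OF e2, of n]]
    by (subst bochner_add) simp_all
   also have "\<dots> = \<tau> * (avg x. g (?a n x) * comm n \<eta> x)" unfolding integral_continuous_adv[OF T(1) gc] by simp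
   finally show "norm (?I n) \<le> \<bar>\<tau>\<bar> * (G * (avg x. \<bar>comm n \<eta> x\<bar>))"
    using gabs[OF E(1)[of n] integrable_comm[OF e2, of n]] by (simp add: abs_mult mult_left_mono)
  qed
 qed
 have d: "(\<eta> -. \<xi>) \<in> ELp 2" by (rule ELp_diff[OF e2 x2]) simp
 have da: "(?a n -. \<eta>) \<in> ELp 2" "(?b n -. \<xi>) \<in> ELp 2" for n by (rule ELp_diff[OF E(1) e2] ELp_diff[OF E(2) x2], simp)+
 have 2: "(\<lambda>n. (?I n) - ?J) ~~> 0"
 proof (rule null_comparison)
  let ?A = "\<lambda>n. n2 (?a n -. \<eta>)" and ?B = "\<lambda>n. n2 (?b n -. \<xi>)"
  have "(\<lambda>n. G * ?A n + G * ?B n + L * (?A n * n2 (\<eta> -. \<xi>))) ~~> G * 0 + G * 0 + L * (0 * n2 (\<eta> -. \<xi>))"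
   by (intro tendsto_intros conv_ker_n2 e2 x2)
  then show "(\<lambda>n. G * ?A n + G * ?B n + L * (?A n * n2 (\<eta> -. \<xi>))) ~~> 0" by simp
  show "norm ((?I n) - ?J)
    \<le> G * ?A n + G * ?B n + L * (?A n * n2 (\<eta> -. \<xi>))" for n
  proof -
   note i = ELp2_integrable[OF da(1)[of n]] ELp2_integrable[OF da(2)[of n]] ELp2_integrable[OF d]
   have i2: "integrable torus (\<lambda>x. ?k n x)"
    unfolding left_diff_distrib by (intro Bochner_Integration.integrable_diff gi E e2 i)
   have "(?I n) - ?J
    = (avg x. g (?a n x) * (?a n x - ?b n x) - g (\<eta> x) * (\<eta> x - \<xi> x))"
    by (intro Bochner_Integration.integral_diff[symmetric] gi E e2 i ELp2_integrable ELp_diff) simp_all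
   also have "\<dots> = (avg x. g (?a n x) * (?a n x - \<eta> x) - g (?a n x) * (?b n x - \<xi> x) + ?k n x)"
    by (intro bochner_cong refl) (simp add: algebra_simps)
   also have "\<dots> = (avg x. g (?a n x) * (?a n x - \<eta> x)) - (avg x. g (?a n x) * (?b n x - \<xi> x))
     + (avg x. ?k n x)"
    using gi[OF E(1)[of n] i(1)] gi[OF E(1)[of n] i(2)] i2 by simp
   finally have "\<bar>(?I n) - ?J\<bar>
     \<le> \<bar>(avg x. g (?a n x) * (?a n x - \<eta> x))\<bar> + \<bar>(avg x. g (?a n x) * (?b n x - \<xi> x))\<bar>
      + \<bar>(avg x. ?k n x)\<bar>" by linarith
   also have "\<dots> \<le> G * ?A n + G * ?B n + L * (?A n * n2 (\<eta> -. \<xi>))"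
   proof (intro add_mono)
    show "\<bar>(avg x. g (?a n x) * (?a n x - \<eta> x))\<bar> \<le> G * ?A n"
     by (rule order_trans[OF gabs[OF E(1) i(1)] mult_left_mono[OF L1_le_n2[OF da(1)] G0]])
    show "\<bar>(avg x. g (?a n x) * (?b n x - \<xi> x))\<bar> \<le> G * ?B n"
     by (rule order_trans[OF gabs[OF E(1) i(2)] mult_left_mono[OF L1_le_n2[OF da(2)] G0]])
    have "\<bar>(avg x. ?k n x)\<bar> \<le> (avg x. \<bar>?k n x\<bar>)"
     by (rule integral_abs_bound)
    also have "\<dots> \<le> (avg x. L * \<bar>(?a n x - \<eta> x) * (\<eta> x - \<xi> x)\<bar>)"
    proof (rule integral_mono)
     show "integrable torus (\<lambda>x. \<bar>?k n x\<bar>)" using i2 by (rule integrable_abs)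
     show "integrable torus (\<lambda>x. L * \<bar>(?a n x - \<eta> x) * (\<eta> x - \<xi> x)\<bar>)" using integrable_ELp2_mult[OF da(1)[of n] d] by simp
     show "\<bar>?k n x\<bar> \<le> L * \<bar>(?a n x - \<eta> x) * (\<eta> x - \<xi> x)\<bar>" for x
      unfolding abs_mult mult.assoc[symmetric] by (intro mult_right_mono L) simp
    qed
    also have "\<dots> \<le> L * (?A n * n2 (\<eta> -. \<xi>))"
     using mult_left_mono[OF L1_mult_le[OF da(1)[of n] d] L(2)] by simp
    finally show "\<bar>(avg x. ?k n x)\<bar> \<le> L * (?A n * n2 (\<eta> -. \<xi>))" .
   qed
   finally show "norm ((?I n) - ?J)
    \<le> G * ?A n + G * ?B n + L * (?A n * n2 (\<eta> -. \<xi>))" by simp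
  qed
 qed
 have "(\<lambda>n. (?I n)) ~~> ?J"
  using 2 by (rule LIM_zero_cancel)
 from LIMSEQ_unique[OF this 1] show ?thesis .
qed

end

text \<open>Powers of a truncated value are bounded and Lipschitz, hence admissible in
  \<open>renormalized\<close>, whereas z^(p-1) itself is unbounded.\<close>

definition clip :: "real => real => real" where "clip R s = max (- R) (min R s)"

lemma clip_bound: "0 \<le> R ==> \<bar>clip R s\<bar> \<le> R" by (auto simp: clip_def)

lemma clip_lipschitz: "\<bar>clip R s - clip R t\<bar> \<le> \<bar>s - t\<bar>" unfolding clip_def by linarith

lemma power_lipschitz:
 assumes R: "0 \<le> R"
 shows "\<exists>L\<ge>0. \<forall>x y. \<bar>x\<bar> \<le> R \<longrightarrow> \<bar>y\<bar> \<le> R \<longrightarrow> \<bar>x ^ m - y ^ m\<bar> \<le> L * \<bar>x - y :: real\<bar>"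
proof (induction m)
 case (Suc m)
 then obtain L where L: "0 \<le> L" "\<And>x y. \<bar>x\<bar> \<le> R ==> \<bar>y\<bar> \<le> R ==> \<bar>x ^ m - y ^ m\<bar> \<le> L * \<bar>x - y :: real\<bar>" by blast
 show ?case
 proof (intro exI[of _ "R * L + R ^ m"] conjI allI impI)
  show "0 \<le> R * L + R ^ m" using R L by simp
  fix x y :: real assume xy: "\<bar>x\<bar> \<le> R" "\<bar>y\<bar> \<le> R"
  have "x ^ Suc m - y ^ Suc m = x * (x ^ m - y ^ m) + (x - y) * y ^ m" by (simp add: algebra_simps)
  then have "\<bar>x ^ Suc m - y ^ Suc m\<bar> \<le> \<bar>x\<bar> * \<bar>x ^ m - y ^ m\<bar> + \<bar>x - y\<bar> * \<bar>y\<bar> ^ m"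
   using abs_triangle_ineq[of "x * (x ^ m - y ^ m)" "(x - y) * y ^ m"] by (simp add: abs_mult power_abs)
  also have "\<dots> \<le> R * (L * \<bar>x - y\<bar>) + \<bar>x - y\<bar> * R ^ m"
   using xy R L by (intro add_mono mult_mono L power_mono) auto
  also have "\<dots> = (R * L + R ^ m) * \<bar>x - y\<bar>" by (simp add: algebra_simps)
  finally show "\<bar>x ^ Suc m - y ^ Suc m\<bar> \<le> (R * L + R ^ m) * \<bar>x - y\<bar>" .
 qed
qed auto

text \<open>Truncation keeps the sign and does not increase the modulus, and the power p - 1 is
  odd.\<close>

lemma clip_power_mult: "even p ==> 2 \<le> p ==> 0 \<le> R ==> clip R s ^ p \<le> clip R s ^ (p - 1) * s"
proof -
 assume p: "even p" "2 \<le> p" and R: "0 \<le> R"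
 have e: "clip R s ^ p = clip R s ^ (p - 1) * clip R s" using p by (metis Suc_1 Suc_le_D diff_Suc_1 power_Suc2)
 consider "R \<le> s" | "s \<le> - R" | "- R \<le> s" "s \<le> R" by linarith
 then show ?thesis
 proof cases
  case 1
  then have "clip R s = R" using R by (simp add: clip_def)
  then show ?thesis unfolding e using 1 R by (simp add: mult_left_mono)
 next
  case 2
  then have c: "clip R s = - R" using R by (simp add: clip_def)
  have "odd (p - 1)" using p by simp
  then have "(- R) ^ (p - 1) \<le> 0" using R by (simp add: power_minus_odd)
  then show ?thesis unfolding e unfolding c using 2 by (intro mult_left_mono_neg) auto
 next
  case 3
  then have "clip R s = s" by (simp add: clip_def)
  then show ?thesis unfolding e by simp
 qed
qed

context vfield begin

text \<open>Renormalization with the (p-1)-st power of the truncated solution exchanges \<eta> for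
  \<xi> in the integral. The tangent inequality for z^p at the truncated value then takes the place
  of Hoelder's inequality, and Fatou removes the truncation.\<close>

lemma weak_solution_Lp:
 assumes w: "weak_eq \<tau> \<xi> \<eta>" and \<xi>: "\<xi> \<in> \<E>" and \<eta>: "\<eta> \<in> \<E>" and p: "even p" "2 \<le> p" and xp: "\<xi> \<in> ELp p"
 shows "\<eta> \<in> ELp p" "(avg x. \<eta> x ^ p) \<le> (avg x. \<xi> x ^ p)"
proof -
 note x2 = zero_mean_L2D(1)[OF \<xi>] and e2 = zero_mean_L2D(1)[OF \<eta>]
 let ?c = "\<lambda>n x. clip (real n) (\<eta> x)"
 have cm: "?c n \<in> borel_measurable torus" for n
  unfolding clip_def using ELpD(3)[OF e2] by (intro borel_measurable_max borel_measurable_min) simp_all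
 have ci: "integrable torus (\<lambda>x. ?c n x ^ m)" for n m
 proof (rule integrable_bounded_by)
  show "integrable torus (\<lambda>x. real n ^ m)" by simp
  show "\<bar>?c n x ^ m\<bar> \<le> real n ^ m" for x unfolding power_abs by (intro power_mono clip_bound) auto
 qed (use cm in simp)
 have le: "(avg x. ?c n x ^ p) \<le> (avg x. \<xi> x ^ p)" for n
 proof -
  let ?g = "\<lambda>s. clip (real n) s ^ (p - 1)"
  obtain L where L: "0 \<le> L" "\<And>x y. \<bar>x\<bar> \<le> real n ==> \<bar>y\<bar> \<le> real n ==> \<bar>x ^ (p - 1) - y ^ (p - 1)\<bar> \<le> L * \<bar>x - y\<bar>"
   using power_lipschitz[of "real n" "p - 1"] by auto
  have gL: "\<bar>?g s - ?g t\<bar> \<le> L * \<bar>s - t\<bar>" for s t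
   by (rule order_trans[OF L(2)[OF clip_bound clip_bound] mult_left_mono[OF clip_lipschitz L(1)]]) auto
  have gb: "\<bar>?g s\<bar> \<le> real n ^ (p - 1)" for s unfolding power_abs by (intro power_mono clip_bound) auto
  have i: "integrable torus (\<lambda>x. ?c n x ^ (p - 1) * f x)" if f: "integrable torus f" for f
  proof (rule integrable_bounded_by)
   show "integrable torus (\<lambda>x. real n ^ (p - 1) * \<bar>f x\<bar>)" using f by simp
   show "(\<lambda>x. ?c n x ^ (p - 1) * f x) \<in> borel_measurable torus" using cm f by auto
   show "\<bar>?c n x ^ (p - 1) * f x\<bar> \<le> real n ^ (p - 1) * \<bar>f x\<bar>" for x unfolding abs_mult by (intro mult_right_mono gb) simp
  qed
  note ie = i[OF ELp2_integrable[OF e2]] and ix = i[OF ELp2_integrable[OF x2]]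
  have "(avg x. ?c n x ^ (p - 1) * (\<eta> x - \<xi> x)) = 0" by (rule renormalized[OF w \<xi> \<eta> gb gL L(1)])
  then have eq: "(avg x. ?c n x ^ (p - 1) * \<eta> x) = (avg x. ?c n x ^ (p - 1) * \<xi> x)"
   using ie ix by (simp add: right_diff_distrib)
  have 1: "(avg x. ?c n x ^ p) \<le> (avg x. ?c n x ^ (p - 1) * \<eta> x)"
   by (intro integral_mono ci ie clip_power_mult p) simp
  have "(avg x. ?c n x ^ p) + real p * ((avg x. ?c n x ^ (p - 1) * \<xi> x) - (avg x. ?c n x ^ (p - 1) * ?c n x))
    = (avg x. ?c n x ^ p + real p * (?c n x ^ (p - 1) * \<xi> x - ?c n x ^ (p - 1) * ?c n x))"
   using ci[of n p] ix i[OF ci[of n 1, unfolded power_one_right]] by simp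
  also have "\<dots> \<le> (avg x. \<xi> x ^ p)"
  proof (intro integral_mono)
   show "integrable torus (\<lambda>x. ?c n x ^ p + real p * (?c n x ^ (p - 1) * \<xi> x - ?c n x ^ (p - 1) * ?c n x))"
    using ci[of n p] ix i[OF ci[of n 1, unfolded power_one_right]] by simp
   show "integrable torus (\<lambda>x. \<xi> x ^ p)" by (rule ELpD(4)[OF xp])
   show "?c n x ^ p + real p * (?c n x ^ (p - 1) * \<xi> x - ?c n x ^ (p - 1) * ?c n x) \<le> \<xi> x ^ p" for x
    using even_power_tangent[OF p(1), of "?c n x" "\<xi> x"] by (simp add: algebra_simps)
  qed
  also have "(avg x. ?c n x ^ (p - 1) * ?c n x) = (avg x. ?c n x ^ p)"
  proof -
   have "?c n x ^ (p - 1) * ?c n x = ?c n x ^ p" for x using p by (cases p) (simp_all add: mult.commute)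
   then show ?thesis by simp
  qed
  finally have 2: "(avg x. ?c n x ^ p) + real p * ((avg x. ?c n x ^ (p - 1) * \<xi> x) - (avg x. ?c n x ^ p)) \<le> (avg x. \<xi> x ^ p)" .
  have "0 \<le> real p * ((avg x. ?c n x ^ (p - 1) * \<xi> x) - (avg x. ?c n x ^ p))" using 1 eq by simp
  with 2 show ?thesis by linarith
 qed
 have lim: "AE x in torus. (\<lambda>n. ?c n x) ~~> \<eta> x"
 proof (rule AE_I2)
  fix x
  obtain N where N: "\<bar>\<eta> x\<bar> \<le> real N" using real_arch_simple by blast
  have "\<forall>\<^sub>F n in sequentially. ?c n x = \<eta> x"
   using eventually_ge_at_top[of N]
  proof eventually_elim
   case (elim n)
   then have "\<bar>\<eta> x\<bar> \<le> real n" using N by (meson of_nat_mono order_trans)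
   then show ?case unfolding clip_def by linarith
  qed
  then show "(\<lambda>n. ?c n x) ~~> \<eta> x" by (rule tendsto_eventually)
 qed
 note F = even_power_Fatou[OF p(1) cm ci ELpD(3)[OF e2] lim le]
 show "\<eta> \<in> ELp p" by (rule ELpI[OF ELpD(1,2)[OF e2] F(1)])
 show "(avg x. \<eta> x ^ p) \<le> (avg x. \<xi> x ^ p)" by (rule F(2))
qed

lemma weak_solution_n2: "weak_eq \<tau> \<xi> \<eta> ==> \<xi> \<in> \<E> ==> \<eta> \<in> \<E> ==> n2 \<eta> \<le> n2 \<xi>"
 unfolding n2_def using weak_solution_Lp(2)[of \<tau> \<xi> \<eta> 2] zero_mean_L2D(1)[of \<xi>] by simp

text \<open>For a fixed velocity the equation is linear; the difference of two solutions has zero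
  data, and the L^2 bound annihilates it.\<close>

lemma weak_solution_unique:
 assumes w: "weak_eq \<tau> \<xi> \<eta>" "weak_eq \<tau> \<xi> \<eta>'" and E: "\<xi> \<in> \<E>" "\<eta> \<in> \<E>" "\<eta>' \<in> \<E>"
 shows "n2 (\<eta> -. \<eta>') = 0"
proof -
 have z: "(\<lambda>x. 0) \<in> \<E>" by (simp add: zero_mean_L2_iff ELp_const)
 have "weak_eq \<tau> (\<lambda>x. 0) (\<eta> -. \<eta>')"
  unfolding weak_eq_def
 proof
  fix j assume j: "j \<in> Z0"
  note e = zero_mean_L2D(1)[OF E(2)] zero_mean_L2D(1)[OF E(3)]
  have "ip (adv (eb j)) (\<eta> -. \<eta>') = ip (adv (eb j)) \<eta> - ip (adv (eb j)) \<eta>'"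
   unfolding L2_inner_commute[of "adv _"] by (intro L2_inner_diff_left e adv_ELp2 e_basis_TP)
  moreover have "ip (\<eta> -. \<eta>') (eb j) = ip \<eta> (eb j) - ip \<eta>' (eb j)"
   by (intro L2_inner_diff_left e TP_ELp e_basis_TP)
  moreover have "ip (\<lambda>x. 0) (eb j) = 0" by (simp add: L2_inner_def)
  ultimately show "ip (\<eta> -. \<eta>') (eb j) = ip (\<lambda>x. 0) (eb j) + \<tau> * ip (adv (eb j)) (\<eta> -. \<eta>')"
   using w[unfolded weak_eq_def, THEN bspec, OF j] by algebra
 qed
 from weak_solution_n2[OF this z zero_mean_diff[OF E(2,3)]]
 have "n2 (\<eta> -. \<eta>') \<le> n2 (\<lambda>x. 0)" .
 moreover have "n2 (\<lambda>x. 0) = 0" by (simp add: n2_def)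
 ultimately show ?thesis using n2_nonneg[of "\<lambda>x. \<eta> x - \<eta>' x"] by linarith
qed

end

section \<open>Existence by the Galerkin method\<close>

lemma weak_compactness_ex:
 assumes F: "\<And>n. F n \<in> \<E>" and C: "\<And>n. n2 (F n) \<le> C"
 shows "\<exists>(r :: nat => nat) f. strict_mono r \<and> f \<in> \<E> \<and> n2 f \<le> C \<and>
  (\<forall>g\<in>ELp 2. (\<lambda>n. ip (F (r n)) g) ~~> ip f g)"
proof (rule weak_compactness[OF F C])
 fix r :: "nat => nat" and f
 assume "strict_mono r" "f \<in> \<E>" "n2 f \<le> C" "\<And>g. g \<in> ELp 2 ==> (\<lambda>n. ip (F (r n)) g) ~~> ip f g"
 then show ?thesis by (intro exI[of _ r] exI[of _ f] conjI ballI)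
qed

text \<open>Elimination of one unknown at a time: the Schur complement inherits positivity of the
  quadratic form. The formulation covers nonsymmetric matrices such as the identity plus a skew
  part.\<close>

lemma pos_def_solvable:
 fixes A :: "'i => 'i => real"
 assumes "finite I" "\<And>y. \<exists>i\<in>I. y i \<noteq> 0 ==> 0 < (\<Sum>i\<in>I. y i * (\<Sum>j\<in>I. A i j * y j))"
 shows "\<exists>y. \<forall>i\<in>I. (\<Sum>j\<in>I. A i j * y j) = b i"
 using assms
proof (induction I arbitrary: A b rule: finite_induct)
 case (insert s I)
 have ass: "0 < A s s"
 proof -
  have "0 < (\<Sum>i\<in>insert s I. (if i = s then 1 else 0) * (\<Sum>j\<in>insert s I. A i j * (if j = s then 1 else 0)))"
   by (rule insert.prems) simp
  also have "\<dots> = A s s"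
  proof -
   have "(\<Sum>j\<in>I. A i j * (if j = s then 1 else 0)) = 0" for i
    using insert.hyps by (intro sum.neutral) auto
   moreover have "(\<Sum>i\<in>I. (if i = s then 1 else 0) * c i) = 0" for c :: "'i => real"
    using insert.hyps by (intro sum.neutral) auto
   ultimately show ?thesis using insert.hyps by simp
  qed
  finally show ?thesis .
 qed
 define A' where "A' i j = A i j - A i s * A s j / A s s" for i j
 have ex: "\<exists>y. \<forall>i\<in>I. (\<Sum>j\<in>I. A' i j * y j) = b i - A i s * b s / A s s"
 proof (rule insert.IH)
  fix y :: "'i => real" assume y: "\<exists>i\<in>I. y i \<noteq> 0"
  define r where "r = (\<Sum>j\<in>I. A s j * y j)"
  \<comment> \<open>The value at s solves the eliminated row with right-hand side 0, so the
    quadratic form of A at z equals that of \<open>A'\<close> at y.\<close>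
  define z where "z = y(s := - r / A s s)"
  have zI: "(\<Sum>j\<in>I. A i j * z j) = (\<Sum>j\<in>I. A i j * y j)" for i
   using insert.hyps by (intro sum.cong) (auto simp: z_def)
  have "0 < (\<Sum>i\<in>insert s I. z i * (\<Sum>j\<in>insert s I. A i j * z j))"
   by (rule insert.prems) (use y insert.hyps in \<open>auto simp: z_def\<close>)
  also have "\<dots> = z s * (A s s * z s + r) + (\<Sum>i\<in>I. z i * (A i s * z s + (\<Sum>j\<in>I. A i j * y j)))"
   using insert.hyps by (simp add: zI r_def)
  also have "A s s * z s + r = 0" using ass by (simp add: z_def)
  also have "(\<Sum>i\<in>I. z i * (A i s * z s + (\<Sum>j\<in>I. A i j * y j))) = (\<Sum>i\<in>I. y i * (\<Sum>j\<in>I. A' i j * y j))"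
  proof (intro sum.cong refl)
   fix i assume i: "i \<in> I"
   have "(\<Sum>j\<in>I. A' i j * y j) = (\<Sum>j\<in>I. A i j * y j - (A i s / A s s) * (A s j * y j))"
    by (intro sum.cong refl) (simp add: A'_def algebra_simps)
   also have "\<dots> = (\<Sum>j\<in>I. A i j * y j) - (A i s / A s s) * r" by (simp add: sum_subtractf sum_distrib_left r_def)
   finally have "(\<Sum>j\<in>I. A' i j * y j) = A i s * z s + (\<Sum>j\<in>I. A i j * y j)" by (simp add: z_def)
   moreover have "z i = y i" using i insert.hyps by (auto simp: z_def)
   ultimately show "z i * (A i s * z s + (\<Sum>j\<in>I. A i j * y j)) = y i * (\<Sum>j\<in>I. A' i j * y j)" by simp
  qed
  finally show "0 < (\<Sum>i\<in>I. y i * (\<Sum>j\<in>I. A' i j * y j))" by simp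
 qed
 then obtain y where y: "\<And>i. i \<in> I ==> (\<Sum>j\<in>I. A' i j * y j) = b i - A i s * b s / A s s" by blast
 define r where "r = (\<Sum>j\<in>I. A s j * y j)"
 define z where "z = y(s := (b s - r) / A s s)"
 have zI: "(\<Sum>j\<in>I. A i j * z j) = (\<Sum>j\<in>I. A i j * y j)" for i
  using insert.hyps by (intro sum.cong) (auto simp: z_def)
 show ?case
 proof (intro exI[of _ z] ballI)
  fix i assume i: "i \<in> insert s I"
  have e: "(\<Sum>j\<in>insert s I. A i j * z j) = A i s * ((b s - r) / A s s) + (\<Sum>j\<in>I. A i j * y j)"
   unfolding sum.insert[OF insert.hyps] zI by (simp add: z_def)
  from i consider "i = s" | "i \<in> I" by blast
  then show "(\<Sum>j\<in>insert s I. A i j * z j) = b i"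
  proof cases
   case 1 then show ?thesis unfolding e using ass by (simp add: r_def[symmetric])
  next
   case 2
   have "(\<Sum>j\<in>I. A' i j * y j) = (\<Sum>j\<in>I. A i j * y j - (A i s / A s s) * (A s j * y j))"
    by (intro sum.cong refl) (simp add: A'_def algebra_simps)
   also have "\<dots> = (\<Sum>j\<in>I. A i j * y j) - (A i s / A s s) * r" by (simp add: sum_subtractf sum_distrib_left r_def)
   finally have "(\<Sum>j\<in>I. A i j * y j) = b i - A i s * b s / A s s + (A i s / A s s) * r" using y[OF 2] by linarith
   then show ?thesis unfolding e by (simp add: algebra_simps diff_divide_distrib)
  qed
 qed
qed simp

context vfield begin

text \<open>The advection matrix is skew, so the quadratic form of the system is the plain sum of
  squares. Pairing the system with its own solution also gives the norm bound.\<close>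

lemma Galerkin:
 assumes \<xi>: "\<xi> \<in> \<E>"
 shows "\<exists>\<eta>. \<eta> \<in> \<E> \<and> n2 \<eta> \<le> n2 \<xi> \<and>
  (\<forall>j\<in>fbox N. ip \<eta> (eb j) = ip \<xi> (eb j) + \<tau> * ip (adv (eb j)) \<eta>)"
proof -
 note x2 = zero_mean_L2D(1)[OF \<xi>]
 let ?I = "fbox N" and ?x = "\<lambda>j. ip \<xi> (eb j)"
 define B where "B j k = ip (adv (eb j)) (eb k)" for j k
 have anti: "B j k = - B k j" for j k unfolding B_def by (rule adv_antisym[OF e_basis_TP e_basis_TP])
 define A where "A j k = (if j = k then 1 else 0) - \<tau> * B j k" for j k
 have row: "(\<Sum>k\<in>?I. A j k * y k) = y j - \<tau> * (\<Sum>k\<in>?I. y k * B j k)" if j: "j \<in> ?I" for j y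
 proof -
  have "(\<Sum>k\<in>?I. A j k * y k) = (\<Sum>k\<in>?I. (if j = k then y k else 0) - \<tau> * (y k * B j k))"
   by (intro sum.cong refl) (simp add: A_def algebra_simps)
  then show ?thesis using j fbox_finite by (simp add: sum_subtractf sum_distrib_left)
 qed
 have q: "(\<Sum>j\<in>?I. y j * (\<Sum>k\<in>?I. A j k * y k)) = (\<Sum>j\<in>?I. (y j)^2)" for y
 proof -
  have "(\<Sum>j\<in>?I. y j * (\<Sum>k\<in>?I. y k * B j k)) = (\<Sum>j\<in>?I. \<Sum>k\<in>?I. y j * y k * B j k)"
   by (simp add: sum_distrib_left mult.assoc)
  moreover have "(\<Sum>j\<in>?I. \<Sum>k\<in>?I. y j * y k * B j k) = (\<Sum>k\<in>?I. \<Sum>j\<in>?I. y j * y k * B j k)" by (rule sum.swap)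
  moreover have "(\<Sum>k\<in>?I. \<Sum>j\<in>?I. y j * y k * B j k) = - (\<Sum>k\<in>?I. \<Sum>j\<in>?I. y k * y j * B k j)"
   unfolding sum_negf[symmetric] by (intro sum.cong refl) (subst anti, simp add: mult_ac)
  ultimately have z: "(\<Sum>j\<in>?I. y j * (\<Sum>k\<in>?I. y k * B j k)) = 0" by linarith
  have "(\<Sum>j\<in>?I. y j * (\<Sum>k\<in>?I. A j k * y k)) = (\<Sum>j\<in>?I. (y j)^2 - \<tau> * (y j * (\<Sum>k\<in>?I. y k * B j k)))"
   by (intro sum.cong refl) (simp only: row, simp add: algebra_simps power2_eq_square)
  then show ?thesis by (simp add: sum_subtractf sum_distrib_left[symmetric] z)
 qed
 obtain y where y: "\<And>j. j \<in> ?I ==> (\<Sum>k\<in>?I. A j k * y k) = ?x j"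
 proof -
  have "\<exists>y. \<forall>j\<in>?I. (\<Sum>k\<in>?I. A j k * y k) = ?x j"
  proof (rule pos_def_solvable[OF fbox_finite])
   fix y :: "int \<times> int => real" assume "\<exists>i\<in>?I. y i \<noteq> 0"
   then obtain i where i: "i \<in> ?I" "y i \<noteq> 0" by blast
   then show "0 < (\<Sum>i\<in>?I. y i * (\<Sum>j\<in>?I. A i j * y j))"
    unfolding q by (intro sum_pos2[OF fbox_finite i(1)]) auto
  qed
  then show thesis using that by blast
 qed
 define \<eta> where "\<eta> = (\<lambda>x. \<Sum>k\<in>?I. y k * eb k x)"
 have eE: "\<eta> \<in> \<E>" unfolding \<eta>_def by (rule e_sum_zero_mean[OF fbox_finite fbox_Z0])
 have eq: "ip \<eta> (eb j) = ?x j + \<tau> * ip (adv (eb j)) \<eta>" if j: "j \<in> ?I" for j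
 proof -
  have "ip \<eta> (eb j) = y j"
   unfolding \<eta>_def using L2_inner_e_sum[OF fbox_finite fbox_Z0 subsetD[OF fbox_Z0 j], of y] j by simp
  moreover have "ip (adv (eb j)) \<eta> = (\<Sum>k\<in>?I. y k * B j k)"
   unfolding B_def \<eta>_def
   by (subst L2_inner_commute) (rule L2_inner_e_sum2[OF fbox_finite fbox_Z0 adv_ELp2[OF e_basis_TP]])
  ultimately show ?thesis using y[OF j] row[OF j] by simp
 qed
 have "(n2 \<eta>)^2 = (\<Sum>j\<in>?I. (y j)^2)" unfolding \<eta>_def by (rule e_sum_norm[OF fbox_finite fbox_Z0])
 also have "\<dots> = (\<Sum>j\<in>?I. y j * ?x j)" unfolding q[symmetric] by (intro sum.cong refl) (simp only: y)
 also have "\<dots> = ip \<eta> \<xi>" unfolding \<eta>_def by (rule L2_inner_e_sum2[OF fbox_finite fbox_Z0 x2, symmetric])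
 also have "\<dots> \<le> n2 \<eta> * n2 \<xi>" using L2_inner_le[OF zero_mean_L2D(1)[OF eE] x2] by linarith
 finally have "n2 \<eta> * n2 \<eta> \<le> n2 \<eta> * n2 \<xi>" by (simp add: power2_eq_square)
 then have "n2 \<eta> \<le> n2 \<xi>" using n2_nonneg[of \<eta>] n2_nonneg[of \<xi>] by (cases "n2 \<eta> = 0") (auto simp: mult_le_cancel_left)
 with eE eq show ?thesis by (intro exI[of _ \<eta>] conjI ballI)
qed

text \<open>Each mode lies in all large boxes, so its Galerkin equation holds eventually; this
  equation is linear in the weakly convergent solutions.\<close>

lemma weak_solution_exists:
 assumes \<xi>: "\<xi> \<in> \<E>" shows "\<exists>\<eta>\<in>\<E>. weak_eq \<tau> \<xi> \<eta>"
proof -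
 obtain h where h0: "\<forall>N. h N \<in> \<E> \<and> n2 (h N) \<le> n2 \<xi> \<and>
  (\<forall>j\<in>fbox N. ip (h N) (eb j) = ip \<xi> (eb j) + \<tau> * ip (adv (eb j)) (h N))"
 proof -
  have "\<forall>N. \<exists>\<eta>. \<eta> \<in> \<E> \<and> n2 \<eta> \<le> n2 \<xi> \<and>
   (\<forall>j\<in>fbox N. ip \<eta> (eb j) = ip \<xi> (eb j) + \<tau> * ip (adv (eb j)) \<eta>)"
   by (rule allI) (rule Galerkin[OF \<xi>])
  from choice[OF this] show thesis using that by (rule exE)
 qed
 have h: "h N \<in> \<E>" "n2 (h N) \<le> n2 \<xi>" for N using h0 by simp_all
 have h3: "ip (h N) (eb j) = ip \<xi> (eb j) + \<tau> * ip (adv (eb j)) (h N)" if "j \<in> fbox N" for j N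
  using h0[rule_format, of N] that by blast
 obtain r :: "nat => nat" and \<eta> where r: "strict_mono r" "\<eta> \<in> \<E>" "n2 \<eta> \<le> n2 \<xi>"
  and r4: "\<forall>g\<in>ELp 2. (\<lambda>n. ip (h (r n)) g) ~~> ip \<eta> g"
  using weak_compactness_ex[of h, OF h] by blast
 have "weak_eq \<tau> \<xi> \<eta>"
  unfolding weak_eq_def
 proof
  fix j assume j: "j \<in> Z0"
  obtain N where N: "{j} \<subseteq> fbox N" using fbox_exhaust[of "{j}"] j by auto
  have "(\<lambda>n. ip (h (r n)) (eb j) - \<tau> * ip (h (r n)) (adv (eb j)))
    ~~> ip \<eta> (eb j) - \<tau> * ip \<eta> (adv (eb j))"
   by (intro tendsto_intros r4[rule_format] TP_ELp e_basis_TP adv_ELp2)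
  moreover have "(\<lambda>n. ip (h (r n)) (eb j) - \<tau> * ip (h (r n)) (adv (eb j))) ~~> ip \<xi> (eb j)"
  proof (rule tendsto_eventually, use eventually_ge_at_top[of N] in eventually_elim)
   case (elim n)
   have "N \<le> r n" using elim seq_suble[OF r(1), of n] by simp
   then have "j \<in> fbox (r n)" using N fbox_mono[of N "r n"] by auto
   from h3[OF this] show "ip (h (r n)) (eb j) - \<tau> * ip (h (r n)) (adv (eb j)) = ip \<xi> (eb j)"
    by (simp add: L2_inner_commute[of "adv _"])
  qed
  ultimately have "ip \<eta> (eb j) - \<tau> * ip \<eta> (adv (eb j)) = ip \<xi> (eb j)"
   by (rule LIMSEQ_unique)
  then show "ip \<eta> (eb j) = ip \<xi> (eb j) + \<tau> * ip (adv (eb j)) \<eta>"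
   by (simp add: L2_inner_commute[of "adv _"])
 qed
 with r(2) show ?thesis by blast
qed

end

section \<open>The step equation tested with functions from W^{1,4}\<close>

lemma TP_weak_gradient:
 assumes f: "f \<in> TP" shows "in_W1p_grad 4 f (grad f)"
proof -
 have L4: "Lp_space 4 = ELp 4" using Lp_space_even[of 4] by simp
 have q: "(\<lambda>x. fst (grad g x)) = pd1 g" "(\<lambda>x. snd (grad g x)) = pd2 g" for g by (simp_all add: pd1_def[abs_def] pd2_def[abs_def])
 show ?thesis
  unfolding in_W1p_grad_def weak_gradient_def L4 q
  by (intro conjI allI impI TP_ELp f TP_pd1 TP_pd2 integration_by_parts)
qed

lemma n2_mult4:
 assumes f: "f \<in> ELp 4" and g: "g \<in> ELp 4"
 shows "n2 (\<lambda>x. f x * g x) \<le> sqrt (sqrt (avg x. f x ^ 4)) * sqrt (sqrt (avg x. g x ^ 4))"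
proof -
 have 1: "(\<lambda>x. (f x)^2) \<in> borel_measurable torus" "integrable torus (\<lambda>x. ((f x)^2)^2)"
  and 2: "(\<lambda>x. (g x)^2) \<in> borel_measurable torus" "integrable torus (\<lambda>x. ((g x)^2)^2)"
  using ELpD[OF f] ELpD[OF g] by simp_all
 have "\<bar>(avg x. (f x)^2 * (g x)^2)\<bar> \<le> sqrt (avg x. ((f x)^2)^2) * sqrt (avg x. ((g x)^2)^2)"
  by (rule Cauchy_Schwarz_abs(2)[OF 1 2])
 then have "(avg x. (f x * g x)^2) \<le> sqrt (avg x. f x ^ 4) * sqrt (avg x. g x ^ 4)"
  by (simp add: power_mult_distrib)
 then show ?thesis unfolding n2_def real_sqrt_mult[symmetric] by (rule real_sqrt_le_mono)
qed

lemma bs_vfield: "\<xi> \<in> \<E> ==> vfield (bs1 \<xi>) (bs2 \<xi>) (n2 \<xi>)"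
 by (intro vfield.intro bs_H1 bs_div)

abbreviation badv :: "tfun => tfun => tfun" where
 "badv \<xi> \<equiv> vfield.adv (bs1 \<xi>) (bs2 \<xi>)"

abbreviation bweak :: "real => tfun => tfun => bool" where
 "bweak \<tau> \<xi> \<equiv> vfield.weak_eq (bs1 \<xi>) (bs2 \<xi>) \<tau> \<xi>"

lemma badv_eq: "\<xi> \<in> \<E> ==> badv \<xi> \<phi> x = bs1 \<xi> x * pd1 \<phi> x + bs2 \<xi> x * pd2 \<phi> x"
 by (rule vfield.adv_def[OF bs_vfield])

text \<open>One direction tests with the modes. For the other, \<zeta> is mollified: its gradient
  becomes the mollified weak gradient and converges in L^4; multiplied by the velocity, which lies
  in L^4, it converges in L^2.\<close>

lemma is_Phi_iff:
 assumes \<xi>: "\<xi> \<in> \<E>" shows "is_Phi \<tau> \<xi> \<eta> \<longleftrightarrow> \<eta> \<in> \<E> \<and> bweak \<tau> \<xi> \<eta>"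
proof
 note V = bs_vfield[OF \<xi>]
 have inn: "biot_savart \<xi> x \<bullet> g = bs1 \<xi> x * fst g + bs2 \<xi> x * snd g" for x g
  by (simp add: inner_prod_def bs1_def bs2_def)
 assume P: "is_Phi \<tau> \<xi> \<eta>"
 show "\<eta> \<in> \<E> \<and> bweak \<tau> \<xi> \<eta>"
  unfolding vfield.weak_eq_def[OF V]
 proof (intro conjI ballI)
  show "\<eta> \<in> \<E>" using P by (simp add: is_Phi_def)
  fix j assume j: "j \<in> Z0"
  have "eb j \<in> \<E>" by (simp add: zero_mean_L2_iff TP_ELp e_basis_zero_mean[OF j])
  then have "ip \<eta> (eb j) = ip \<xi> (eb j) + \<tau> * ip (\<lambda>x. biot_savart \<xi> x \<bullet> grad (eb j) x) \<eta>"
   using P TP_weak_gradient[OF e_basis_TP[of j]] unfolding is_Phi_def by blast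
  then show "ip \<eta> (eb j) = ip \<xi> (eb j) + \<tau> * ip (badv \<xi> (eb j)) \<eta>"
   unfolding inn pd1_def[symmetric] pd2_def[symmetric] badv_eq[OF \<xi>, abs_def] .
 qed
next
 note V = bs_vfield[OF \<xi>]
 have inn: "biot_savart \<xi> x \<bullet> g = bs1 \<xi> x * fst g + bs2 \<xi> x * snd g" for x g
  by (simp add: inner_prod_def bs1_def bs2_def)
 assume "\<eta> \<in> \<E> \<and> bweak \<tau> \<xi> \<eta>"
 then have \<eta>: "\<eta> \<in> \<E>" and w: "bweak \<tau> \<xi> \<eta>" by auto
 note x2 = zero_mean_L2D(1)[OF \<xi>] and e2 = zero_mean_L2D(1)[OF \<eta>]
 show "is_Phi \<tau> \<xi> \<eta>"
  unfolding is_Phi_def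
 proof (intro conjI allI impI \<eta>)
  fix \<zeta> g assume "\<zeta> \<in> \<E> \<and> in_W1p_grad 4 \<zeta> g"
  then have z: "\<zeta> \<in> \<E>" and W: "in_W1p_grad 4 \<zeta> g" by auto
  note z2 = zero_mean_L2D(1)[OF z]
  let ?g1 = "\<lambda>x. fst (g x)" and ?g2 = "\<lambda>x. snd (g x)"
  have L4: "Lp_space 4 = ELp 4" using Lp_space_even[of 4] by simp
  have g4: "?g1 \<in> ELp 4" "?g2 \<in> ELp 4" using W L4 by (auto simp: in_W1p_grad_def)
  have wg: "ip \<zeta> (pd1 \<phi>) = - ip ?g1 \<phi>" "ip \<zeta> (pd2 \<phi>) = - ip ?g2 \<phi>" if "\<phi> \<in> TP" for \<phi>
   using W TP_test[OF that] unfolding in_W1p_grad_def weak_gradient_def pd1_def[abs_def] pd2_def[abs_def] by blast+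
  let ?z = "\<lambda>n. conv (ker n) \<zeta>"
  have T: "?z n \<in> TP" for n by (rule conv_TP[OF ker_TP ELp2_integrable[OF z2]])
  have pd: "pd1 (?z n) = conv (ker n) ?g1" "pd2 (?z n) = conv (ker n) ?g2" for n
  proof -
   have "conv (pd1 (ker n)) \<zeta> x = conv (ker n) ?g1 x" "conv (pd2 (ker n)) \<zeta> x = conv (ker n) ?g2 x" for x
    using wg[OF TP_reflect[OF ker_TP[of n]], of x, unfolded pd_reflect[OF ker_TP]] by (simp_all add: conv_def L2_inner_def mult.commute)
   then show "pd1 (?z n) = conv (ker n) ?g1" "pd2 (?z n) = conv (ker n) ?g2"
    unfolding pd_conv[OF ker_TP ELp2_integrable[OF z2]] by auto
  qed
  define U where "U x = bs1 \<xi> x * ?g1 x + bs2 \<xi> x * ?g2 x" for x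
  have UE: "U \<in> ELp 2" unfolding U_def[abs_def] by (intro ELp_add ELp_mult4 bs_ELp4[OF \<xi>] g4) simp
  have aE: "badv \<xi> (?z n) \<in> ELp 2" for n by (rule vfield.adv_ELp2[OF V T])
  have c4: "conv (ker n) h \<in> ELp 4" if "h \<in> ELp 4" for n h
   by (rule TP_ELp[OF conv_TP[OF ker_TP ELp_integrable[OF that]]]) simp_all
  have lim: "(\<lambda>n. n2 (badv \<xi> (?z n) -. U)) ~~> 0"
  proof (rule tendsto_sandwich[OF _ _ tendsto_const])
   let ?s = "\<lambda>f. sqrt (sqrt (avg x. f x ^ 4))"
   let ?d1 = "\<lambda>n x. conv (ker n) ?g1 x - ?g1 x" and ?d2 = "\<lambda>n x. conv (ker n) ?g2 x - ?g2 x"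
   have "(\<lambda>n. ?s (bs1 \<xi>) * ?s (?d1 n) + ?s (bs2 \<xi>) * ?s (?d2 n)) ~~> ?s (bs1 \<xi>) * sqrt (sqrt 0) + ?s (bs2 \<xi>) * sqrt (sqrt 0)"
    by (intro tendsto_intros conv_ker_tendsto g4) simp_all
   then show "(\<lambda>n. ?s (bs1 \<xi>) * ?s (?d1 n) + ?s (bs2 \<xi>) * ?s (?d2 n)) ~~> 0" by simp
   show "\<forall>\<^sub>F n in sequentially. n2 (badv \<xi> (?z n) -. U) \<le> ?s (bs1 \<xi>) * ?s (?d1 n) + ?s (bs2 \<xi>) * ?s (?d2 n)"
   proof (intro always_eventually allI)
    fix n
    have d: "?d1 n \<in> ELp 4" "?d2 n \<in> ELp 4" by (intro ELp_diff c4 g4; simp)+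
    have "(badv \<xi> (?z n) -. U) = (\<lambda>x. bs1 \<xi> x * ?d1 n x + bs2 \<xi> x * ?d2 n x)"
     unfolding badv_eq[OF \<xi>] pd U_def by (rule ext) (simp add: algebra_simps)
    then have "n2 (badv \<xi> (?z n) -. U) \<le> n2 (\<lambda>x. bs1 \<xi> x * ?d1 n x) + n2 (\<lambda>x. bs2 \<xi> x * ?d2 n x)"
     using n2_triangle[OF ELp_mult4[OF bs_ELp4(1)[OF \<xi>] d(1)] ELp_mult4[OF bs_ELp4(2)[OF \<xi>] d(2)]] by simp
    also have "\<dots> \<le> ?s (bs1 \<xi>) * ?s (?d1 n) + ?s (bs2 \<xi>) * ?s (?d2 n)"
     by (intro add_mono n2_mult4 bs_ELp4[OF \<xi>] d)
    finally show "n2 (badv \<xi> (?z n) -. U) \<le> ?s (bs1 \<xi>) * ?s (?d1 n) + ?s (bs2 \<xi>) * ?s (?d2 n)" .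
   qed
  qed simp
  have zl: "(\<lambda>n. ip (?z n) h) ~~> ip \<zeta> h" if "h \<in> ELp 2" for h
   by (rule tendsto_L2_inner[OF TP_ELp[OF T] z2 conv_ker_n2[OF z2] that])
  have lim2: "(\<lambda>n. ip (?z n) \<xi> + \<tau> * ip (badv \<xi> (?z n)) \<eta>) ~~> ip \<zeta> \<xi> + \<tau> * ip U \<eta>"
   by (intro tendsto_intros zl x2 tendsto_L2_inner[OF aE UE lim e2])
  have eqn: "ip (?z n) \<eta> = ip (?z n) \<xi> + \<tau> * ip (badv \<xi> (?z n)) \<eta>" for n
   using vfield.weak_eq_TP[OF V w \<xi> \<eta> T] by (simp add: L2_inner_commute[of "?z n"])
  from LIMSEQ_unique[OF zl[OF e2, unfolded eqn] lim2]
  show "ip \<eta> \<zeta> = ip \<xi> \<zeta> + \<tau> * ip (\<lambda>x. biot_savart \<xi> x \<bullet> g x) \<eta>"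
   unfolding inn U_def[abs_def] by (simp only: L2_inner_commute[of \<zeta>])
 qed
qed

section \<open>Properties of the solution operator\<close>

lemma Phi_is_Phi:
 assumes \<xi>: "\<xi> \<in> \<E>" shows "Phi \<tau> \<xi> \<in> \<E>" "bweak \<tau> \<xi> (Phi \<tau> \<xi>)"
proof -
 have "\<exists>\<eta>. is_Phi \<tau> \<xi> \<eta>"
  using vfield.weak_solution_exists[OF bs_vfield[OF \<xi>] \<xi>, of \<tau>] is_Phi_iff[OF \<xi>] by blast
 then have "is_Phi \<tau> \<xi> (Phi \<tau> \<xi>)" unfolding Phi_def by (rule someI_ex)
 then show "Phi \<tau> \<xi> \<in> \<E>" "bweak \<tau> \<xi> (Phi \<tau> \<xi>)" using is_Phi_iff[OF \<xi>] by auto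
qed

lemma Phi_Lp:
 assumes "\<xi> \<in> \<E>" "even p" "2 \<le> p" "\<xi> \<in> ELp p"
 shows "Phi \<tau> \<xi> \<in> ELp p" "(avg x. Phi \<tau> \<xi> x ^ p) \<le> (avg x. \<xi> x ^ p)"
 using vfield.weak_solution_Lp[OF bs_vfield[OF assms(1)] Phi_is_Phi(2)[OF assms(1)] assms(1) Phi_is_Phi(1)[OF assms(1)] assms(2-4)] by auto

lemma Phi_n2: "\<xi> \<in> \<E> ==> n2 (Phi \<tau> \<xi>) \<le> n2 \<xi>"
 by (rule vfield.weak_solution_n2[OF bs_vfield Phi_is_Phi(2)]) (simp_all add: Phi_is_Phi(1))

lemma tendsto_subsequence_principle:
 fixes X :: "nat => real"
 assumes "\<And>r :: nat => nat. strict_mono r ==> \<exists>s :: nat => nat. strict_mono s \<and> (\<lambda>n. X (r (s n))) ~~> L"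
 shows "X ~~> L"
proof (rule ccontr)
 assume "\<not> X ~~> L"
 then have "\<exists>e>0. \<forall>N. \<exists>n\<ge>N. e \<le> \<bar>X n - L\<bar>"
  unfolding LIMSEQ_iff real_norm_def not_all not_ex not_imp not_less by blast
 then obtain e where e: "0 < e" "\<forall>N. \<exists>n\<ge>N. e \<le> \<bar>X n - L\<bar>" by blast
 have "infinite {n. e \<le> \<bar>X n - L\<bar>}" unfolding infinite_nat_iff_unbounded_le mem_Collect_eq by (rule e(2))
 from infinite_enumerate[OF this] obtain r :: "nat => nat" where r: "strict_mono r" "\<forall>n. r n \<in> {n. e \<le> \<bar>X n - L\<bar>}" by blast
 obtain s where "(\<lambda>n. X (r (s n))) ~~> L" using assms[OF r(1)] by blast
 from LIMSEQ_D[OF this e(1)] obtain N where "\<forall>n\<ge>N. \<bar>X (r (s n)) - L\<bar> < e" by auto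
 then have "\<bar>X (r (s N)) - L\<bar> < e" by blast
 moreover have "e \<le> \<bar>X (r (s N)) - L\<bar>" using r(2) by simp
 ultimately show False by simp
qed

lemma n2_mult_TP:
 assumes f: "f \<in> ELp 2" and W: "W \<in> TP" "\<And>x. \<bar>W x\<bar> \<le> B" shows "n2 (\<lambda>x. f x * W x) \<le> B * n2 f"
proof (rule power2_le_imp_le)
 have B: "0 \<le> B" using W(2)[of 0] by linarith
 then show "0 \<le> B * n2 f" by simp
 have "(avg x. (f x * W x)^2) \<le> (avg x. B\<^sup>2 * (f x)^2)"
 proof (rule integral_mono)
  show "integrable torus (\<lambda>x. (f x * W x)^2)" by (rule ELpD(4)[OF ELp2_mult_TP[OF f W(1)]])
  show "integrable torus (\<lambda>x. B\<^sup>2 * (f x)^2)" using ELpD(4)[OF f] by simp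
  fix x
  have "(W x)^2 \<le> B^2" using power_mono[OF W(2)[of x], of 2] by simp
  then show "(f x * W x)^2 \<le> B^2 * (f x)^2" unfolding power_mult_distrib mult.commute[of "(f x)^2"] by (rule mult_right_mono) simp
 qed
 then show "(n2 (\<lambda>x. f x * W x))^2 \<le> (B * n2 f)^2" unfolding power_mult_distrib n2_sq by simp
qed

text \<open>Continuity from the norm to the weak topology. Every subsequence has a further one along
  which the solutions converge weakly; the velocities converge in norm, so the limit solves the
  limiting equation, and uniqueness identifies it with the chosen solution up to a null set.\<close>

lemma Phi_continuous:
 assumes X: "\<And>n. X n \<in> \<E>" and \<xi>: "\<xi> \<in> \<E>" and lim: "(\<lambda>n. n2 (X n -. \<xi>)) ~~> 0" and g: "g \<in> ELp 2"
 shows "(\<lambda>n. ip (Phi \<tau> (X n)) g) ~~> ip (Phi \<tau> \<xi>) g"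
proof (rule tendsto_subsequence_principle)
 fix r :: "nat => nat" assume r: "strict_mono r"
 note x2 = zero_mean_L2D(1)[OF \<xi>] and X2 = zero_mean_L2D(1)[OF X]
 have E: "eb j \<in> ELp 2" for j by (rule TP_ELp[OF e_basis_TP])
 obtain D where D': "\<forall>n. norm (n2 (X n -. \<xi>)) \<le> D"
  using convergent_imp_Bseq[OF convergentI[OF lim]] unfolding Bseq_def by blast
 then have D: "n2 (X n -. \<xi>) \<le> D" for n by simp
 have b: "n2 (Phi \<tau> (X (r n))) \<le> D + n2 \<xi>" for n
  using Phi_n2[OF X, of \<tau> "r n"] n2_triangle[OF ELp_diff[OF X2 x2] x2, of "r n"] D[of "r n"] by simp
 obtain s :: "nat => nat" and \<eta> where s: "strict_mono s" "\<eta> \<in> \<E>" "n2 \<eta> \<le> D + n2 \<xi>"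
  and s4: "\<forall>g\<in>ELp 2. (\<lambda>n. ip (Phi \<tau> (X (r (s n)))) g) ~~> ip \<eta> g"
  using weak_compactness_ex[of "\<lambda>n. Phi \<tau> (X (r n))", OF Phi_is_Phi(1)[OF X] b] by blast
 let ?q = "\<lambda>n. r (s n)"
 have q: "strict_mono ?q" using strict_mono_o[OF r s(1)] by (simp add: o_def)
 have limq: "(\<lambda>n. n2 (X (?q n) -. \<xi>)) ~~> 0"
  using LIMSEQ_subseq_LIMSEQ[OF lim q] by (simp add: o_def)
 let ?F = "\<lambda>n. Phi \<tau> (X (?q n))"
 note F2 = zero_mean_L2D(1)[OF Phi_is_Phi(1)[OF X]]
 have "bweak \<tau> \<xi> \<eta>"
  unfolding vfield.weak_eq_def[OF bs_vfield[OF \<xi>]]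
 proof
  fix j assume j: "j \<in> Z0"
  let ?B = "\<lambda>n. badv (X (?q n)) (eb j) -. badv \<xi> (eb j)"
  have T: "pd1 (eb j) \<in> TP" "pd2 (eb j) \<in> TP" by (intro TP_pd1 TP_pd2 e_basis_TP)+
  obtain B1 B2 where B: "\<And>x. \<bar>pd1 (eb j) x\<bar> \<le> B1" "\<And>x. \<bar>pd2 (eb j) x\<bar> \<le> B2"
   using TP_bounded[OF T(1)] TP_bounded[OF T(2)] by blast
  have B0: "0 \<le> B1" "0 \<le> B2" using B(1)[of 0] B(2)[of 0] by linarith+
  let ?R = "\<lambda>n. (B1 + B2) * n2 (X (?q n) -. \<xi>) * (D + n2 \<xi>)"
  have aE: "badv \<xi> (eb j) \<in> ELp 2" by (rule vfield.adv_ELp2[OF bs_vfield[OF \<xi>] e_basis_TP])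
  have aXE: "badv (X n) (eb j) \<in> ELp 2" for n by (rule vfield.adv_ELp2[OF bs_vfield[OF X] e_basis_TP])
  \<comment> \<open>The change of velocity is small in norm and is paired with solutions that are
    only bounded.\<close>
  have d: "(\<lambda>n. ip (?B n) (?F n)) ~~> 0"
  proof (rule null_comparison)
   have "(\<lambda>n. ?R n) ~~> (B1 + B2) * 0 * (D + n2 \<xi>)"
    by (intro tendsto_intros limq)
   then show "(\<lambda>n. ?R n) ~~> 0" by simp
   show "norm (ip (?B n) (?F n))
     \<le> ?R n" for n
   proof -
    let ?Y = "X (?q n)"
    have e1: "(bs1 ?Y -. bs1 \<xi>) \<in> ELp 2" by (rule ELp_diff[OF bs_ELp2(1)[OF X] bs_ELp2(1)[OF \<xi>]]) simp
    have e2: "(bs2 ?Y -. bs2 \<xi>) \<in> ELp 2" by (rule ELp_diff[OF bs_ELp2(2)[OF X] bs_ELp2(2)[OF \<xi>]]) simp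
    have "(?B n)
     = (\<lambda>x. (bs1 ?Y x - bs1 \<xi> x) * pd1 (eb j) x + (bs2 ?Y x - bs2 \<xi> x) * pd2 (eb j) x)"
     unfolding badv_eq[OF X] badv_eq[OF \<xi>] by (rule ext) (simp add: algebra_simps)
    then have "n2 (?B n)
      \<le> n2 (\<lambda>x. (bs1 ?Y x - bs1 \<xi> x) * pd1 (eb j) x) + n2 (\<lambda>x. (bs2 ?Y x - bs2 \<xi> x) * pd2 (eb j) x)"
     using n2_triangle[OF ELp2_mult_TP[OF e1 T(1)] ELp2_mult_TP[OF e2 T(2)]] by simp
    also have "\<dots> \<le> B1 * n2 (bs1 ?Y -. bs1 \<xi>) + B2 * n2 (bs2 ?Y -. bs2 \<xi>)"
     by (intro add_mono n2_mult_TP e1 e2 T B)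
    also have "\<dots> \<le> B1 * n2 (?Y -. \<xi>) + B2 * n2 (?Y -. \<xi>)"
     by (intro add_mono mult_left_mono bs_diff_n2 X \<xi> B0)
    finally have le: "n2 (?B n) \<le> (B1 + B2) * n2 (?Y -. \<xi>)"
     by (simp add: distrib_right)
    have "norm (ip (?B n) (?F n))
      \<le> n2 (?B n) * n2 (?F n)"
     unfolding real_norm_def by (rule L2_inner_le[OF ELp_diff[OF aXE aE] F2]) simp
    also have "\<dots> \<le> ?R n"
     by (intro mult_mono le b mult_nonneg_nonneg add_nonneg_nonneg B0 n2_nonneg)
    finally show "norm (ip (?B n) (?F n))
      \<le> ?R n" .
   qed
  qed
  have rhs: "ip (?F n) (eb j) = ip (X (?q n)) (eb j)
    + \<tau> * (ip (?B n) (?F n) + ip (?F n) (badv \<xi> (eb j)))" for n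
  proof -
   have "ip (?B n) (?F n)
     = ip (badv (X (?q n)) (eb j)) (?F n) - ip (badv \<xi> (eb j)) (?F n)"
    by (rule L2_inner_diff_left[OF aXE aE F2])
   then show ?thesis
    using Phi_is_Phi(2)[OF X[of "?q n"], of \<tau>, unfolded vfield.weak_eq_def[OF bs_vfield[OF X]], THEN bspec, OF j]
    unfolding L2_inner_commute[of "?F n" "badv \<xi> _"] by simp
  qed
  have "(\<lambda>n. ip (X (?q n)) (eb j)
    + \<tau> * (ip (?B n) (?F n) + ip (?F n) (badv \<xi> (eb j))))
    ~~> ip \<xi> (eb j) + \<tau> * (0 + ip \<eta> (badv \<xi> (eb j)))"
   by (intro tendsto_intros d s4[rule_format] aE tendsto_L2_inner[OF X2 x2 limq E])
  from LIMSEQ_unique[OF s4[rule_format, OF E[of j], unfolded rhs] this]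
  show "ip \<eta> (eb j) = ip \<xi> (eb j) + \<tau> * ip (badv \<xi> (eb j)) \<eta>"
   by (simp add: L2_inner_commute[of _ "badv \<xi> (eb j)"])
 qed
 from vfield.weak_solution_unique[OF bs_vfield[OF \<xi>] this Phi_is_Phi(2)[OF \<xi>] \<xi> s(2) Phi_is_Phi(1)[OF \<xi>]]
 have n0: "n2 (\<eta> -. Phi \<tau> \<xi>) = 0" .
 note e2 = zero_mean_L2D(1)[OF s(2)] and p2 = zero_mean_L2D(1)[OF Phi_is_Phi(1)[OF \<xi>]]
 have "\<bar>ip \<eta> g - ip (Phi \<tau> \<xi>) g\<bar> \<le> n2 (\<eta> -. Phi \<tau> \<xi>) * n2 g"
  unfolding L2_inner_diff_left[OF e2 p2 g, symmetric] by (rule L2_inner_le[OF ELp_diff[OF e2 p2] g]) simp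
 then have "ip \<eta> g = ip (Phi \<tau> \<xi>) g" using n0 by simp
 then show "\<exists>s :: nat => nat. strict_mono s \<and> (\<lambda>n. ip (Phi \<tau> (X (r (s n)))) g) ~~> ip (Phi \<tau> \<xi>) g"
  using s(1) s4[rule_format, OF g] by auto
qed

section \<open>Lebesgue norms\<close>

context prob_space begin

text \<open>Young's inequality t^q \<le> (q/p) t^p + 1 - q/p gives integrability, and after division
  of f by its L^p norm also the comparison of norms; a vanishing norm is treated separately.\<close>

lemma
 fixes f :: "'a => real"
 assumes f: "f \<in> borel_measurable M" and q: "0 < q" "q \<le> p" and i: "integrable M (\<lambda>x. \<bar>f x\<bar> powr p)"
 shows integrable_powr_mono: "integrable M (\<lambda>x. \<bar>f x\<bar> powr q)"
  and Lyapunov: "expectation (\<lambda>x. \<bar>f x\<bar> powr q) powr (1 / q) \<le> expectation (\<lambda>x. \<bar>f x\<bar> powr p) powr (1 / p)"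
proof -
 have p: "0 < p" using q by linarith
 have young: "t powr q \<le> q / p * t powr p + (1 - q / p)" if t: "0 \<le> t" for t
 proof (cases "t = 0")
  case True then show ?thesis using q p by simp
 next
  case False
  have "(t powr p) powr (q / p) * 1 powr (1 - q / p) \<le> q / p * t powr p + (1 - q / p) * 1"
   by (rule Youngs_inequality_0) (use q p False t in auto)
  then show ?thesis using p by (simp add: powr_powr)
 qed
 show iq: "integrable M (\<lambda>x. \<bar>f x\<bar> powr q)"
 proof (rule integrable_bounded_by)
  show "integrable M (\<lambda>x. q / p * \<bar>f x\<bar> powr p + (1 - q / p))" using i by simp
  show "\<bar>\<bar>f x\<bar> powr q\<bar> \<le> q / p * \<bar>f x\<bar> powr p + (1 - q / p)" for x using young[of "\<bar>f x\<bar>"] by simp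
 qed (use f in simp)
 let ?I = "expectation (\<lambda>x. \<bar>f x\<bar> powr p)"
 have I0: "0 \<le> ?I" by simp
 show "expectation (\<lambda>x. \<bar>f x\<bar> powr q) powr (1 / q) \<le> ?I powr (1 / p)"
 proof (cases "?I = 0")
  case True
  then have "AE x in M. \<bar>f x\<bar> powr p = 0" using integral_nonneg_eq_0_iff_AE[OF i] by simp
  then have "AE x in M. \<bar>f x\<bar> powr q = 0" by eventually_elim simp
  then have "expectation (\<lambda>x. \<bar>f x\<bar> powr q) = 0" by (rule integral_eq_zero_AE)
  then show ?thesis by simp
 next
  case False
  define N where "N = ?I powr (1 / p)"
  have N: "0 < N" using False by (simp add: N_def)
  have Np: "N powr p = ?I" unfolding N_def powr_powr using p I0 by simp
  have "expectation (\<lambda>x. \<bar>f x\<bar> powr q) / N powr q = expectation (\<lambda>x. \<bar>f x\<bar> powr q / N powr q)" by simp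
  also have "\<dots> \<le> expectation (\<lambda>x. q / p * (\<bar>f x\<bar> powr p / N powr p) + (1 - q / p))"
  proof (rule integral_mono)
   show "integrable M (\<lambda>x. \<bar>f x\<bar> powr q / N powr q)" using iq by simp
   show "integrable M (\<lambda>x. q / p * (\<bar>f x\<bar> powr p / N powr p) + (1 - q / p))" using i by simp
   show "\<bar>f x\<bar> powr q / N powr q \<le> q / p * (\<bar>f x\<bar> powr p / N powr p) + (1 - q / p)" for x
    using young[of "\<bar>f x\<bar> / N"] N by (simp add: powr_divide)
  qed
  also have "\<dots> = 1" using i False p by (simp add: Np prob_space)
  finally have "expectation (\<lambda>x. \<bar>f x\<bar> powr q) \<le> N powr q" using N by (simp add: divide_le_eq)
  then have "expectation (\<lambda>x. \<bar>f x\<bar> powr q) powr (1 / q) \<le> (N powr q) powr (1 / q)"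
   using q by (intro powr_mono2) auto
  also have "\<dots> = N" unfolding powr_powr using q N by simp
  finally show ?thesis by (simp add: N_def)
 qed
qed

end

lemma Lp_space_mono: "0 < q ==> q \<le> p ==> f \<in> Lp_space p ==> f \<in> Lp_space q"
 using torus.integrable_powr_mono[OF measurable_torus, of f q p] by (auto simp: Lp_space_def)

lemma Lp_norm_mono: "0 < q ==> q \<le> p ==> f \<in> Lp_space p ==> Lp_norm q f \<le> Lp_norm p f"
 using torus.Lyapunov[OF measurable_torus, of f q p] by (auto simp: Lp_space_def Lp_norm_def)

definition Ip :: "nat => tfun => real" where "Ip p f = (avg x. f x ^ p)"

lemma Ip_nonneg: "even p ==> 0 \<le> Ip p f"
 unfolding Ip_def by (intro integral_nonneg_AE AE_I2 zero_le_even_power)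

lemma Lp_norm_even: "even p ==> 0 < p ==> Lp_norm (real p) f = Ip p f powr (1 / real p)"
 unfolding Lp_norm_def Ip_def by (simp add: abs_powr_even)

lemma Lp_norm_nonneg: "0 \<le> Lp_norm p f" by (simp add: Lp_norm_def)

lemma Lp_norm_power: "even p ==> 0 < p ==> Lp_norm (real p) f ^ p = Ip p f"
proof -
 assume p: "even p" "0 < p"
 have "Lp_norm (real p) f ^ p = (Ip p f powr (1 / real p)) powr (real p)"
  unfolding Lp_norm_even[OF p] using p by (cases "Ip p f = 0") (simp_all add: powr_realpow Ip_nonneg)
 then show ?thesis unfolding powr_powr using p by (simp add: Ip_nonneg)
qed

lemma Lp_norm_powr: "even p ==> 0 < p ==> Lp_norm (real p) f powr (real p) = Ip p f"
 unfolding Lp_norm_even powr_powr by (simp add: Ip_nonneg)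

lemma Lp_norm_le: "even p ==> 0 < p ==> 0 \<le> B ==> Ip p f \<le> B ^ p ==> Lp_norm (real p) f \<le> B"
 using power_mono_iff[of "Lp_norm (real p) f" B p] by (simp add: Lp_norm_power Lp_norm_nonneg)

text \<open>The cases with a zero argument reduce to z^q \<le> z on [0,1]; the others are convexity
  on the positive half line.\<close>

lemma powr_convex_nonneg:
 fixes u v :: real
 assumes q: "1 \<le> q" and u: "0 \<le> u" and v: "0 \<le> v" and l: "0 \<le> l" "0 \<le> k" "k + l = 1"
 shows "(k * u + l * v) powr q \<le> k * u powr q + l * v powr q"
proof -
 have le: "z powr q \<le> z" if "0 \<le> z" "z \<le> 1" for z :: real
  using powr_mono'[OF q that] that by simp
 consider "u = 0" | "v = 0" | "0 < u" "0 < v" using u v by linarith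
 then show ?thesis
 proof cases
  case 1
  then show ?thesis using mult_right_mono[OF le[of l], of "v powr q"] l by (simp add: powr_mult)
 next
  case 2
  then show ?thesis using mult_right_mono[OF le[of k], of "u powr q"] l by (simp add: powr_mult)
 next
  case 3
  have "k = 1 - l" using l by simp
  with convex_onD[OF powr_convex[OF q], of l u v] 3 l show ?thesis by simp
 qed
qed

lemma Lp_space_measurable: "f \<in> Lp_space q ==> f \<in> borel_measurable torus"
 by (auto simp: Lp_space_def intro: measurable_torus)

lemma Lp_space_add:
 assumes q: "0 \<le> q" and f: "f \<in> Lp_space q" and g: "g \<in> Lp_space q"
 shows "(\<lambda>x. f x + g x) \<in> Lp_space q"
proof -
 note m = Lp_space_measurable[OF f] Lp_space_measurable[OF g]
 have "integrable torus (\<lambda>x. \<bar>f x + g x\<bar> powr q)"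
 proof (rule integrable_bounded_by)
  show "integrable torus (\<lambda>x. 2 powr q * (\<bar>f x\<bar> powr q + \<bar>g x\<bar> powr q))" using f g by (simp add: Lp_space_def)
  show "(\<lambda>x. \<bar>f x + g x\<bar> powr q) \<in> borel_measurable torus" using m by simp
  fix x
  have "\<bar>f x + g x\<bar> powr q \<le> (2 * max \<bar>f x\<bar> \<bar>g x\<bar>) powr q" using q by (intro powr_mono2) auto
  also have "\<dots> = 2 powr q * (max \<bar>f x\<bar> \<bar>g x\<bar>) powr q" by (rule powr_mult)
  also have "\<dots> \<le> 2 powr q * (\<bar>f x\<bar> powr q + \<bar>g x\<bar> powr q)" by (intro mult_left_mono) (auto simp: max_def)
  finally show "\<bar>\<bar>f x + g x\<bar> powr q\<bar> \<le> 2 powr q * (\<bar>f x\<bar> powr q + \<bar>g x\<bar> powr q)" by simp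
 qed
 then show ?thesis using f g by (auto simp: Lp_space_def periodic_def)
qed

lemma Lp_space_diff:
 assumes "0 \<le> q" "f \<in> Lp_space q" "g \<in> Lp_space q" shows "(f -. g) \<in> Lp_space q"
proof -
 have "(\<lambda>x. - g x) \<in> Lp_space q" using assms(3) by (auto simp: Lp_space_def periodic_def)
 from Lp_space_add[OF assms(1,2) this] show ?thesis by simp
qed

text \<open>Convexity of z^q with the weights A/(A+B) and B/(A+B), where A and B are the norms
  enlarged by e/2 so that one can divide by them.\<close>

lemma Minkowski_powr:
 assumes q: "1 \<le> q" and f: "f \<in> Lp_space q" and g: "g \<in> Lp_space q"
 shows "Lp_norm q (\<lambda>x. f x + g x) \<le> Lp_norm q f + Lp_norm q g"
proof (rule field_le_epsilon)
 fix e :: real assume e: "0 < e"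
 let ?I = "\<lambda>f. (avg x. \<bar>f x\<bar> powr q)"
 define A where "A = Lp_norm q f + e / 2"
 define B where "B = Lp_norm q g + e / 2"
 have A: "0 < A" and B: "0 < B" using e Lp_norm_nonneg[of q] by (auto simp: A_def B_def add_nonneg_pos)
 have Ir: "?I h = Lp_norm q h powr q" for h unfolding Lp_norm_def powr_powr using q by simp
 have fA: "?I f \<le> A powr q" "?I g \<le> B powr q"
  unfolding Ir A_def B_def using e q by (intro powr_mono2 Lp_norm_nonneg; simp)+
 have i: "integrable torus (\<lambda>x. \<bar>f x\<bar> powr q)" "integrable torus (\<lambda>x. \<bar>g x\<bar> powr q)" using f g by (auto simp: Lp_space_def)
 have s: "integrable torus (\<lambda>x. \<bar>f x + g x\<bar> powr q)" using Lp_space_add[OF _ f g] q by (simp add: Lp_space_def)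
 let ?k = "A / (A + B)" and ?l = "B / (A + B)"
 let ?T = "\<lambda>x. (A + B) powr q * (?k * (\<bar>f x\<bar> powr q / A powr q) + ?l * (\<bar>g x\<bar> powr q / B powr q))"
 have kl: "0 \<le> ?l" "0 \<le> ?k" "?k + ?l = 1" using A B by (auto simp: add_divide_distrib[symmetric])
 have "?I (\<lambda>x. f x + g x) \<le> (avg x. ?T x)"
 proof (rule integral_mono[OF s])
  show "integrable torus (\<lambda>x. ?T x)" using i by simp
  fix x
  have eq: "(A + B) * (?k * (\<bar>f x\<bar> / A) + ?l * (\<bar>g x\<bar> / B)) = \<bar>f x\<bar> + \<bar>g x\<bar>"
   using A B by (simp add: add_divide_distrib[symmetric])
  have "\<bar>f x + g x\<bar> powr q \<le> ((A + B) * (?k * (\<bar>f x\<bar> / A) + ?l * (\<bar>g x\<bar> / B))) powr q"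
   unfolding eq using q by (intro powr_mono2) auto
  also have "\<dots> = (A + B) powr q * (?k * (\<bar>f x\<bar> / A) + ?l * (\<bar>g x\<bar> / B)) powr q" by (rule powr_mult)
  also have "\<dots> \<le> (A + B) powr q * (?k * (\<bar>f x\<bar> / A) powr q + ?l * (\<bar>g x\<bar> / B) powr q)"
   using A B by (intro mult_left_mono powr_convex_nonneg q kl) auto
  finally show "\<bar>f x + g x\<bar> powr q \<le> ?T x"
   using A B by (simp add: powr_divide)
 qed
 also have "\<dots> = (A + B) powr q * (?k * (?I f / A powr q) + ?l * (?I g / B powr q))" using i by simp
 also have "\<dots> \<le> (A + B) powr q * (?k * 1 + ?l * 1)"
  using A B fA by (intro mult_left_mono add_mono) (auto simp: divide_le_eq)
 also have "\<dots> = (A + B) powr q" using kl by simp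
 finally have "Lp_norm q (\<lambda>x. f x + g x) \<le> ((A + B) powr q) powr (1 / q)"
  unfolding Lp_norm_def using q by (intro powr_mono2) auto
 also have "\<dots> = A + B" unfolding powr_powr using q A B by simp
 finally show "Lp_norm q (\<lambda>x. f x + g x) \<le> Lp_norm q f + Lp_norm q g + e" by (simp add: A_def B_def)
qed

lemma Minkowski: "even p ==> 0 < p ==> f \<in> ELp p ==> g \<in> ELp p ==>
  Lp_norm (real p) (\<lambda>x. f x + g x) \<le> Lp_norm (real p) f + Lp_norm (real p) g"
 using Minkowski_powr[of "real p" f g] by (simp add: Lp_space_even)

lemma Lp_norm_minus_commute: "Lp_norm p (f -. g) = Lp_norm p (g -. f)"
 unfolding Lp_norm_def by (simp add: abs_minus_commute)

lemma Lp_norm_triangle3: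
 assumes p: "even p" "0 < p" and f: "f \<in> ELp p" and g: "g \<in> ELp p" and h: "h \<in> ELp p"
 shows "Lp_norm (real p) (f -. h) \<le> Lp_norm (real p) (f -. g) + Lp_norm (real p) (g -. h)"
 using Minkowski[OF p ELp_diff[OF f g p(1)] ELp_diff[OF g h p(1)]] by simp

lemma Lp_norm_diff_le:
 assumes p: "even p" "0 < p" and f: "f \<in> ELp p" and g: "g \<in> ELp p"
 shows "\<bar>Lp_norm (real p) f - Lp_norm (real p) g\<bar> \<le> Lp_norm (real p) (f -. g)"
 using Minkowski[OF p ELp_diff[OF f g p(1)] g] Minkowski[OF p ELp_diff[OF g f p(1)] f] Lp_norm_minus_commute[of "real p" f g] by simp

lemma Lp_norm_tendsto_0:
 assumes p: "even p" "0 < p" and "(\<lambda>n. Ip p (F n)) ~~> 0" shows "(\<lambda>n. Lp_norm (real p) (F n)) ~~> 0"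
 unfolding Lp_norm_even[OF p] using assms
 by (intro tendsto_zero_powrI[where b="1 / real p"]) (auto simp: Ip_nonneg)

lemma Ip_tendsto:
 assumes p: "even p" "0 < p" and F: "\<And>n. F n \<in> ELp p" and f: "f \<in> ELp p" and lim: "(\<lambda>n. Ip p (F n -. f)) ~~> 0"
 shows "(\<lambda>n. Ip p (F n)) ~~> Ip p f"
proof -
 have "(\<lambda>n. Lp_norm (real p) (F n) - Lp_norm (real p) f) ~~> 0"
  by (rule Lim_null_comparison[OF _ Lp_norm_tendsto_0[OF p lim]]) (use Lp_norm_diff_le[OF p F f] in simp)
 then have "(\<lambda>n. Lp_norm (real p) (F n)) ~~> Lp_norm (real p) f" by (rule LIM_zero_cancel)
 then have "(\<lambda>n. Lp_norm (real p) (F n) ^ p) ~~> Lp_norm (real p) f ^ p" by (rule tendsto_power)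
 then show ?thesis unfolding Lp_norm_power[OF p] .
qed

section \<open>Measurability through Fourier coefficients\<close>

text \<open>By orthogonality a single frequency in V only meets the modes of that frequency up to
  sign. A mollified function of mean zero is therefore determined by finitely many
  coefficients.\<close>

lemma conv_e_basis_finite:
 "V \<in> TP ==> \<exists>K. finite K \<and> K \<subseteq> Z0 \<and> (\<forall>k\<in>Z0 - K. \<forall>x. conv V (eb k) x = 0)"
proof (induction rule: TP.induct)
 case (cos j b)
 show ?case
 proof (intro exI[of _ "{j, - j} \<inter> Z0"] conjI ballI allI)
  fix k x assume k: "k \<in> Z0 - {j, - j} \<inter> Z0"
  have "- j - k \<noteq> 0" "k - j \<noteq> 0" using k by (auto simp: eq_neg_iff_add_eq_0 add.commute)
  have "conv (\<lambda>x. cos (ang j x + b)) (eb k) x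
    = (avg y. sqrt 2 / 2 * cos (ang (- j - k) y + (ang j x + b - ph k)) + sqrt 2 / 2 * cos (ang (k - j) y + (ang j x + b + ph k)))"
   unfolding conv_def
  proof (intro bochner_cong refl)
   fix y
   have "cos (ang j (x - y) + b) * cos (ang k y + ph k)
    = cos (ang (- j - k) y + (ang j x + b - ph k)) / 2 + cos (ang (k - j) y + (ang j x + b + ph k)) / 2"
    unfolding cos_times_cos add_divide_distrib by (simp add: ang_diff_right ang_diff ang_minus algebra_simps)
   then have "sqrt 2 * (cos (ang j (x - y) + b) * cos (ang k y + ph k))
    = sqrt 2 * (cos (ang (- j - k) y + (ang j x + b - ph k)) / 2 + cos (ang (k - j) y + (ang j x + b + ph k)) / 2)" by (simp only:)
   then show "cos (ang j (x - y) + b) * eb k y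
     = sqrt 2 / 2 * cos (ang (- j - k) y + (ang j x + b - ph k)) + sqrt 2 / 2 * cos (ang (k - j) y + (ang j x + b + ph k))"
    unfolding e_basis_eq by (simp add: distrib_left mult_ac)
  qed
  also have "\<dots> = 0"
   using integral_cos_ang[OF \<open>- j - k \<noteq> 0\<close>] integral_cos_ang[OF \<open>k - j \<noteq> 0\<close>]
   by (subst bochner_add[OF TP_integrable[OF TP.scale[OF TP.cos]] TP_integrable[OF TP.scale[OF TP.cos]]])
    (simp only: integral_mult_right_zero mult_zero_right add_0)
  finally show "conv (\<lambda>x. cos (ang j x + b)) (eb k) x = 0" .
 qed auto
next
 case (scale V c)
 then obtain K where "finite K" "K \<subseteq> Z0" "\<forall>k\<in>Z0 - K. \<forall>x. conv V (eb k) x = 0" by blast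
 then show ?case by (intro exI[of _ K]) (simp add: conv_scale_left)
next
 case (add V U)
 then obtain K L where "finite K" "K \<subseteq> Z0" "\<forall>k\<in>Z0 - K. \<forall>x. conv V (eb k) x = 0"
  "finite L" "L \<subseteq> Z0" "\<forall>k\<in>Z0 - L. \<forall>x. conv U (eb k) x = 0" by blast
 then show ?case using add.hyps by (intro exI[of _ "K \<union> L"]) (simp add: conv_add_left TP_integrable)
qed

definition hk :: "nat => int \<times> int => tfun" where "hk n k = conv (ker n) (eb k)"

text \<open>One finite set of modes that serves for all functions mollified with
  \<open>ker n\<close>.\<close>

definition KK :: "nat => (int \<times> int) set" where
 "KK n = (SOME K. finite K \<and> K \<subseteq> Z0 \<and> (\<forall>k\<in>Z0 - K. \<forall>x. hk n k x = 0))"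

lemma KK: "finite (KK n)" "KK n \<subseteq> Z0" "k \<in> Z0 ==> k \<notin> KK n ==> hk n k x = 0"
proof -
 have "finite (KK n) \<and> KK n \<subseteq> Z0 \<and> (\<forall>k\<in>Z0 - KK n. \<forall>x. hk n k x = 0)"
  unfolding KK_def by (rule someI_ex) (unfold hk_def, rule conv_e_basis_finite[OF ker_TP])
 then show "finite (KK n)" "KK n \<subseteq> Z0" "k \<in> Z0 ==> k \<notin> KK n ==> hk n k x = 0" by auto
qed

lemma hk_TP: "hk n k \<in> TP" unfolding hk_def by (rule conv_TP[OF ker_TP TP_integrable[OF e_basis_TP]])

lemma hk_zero_mean: "k \<in> Z0 ==> hk n k \<in> \<E>"
 unfolding zero_mean_L2_iff using integral_conv[OF ker_prob TP_integrable[OF e_basis_TP[of k]], of n]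
 by (simp add: TP_ELp[OF hk_TP]) (simp add: hk_def e_basis_zero_mean)

lemma hk_bounded: "\<bar>hk n k x\<bar> \<le> sqrt 2"
proof -
 note V = prob_kernelD[OF ker_prob]
 have i: "integrable torus (\<lambda>y. ker n (x - y) * eb k y)" by (rule integrable_conv[OF V(1) TP_integrable[OF e_basis_TP]])
 have "\<bar>hk n k x\<bar> \<le> (avg y. \<bar>ker n (x - y) * eb k y\<bar>)" unfolding hk_def conv_def by (rule integral_abs_bound)
 also have "\<dots> \<le> (avg y. ker n (x - y) * sqrt 2)"
 proof (rule integral_mono)
  show "integrable torus (\<lambda>y. \<bar>ker n (x - y) * eb k y\<bar>)" using i by (rule integrable_abs)
  show "integrable torus (\<lambda>y. ker n (x - y) * sqrt 2)" using TP_integrable[OF TP_reflect[OF V(1)]] by simp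
  show "\<bar>ker n (x - y) * eb k y\<bar> \<le> ker n (x - y) * sqrt 2" for y
   unfolding abs_mult abs_of_nonneg[OF V(2)] by (intro mult_left_mono e_basis_bounded V(2))
 qed
 also have "\<dots> = sqrt 2" by (simp add: prob_kernel_reflect[OF ker_prob])
 finally show ?thesis .
qed

lemma conv_ker_rep:
 assumes f: "f \<in> \<E>" shows "conv (ker n) f x = (\<Sum>k\<in>KK n. ip f (eb k) * hk n k x)"
proof -
 let ?V = "\<lambda>y. ker n (x - y)"
 have V: "?V \<in> TP" by (rule TP_reflect[OF ker_TP])
 have Vh: "ip ?V (eb k) = hk n k x" for k by (simp add: hk_def conv_def L2_inner_def)
 obtain K where K: "finite K" "K \<subseteq> Z0"
  "\<And>g. g \<in> \<E> ==> ip g ?V = (\<Sum>k\<in>K. ip ?V (eb k) * ip g (eb k))"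
  "\<And>k. k \<in> Z0 ==> k \<notin> K ==> ip ?V (eb k) = 0" by (rule TP_inner_expansion[OF V]) blast
 have "conv (ker n) f x = ip f ?V" by (simp add: conv_def L2_inner_def mult.commute)
 also have "\<dots> = (\<Sum>k\<in>K. hk n k x * ip f (eb k))" unfolding K(3)[OF f] Vh ..
 also have "\<dots> = (\<Sum>k\<in>KK n. hk n k x * ip f (eb k))"
 proof (rule sum.mono_neutral_cong[OF KK(1) K(1)])
  show "hk n k x * ip f (eb k) = 0" if "k \<in> KK n - K" for k
  proof -
   have "k \<in> Z0" "k \<notin> K" using that subsetD[OF KK(2), of k n] by auto
   from K(4)[OF this] show ?thesis by (simp add: Vh)
  qed
  show "hk n k x * ip f (eb k) = 0" if "k \<in> K - KK n" for k
  proof -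
   have "k \<in> Z0" "k \<notin> KK n" using that subsetD[OF K(2), of k] by auto
   from KK(3)[OF this] show ?thesis by simp
  qed
 qed simp
 finally show ?thesis by (simp add: mult.commute)
qed

text \<open>Random functions are described by scalar measurability of their coefficients, a property
  that the recursion preserves without joint measurability in the sample and space variables.
  Membership in \<open>\<E>\<close> is required at every sample point because \<open>Phi\<close> is
  only controlled there.\<close>

definition coefmeas :: "'w measure => ('w => plane => real) => bool" where
 "coefmeas G X \<longleftrightarrow> (\<forall>w\<in>space G. X w \<in> \<E>) \<and> (\<forall>k\<in>Z0. (\<lambda>w. ip (X w) (eb k)) \<in> borel_measurable G)"

lemma coefmeasD:
 assumes "coefmeas G X"
 shows "w \<in> space G ==> X w \<in> \<E>" "k \<in> Z0 ==> (\<lambda>w. ip (X w) (eb k)) \<in> borel_measurable G"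
 using assms by (auto simp: coefmeas_def)

lemma conv_ker_joint_measurable:
 assumes X: "coefmeas G X" and h: "h \<in> TP"
 shows "(\<lambda>(w, x). (\<Sum>k\<in>KK n. ip (X w) (eb k) * hk n k x) + h x) \<in> borel_measurable (G \<Otimes>\<^sub>M torus)"
 unfolding case_prod_beta'
proof (intro borel_measurable_add borel_measurable_sum borel_measurable_times)
 show "(\<lambda>q. h (snd q)) \<in> borel_measurable (G \<Otimes>\<^sub>M torus)"
  by (rule measurable_compose[OF measurable_snd measurable_torus[OF TP_measurable[OF h]]])
 show "(\<lambda>q. hk n k (snd q)) \<in> borel_measurable (G \<Otimes>\<^sub>M torus)" for k
  by (rule measurable_compose[OF measurable_snd measurable_torus[OF TP_measurable[OF hk_TP]]])
 show "(\<lambda>q. ip (X (fst q)) (eb k)) \<in> borel_measurable (G \<Otimes>\<^sub>M torus)" if "k \<in> KK n" for k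
  by (rule measurable_compose[OF measurable_fst coefmeasD(2)[OF X]]) (use that KK in auto)
qed

text \<open>Mollification gives a finite sum that is jointly measurable, so its power integral is
  measurable; the limit is then taken at each sample point. The offset h serves to differentiate the
  power integral in \<open>Np_measurable\<close>.\<close>

lemma Ip_add_measurable:
 assumes X: "coefmeas G X" and Xp: "\<And>w. w \<in> space G ==> X w \<in> ELp p" and p: "even p" "2 \<le> p" and h: "h \<in> TP"
 shows "(\<lambda>w. Ip p (\<lambda>x. X w x + h x)) \<in> borel_measurable G"
proof (rule borel_measurable_LIMSEQ_real)
 have p0: "0 < p" using p by simp
 let ?S = "\<lambda>n w x. (\<Sum>k\<in>KK n. ip (X w) (eb k) * hk n k x) + h x"
 have "(\<lambda>(w, x). ?S n w x ^ p) \<in> borel_measurable (G \<Otimes>\<^sub>M torus)" for n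
  using borel_measurable_power[OF conv_ker_joint_measurable[OF X h, of n], of p] by (simp add: case_prod_beta')
 then show "(\<lambda>w. Ip p (?S n w)) \<in> borel_measurable G" for n
  unfolding Ip_def by (rule torus.borel_measurable_lebesgue_integral)
 fix w assume w: "w \<in> space G"
 have E: "X w \<in> \<E>" by (rule coefmeasD(1)[OF X w])
 note xp = Xp[OF w]
 have S: "?S n w = (\<lambda>x. conv (ker n) (X w) x + h x)" for n by (simp add: conv_ker_rep[OF E])
 show "(\<lambda>n. Ip p (?S n w)) ~~> Ip p (\<lambda>x. X w x + h x)"
  unfolding S
 proof (rule Ip_tendsto[OF p(1) p0])
  show "(\<lambda>x. conv (ker n) (X w) x + h x) \<in> ELp p" for n
   by (intro TP_ELp TP.add h conv_TP ker_TP ELp_integrable[OF xp p])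
  show "(\<lambda>x. X w x + h x) \<in> ELp p" by (intro ELp_add xp TP_ELp h p)
  show "(\<lambda>n. Ip p (\<lambda>x. conv (ker n) (X w) x + h x - (X w x + h x))) ~~> 0"
   using conv_ker_tendsto[OF p xp] by (simp add: Ip_def)
 qed
qed

lemma Ip_measurable:
 assumes "coefmeas G X" "\<And>w. w \<in> space G ==> X w \<in> ELp p" "even p" "2 \<le> p"
 shows "(\<lambda>w. Ip p (X w)) \<in> borel_measurable G"
 using Ip_add_measurable[OF assms TP_const[of 0]] by simp

text \<open>A weighted Young inequality, obtained by comparing |y| with d |x|.\<close>

lemma abs_power_mult_le:
 fixes x y :: real
 assumes p: "even p" "2 \<le> p" and d: "0 < d"
 shows "\<bar>x ^ (p - 1) * y\<bar> \<le> d * x ^ p + (1 / d) ^ (p - 1) * y ^ p"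
proof -
 have a: "\<bar>x\<bar> ^ p = x ^ p" "\<bar>y\<bar> ^ p = y ^ p" using p by (simp_all add: power_even_abs)
 have s: "z ^ p = z ^ (p - 1) * z" for z :: real using p by (cases p) (simp_all add: mult.commute)
 show ?thesis
 proof (cases "\<bar>y\<bar> \<le> d * \<bar>x\<bar>")
  case True
  have "\<bar>x ^ (p - 1) * y\<bar> \<le> \<bar>x\<bar> ^ (p - 1) * (d * \<bar>x\<bar>)" unfolding abs_mult power_abs by (intro mult_left_mono True) simp
  also have "\<dots> = d * x ^ p" unfolding a(1)[symmetric] s[of "\<bar>x\<bar>"] by simp
  also have "\<dots> \<le> d * x ^ p + (1 / d) ^ (p - 1) * y ^ p" using p d by (simp add: zero_le_even_power)
  finally show ?thesis .
 next
  case False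
  then have "\<bar>x\<bar> \<le> 1 / d * \<bar>y\<bar>" using d by (simp add: field_simps)
  then have "\<bar>x\<bar> ^ (p - 1) \<le> (1 / d * \<bar>y\<bar>) ^ (p - 1)" by (intro power_mono) auto
  then have "\<bar>x ^ (p - 1) * y\<bar> \<le> (1 / d * \<bar>y\<bar>) ^ (p - 1) * \<bar>y\<bar>" unfolding abs_mult power_abs by (intro mult_right_mono) auto
  also have "\<dots> = (1 / d) ^ (p - 1) * y ^ p" unfolding a(2)[symmetric] s[of "\<bar>y\<bar>"] power_mult_distrib by simp
  also have "\<dots> \<le> d * x ^ p + (1 / d) ^ (p - 1) * y ^ p" using p d by (simp add: zero_le_even_power)
  finally show ?thesis .
 qed
qed

lemma integrable_power_mult:
 assumes p: "even p" "2 \<le> p" and a: "a \<in> ELp p" and b: "b \<in> ELp p"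
 shows "integrable torus (\<lambda>x. a x ^ (p - 1) * b x)"
proof (rule integrable_bounded_by)
 show "integrable torus (\<lambda>x. 1 * a x ^ p + (1 / 1) ^ (p - 1) * b x ^ p)" using ELpD(4)[OF a] ELpD(4)[OF b] by simp
 show "(\<lambda>x. a x ^ (p - 1) * b x) \<in> borel_measurable torus" using ELpD(3)[OF a] ELpD(3)[OF b] by simp
 show "\<bar>a x ^ (p - 1) * b x\<bar> \<le> 1 * a x ^ p + (1 / 1) ^ (p - 1) * b x ^ p" for x by (rule abs_power_mult_le[OF p]) simp
qed

text \<open>Up to the factor p, the derivative of the p-th power integral at a in the direction b;
  it is the linear term in the expansion of a step.\<close>

definition Np :: "nat => tfun => tfun => real" where
 "Np p a b = (avg x. a x ^ (p - 1) * b x)"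

lemma Np_abs_le:
 assumes p: "even p" "2 \<le> p" and a: "a \<in> ELp p" and b: "b \<in> ELp p" and d: "0 < d"
 shows "\<bar>Np p a b\<bar> \<le> d * Ip p a + (1 / d) ^ (p - 1) * Ip p b"
proof -
 note i = ELpD(4)[OF a] ELpD(4)[OF b]
 have "\<bar>Np p a b\<bar> \<le> (avg x. \<bar>a x ^ (p - 1) * b x\<bar>)" unfolding Np_def by (rule integral_abs_bound)
 also have "\<dots> \<le> (avg x. d * a x ^ p + (1 / d) ^ (p - 1) * b x ^ p)"
  using i integrable_power_mult[OF p a b] by (intro integral_mono abs_power_mult_le p d) auto
 also have "\<dots> = d * Ip p a + (1 / d) ^ (p - 1) * Ip p b" unfolding Ip_def using i by simp
 finally show ?thesis .
qed

text \<open>Young with a small weight d makes the contribution of a small; for this fixed d the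
  mollification error of b vanishes.\<close>

lemma Np_tendsto:
 assumes p: "even p" "2 \<le> p" and a: "a \<in> ELp p" and b: "b \<in> ELp p"
 shows "(\<lambda>n. Np p a (conv (ker n) b)) ~~> Np p a b"
proof -
 have cE: "conv (ker n) b \<in> ELp p" for n by (rule TP_ELp[OF conv_TP[OF ker_TP ELp_integrable[OF b p]]])
 have dE: "(conv (ker n) b -. b) \<in> ELp p" for n by (rule ELp_diff[OF cE b p(1)])
 have eq: "Np p a (conv (ker n) b) - Np p a b = Np p a (conv (ker n) b -. b)" for n
  unfolding Np_def right_diff_distrib using integrable_power_mult[OF p a cE] integrable_power_mult[OF p a b] by simp
 have "(\<lambda>n. Np p a (conv (ker n) b) - Np p a b) ~~> 0"
 proof (rule LIMSEQ_I)
  fix e :: real assume e: "0 < e"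
  define d where "d = e / 2 / (Ip p a + 1)"
  have I0: "0 < Ip p a + 1" using Ip_nonneg[OF p(1), of a] by linarith
  have d: "0 < d" using e I0 by (simp add: d_def)
  have dI: "d * Ip p a < e / 2"
  proof -
   have "d * Ip p a < d * (Ip p a + 1)" using d by simp
   also have "\<dots> = e / 2" unfolding d_def by (rule nonzero_eq_divide_eq[THEN iffD1]) (use I0 in simp_all)
   finally show ?thesis .
  qed
  have "(\<lambda>n. (1 / d) ^ (p - 1) * Ip p (conv (ker n) b -. b)) ~~> (1 / d) ^ (p - 1) * 0"
   unfolding Ip_def by (intro tendsto_intros conv_ker_tendsto p b)
  then have "\<forall>\<^sub>F n in sequentially. (1 / d) ^ (p - 1) * Ip p (conv (ker n) b -. b) < e / 2"
   using e by (intro order_tendstoD(2)) auto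
  then obtain N where N: "\<And>n. N \<le> n ==> (1 / d) ^ (p - 1) * Ip p (conv (ker n) b -. b) < e / 2"
   by (auto simp: eventually_sequentially)
  show "\<exists>no. \<forall>n\<ge>no. norm (Np p a (conv (ker n) b) - Np p a b - 0) < e"
  proof (intro exI[of _ N] allI impI)
   fix n assume "N \<le> n"
   from N[OF this] Np_abs_le[OF p a dE d, of n] dI show "norm (Np p a (conv (ker n) b) - Np p a b - 0) < e"
    unfolding eq by simp
  qed
 qed
 then show ?thesis by (rule LIM_zero_cancel)
qed

text \<open>The pairing is the limit of difference quotients of power integrals, which are
  measurable. Convexity encloses the quotients between two explicit integrands, which provides both
  pointwise convergence and an integrable majorant.\<close>

lemma Np_measurable:
 assumes X: "coefmeas G X" and Xp: "\<And>w. w \<in> space G ==> X w \<in> ELp p" and p: "even p" "2 \<le> p" and h: "h \<in> TP"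
 shows "(\<lambda>w. Np p (X w) h) \<in> borel_measurable G"
proof (rule borel_measurable_LIMSEQ_real)
 let ?e = "\<lambda>m. inverse (real (Suc m))"
 let ?D = "\<lambda>m w. (Ip p (\<lambda>x. X w x + ?e m * h x) - Ip p (X w)) / (real p * ?e m)"
 show "?D m \<in> borel_measurable G" for m
  by (intro borel_measurable_divide borel_measurable_diff Ip_add_measurable[OF X Xp p TP.scale[OF h]] Ip_measurable[OF X Xp p]) simp_all
 fix w assume w: "w \<in> space G"
 let ?a = "X w"
 note a = Xp[OF w]
 obtain B where B: "\<And>x. \<bar>h x\<bar> \<le> B" using TP_bounded[OF h] by blast
 have hE: "(\<lambda>x. ?e m * h x) \<in> ELp p" for m by (rule TP_ELp[OF TP.scale[OF h]])
 have aE: "(\<lambda>x. ?a x + ?e m * h x) \<in> ELp p" for m by (rule ELp_add[OF a hE p(1)])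
 have odd: "odd (p - 1)" using p by simp
 note i = ELpD(4)[OF a] ELpD(4)[OF aE]
 have mh: "h \<in> borel_measurable torus" by (rule measurable_torus[OF TP_measurable[OF h]])
 let ?q = "\<lambda>m x. ((?a x + ?e m * h x) ^ p - ?a x ^ p) / (real p * ?e m)"
 have D: "?D m w = (avg x. ?q m x)" for m unfolding Ip_def using i by simp
 have bnd: "?a x ^ (p - 1) * h x \<le> ?q m x \<and> ?q m x \<le> (?a x + ?e m * h x) ^ (p - 1) * h x" for m x
 proof -
  have pe: "0 < real p * ?e m" using p by simp
  have "?a x ^ p + real p * ?a x ^ (p - 1) * (?e m * h x) \<le> (?a x + ?e m * h x) ^ p"
   using even_power_tangent[OF p(1), of "?a x" "?a x + ?e m * h x"] by simp
  moreover have "(?a x + ?e m * h x) ^ p + real p * (?a x + ?e m * h x) ^ (p - 1) * (- (?e m * h x)) \<le> ?a x ^ p"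
   using even_power_tangent[OF p(1), of "?a x + ?e m * h x" "?a x"] by simp
  ultimately show ?thesis unfolding pos_le_divide_eq[OF pe] pos_divide_le_eq[OF pe] by (simp add: algebra_simps)
 qed
 show "(\<lambda>m. ?D m w) ~~> Np p ?a h"
  unfolding D Np_def
 proof (rule integral_dominated_convergence[where w="\<lambda>x. 2 ^ p * (?a x ^ p + B ^ p) + (1 + B ^ p)"])
  show "(\<lambda>x. ?a x ^ (p - 1) * h x) \<in> borel_measurable torus" using ELpD(3)[OF a] mh by simp
  show "?q m \<in> borel_measurable torus" for m using ELpD(3)[OF a] mh by simp
  show "integrable torus (\<lambda>x. 2 ^ p * (?a x ^ p + B ^ p) + (1 + B ^ p))" using i(1) by simp
  show "AE x in torus. (\<lambda>m. ?q m x) ~~> ?a x ^ (p - 1) * h x"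
  proof (rule AE_I2)
   fix x
   have "(\<lambda>m. (?a x + ?e m * h x) ^ (p - 1) * h x) ~~> (?a x + 0 * h x) ^ (p - 1) * h x"
    by (intro tendsto_intros LIMSEQ_inverse_real_of_nat)
   then have lim: "(\<lambda>m. (?a x + ?e m * h x) ^ (p - 1) * h x) ~~> ?a x ^ (p - 1) * h x" by simp
   show "(\<lambda>m. ?q m x) ~~> ?a x ^ (p - 1) * h x"
    by (rule tendsto_sandwich[OF _ _ tendsto_const lim]) (use bnd in \<open>auto intro!: always_eventually\<close>)
  qed
  show "AE x in torus. norm (?q m x) \<le> 2 ^ p * (?a x ^ p + B ^ p) + (1 + B ^ p)" for m
  proof (rule AE_I2)
   fix x
   have B0: "0 \<le> B" using B[of x] by linarith
   have hp: "h x ^ p \<le> B ^ p" using power_mono[OF B[of x], of p] p by (simp add: power_even_abs)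
   have hB: "\<bar>z ^ (p - 1) * h x\<bar> \<le> z ^ p + B ^ p" for z
    using abs_power_mult_le[OF p zero_less_one, of z "h x"] hp by simp
   have e1: "0 < ?e m" "?e m \<le> 1" by (auto simp: inverse_le_1_iff)
   have "(?a x + ?e m * h x) ^ p \<le> 2 ^ p * (?a x ^ p + (?e m * h x) ^ p)" by (rule even_power_add_bound[OF p(1)])
   also have "(?e m * h x) ^ p \<le> B ^ p"
   proof -
    have "\<bar>?e m * h x\<bar> \<le> 1 * B" unfolding abs_mult using e1 B[of x] by (intro mult_mono) auto
    then have "\<bar>?e m * h x\<bar> ^ p \<le> B ^ p" by (intro power_mono) auto
    then show ?thesis using p by (simp add: power_even_abs)
   qed
   finally have 1: "(?a x + ?e m * h x) ^ p \<le> 2 ^ p * (?a x ^ p + B ^ p)" by simp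
   have "?a x ^ p \<le> 2 ^ p * (?a x ^ p + B ^ p)"
   proof -
    have "0 \<le> ?a x ^ p" "0 \<le> B ^ p" using p B0 by (simp_all add: zero_le_even_power)
    then have "1 * (?a x ^ p + B ^ p) \<le> 2 ^ p * (?a x ^ p + B ^ p)" by (intro mult_right_mono) auto
    then show ?thesis using \<open>0 \<le> B ^ p\<close> unfolding mult_1 by linarith
   qed
   with 1 bnd[of x m] hB[of "?a x"] hB[of "?a x + ?e m * h x"] show "norm (?q m x) \<le> 2 ^ p * (?a x ^ p + B ^ p) + (1 + B ^ p)"
    unfolding real_norm_def by linarith
  qed
 qed
qed

section \<open>Borel measurability in Lebesgue spaces\<close>

lemma space_Lp_borel: "space (Lp_borel p) = Lp_space p" unfolding Lp_borel_def by (simp add: space_measure_of_conv)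

definition Lp_open :: "real => tfun set => bool" where
 "Lp_open p U \<longleftrightarrow> U \<subseteq> Lp_space p \<and> (\<forall>f\<in>U. \<exists>e>0. \<forall>g\<in>Lp_space p. Lp_norm p (g -. f) < e \<longrightarrow> g \<in> U)"

lemma Lp_borel_eq: "Lp_borel p = sigma (Lp_space p) {U. Lp_open p U}" unfolding Lp_borel_def Lp_open_def ..

lemma Lp_open_subset: "{U. Lp_open p U} \<subseteq> Pow (Lp_space p)" by (auto simp: Lp_open_def)

lemma sets_Lp_borelI: "Lp_open p U ==> U \<in> sets (Lp_borel p)"
 unfolding Lp_borel_eq sets_measure_of[OF Lp_open_subset] by (intro sigma_sets.Basic) simp

lemma measurable_Lp_borelI:
 assumes "\<And>w. w \<in> space G ==> X w \<in> Lp_space p" "\<And>U. Lp_open p U ==> X -` U \<inter> space G \<in> sets G"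
 shows "X \<in> measurable G (Lp_borel p)"
 unfolding Lp_borel_eq by (rule measurable_measure_of[OF Lp_open_subset]) (use assms in auto)

lemma Lp_borel_continuous_measurable:
 fixes \<phi> :: "tfun => real"
 assumes "\<And>f d. f \<in> Lp_space p ==> 0 < d ==> \<exists>e>0. \<forall>g\<in>Lp_space p. Lp_norm p (g -. f) < e \<longrightarrow> \<bar>\<phi> g - \<phi> f\<bar> < d"
 shows "\<phi> \<in> borel_measurable (Lp_borel p)"
proof (rule borel_measurableI)
 fix S :: "real set" assume S: "open S"
 have "Lp_open p (\<phi> -` S \<inter> Lp_space p)"
  unfolding Lp_open_def
 proof (intro conjI ballI)
  fix f assume f: "f \<in> \<phi> -` S \<inter> Lp_space p"
  then obtain d where d: "0 < d" "\<And>y. dist y (\<phi> f) < d ==> y \<in> S" using S unfolding open_dist by blast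
  obtain e where "0 < e" "\<forall>g\<in>Lp_space p. Lp_norm p (g -. f) < e \<longrightarrow> \<bar>\<phi> g - \<phi> f\<bar> < d" using assms[OF _ d(1), of f] f by blast
  with d(2) show "\<exists>e>0. \<forall>g\<in>Lp_space p. Lp_norm p (g -. f) < e \<longrightarrow> g \<in> \<phi> -` S \<inter> Lp_space p"
   unfolding dist_real_def by blast
 qed simp
 from sets_Lp_borelI[OF this] show "\<phi> -` S \<inter> space (Lp_borel p) \<in> sets (Lp_borel p)" unfolding space_Lp_borel .
qed

lemma e_sum_hk_zero_mean: "(\<lambda>x. \<Sum>k\<in>KK n. y k * hk n k x) \<in> \<E>"
proof -
 have T: "(\<lambda>x. \<Sum>k\<in>KK n. y k * hk n k x) \<in> TP" by (intro TP_sum KK TP.scale hk_TP)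
 have "(avg x. (\<Sum>k\<in>KK n. y k * hk n k x)) = (\<Sum>k\<in>KK n. (avg x. y k * hk n k x))"
  by (intro bochner_sum TP_integrable TP.scale hk_TP)
 also have "\<dots> = 0"
  by (intro sum.neutral ballI) (simp add: zero_mean_L2D(2)[OF hk_zero_mean[OF subsetD[OF KK(2)]]])
 finally show ?thesis by (simp add: zero_mean_L2_iff TP_ELp[OF T])
qed

lemma coef_function_measurable:
 assumes X: "coefmeas G X"
 shows "(\<lambda>w k. if k \<in> Z0 then ip (X w) (eb k) else 0) \<in> measurable G (borel :: ((int \<times> int) => real) measure)"
proof (rule measurable_coordinatewise_then_product)
 show "(\<lambda>w. if k \<in> Z0 then ip (X w) (eb k) else 0) \<in> borel_measurable G" for k
  using coefmeasD(2)[OF X, of k] by (cases "k \<in> Z0") simp_all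
qed

lemma conv_ker_rep': "f \<in> \<E> ==> conv (ker n) f = (\<lambda>x. \<Sum>k\<in>KK n. (if k \<in> Z0 then ip f (eb k) else 0) * hk n k x)"
proof (rule ext)
 fix x assume f: "f \<in> \<E>"
 show "conv (ker n) f x = (\<Sum>k\<in>KK n. (if k \<in> Z0 then ip f (eb k) else 0) * hk n k x)"
  unfolding conv_ker_rep[OF f] using KK(2) by (intro sum.cong) auto
qed

lemma hk_sum_diff_bound:
 "\<bar>(\<Sum>k\<in>KK n. y k * hk n k x) - (\<Sum>k\<in>KK n. z k * hk n k x)\<bar> \<le> (\<Sum>k\<in>KK n. sqrt 2 * \<bar>y k - z k\<bar>)"
proof -
 have "\<bar>(\<Sum>k\<in>KK n. y k * hk n k x) - (\<Sum>k\<in>KK n. z k * hk n k x)\<bar> = \<bar>\<Sum>k\<in>KK n. (y k - z k) * hk n k x\<bar>"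
  by (simp add: sum_subtractf left_diff_distrib)
 also have "\<dots> \<le> (\<Sum>k\<in>KK n. \<bar>(y k - z k) * hk n k x\<bar>)" by (rule sum_abs)
 also have "\<dots> \<le> (\<Sum>k\<in>KK n. sqrt 2 * \<bar>y k - z k\<bar>)"
  unfolding abs_mult mult.commute[of "sqrt 2"] by (intro sum_mono mult_left_mono hk_bounded) simp
 finally show ?thesis .
qed

lemma Ip_le_const: "even p ==> f \<in> ELp p ==> (\<And>x. \<bar>f x\<bar> \<le> B) ==> Ip p f \<le> B ^ p"
proof -
 assume p: "even p" and f: "f \<in> ELp p" and B: "\<And>x. \<bar>f x\<bar> \<le> B"
 have "Ip p f \<le> (avg x. B ^ p)" unfolding Ip_def
 proof (rule integral_mono[OF ELpD(4)[OF f]])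
  show "f x ^ p \<le> B ^ p" for x using power_mono[OF B[of x], of p] p by (simp add: power_even_abs)
 qed simp
 then show ?thesis by (simp add: torus.prob_space)
qed

text \<open>An open set U is the union of the sets \<open>O' m\<close> of points around which a ball
  of radius greater than 1/(m+1) lies in U. The value of X is in U iff for some m its mollifications
  are eventually in \<open>O' m\<close>, and each of these events is an open condition on finitely
  many coefficients.\<close>

lemma coefmeas_Lp_borel:
 assumes X: "coefmeas G X" and Xp: "\<And>w. w \<in> space G ==> X w \<in> ELp p" and p: "even p" "2 \<le> p"
 shows "X \<in> measurable G (Lp_borel (real p))"
proof (rule measurable_Lp_borelI)
 have p0: "0 < p" using p by simp
 note Ls = Lp_space_even[OF p(1) p0]
 let ?L = "Lp_norm (real p)"
 show "X w \<in> Lp_space (real p)" if "w \<in> space G" for w using Xp[OF that] by (simp add: Ls)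
 fix U assume "Lp_open (real p) U"
 then have U: "\<And>f. f \<in> U ==> f \<in> ELp p" "\<And>f. f \<in> U ==> \<exists>e>0. \<forall>g\<in>ELp p. ?L (g -. f) < e \<longrightarrow> g \<in> U"
  unfolding Lp_open_def Ls by auto
 \<comment> \<open>The strict inequality leaves room to move the centre, which makes the preimages
   under the finite sums open.\<close>
 define O' where "O' m = {f \<in> ELp p. \<exists>e > inverse (real (Suc m)). \<forall>g\<in>ELp p. ?L (g -. f) < e \<longrightarrow> g \<in> U}" for m
 let ?\<Psi> = "\<lambda>n (y :: (int \<times> int) => real) x. \<Sum>k\<in>KK n. y k * hk n k x"
 have \<Psi>E: "?\<Psi> n y \<in> ELp p" for n y by (intro TP_ELp TP_sum KK TP.scale hk_TP)
 have op: "open {y. ?\<Psi> n y \<in> O' m}" for n m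
 proof (subst open_subopen, intro ballI)
  fix y assume "y \<in> {y. ?\<Psi> n y \<in> O' m}"
  then obtain e where e: "inverse (real (Suc m)) < e" "\<forall>g\<in>ELp p. ?L (g -. ?\<Psi> n y) < e \<longrightarrow> g \<in> U"
   unfolding O'_def by blast
  define d where "d = (e - inverse (real (Suc m))) / 2"
  have d: "0 < d" using e(1) by (simp add: d_def)
  let ?T = "{z. (\<Sum>k\<in>KK n. sqrt 2 * \<bar>z k - y k\<bar>) < d}"
  have "open ?T"
   by (intro open_Collect_less continuous_on_sum continuous_on_mult continuous_on_const continuous_on_rabs continuous_on_diff continuous_on_product_coordinates)
  moreover have "y \<in> ?T" using d by simp
  moreover have "?T \<subseteq> {y. ?\<Psi> n y \<in> O' m}"
  proof safe
   fix z assume z: "(\<Sum>k\<in>KK n. sqrt 2 * \<bar>z k - y k\<bar>) < d"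
   have "?L (?\<Psi> n z -. ?\<Psi> n y) \<le> (\<Sum>k\<in>KK n. sqrt 2 * \<bar>z k - y k\<bar>)"
    by (rule Lp_norm_le[OF p(1) p0 _ Ip_le_const[OF p(1) ELp_diff[OF \<Psi>E \<Psi>E p(1)] hk_sum_diff_bound]]) (simp add: sum_nonneg)
   then have zd: "?L (?\<Psi> n z -. ?\<Psi> n y) < d" using z by linarith
   show "?\<Psi> n z \<in> O' m"
    unfolding O'_def
   proof (intro CollectI conjI \<Psi>E exI[of _ "e - d"] ballI impI)
    show "inverse (real (Suc m)) < e - d" unfolding d_def less_diff_eq using e(1) field_less_half_sum[OF e(1)] by argo
    fix g assume g: "g \<in> ELp p" "?L (g -. ?\<Psi> n z) < e - d"
    have "?L (g -. ?\<Psi> n y) < e"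
     using Lp_norm_triangle3[OF p(1) p0 g(1) \<Psi>E \<Psi>E, of y n z n] g(2) zd by linarith
    then show "g \<in> U" using e(2) g(1) by blast
   qed
  qed
  ultimately show "\<exists>T. open T \<and> y \<in> T \<and> T \<subseteq> {y. ?\<Psi> n y \<in> O' m}" by blast
 qed
 let ?y = "\<lambda>w k. if k \<in> Z0 then ip (X w) (eb k) else 0"
 let ?U = "\<Union>m. \<Union>N. \<Inter>n\<in>{N..}. {w \<in> space G. ?\<Psi> n (?y w) \<in> O' m}"
 have ms: "{w \<in> space G. ?\<Psi> n (?y w) \<in> O' m} \<in> sets G" for n m
 proof -
  have "{w \<in> space G. ?\<Psi> n (?y w) \<in> O' m} = ?y -` {y. ?\<Psi> n y \<in> O' m} \<inter> space G" by auto
  also have "\<dots> \<in> sets G" by (rule measurable_sets[OF coef_function_measurable[OF X]]) (use op in simp)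
  finally show ?thesis .
 qed
 have "X -` U \<inter> space G = ?U"
 proof (rule set_eqI)
  fix w
  show "w \<in> X -` U \<inter> space G \<longleftrightarrow> w \<in> ?U"
  proof (cases "w \<in> space G")
   case True
   have E: "X w \<in> \<E>" by (rule coefmeasD(1)[OF X True])
   note xp = Xp[OF True]
   have S: "?\<Psi> n (?y w) = conv (ker n) (X w)" for n by (rule conv_ker_rep'[OF E, symmetric])
   have cE: "conv (ker n) (X w) \<in> ELp p" for n by (rule TP_ELp[OF conv_TP[OF ker_TP ELp_integrable[OF xp p]]])
   have lim: "(\<lambda>n. ?L (conv (ker n) (X w) -. X w)) ~~> 0"
    by (rule Lp_norm_tendsto_0[OF p(1) p0]) (use conv_ker_tendsto[OF p xp] in \<open>simp add: Ip_def\<close>)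
   have "X w \<in> U \<longleftrightarrow> (\<exists>m N. \<forall>n\<ge>N. conv (ker n) (X w) \<in> O' m)"
   proof
    assume "X w \<in> U"
    then obtain e where e: "0 < e" "\<forall>g\<in>ELp p. ?L (g -. X w) < e \<longrightarrow> g \<in> U" using U(2) by blast
    obtain m where m: "inverse (real (Suc m)) < e / 2" using reals_Archimedean[of "e / 2"] e by auto
    obtain N where N: "\<And>n. N \<le> n ==> ?L (conv (ker n) (X w) -. X w) < e / 2"
     using order_tendstoD(2)[OF lim, of "e / 2"] e by (auto simp: eventually_sequentially)
    show "\<exists>m N. \<forall>n\<ge>N. conv (ker n) (X w) \<in> O' m"
    proof (rule exI[of _ m], rule exI[of _ N], intro allI impI)
     fix n assume n: "N \<le> n"
     show "conv (ker n) (X w) \<in> O' m"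
      unfolding O'_def
     proof (intro CollectI conjI cE exI[of _ "e / 2"] ballI impI m)
      fix g assume g: "g \<in> ELp p" "?L (g -. conv (ker n) (X w)) < e / 2"
      have "?L (g -. X w) < e"
       using Lp_norm_triangle3[OF p(1) p0 g(1) cE xp, of n] g(2) N[OF n] by linarith
      then show "g \<in> U" using e(2) g(1) by blast
     qed
    qed
   next
    assume "\<exists>m N. \<forall>n\<ge>N. conv (ker n) (X w) \<in> O' m"
    then obtain m N where mN: "\<forall>n\<ge>N. conv (ker n) (X w) \<in> O' m" by blast
    obtain N' where N': "\<And>n. N' \<le> n ==> ?L (conv (ker n) (X w) -. X w) < inverse (real (Suc m))"
     using order_tendstoD(2)[OF lim, of "inverse (real (Suc m))"] by (auto simp: eventually_sequentially)
    let ?n = "max N N'"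
    have "conv (ker ?n) (X w) \<in> O' m" using mN by simp
    then obtain e where e: "inverse (real (Suc m)) < e" "\<forall>g\<in>ELp p. ?L (g -. conv (ker ?n) (X w)) < e \<longrightarrow> g \<in> U"
     unfolding O'_def by blast
    have "?L (X w -. conv (ker ?n) (X w)) < e"
     using N'[of ?n] e(1) unfolding Lp_norm_minus_commute[of "real p" "X w"] by simp
    then show "X w \<in> U" using e(2) xp by blast
   qed
   moreover have "w \<in> ?U \<longleftrightarrow> (\<exists>m N. \<forall>n\<ge>N. ?\<Psi> n (?y w) \<in> O' m)"
    using True by auto
   ultimately show ?thesis using True unfolding S by simp
  next
   case False
   have "w \<notin> (\<Inter>n\<in>{N..}. {w \<in> space G. ?\<Psi> n (?y w) \<in> O' m})" for N m using False by (auto intro: exI[of _ N])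
   then show ?thesis using False by auto
  qed
 qed
 also have "\<dots> \<in> sets G"
  by (rule sets.countable_UN, rule image_subsetI, rule sets.countable_UN, rule image_subsetI, rule sets.countable_INT', auto simp: ms)
 finally show "X -` U \<inter> space G \<in> sets G" .
qed

text \<open>On a probability space the L^q norm is dominated by the L^p norm, so the trace of an
  L^q-open set is L^p-open.\<close>

lemma Lp_borel_mono:
 assumes q: "0 < q" "q \<le> p" and X: "X \<in> measurable G (Lp_borel p)" shows "X \<in> measurable G (Lp_borel q)"
proof (rule measurable_Lp_borelI)
 have sp: "X w \<in> Lp_space p" if "w \<in> space G" for w
  using measurable_space[OF X that] by (simp add: space_Lp_borel)
 show "X w \<in> Lp_space q" if "w \<in> space G" for w by (rule Lp_space_mono[OF q sp[OF that]])
 fix U assume U: "Lp_open q U"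
 have p0: "0 \<le> p" using q by linarith
 have "Lp_open p (U \<inter> Lp_space p)"
  unfolding Lp_open_def
 proof (intro conjI ballI)
  fix f assume f: "f \<in> U \<inter> Lp_space p"
  then obtain e where e: "0 < e" "\<forall>g\<in>Lp_space q. Lp_norm q (g -. f) < e \<longrightarrow> g \<in> U" using U unfolding Lp_open_def by blast
  have "Lp_norm q (g -. f) \<le> Lp_norm p (g -. f)" if "g \<in> Lp_space p" for g
   using f that by (intro Lp_norm_mono[OF q] Lp_space_diff p0) auto
  then show "\<exists>e>0. \<forall>g\<in>Lp_space p. Lp_norm p (g -. f) < e \<longrightarrow> g \<in> U \<inter> Lp_space p"
   using e Lp_space_mono[OF q] by (meson IntI order_le_less_trans)
 qed simp
 from measurable_sets[OF X sets_Lp_borelI[OF this]] have "X -` (U \<inter> Lp_space p) \<inter> space G \<in> sets G" .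
 moreover have "X -` (U \<inter> Lp_space p) \<inter> space G = X -` U \<inter> space G" using sp by auto
 ultimately show "X -` U \<inter> space G \<in> sets G" by simp
qed

lemma n2_le_Lp_norm: "even p ==> 2 \<le> p ==> f \<in> ELp p ==> n2 f \<le> Lp_norm (real p) f"
proof -
 assume p: "even p" "2 \<le> p" and f: "f \<in> ELp p"
 have "n2 f = Lp_norm 2 f"
  using Lp_norm_even[of 2 f] unfolding n2_def Ip_def by (simp add: powr_half_sqrt)
 also have "\<dots> \<le> Lp_norm (real p) f"
  by (rule Lp_norm_mono) (use p f in \<open>auto simp: Lp_space_even\<close>)
 finally show ?thesis .
qed

lemma coef_Lp_borel_measurable:
 assumes p: "even p" "2 \<le> p" shows "(\<lambda>f. ip f (eb k)) \<in> borel_measurable (Lp_borel (real p))"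
proof (rule Lp_borel_continuous_measurable)
 have p0: "0 < p" using p by simp
 note Ls = Lp_space_even[OF p(1) p0]
 note E = TP_ELp[OF e_basis_TP[of k], of 2]
 fix f and d :: real assume f: "f \<in> Lp_space (real p)" and d: "0 < d"
 let ?c = "n2 (eb k) + 1"
 have c: "0 < ?c" using n2_nonneg[of "eb k"] by linarith
 show "\<exists>e>0. \<forall>g\<in>Lp_space (real p). Lp_norm (real p) (g -. f) < e \<longrightarrow> \<bar>ip g (eb k) - ip f (eb k)\<bar> < d"
  unfolding Ls
 proof (intro exI[of _ "d / ?c"] conjI ballI impI)
  show "0 < d / ?c" using d c by simp
  fix g assume g: "g \<in> ELp p" "Lp_norm (real p) (g -. f) < d / ?c"
  have f2: "f \<in> ELp 2" "g \<in> ELp 2" using ELp_mono[OF f[unfolded Ls] p(1), of 2] ELp_mono[OF g(1) p(1), of 2] p by auto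
  have gf: "(g -. f) \<in> ELp p" by (rule ELp_diff[OF g(1) f[unfolded Ls] p(1)])
  have "\<bar>ip g (eb k) - ip f (eb k)\<bar> \<le> n2 (g -. f) * n2 (eb k)"
   unfolding L2_inner_diff_left[OF f2(2) f2(1) E, symmetric] by (rule L2_inner_le[OF ELp_diff[OF f2(2,1)] E]) simp
  also have "\<dots> \<le> Lp_norm (real p) (g -. f) * ?c"
   by (intro mult_mono n2_le_Lp_norm p gf) (auto simp: Lp_norm_nonneg)
  also have "\<dots> < d" using g(2) c by (simp add: pos_less_divide_eq)
  finally show "\<bar>ip g (eb k) - ip f (eb k)\<bar> < d" .
 qed
qed

text \<open>For mollified input the coefficients of the solution are continuous functions of
  finitely many coefficients of the input, by \<open>Phi_continuous\<close>; the same lemma then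
  removes the mollification.\<close>

lemma Phi_coefmeas:
 assumes X: "coefmeas G X" shows "coefmeas G (\<lambda>w. Phi \<tau> (X w))"
 unfolding coefmeas_def
proof (intro conjI ballI)
 show "Phi \<tau> (X w) \<in> \<E>" if "w \<in> space G" for w by (rule Phi_is_Phi(1)[OF coefmeasD(1)[OF X that]])
 fix k assume k: "k \<in> Z0"
 note E = TP_ELp[OF e_basis_TP[of k], of 2]
 let ?\<Psi> = "\<lambda>n (y :: (int \<times> int) => real) x. \<Sum>k\<in>KK n. y k * hk n k x"
 let ?y = "\<lambda>w k. if k \<in> Z0 then ip (X w) (eb k) else 0"
 have cont: "continuous_on UNIV (\<lambda>y. ip (Phi \<tau> (?\<Psi> n y)) (eb k))" for n
 proof (rule continuous_on_sequentiallyI)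
  fix Y :: "nat => (int \<times> int) => real" and y assume lim: "Y ~~> y"
  have coord: "(\<lambda>m. Y m j) ~~> y j" for j
  proof -
   have "continuous_on UNIV (\<lambda>y :: (int \<times> int) => real. y j)" by (rule continuous_on_product_coordinates)
   from continuous_on_tendsto_compose[OF this lim] show ?thesis by simp
  qed
  have P: "?\<Psi> n z \<in> ELp 2" for z by (rule zero_mean_L2D(1)[OF e_sum_hk_zero_mean])
  have "(\<lambda>m. n2 (?\<Psi> n (Y m) -. ?\<Psi> n y)) ~~> 0"
  proof (rule tendsto_sandwich[OF _ _ tendsto_const])
   show "\<forall>\<^sub>F m in sequentially. n2 (?\<Psi> n (Y m) -. ?\<Psi> n y) \<le> (\<Sum>k\<in>KK n. sqrt 2 * \<bar>Y m k - y k\<bar>)"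
   proof (intro always_eventually allI)
    fix m
    have "(n2 (?\<Psi> n (Y m) -. ?\<Psi> n y))^2 \<le> (\<Sum>k\<in>KK n. sqrt 2 * \<bar>Y m k - y k\<bar>)^2"
     unfolding n2_sq Ip_def[symmetric] by (intro Ip_le_const ELp_diff P hk_sum_diff_bound) simp_all
    then show "n2 (?\<Psi> n (Y m) -. ?\<Psi> n y) \<le> (\<Sum>k\<in>KK n. sqrt 2 * \<bar>Y m k - y k\<bar>)"
     by (rule power2_le_imp_le) (simp add: sum_nonneg)
   qed
   have "(\<lambda>m. \<Sum>k\<in>KK n. sqrt 2 * \<bar>Y m k - y k\<bar>) ~~> (\<Sum>k\<in>KK n. sqrt 2 * \<bar>y k - y k\<bar>)"
    by (intro tendsto_intros coord)
   then show "(\<lambda>m. \<Sum>k\<in>KK n. sqrt 2 * \<bar>Y m k - y k\<bar>) ~~> 0" by simp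
  qed simp
  from Phi_continuous[OF e_sum_hk_zero_mean e_sum_hk_zero_mean this E]
  show "(\<lambda>m. ip (Phi \<tau> (?\<Psi> n (Y m))) (eb k)) ~~> ip (Phi \<tau> (?\<Psi> n y)) (eb k)" .
 qed
 show "(\<lambda>w. ip (Phi \<tau> (X w)) (eb k)) \<in> borel_measurable G"
 proof (rule borel_measurable_LIMSEQ_real)
  show "(\<lambda>w. ip (Phi \<tau> (?\<Psi> n (?y w))) (eb k)) \<in> borel_measurable G" for n
   by (rule measurable_compose[OF coef_function_measurable[OF X] borel_measurable_continuous_onI[OF cont]])
  fix w assume w: "w \<in> space G"
  have x: "X w \<in> \<E>" by (rule coefmeasD(1)[OF X w])
  note x2 = zero_mean_L2D[OF x]
  have cE: "conv (ker n) (X w) \<in> \<E>" for n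
   using integral_conv[OF ker_prob ELp2_integrable[OF x2(1)], of n] x2(2)
   by (simp add: zero_mean_L2_iff TP_ELp[OF conv_TP[OF ker_TP ELp2_integrable[OF x2(1)]]])
  show "(\<lambda>n. ip (Phi \<tau> (?\<Psi> n (?y w))) (eb k)) ~~> ip (Phi \<tau> (X w)) (eb k)"
   unfolding conv_ker_rep'[OF x, symmetric] by (rule Phi_continuous[OF cE x conv_ker_n2[OF x2(1)] E])
 qed
qed

section \<open>The noise\<close>

lemma coefmeas_mono:
 "coefmeas G X ==> space G = space H ==> sets G \<subseteq> sets H ==> coefmeas H X"
 unfolding coefmeas_def measurable_def by (simp add: subset_iff)

lemma coefmeas_add:
 assumes X: "coefmeas G X" and Y: "coefmeas G Y" shows "coefmeas G (\<lambda>w x. X w x + Y w x)"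
 unfolding coefmeas_def
proof (intro conjI ballI)
 show "(\<lambda>x. X w x + Y w x) \<in> \<E>" if "w \<in> space G" for w by (intro zero_mean_add coefmeasD(1)[OF X that] coefmeasD(1)[OF Y that])
 fix k assume k: "k \<in> Z0"
 have "(\<lambda>w. ip (X w) (eb k) + ip (Y w) (eb k)) \<in> borel_measurable G"
  by (intro borel_measurable_add coefmeasD(2)[OF X k] coefmeasD(2)[OF Y k])
 also have "?this \<longleftrightarrow> (\<lambda>w. ip (\<lambda>x. X w x + Y w x) (eb k)) \<in> borel_measurable G"
  by (intro measurable_cong L2_inner_add_left[symmetric] TP_ELp[OF e_basis_TP] zero_mean_L2D(1) coefmeasD(1)[OF X] coefmeasD(1)[OF Y])
 finally show "(\<lambda>w. ip (\<lambda>x. X w x + Y w x) (eb k)) \<in> borel_measurable G" .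
qed

lemma coefmeas_uminus: "coefmeas G X ==> coefmeas G (\<lambda>w x. - X w x)"
 using zero_mean_cmult[of _ "- 1"] L2_inner_cmult_left[of "- 1"] unfolding coefmeas_def by simp

lemma coefmeas_if:
 assumes X: "coefmeas G X" and A: "A \<in> sets G" shows "coefmeas G (\<lambda>w. if w \<in> A then X w else (\<lambda>x. 0))"
 unfolding coefmeas_def
proof (intro conjI ballI)
 show "(if w \<in> A then X w else (\<lambda>x. 0)) \<in> \<E>" if "w \<in> space G" for w
  using coefmeasD(1)[OF X that] zero_mean_cmult[of "X w" 0] by simp
 fix k assume k: "k \<in> Z0"
 have "(\<lambda>w. if w \<in> A then ip (X w) (eb k) else 0) \<in> borel_measurable G"
  using coefmeasD(2)[OF X k] A by (intro measurable_If_set) (auto intro: sets.sets_into_space[THEN Int_absorb2, THEN ssubst])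
 moreover have "ip (if w \<in> A then X w else (\<lambda>x. 0)) (eb k) = (if w \<in> A then ip (X w) (eb k) else 0)" for w
  by (simp add: L2_inner_def)
 ultimately show "(\<lambda>w. ip (if w \<in> A then X w else (\<lambda>x. 0)) (eb k)) \<in> borel_measurable G" by (simp only:)
qed

context complete_filtered_prob_space begin

lemma space_F: "0 \<le> t ==> space (F t) = space M"
 using subalgebra_F[of t] by (simp add: subalgebra_def)

lemma null_sets_F: "0 \<le> t ==> null_sets M \<subseteq> sets (F t)"
 using null_F mono_F[of 0 t] by simp

lemma measurable_F_M: "0 \<le> t ==> f \<in> measurable (F t) N ==> f \<in> measurable M N"
 using measurable_from_subalg[OF subalgebra_F] .

lemma measurable_F_mono: "0 \<le> s ==> s \<le> t ==> f \<in> measurable (F s) N ==> f \<in> measurable (F t) N"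
 by (rule measurable_from_subalg[of "F t" "F s"]) (simp_all add: subalgebra_def space_F mono_F)

lemma coefmeas_F_mono: "0 \<le> s ==> s \<le> t ==> coefmeas (F s) X ==> coefmeas (F t) X"
 by (rule coefmeas_mono[of "F s"]) (simp_all add: space_F mono_F)

text \<open>Completeness puts all subsets of null sets into every \<open>F t\<close> with t
  nonnegative, so a function that agrees almost surely with an adapted one is itself
  adapted.\<close>

lemma F_measurable_AE:
 fixes f :: "'w => real"
 assumes t: "0 \<le> t" and h: "h \<in> borel_measurable (F t)" and eq: "AE w in M. f w = h w"
 shows "f \<in> borel_measurable (F t)"
proof (rule measurableI)
 fix A :: "real set" assume A: "A \<in> sets borel"
 obtain N where N: "N \<in> null_sets M" "\<And>w. w \<in> space M ==> w \<notin> N ==> f w = h w"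
  using eq unfolding eventually_ae_filter by blast
 have Nf: "f -` A \<inter> space M \<inter> N \<in> sets (F t)" "N \<in> sets (F t)"
  using null_sets_F[OF t] N(1) complete2[of "f -` A \<inter> space M \<inter> N" N] by auto
 have "h -` A \<inter> space (F t) - N \<in> sets (F t)" by (intro sets.Diff measurable_sets[OF h A] Nf)
 then have "(h -` A \<inter> space (F t) - N) \<union> (f -` A \<inter> space M \<inter> N) \<in> sets (F t)" by (intro sets.Un Nf)
 also have "(h -` A \<inter> space (F t) - N) \<union> (f -` A \<inter> space M \<inter> N) = f -` A \<inter> space (F t)"
  using N(2) unfolding space_F[OF t] by fastforce
 finally show "f -` A \<inter> space (F t) \<in> sets (F t)" .
qed simp

lemma M_measurable_AE:
 fixes f :: "'w => real"
 assumes h: "h \<in> borel_measurable M" and eq: "AE w in M. f w = h w"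
 shows "f \<in> borel_measurable M"
proof (rule measurableI)
 fix A :: "real set" assume A: "A \<in> sets borel"
 show "f -` A \<inter> space M \<in> sets M"
  by (rule in_sets_AE[OF _ measurable_sets[OF h A]]) (use eq in auto)
qed simp

lemma M_limit_measurable:
 fixes f :: "'w => real"
 assumes u: "\<And>n. u n \<in> borel_measurable M" and lim: "AE w in M. (\<lambda>n. u n w) ~~> f w"
 shows "f \<in> borel_measurable M"
proof (rule M_measurable_AE)
 show "(\<lambda>w. lim (\<lambda>n. u n w)) \<in> borel_measurable M" by (rule borel_measurable_lim_metric[OF u])
 show "AE w in M. f w = lim (\<lambda>n. u n w)" using lim by eventually_elim (simp add: limI)
qed

text \<open>Integrability is upgraded from almost every to every sample point by inserting the zero
  function on a null set, since the measurability lemmas ask for it everywhere.\<close>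

lemma coefmeas_modification:
 assumes t: "0 \<le> t" and X: "coefmeas (F t) X" and ae: "AE w in M. X w \<in> ELp p"
 obtains Y where "coefmeas (F t) Y" "\<And>w. w \<in> space (F t) ==> Y w \<in> ELp p" "AE w in M. X w = Y w"
proof -
 obtain N where N: "N \<in> null_sets M" "\<And>w. w \<in> space M ==> w \<notin> N ==> X w \<in> ELp p"
  using ae unfolding eventually_ae_filter by blast
 have A: "space (F t) - N \<in> sets (F t)" using N(1) null_sets_F[OF t] by auto
 show ?thesis
 proof (rule that)
  show "coefmeas (F t) (\<lambda>w. if w \<in> space (F t) - N then X w else (\<lambda>x. 0))" by (rule coefmeas_if[OF X A])
  show "(if w \<in> space (F t) - N then X w else (\<lambda>x. 0)) \<in> ELp p" if "w \<in> space (F t)" for w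
   using N(2)[of w] ELp_cmult[of "\<lambda>x. 0" p 0] TP_ELp[OF TP_const[of 0]] by (simp add: space_F[OF t])
  show "AE w in M. X w = (if w \<in> space (F t) - N then X w else (\<lambda>x. 0))"
   using AE_not_in[OF N(1)] AE_space by eventually_elim (simp add: space_F[OF t])
 qed
qed

lemma Ip_F_measurable:
 assumes t: "0 \<le> t" and X: "coefmeas (F t) X" and ae: "AE w in M. X w \<in> ELp p" and p: "even p" "2 \<le> p"
 shows "(\<lambda>w. Ip p (X w)) \<in> borel_measurable (F t)"
proof -
 obtain Y where Y: "coefmeas (F t) Y" "\<And>w. w \<in> space (F t) ==> Y w \<in> ELp p" "AE w in M. X w = Y w"
  by (rule coefmeas_modification[OF t X ae]) blast
 show ?thesis
 proof (rule F_measurable_AE[OF t])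
  show "(\<lambda>w. Ip p (Y w)) \<in> borel_measurable (F t)" by (rule Ip_measurable[OF Y(1,2) p])
  show "AE w in M. Ip p (X w) = Ip p (Y w)" using Y(3) by eventually_elim simp
 qed
qed

lemma Np_F_measurable:
 assumes t: "0 \<le> t" and X: "coefmeas (F t) X" and ae: "AE w in M. X w \<in> ELp p" and p: "even p" "2 \<le> p" and h: "h \<in> TP"
 shows "(\<lambda>w. Np p (X w) h) \<in> borel_measurable (F t)"
proof -
 obtain Y where Y: "coefmeas (F t) Y" "\<And>w. w \<in> space (F t) ==> Y w \<in> ELp p" "AE w in M. X w = Y w"
  by (rule coefmeas_modification[OF t X ae]) blast
 show ?thesis
 proof (rule F_measurable_AE[OF t])
  show "(\<lambda>w. Np p (Y w) h) \<in> borel_measurable (F t)" by (rule Np_measurable[OF Y(1,2) p h])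
  show "AE w in M. Np p (X w) h = Np p (Y w) h" using Y(3) by eventually_elim simp
 qed
qed

end

lemma countable_Z0: "countable Z0" by (rule countableI_type)

text \<open>\<open>S\<close> bounds the partial sums of the squared noise weights. It will come from
  the summability hypothesis, because the L^p norms of the modes are at least 1.\<close>

locale curl_noise = complete_filtered_prob_space M F for M :: "'w measure" and F +
 fixes \<beta> :: "int \<times> int => real => 'w => real" and c :: "int \<times> int => real" and W :: "real => 'w => tfun" and S :: real
 assumes fam: "independent_wiener_family M F \<beta> Z0" and W: "is_W_curl M c \<beta> W"
  and S: "\<And>K. finite K ==> K \<subseteq> Z0 ==> (\<Sum>k\<in>K. (norm (kvec k) * c (- k))^2) \<le> S"
begin

text \<open>The minus sign is that of \<open>beta_tilde\<close>: the coefficient of the noise at the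
  mode k is \<open>g k\<close> times the Wiener process of index -k.\<close>

definition g :: "int \<times> int => real" where "g k = - (2 * pi * (norm (kvec k) * c (- k)))"

definition D :: "real => real => int \<times> int => 'w => real" where "D s t k w = \<beta> k t w - \<beta> k s w"

lemma wiener: "k \<in> Z0 ==> wiener_process M F (\<beta> k)"
 using fam by (simp add: independent_wiener_family_def)

lemma beta_measurable: "k \<in> Z0 ==> 0 \<le> t ==> \<beta> k t \<in> borel_measurable (F t)"
 using wiener[of k] by (simp add: wiener_process_def)

lemma W_zero_mean: "0 \<le> t ==> w \<in> space M ==> W t w \<in> \<E>"
 using W measurable_space[of "W t" M "restrict_space (Lp_borel 2) \<E>" w] by (simp add: is_W_curl_def space_restrict_space)

lemma W_coef_measurable: "0 \<le> t ==> (\<lambda>w. ip (W t w) (eb k)) \<in> borel_measurable M"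
proof -
 assume "0 \<le> t"
 then have "W t \<in> measurable M (Lp_borel 2)" using W by (simp add: is_W_curl_def measurable_restrict_space2_iff)
 from measurable_compose[OF this, of "\<lambda>f. ip f (eb k)"] coef_Lp_borel_measurable[of 2 k] show ?thesis by simp
qed

lemma n2_eq_Lp_norm: "n2 f = Lp_norm 2 f"
 using Lp_norm_even[of 2 f] unfolding n2_def Ip_def by (simp add: powr_half_sqrt)

text \<open>Every partial sum that contains k has the same k-th coefficient, so the deviation is
  bounded by the norm of the remainder, which tends to 0 in mean square.\<close>

lemma W_coef:
 assumes t: "0 \<le> t" and k: "k \<in> Z0"
 shows "AE w in M. ip (W t w) (eb k) = g k * \<beta> (- k) t w"
proof -
 let ?R = "\<lambda>K w x. W t w x - 2 * pi * (\<Sum>j\<in>K. norm (kvec j) * c (- j) * beta_tilde \<beta> j t w * eb j x)"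
 let ?d = "\<lambda>w. (ip (W t w) (eb k) - g k * \<beta> (- k) t w)^2"
 have lim: "((\<lambda>K. \<integral>\<^sup>+w. ennreal ((Lp_norm 2 (?R K w))^2) \<partial>M) \<longlongrightarrow> 0) (finite_subsets_at_top Z0)"
  using W t by (simp add: is_W_curl_def)
 have m: "?d \<in> borel_measurable M"
  using W_coef_measurable[OF t, of k] measurable_F_M[OF t beta_measurable[of "- k", OF _ t]] k by (simp add: minus_Z0)
 have le: "?d w \<le> (Lp_norm 2 (?R K w))^2" if K: "finite K" "{k} \<subseteq> K" "K \<subseteq> Z0" and w: "w \<in> space M" for K w
 proof -
  let ?E = "\<lambda>x. \<Sum>j\<in>K. (g j * \<beta> (- j) t w) * eb j x"
  have eq: "?R K w = (W t w -. ?E)"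
   by (simp add: g_def beta_tilde_def sum_distrib_left mult_ac)
  note w2 = zero_mean_L2D(1)[OF W_zero_mean[OF t w]]
  note E2 = zero_mean_L2D(1)[OF e_sum_zero_mean[OF K(1,3), of "\<lambda>j. g j * \<beta> (- j) t w"]]
  note e2 = TP_ELp[OF e_basis_TP[of k], of 2]
  have "n2 (eb k) = 1" using e_basis_orthonormal[OF k k] by (simp add: n2_def L2_inner_def power2_eq_square)
  moreover have "ip (?R K w) (eb k) = ip (W t w) (eb k) - g k * \<beta> (- k) t w"
   unfolding eq L2_inner_diff_left[OF w2 E2 e2] L2_inner_e_sum[OF K(1,3) k] using K(2) by simp
  ultimately have "\<bar>ip (W t w) (eb k) - g k * \<beta> (- k) t w\<bar> \<le> n2 (?R K w)"
   using L2_inner_le[OF ELp_diff[OF w2 E2] e2] unfolding eq by simp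
  then show ?thesis unfolding n2_eq_Lp_norm[symmetric] using abs_le_square_iff[of _ "n2 (?R K w)"] n2_nonneg[of "?R K w"] by simp
 qed
 have "\<forall>\<^sub>F K in finite_subsets_at_top Z0. (\<integral>\<^sup>+w. ennreal (?d w) \<partial>M) \<le> (\<integral>\<^sup>+w. ennreal ((Lp_norm 2 (?R K w))^2) \<partial>M)"
  unfolding eventually_finite_subsets_at_top
  by (intro exI[of _ "{k}"]) (use k le in \<open>auto intro!: nn_integral_mono ennreal_leI\<close>)
 from tendsto_lowerbound[OF lim this] have "(\<integral>\<^sup>+w. ennreal (?d w) \<partial>M) = 0" by simp
 then have "AE w in M. ennreal (?d w) = 0" using m by (subst (asm) nn_integral_0_iff_AE) auto
 then show ?thesis by eventually_elim (simp add: ennreal_eq_0_iff)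
qed

lemma W_coefmeas: "0 \<le> t ==> coefmeas (F t) (W t)"
 unfolding coefmeas_def
proof (intro conjI ballI)
 assume t: "0 \<le> t"
 show "W t w \<in> \<E>" if "w \<in> space (F t)" for w using W_zero_mean[OF t] that by (simp add: space_F[OF t])
 fix k assume k: "k \<in> Z0"
 show "(\<lambda>w. ip (W t w) (eb k)) \<in> borel_measurable (F t)"
  by (rule F_measurable_AE[OF t _ W_coef[OF t k]]) (use beta_measurable[of "- k" t] t k in \<open>simp add: minus_Z0\<close>)
qed

definition incr :: "real => real => 'w => tfun" where "incr s t w x = W t w x - W s w x"

lemma incr_coefmeas: "0 \<le> s ==> s \<le> t ==> coefmeas (F t) (incr s t)"
 using coefmeas_add[OF W_coefmeas coefmeas_uminus[OF coefmeas_F_mono[OF _ _ W_coefmeas]], of t s] by (simp add: incr_def[abs_def])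

lemma incr_zero_mean: "0 \<le> s ==> s \<le> t ==> w \<in> space M ==> incr s t w \<in> \<E>"
 using coefmeasD(1)[OF incr_coefmeas] space_F[of t] by simp

lemma incr_coef:
 assumes "0 \<le> s" "s \<le> t" shows "AE w in M. \<forall>k\<in>Z0. ip (incr s t w) (eb k) = g k * D s t (- k) w"
proof (subst AE_ball_countable[OF countable_Z0], intro ballI)
 fix k assume k: "k \<in> Z0"
 have t: "0 \<le> t" using assms by simp
 show "AE w in M. ip (incr s t w) (eb k) = g k * D s t (- k) w"
  using W_coef[OF t k] W_coef[OF assms(1) k] AE_space
 proof eventually_elim
  case (elim w)
  have "ip (incr s t w) (eb k) = ip (W t w) (eb k) - ip (W s w) (eb k)"
   unfolding incr_def using elim(3) t assms(1)
   by (intro L2_inner_diff_left TP_ELp e_basis_TP zero_mean_L2D(1) W_zero_mean)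
  then show ?case using elim by (simp add: D_def right_diff_distrib)
 qed
qed

text \<open>Outside one null set, and for all n at once, the mollified increment is a finite sum of
  scalar increments.\<close>

lemma conv_incr:
 assumes "0 \<le> s" "s \<le> t"
 shows "AE w in M. \<forall>n. conv (ker n) (incr s t w) = (\<lambda>x. \<Sum>k\<in>KK n. g k * D s t (- k) w * hk n k x)"
 using incr_coef[OF assms] AE_space
proof eventually_elim
 case (elim w)
 show ?case
 proof (intro allI ext)
  fix n x
  show "conv (ker n) (incr s t w) x = (\<Sum>k\<in>KK n. g k * D s t (- k) w * hk n k x)"
   unfolding conv_ker_rep[OF incr_zero_mean[OF assms elim(2)]]
   by (rule sum.cong[OF refl]) (use elim(1) subsetD[OF KK(2)] in simp)
 qed
qed

lemma D_indep: "0 \<le> s ==> 0 \<le> t ==> indep_vars (\<lambda>_. borel) (D s t) Z0"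
proof -
 assume st: "0 \<le> s" "0 \<le> t"
 have "indep_vars (\<lambda>k. PiM {0..} (\<lambda>t. borel)) (\<lambda>k w. \<lambda>t\<in>{0..}. \<beta> k t w) Z0" using fam by (simp add: independent_wiener_family_def)
 from indep_vars_compose2[OF this, of "\<lambda>k f. f t - f s" "\<lambda>_. borel"]
 have "indep_vars (\<lambda>_. borel) (\<lambda>k w. (\<lambda>t\<in>{0..}. \<beta> k t w) t - (\<lambda>t\<in>{0..}. \<beta> k t w) s) Z0" using st by simp
 then show ?thesis using st by (simp add: D_def[abs_def])
qed

lemma D_distributed: "k \<in> Z0 ==> 0 \<le> s ==> s < t ==> distributed M lborel (D s t k) (normal_density 0 (sqrt (t - s)))"
 using wiener[of k] by (simp add: wiener_process_def D_def[abs_def])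

lemma D_measurable: "k \<in> Z0 ==> 0 \<le> s ==> s \<le> t ==> D s t k \<in> borel_measurable M"
 unfolding D_def using measurable_F_M[OF _ beta_measurable, of t k] measurable_F_M[OF _ beta_measurable, of s k] by simp

lemma Gaussian_moment:
 assumes d: "distributed M lborel X (normal_density 0 \<sigma>)" and \<sigma>: "0 < \<sigma>"
 shows "integrable M (\<lambda>w. X w ^ (2 * m))" "expectation (\<lambda>w. X w ^ (2 * m)) = fact (2 * m) / (2 ^ m * fact m) * (\<sigma>^2) ^ m"
proof -
 have h: "has_bochner_integral lborel (\<lambda>x. normal_density 0 \<sigma> x * x ^ (2 * m)) (fact (2 * m) / ((2 / \<sigma>^2) ^ m * fact m))"
  using normal_moment_even[OF \<sigma>, of 0 m] by simp
 show "integrable M (\<lambda>w. X w ^ (2 * m))"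
  using h distributed_integrable[OF d, of "\<lambda>x. x ^ (2 * m)"] by (auto simp: has_bochner_integral_iff)
 have "expectation (\<lambda>w. X w ^ (2 * m)) = fact (2 * m) / ((2 / \<sigma>^2) ^ m * fact m)"
  using h distributed_integral[OF d, of "\<lambda>x. x ^ (2 * m)"] by (auto simp: has_bochner_integral_iff)
 also have "\<dots> = fact (2 * m) / (2 ^ m * fact m) * (\<sigma>^2) ^ m" using \<sigma> by (simp add: power_divide)
 finally show "expectation (\<lambda>w. X w ^ (2 * m)) = fact (2 * m) / (2 ^ m * fact m) * (\<sigma>^2) ^ m" .
qed

lemma D_mean: "k \<in> Z0 ==> 0 \<le> s ==> s < t ==> integrable M (D s t k)"
 "k \<in> Z0 ==> 0 \<le> s ==> s < t ==> expectation (D s t k) = 0"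
proof -
 assume k: "k \<in> Z0" and st: "0 \<le> s" "s < t"
 note d = D_distributed[OF k st]
 have \<sigma>: "0 < sqrt (t - s)" using st by simp
 have i: "integrable M (\<lambda>w. D s t k w ^ 2)" using Gaussian_moment(1)[OF d \<sigma>, of 1] by simp
 show "integrable M (D s t k)"
  by (rule integrable_of_power[OF D_measurable[OF k] _ _ i]) (use st in auto)
 show "expectation (D s t k) = 0"
  using normal_distributed_expectation[OF \<sigma> d] by simp
qed

text \<open>A sum of independent centred normal variables is normal, and its even moments are powers
  of the variance times the factor displayed.\<close>

lemma Gaussian_sum_moment:
 assumes K: "finite K" "K \<subseteq> Z0" and st: "0 \<le> s" "s < t" and m: "0 < m" and V: "(\<Sum>k\<in>K. (a k)^2) \<le> V"
 shows "integrable M (\<lambda>w. (\<Sum>k\<in>K. a k * D s t (- k) w) ^ (2 * m))"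
  "expectation (\<lambda>w. (\<Sum>k\<in>K. a k * D s t (- k) w) ^ (2 * m)) \<le> fact (2 * m) / (2 ^ m * fact m) * (V * (t - s)) ^ m"
proof -
 let ?S = "\<lambda>w. (\<Sum>k\<in>K. a k * D s t (- k) w)" and ?C = "fact (2 * m) / (2 ^ m * fact m) * (V * (t - s)) ^ m"
 \<comment> \<open>Vanishing coefficients are dropped because they would give variables of zero
   variance, which have no density; the reflection matches the index of the Wiener
   processes.\<close>
 define J where "J = uminus ` {k\<in>K. a k \<noteq> 0}"
 have J: "finite J" "J \<subseteq> Z0" using K minus_Z0 by (auto simp: J_def)
 have inj: "inj_on uminus {k\<in>K. a k \<noteq> 0}" by (simp add: inj_on_def)
 have "?S w = (\<Sum>k | k \<in> K \<and> a k \<noteq> 0. a k * D s t (- k) w)" for w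
  using K(1) by (intro sum.mono_neutral_right) auto
 also have "\<dots> w = (\<Sum>j\<in>J. 0 + a (- j) * D s t j w)" for w unfolding J_def sum.reindex[OF inj] by simp
 finally have eq: "(\<lambda>w. ?S w ^ (2 * m)) = (\<lambda>w. (\<Sum>j\<in>J. 0 + a (- j) * D s t j w) ^ (2 * m))" by simp
 have V0: "0 \<le> V" using V by (meson order_trans sum_nonneg zero_le_power2)
 have "integrable M (\<lambda>w. ?S w ^ (2 * m)) \<and>
  expectation (\<lambda>w. ?S w ^ (2 * m)) \<le> ?C"
 proof (cases "J = {}")
  case True then show ?thesis unfolding eq using V0 st m by (simp add: power_0_left)
 next
  case False
  have an: "a (- j) \<noteq> 0" if "j \<in> J" for j using that by (auto simp: J_def)
  let ?\<sigma> = "\<lambda>j. \<bar>a (- j)\<bar> * sqrt (t - s)"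
  have iv: "indep_vars (\<lambda>_. borel) (\<lambda>j w. 0 + a (- j) * D s t j w) J"
   using indep_vars_compose2[OF indep_vars_subset[OF D_indep J(2)], of s t "\<lambda>j x. 0 + a (- j) * x" "\<lambda>_. borel"] st by simp
  have "distributed M lborel (\<lambda>w. \<Sum>j\<in>J. 0 + a (- j) * D s t j w)
    (normal_density (\<Sum>j\<in>J. 0 + a (- j) * 0) (sqrt (\<Sum>j\<in>J. (?\<sigma> j)^2)))"
   using sum_indep_normal[OF J(1) False iv, of ?\<sigma> "\<lambda>j. 0 + a (- j) * 0"] normal_density_affine[OF D_distributed, of _ s t "a (- _)" 0]
    an st J(2) by (simp add: subset_iff)
  then have dist: "distributed M lborel (\<lambda>w. \<Sum>j\<in>J. 0 + a (- j) * D s t j w) (normal_density 0 (sqrt (\<Sum>j\<in>J. (?\<sigma> j)^2)))" by simp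
  have pos: "0 < (\<Sum>j\<in>J. (?\<sigma> j)^2)" using J(1) False an st by (intro sum_pos) auto
  have "(\<Sum>j\<in>J. (?\<sigma> j)^2) = (\<Sum>j\<in>J. (a (- j))^2) * (t - s)" using st by (simp add: power_mult_distrib sum_distrib_right)
  also have "(\<Sum>j\<in>J. (a (- j))^2) = (\<Sum>k | k \<in> K \<and> a k \<noteq> 0. (a k)^2)" unfolding J_def sum.reindex[OF inj] by simp
  also have "\<dots> = (\<Sum>k\<in>K. (a k)^2)" using K(1) by (intro sum.mono_neutral_left) auto
  finally have "(\<Sum>j\<in>J. (?\<sigma> j)^2) \<le> V * (t - s)" using V st by (simp add: mult_right_mono)
  then have "(\<Sum>j\<in>J. (?\<sigma> j)^2) ^ m \<le> (V * (t - s)) ^ m" using pos by (intro power_mono) auto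
  then show ?thesis
   unfolding eq using Gaussian_moment[OF dist, of m] pos by (simp add: mult_left_mono divide_right_mono)
 qed
 then show "integrable M (\<lambda>w. ?S w ^ (2 * m))"
  "expectation (\<lambda>w. ?S w ^ (2 * m)) \<le> ?C" by auto
qed

end

text \<open>A subsequence that realises the lower limit has bounded power integrals; the arbitrary
  slack e then sharpens that bound to the lower limit itself.\<close>

lemma ELp_Fatou_liminf:
 assumes b: "b \<in> ELp 2" and p: "even p" and L: "liminf (\<lambda>n. ennreal (Ip p (conv (ker n) b))) < \<infinity>" (is "?L < \<infinity>")
 shows "b \<in> ELp p" "ennreal (Ip p b) \<le> liminf (\<lambda>n. ennreal (Ip p (conv (ker n) b)))"
proof -
 let ?u = "\<lambda>n. ennreal (Ip p (conv (ker n) b))"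
 obtain r where r: "strict_mono r" "(?u \<circ> r) ~~> ?L" using liminf_subseq_lim by blast
 obtain l where l: "?L = ennreal l" "0 \<le> l" using L by (cases ?L) auto
 have T: "conv (ker n) b \<in> ELp q" for n q by (rule TP_ELp[OF conv_TP[OF ker_TP ELp2_integrable[OF b]]])
 have *: "b \<in> ELp p \<and> Ip p b \<le> l + e" if e: "0 < e" for e
 proof -
  have "?L < ennreal (l + e)" using l e by (simp add: ennreal_lessI)
  then obtain N where N: "\<And>n. N \<le> n ==> ?u (r n) < ennreal (l + e)"
   using order_tendstoD(2)[OF r(2)] by (auto simp: eventually_sequentially)
  have C: "Ip p (conv (ker (r (n + N))) b) \<le> l + e" for n
   using N[of "n + N"] Ip_nonneg[OF p] by (simp add: ennreal_less_iff less_imp_le)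
  have lim: "(\<lambda>n. n2 (\<lambda>x. conv (ker (r (n + N))) b x - b x)) ~~> 0"
   using LIMSEQ_ignore_initial_segment[OF LIMSEQ_subseq_LIMSEQ[OF conv_ker_n2[OF b] r(1)], of N] by (simp add: o_def)
  show ?thesis using ELp_Fatou_subseq[OF T b lim p T C[unfolded Ip_def]] unfolding Ip_def by blast
 qed
 show "b \<in> ELp p" using *[of 1] by simp
 have "Ip p b \<le> l" by (rule field_le_epsilon) (use * in blast)
 then show "ennreal (Ip p b) \<le> ?L" unfolding l by (rule ennreal_leI)
qed

context curl_noise begin

lemma S_nonneg: "0 \<le> S" using S[of "{}"] by simp

text \<open>The Gaussian factor (2m)!/(2^m m!) times the m-th power of a variance bound: (2 pi)^2
  comes from the weights \<open>g\<close>, and the factor 2 from the squared bound on the mollified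
  modes.\<close>

definition moment_const :: "nat => real" where
 "moment_const m = fact (2 * m) / (2 ^ m * fact m) * (2 * ((2 * pi)^2 * S)) ^ m"

lemma moment_const_nonneg: "0 \<le> moment_const m"
 unfolding moment_const_def using S_nonneg by simp

text \<open>At a fixed point x the mollified increment is a centred Gaussian sum whose variance is
  bounded independently of x and n. Its moment is integrated over the torus, and Fatou in n
  transfers membership, integrability and the bound to the increment itself.\<close>

lemma
 assumes st: "0 \<le> s" "s < t" and p: "even p" "2 \<le> p"
 shows incr_ELp: "AE w in M. incr s t w \<in> ELp p"
  and incr_Ip_integrable: "integrable M (\<lambda>w. Ip p (incr s t w))"
  and incr_Ip_le: "expectation (\<lambda>w. Ip p (incr s t w)) \<le> moment_const (p div 2) * (t - s) ^ (p div 2)"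
proof -
 obtain m where pm: "p = 2 * m" and m: "0 < m" using p by (auto elim!: evenE)
 define A where "A = moment_const m * (t - s) ^ m"
 have A0: "0 \<le> A" using moment_const_nonneg st by (simp add: A_def)
 let ?Z = "\<lambda>n w x. \<Sum>k\<in>KK n. g k * D s t (- k) w * hk n k x"
 have jm: "(\<lambda>(w, x). ennreal (?Z n w x ^ p)) \<in> borel_measurable (M \<Otimes>\<^sub>M torus)" for n
  unfolding case_prod_beta'
 proof (intro measurable_compose[OF _ measurable_ennreal] borel_measurable_power borel_measurable_sum borel_measurable_times borel_measurable_const)
  show "(\<lambda>q. hk n k (snd q)) \<in> borel_measurable (M \<Otimes>\<^sub>M torus)" for k
   by (rule measurable_compose[OF measurable_snd measurable_torus[OF TP_measurable[OF hk_TP]]])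
  show "(\<lambda>q. D s t (- k) (fst q)) \<in> borel_measurable (M \<Otimes>\<^sub>M torus)" if "k \<in> KK n" for k
   by (rule measurable_compose[OF measurable_fst D_measurable]) (use that subsetD[OF KK(2)] st in \<open>simp_all add: minus_Z0\<close>)
 qed
 have ZT: "?Z n w \<in> TP" for n w by (intro TP_sum KK TP.scale hk_TP)
 have mean: "(\<integral>\<^sup>+w. ennreal (?Z n w x ^ p) \<partial>M) \<le> ennreal A" for n x
 proof -
  have h2: "(hk n k x)^2 \<le> 2" for k
   using power_mono[OF hk_bounded[of n k x], of 2] by simp
  have "(\<Sum>k\<in>KK n. (g k * hk n k x)^2) \<le> (\<Sum>k\<in>KK n. 2 * ((2 * pi)^2 * (norm (kvec k) * c (- k))^2))"
  proof (rule sum_mono)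
   fix k
   have "(g k * hk n k x)^2 = ((2 * pi)^2 * (norm (kvec k) * c (- k))^2) * (hk n k x)^2"
    unfolding g_def power_mult_distrib power2_minus ..
   also have "\<dots> \<le> ((2 * pi)^2 * (norm (kvec k) * c (- k))^2) * 2" by (intro mult_left_mono h2) simp
   finally show "(g k * hk n k x)^2 \<le> 2 * ((2 * pi)^2 * (norm (kvec k) * c (- k))^2)" by simp
  qed
  also have "\<dots> \<le> 2 * ((2 * pi)^2 * S)"
   using S[OF KK(1,2)[of n]] by (simp add: sum_distrib_left[symmetric])
  finally have V: "(\<Sum>k\<in>KK n. (g k * hk n k x)^2) \<le> 2 * ((2 * pi)^2 * S)" .
  note G = Gaussian_sum_moment[OF KK(1,2) st m V]
  have eq: "?Z n w x ^ p = (\<Sum>k\<in>KK n. g k * hk n k x * D s t (- k) w) ^ (2 * m)" for w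
   unfolding pm by (simp add: mult_ac)
  have "(\<integral>\<^sup>+w. ennreal (?Z n w x ^ p) \<partial>M) = ennreal (expectation (\<lambda>w. ?Z n w x ^ p))"
   by (rule nn_integral_eq_integral) (use G(1) p in \<open>simp_all add: eq zero_le_even_power\<close>)
  also have "\<dots> \<le> ennreal A"
   unfolding eq using G(2) by (intro ennreal_leI) (simp add: A_def moment_const_def power_mult_distrib mult_ac)
  finally show ?thesis .
 qed
 have pr: "pair_sigma_finite M torus" by (rule pair_sigma_finite.intro) unfold_locales
 have ZI: "(navg x. ennreal (?Z n w x ^ p)) = ennreal (Ip p (?Z n w))" for n w
  unfolding Ip_def by (rule nn_integral_eq_integral) (use ELpD(4)[OF TP_ELp[OF ZT]] p in \<open>simp_all add: zero_le_even_power\<close>)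
 have Zm: "(\<lambda>w. ennreal (Ip p (?Z n w))) \<in> borel_measurable M" for n
  using torus.borel_measurable_nn_integral[OF jm, of n] unfolding ZI .
 have mean': "(\<integral>\<^sup>+w. ennreal (Ip p (?Z n w)) \<partial>M) \<le> ennreal A" for n
 proof -
  have "(\<integral>\<^sup>+w. ennreal (Ip p (?Z n w)) \<partial>M) = (navg x. (\<integral>\<^sup>+w. ennreal (?Z n w x ^ p) \<partial>M))"
   unfolding ZI[symmetric] by (rule pair_sigma_finite.Fubini'[OF pr jm, symmetric])
  also have "\<dots> \<le> (navg x. ennreal A)" by (rule nn_integral_mono[OF mean])
  finally show ?thesis by (simp add: torus.emeasure_space_1)
 qed
 have "(\<integral>\<^sup>+w. liminf (\<lambda>n. ennreal (Ip p (?Z n w))) \<partial>M) \<le> liminf (\<lambda>n. \<integral>\<^sup>+w. ennreal (Ip p (?Z n w)) \<partial>M)"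
  by (rule nn_integral_liminf[OF Zm])
 also have "\<dots> \<le> liminf (\<lambda>n. ennreal A)" by (intro Liminf_mono always_eventually allI mean')
 finally have LA: "(\<integral>\<^sup>+w. liminf (\<lambda>n. ennreal (Ip p (?Z n w))) \<partial>M) \<le> ennreal A" by (simp add: Liminf_const)
 have fin: "AE w in M. liminf (\<lambda>n. ennreal (Ip p (?Z n w))) \<noteq> \<infinity>"
  by (rule nn_integral_PInf_AE) (use LA Zm in \<open>auto simp: top_unique\<close>)
 have st': "s \<le> t" using st by simp
 have both: "AE w in M. incr s t w \<in> ELp p \<and> ennreal (Ip p (incr s t w)) \<le> liminf (\<lambda>n. ennreal (Ip p (?Z n w)))"
  using fin conv_incr[OF st(1) st'] AE_space
 proof eventually_elim
  case (elim w)
  have "liminf (\<lambda>n. ennreal (Ip p (conv (ker n) (incr s t w)))) < \<infinity>"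
   unfolding elim(2)[rule_format] using elim(1) by (simp add: less_top)
  from ELp_Fatou_liminf[OF zero_mean_L2D(1)[OF incr_zero_mean[OF st(1) st' elim(3)]] p(1) this]
  show ?case unfolding elim(2)[rule_format] by blast
 qed
 then show ae: "AE w in M. incr s t w \<in> ELp p" by eventually_elim blast
 have Im: "(\<lambda>w. Ip p (incr s t w)) \<in> borel_measurable M"
  by (rule measurable_F_M[OF _ Ip_F_measurable[OF _ incr_coefmeas[OF st(1) st'] ae p]]) (use st in auto)
 have "(\<integral>\<^sup>+w. ennreal (Ip p (incr s t w)) \<partial>M) \<le> (\<integral>\<^sup>+w. liminf (\<lambda>n. ennreal (Ip p (?Z n w))) \<partial>M)"
  by (rule nn_integral_mono_AE) (use both in \<open>eventually_elim, blast\<close>)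
 with LA have le: "(\<integral>\<^sup>+w. ennreal (Ip p (incr s t w)) \<partial>M) \<le> ennreal A" by (rule order_trans[rotated])
 have "(\<integral>\<^sup>+w. ennreal (Ip p (incr s t w)) \<partial>M) < \<infinity>" using le_less_trans[OF le] by simp
 then show i: "integrable M (\<lambda>w. Ip p (incr s t w))"
  by (intro integrableI_nonneg Im) (simp_all add: Ip_nonneg p)
 have "ennreal (expectation (\<lambda>w. Ip p (incr s t w))) \<le> ennreal A"
  using le nn_integral_eq_integral[OF i] by (simp add: Ip_nonneg p)
 then show "expectation (\<lambda>w. Ip p (incr s t w)) \<le> moment_const (p div 2) * (t - s) ^ (p div 2)"
  using A0 by (simp add: A_def pm)
qed

lemma incr_indep:
 assumes k: "k \<in> Z0" and st: "0 \<le> s" "s < t" and H: "H \<in> borel_measurable (F s)"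
 shows "indep_var borel H borel (D s t k)"
 unfolding indep_var_eq
proof (intro conjI)
 show "H \<in> borel_measurable M" by (rule measurable_F_M[OF st(1) H])
 show "D s t k \<in> borel_measurable M" using D_measurable[OF k] st by simp
 have "indep_set (sets (F s)) (sets (vimage_algebra (space M) (D s t k) borel))"
  using wiener[OF k] st by (simp add: wiener_process_def D_def[abs_def])
 then show "indep_set (sigma_sets (space M) {H -` A \<inter> space M |A. A \<in> sets borel}) (sigma_sets (space M) {D s t k -` A \<inter> space M |A. A \<in> sets borel})"
  unfolding indep_set_def
 proof (rule indep_sets_mono_sets)
  fix i :: bool
  have "sigma_sets (space M) {H -` A \<inter> space M |A. A \<in> sets borel} \<subseteq> sets (F s)"
   unfolding space_F[OF st(1), symmetric]
   by (rule sets.sigma_sets_subset) (use measurable_sets[OF H] in auto)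
  then show "(case i of True => sigma_sets (space M) {H -` A \<inter> space M |A. A \<in> sets borel}
     | False => sigma_sets (space M) {D s t k -` A \<inter> space M |A. A \<in> sets borel})
    \<subseteq> (case i of True => sets (F s) | False => sets (vimage_algebra (space M) (D s t k) borel))"
   by (cases i) (simp_all add: sets_vimage_algebra)
 qed
qed

text \<open>With the mollified increment the pairing is a finite sum of variables of the past times
  independent centred ones, so its mean is zero; dominated convergence removes the mollification.
  The weight G makes room for partial sums and running maxima.\<close>

lemma
 assumes st: "0 \<le> s" "s < t" and p: "even p" "2 \<le> p" and a: "coefmeas (F s) a" and ap: "AE w in M. a w \<in> ELp p"
  and G: "G \<in> borel_measurable (F s)" "integrable M G" and Ga: "integrable M (\<lambda>w. G w * Ip p (a w))"
  and Gb: "integrable M (\<lambda>w. G w * Ip p (incr s t w))"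
 shows Np_incr_integrable: "integrable M (\<lambda>w. G w * Np p (a w) (incr s t w))"
  and Np_incr_mean: "expectation (\<lambda>w. G w * Np p (a w) (incr s t w)) = 0"
proof -
 let ?b = "incr s t"
 let ?H = "\<lambda>n k w. G w * Np p (a w) (hk n k)"
 let ?u = "\<lambda>n w. \<Sum>k\<in>KK n. g k * (?H n k w * D s t (- k) w)"
 have Hm: "?H n k \<in> borel_measurable (F s)" for n k
  by (intro borel_measurable_times G Np_F_measurable[OF st(1) a ap p hk_TP])
 have Hi: "integrable M (?H n k)" for n k
 proof (rule bochner_bound)
  show "integrable M (\<lambda>w. \<bar>G w * Ip p (a w)\<bar> + \<bar>G w * Ip p (hk n k)\<bar>)"
   by (intro bochner_integrable_add integrable_abs Ga integrable_mult_left G)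
  show "?H n k \<in> borel_measurable M" by (rule measurable_F_M[OF st(1) Hm])
  show "AE w in M. norm (?H n k w) \<le> norm (\<bar>G w * Ip p (a w)\<bar> + \<bar>G w * Ip p (hk n k)\<bar>)"
   using ap
  proof eventually_elim
   case (elim w)
   have "\<bar>Np p (a w) (hk n k)\<bar> \<le> Ip p (a w) + Ip p (hk n k)"
    using Np_abs_le[OF p elim TP_ELp[OF hk_TP] zero_less_one] by simp
   then have "\<bar>G w\<bar> * \<bar>Np p (a w) (hk n k)\<bar> \<le> \<bar>G w\<bar> * (Ip p (a w) + Ip p (hk n k))" by (intro mult_left_mono) auto
   then show ?case by (simp add: abs_mult distrib_left Ip_nonneg p)
  qed
 qed
 have mk: "- k \<in> Z0" if "k \<in> KK n" for k n using subsetD[OF KK(2) that] by (simp add: minus_Z0)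
 have iv: "integrable M (\<lambda>w. ?H n k w * D s t (- k) w)" "expectation (\<lambda>w. ?H n k w * D s t (- k) w) = 0" if "k \<in> KK n" for n k
  using indep_var_integrable[OF incr_indep[OF mk[OF that] st Hm] Hi D_mean(1)[OF mk[OF that] st]]
   indep_var_lebesgue_integral[OF incr_indep[OF mk[OF that] st Hm] Hi D_mean(1)[OF mk[OF that] st]]
   D_mean(2)[OF mk[OF that] st] by simp_all
 have u0: "expectation (?u n) = 0" for n
 proof -
  have "expectation (?u n) = (\<Sum>k\<in>KK n. expectation (\<lambda>w. g k * (?H n k w * D s t (- k) w)))"
   by (rule bochner_sum) (intro integrable_mult_right iv)
  also have "\<dots> = 0" by (rule sum.neutral) (simp add: iv)
  finally show ?thesis .
 qed
 have um: "?u n \<in> borel_measurable M" for n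
  by (intro borel_measurable_sum borel_measurable_times borel_measurable_const measurable_F_M[OF st(1) Hm] D_measurable mk)
    (use st in auto)
 have st': "s \<le> t" using st by simp
 have eq: "AE w in M. \<forall>n. ?u n w = G w * Np p (a w) (conv (ker n) (?b w))"
  using conv_incr[OF st(1) st'] ap
 proof eventually_elim
  case (elim w)
  show ?case
  proof
   fix n
   have "Np p (a w) (conv (ker n) (?b w)) = (avg x. (\<Sum>k\<in>KK n. g k * D s t (- k) w * (a w x ^ (p - 1) * hk n k x)))"
    unfolding Np_def elim(1)[rule_format] by (intro bochner_cong refl) (simp add: sum_distrib_left mult_ac)
   also have "\<dots> = (\<Sum>k\<in>KK n. g k * D s t (- k) w * Np p (a w) (hk n k))"
    unfolding Np_def using integrable_power_mult[OF p elim(2) TP_ELp[OF hk_TP]]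
    by (subst bochner_sum) simp_all
   finally show "?u n w = G w * Np p (a w) (conv (ker n) (?b w))"
    by (simp add: sum_distrib_left mult_ac)
  qed
 qed
 note bp = incr_ELp[OF st p]
 have lim: "AE w in M. (\<lambda>n. ?u n w) ~~> G w * Np p (a w) (?b w)"
  using eq ap bp
 proof eventually_elim
  case (elim w)
  show ?case unfolding elim(1)[rule_format] by (intro tendsto_intros Np_tendsto p elim)
 qed
 have w: "integrable M (\<lambda>w. \<bar>G w * Ip p (a w)\<bar> + \<bar>G w * Ip p (?b w)\<bar>)"
  by (intro bochner_integrable_add integrable_abs Ga Gb)
 have bnd: "AE w in M. norm (?u n w) \<le> \<bar>G w * Ip p (a w)\<bar> + \<bar>G w * Ip p (?b w)\<bar>" for n
  using eq ap bp
 proof eventually_elim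
  case (elim w)
  have T: "conv (ker n) (?b w) \<in> ELp p" by (rule TP_ELp[OF conv_TP[OF ker_TP ELp_integrable[OF elim(3) p]]])
  have "\<bar>Np p (a w) (conv (ker n) (?b w))\<bar> \<le> Ip p (a w) + Ip p (?b w)"
   using Np_abs_le[OF p elim(2) T zero_less_one] conv_power_le[OF ker_prob[of n] elim(3) p] by (simp add: Ip_def)
  then have "\<bar>G w\<bar> * \<bar>Np p (a w) (conv (ker n) (?b w))\<bar> \<le> \<bar>G w\<bar> * (Ip p (a w) + Ip p (?b w))" by (intro mult_left_mono) auto
  then show ?case unfolding elim(1)[rule_format] by (simp add: abs_mult distrib_left Ip_nonneg p)
 qed
 note dct = M_limit_measurable[OF um lim] um w lim bnd
 show "integrable M (\<lambda>w. G w * Np p (a w) (?b w))" by (rule integrable_dominated_convergence[OF dct])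
 have "(\<lambda>n. expectation (?u n)) ~~> expectation (\<lambda>w. G w * Np p (a w) (?b w))" by (rule integral_dominated_convergence[OF dct])
 then show "expectation (\<lambda>w. G w * Np p (a w) (?b w)) = 0" unfolding u0 by (simp add: LIMSEQ_const_iff)
qed

end

section \<open>Moments of the numerical solution\<close>

lemma Ip_square_le:
 assumes f: "f \<in> ELp (2 * p)" and p: "even p" "2 \<le> p"
 shows "(Ip p f)^2 \<le> Ip (2 * p) f"
 using torus.power_expectation_le[of "\<lambda>x. f x ^ p" 2] ELpD(3,4)[OF f]
 by (simp add: Ip_def power_mult[symmetric] mult.commute)

lemma Np_conv_ker:
 assumes p: "even p" "2 \<le> p" and a: "a \<in> ELp p" and b: "b \<in> \<E>"
 shows "Np p a (conv (ker n) b) = (\<Sum>k\<in>KK n. ip b (eb k) * Np p a (hk n k))"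
proof -
 have "Np p a (conv (ker n) b) = (avg x. (\<Sum>k\<in>KK n. ip b (eb k) * (a x ^ (p - 1) * hk n k x)))"
  unfolding Np_def conv_ker_rep[OF b] by (intro bochner_cong refl) (simp add: sum_distrib_left mult_ac)
 also have "\<dots> = (\<Sum>k\<in>KK n. ip b (eb k) * Np p a (hk n k))"
  unfolding Np_def using integrable_power_mult[OF p a TP_ELp[OF hk_TP]]
  by (subst bochner_sum) simp_all
 finally show ?thesis .
qed

text \<open>\<open>even_power_add_le\<close> with the step size as its parameter, integrated over
  the torus; the contraction property of \<open>Phi\<close> then replaces powers of the transported
  function by powers of x.\<close>

lemma euler_step_le:
 assumes p: "even p" "2 \<le> p" and x: "x \<in> \<E>" "x \<in> ELp p" and b: "b \<in> ELp p" and \<tau>: "0 < \<tau>"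
 shows "(\<lambda>z. Phi \<tau> x z + b z) \<in> ELp p"
  and "Ip p (\<lambda>z. Phi \<tau> x z + b z) \<le> Ip p x + real p * Np p (Phi \<tau> x) b
      + 2 ^ p * (\<tau> * Ip p x + (1 + (1 / \<tau>) ^ (p div 2 - 1)) * Ip p b)"
proof -
 let ?a = "Phi \<tau> x"
 note a = Phi_Lp[OF x(1) p x(2), of \<tau>]
 note i = ELpD(4)[OF a(1)] ELpD(4)[OF b] integrable_power_mult[OF p a(1) b]
 show E: "(\<lambda>z. ?a z + b z) \<in> ELp p" by (rule ELp_add[OF a(1) b p(1)])
 have "Ip p (\<lambda>z. ?a z + b z) \<le> (avg z. ?a z ^ p + real p * (?a z ^ (p - 1) * b z)
   + 2 ^ p * (\<tau> * ?a z ^ p + (1 + (1 / \<tau>) ^ (p div 2 - 1)) * b z ^ p))"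
  unfolding Ip_def using i by (intro integral_mono ELpD(4)[OF E] even_power_add_le p \<tau>) auto
 also have "\<dots> = Ip p ?a + real p * Np p ?a b + 2 ^ p * (\<tau> * Ip p ?a + (1 + (1 / \<tau>) ^ (p div 2 - 1)) * Ip p b)"
  unfolding Ip_def Np_def using i by simp
 also have "\<dots> \<le> Ip p x + real p * Np p ?a b + 2 ^ p * (\<tau> * Ip p x + (1 + (1 / \<tau>) ^ (p div 2 - 1)) * Ip p b)"
  using a(2) \<tau> by (intro add_mono mult_left_mono order_refl) (auto simp: Ip_def)
 finally show "Ip p (\<lambda>z. ?a z + b z) \<le> Ip p x + real p * Np p ?a b
      + 2 ^ p * (\<tau> * Ip p x + (1 + (1 / \<tau>) ^ (p div 2 - 1)) * Ip p b)" .
qed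

lemma one_plus_power_le_exp: "0 \<le> (x::real) ==> (1 + x) ^ n \<le> exp (real n * x)"
 using power_mono[OF exp_ge_add_one_self_aux[of x], of n] by (simp add: exp_of_nat_mult)

primrec rmax :: "(nat => real) => nat => real" where
 "rmax Y 0 = Y 0" | "rmax Y (Suc n) = max (rmax Y n) (Y (Suc n))"

lemma rmax_ge: "i \<le> n ==> Y i \<le> rmax Y n"
 by (induction n) (auto simp: le_Suc_eq)

text \<open>The running maximum m only moves when it equals the new value of y, so 2 m y - m^2
  dominates the discrete integral of 2 m against the increments of y; the rest is a completed
  square. For a martingale the sum has mean zero, and Doob's inequality with constant 4
  remains.\<close>

lemma pathwise_Doob:
 assumes "Y 0 = 0"
 shows "(rmax Y n)^2 \<le> 4 * (Y n)^2 - 4 * (\<Sum>i<n. rmax Y i * (Y (Suc i) - Y i))"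
proof -
 have "2 * (\<Sum>i<n. rmax Y i * (Y (Suc i) - Y i)) \<le> 2 * rmax Y n * Y n - (rmax Y n)^2"
 proof (induction n)
  case (Suc n)
  let ?m = "rmax Y n" and ?y = "Y n" and ?z = "Y (Suc n)"
  have "2 * ?m * ?z - ?m\<^sup>2 \<le> 2 * max ?m ?z * ?z - (max ?m ?z)^2"
   using zero_le_power2[of "?m - ?z"] by (cases "?m \<le> ?z") (simp_all add: power2_eq_square algebra_simps)
  with Suc show ?case by (simp add: algebra_simps)
 qed (simp add: assms)
 with zero_le_power2[of "2 * Y n - rmax Y n"] show ?thesis by (simp add: power2_eq_square algebra_simps)
qed

context curl_noise begin

text \<open>When both arguments are random the second one is mollified: the pairing becomes a finite
  sum of coefficients of b times pairings with fixed functions.\<close>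

lemma Np_F_measurable':
 assumes t: "0 \<le> t" and a: "coefmeas (F t) a" and ap: "AE w in M. a w \<in> ELp p"
  and b: "coefmeas (F t) b" and bp: "AE w in M. b w \<in> ELp p" and p: "even p" "2 \<le> p"
 shows "(\<lambda>w. Np p (a w) (b w)) \<in> borel_measurable (F t)"
proof (rule F_measurable_AE[OF t])
 let ?u = "\<lambda>n w. \<Sum>k\<in>KK n. ip (b w) (eb k) * Np p (a w) (hk n k)"
 show "(\<lambda>w. lim (\<lambda>n. ?u n w)) \<in> borel_measurable (F t)"
  by (intro borel_measurable_lim_metric borel_measurable_sum borel_measurable_times coefmeasD(2)[OF b]
    Np_F_measurable[OF t a ap p hk_TP] subsetD[OF KK(2)])
 show "AE w in M. Np p (a w) (b w) = lim (\<lambda>n. ?u n w)"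
  using ap bp AE_space
 proof eventually_elim
  case (elim w)
  have "b w \<in> \<E>" using coefmeasD(1)[OF b] elim(3) by (simp add: space_F[OF t])
  from Np_conv_ker[OF p elim(1) this] Np_tendsto[OF p elim(1,2)] show ?case by (simp add: limI)
 qed
qed

context
 fixes \<xi> :: "'w => tfun" and \<tau> T :: real
 assumes \<xi>: "coefmeas (F 0) \<xi>" and \<tau>: "0 < \<tau>" "\<tau> \<le> T"
begin

abbreviation X :: "nat => 'w => tfun" where "X \<equiv> split_euler \<tau> W \<xi>"
abbreviation t :: "nat => real" where "t i \<equiv> real i * \<tau>"
abbreviation b :: "nat => 'w => tfun" where "b i \<equiv> incr (t i) (t (Suc i))"
abbreviation N :: "nat => nat => 'w => real" where "N p i w \<equiv> Np p (Phi \<tau> (X i w)) (b i w)"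

lemma t: "0 \<le> t i" "t i < t (Suc i)" "t i \<le> t (Suc i)" "t (Suc i) - t i = \<tau>"
 using \<tau> by (auto simp: distrib_right)

lemma X_Suc: "X (Suc i) w = (\<lambda>x. Phi \<tau> (X i w) x + b i w x)"
 by (simp add: incr_def)

text \<open>Adaptedness: \<open>Phi\<close> acts on what is known at time \<open>t i\<close>, and
  the increment is known one step later.\<close>

lemma X_coefmeas: "coefmeas (F (t i)) (X i)"
proof (induction i)
 case 0 then show ?case using \<xi> by simp
next
 case (Suc i)
 show ?case
  using coefmeas_add[OF coefmeas_F_mono[OF t(1,3) Phi_coefmeas[OF Suc]] incr_coefmeas[OF t(1,3)], of \<tau>]
  unfolding X_Suc[abs_def] .
qed

lemma X_zero_mean: "w \<in> space M ==> X i w \<in> \<E>"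
 using coefmeasD(1)[OF X_coefmeas] by (simp add: space_F[OF t(1)])

lemma b_ELp: "even p ==> 2 \<le> p ==> AE w in M. b i w \<in> ELp p"
 by (rule incr_ELp[OF t(1,2)])

lemma b_Ip: "even p ==> 2 \<le> p ==> integrable M (\<lambda>w. Ip p (b i w))"
 "even p ==> 2 \<le> p ==> expectation (\<lambda>w. Ip p (b i w)) \<le> moment_const (p div 2) * \<tau> ^ (p div 2)"
 using incr_Ip_integrable[OF t(1,2)] incr_Ip_le[OF t(1,2)] unfolding t(4) by auto

context
 fixes p :: nat
 assumes p: "even p" "2 \<le> p" and \<xi>p: "AE w in M. \<xi> w \<in> ELp p" "integrable M (\<lambda>w. Ip p (\<xi> w))"
begin

lemma X_ELp: "AE w in M. X i w \<in> ELp p"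
proof (induction i)
 case 0 then show ?case using \<xi>p by simp
next
 case (Suc i)
 from Suc b_ELp[OF p, of i] AE_space show ?case
 proof eventually_elim
  case (elim w)
  show ?case unfolding X_Suc by (rule euler_step_le(1)[OF p X_zero_mean[OF elim(3)] elim(1,2) \<tau>(1)])
 qed
qed

lemma a_ELp: "AE w in M. Phi \<tau> (X i w) \<in> ELp p"
 using X_ELp[of i] AE_space by eventually_elim (rule Phi_Lp[OF X_zero_mean p])

lemma a_coefmeas: "coefmeas (F (t i)) (\<lambda>w. Phi \<tau> (X i w))" by (rule Phi_coefmeas[OF X_coefmeas])

lemma X_Ip_measurable: "(\<lambda>w. Ip p (X i w)) \<in> borel_measurable M"
 by (rule measurable_F_M[OF t(1) Ip_F_measurable[OF t(1) X_coefmeas X_ELp p]])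

lemma a_Ip_le: "AE w in M. Ip p (Phi \<tau> (X i w)) \<le> Ip p (X i w)"
 using X_ELp[of i] AE_space unfolding Ip_def by eventually_elim (rule Phi_Lp(2)[OF X_zero_mean p])

lemma a_Ip_measurable: "(\<lambda>w. Ip p (Phi \<tau> (X i w))) \<in> borel_measurable M"
 by (rule measurable_F_M[OF t(1) Ip_F_measurable[OF t(1) a_coefmeas a_ELp p]])

lemma X_step:
 "AE w in M. Ip p (X (Suc i) w) \<le> Ip p (X i w) + real p * N p i w
      + 2 ^ p * (\<tau> * Ip p (X i w) + (1 + (1 / \<tau>) ^ (p div 2 - 1)) * Ip p (b i w))"
 using X_ELp[of i] b_ELp[OF p, of i] AE_space
proof eventually_elim
 case (elim w)
 show ?case unfolding X_Suc by (rule euler_step_le(2)[OF p X_zero_mean[OF elim(3)] elim(1,2) \<tau>(1)])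
qed

text \<open>A crude bound of the linear term, by Young with weight 1, is enough here. The sharp
  estimate uses that this term has mean zero and needs integrability beforehand.\<close>

lemma X_Ip_integrable: "integrable M (\<lambda>w. Ip p (X i w))"
proof (induction i)
 case 0 then show ?case using \<xi>p by simp
next
 case (Suc i)
 show ?case
 proof (rule bochner_bound[OF _ X_Ip_measurable])
  let ?w = "\<lambda>w. Ip p (X i w) + real p * (Ip p (X i w) + Ip p (b i w))
      + 2 ^ p * (\<tau> * Ip p (X i w) + (1 + (1 / \<tau>) ^ (p div 2 - 1)) * Ip p (b i w))"
  show "integrable M ?w" using Suc b_Ip(1)[OF p, of i] by simp
  show "AE w in M. norm (Ip p (X (Suc i) w)) \<le> norm (?w w)"
   using X_step[of i] a_ELp[of i] b_ELp[OF p, of i] a_Ip_le[of i]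
  proof eventually_elim
   case (elim w)
   have "N p i w \<le> Ip p (X i w) + Ip p (b i w)"
    using Np_abs_le[OF p elim(2,3) zero_less_one] elim(4) by simp
   then have "real p * N p i w \<le> real p * (Ip p (X i w) + Ip p (b i w))" by (rule mult_left_mono) simp
   with elim(1) have "Ip p (X (Suc i) w) \<le> ?w w" by simp
   then show ?case using Ip_nonneg[OF p(1), of "X (Suc i) w"] by simp
  qed
 qed
qed

lemma a_Ip_integrable: "integrable M (\<lambda>w. Ip p (Phi \<tau> (X i w)))"
 by (rule bochner_bound[OF X_Ip_integrable a_Ip_measurable])
   (use a_Ip_le[of i] in \<open>eventually_elim, simp add: Ip_nonneg p\<close>)

lemma N_mean: "integrable M (N p i)" "expectation (N p i) = 0"
proof -
 have "integrable M (\<lambda>w. 1 * Ip p (Phi \<tau> (X i w)))" "integrable M (\<lambda>w. 1 * Ip p (b i w))"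
  using a_Ip_integrable[of i] b_Ip(1)[OF p, of i] by (simp_all only: mult_1)
 note l = t(1,2) p a_coefmeas a_ELp borel_measurable_const integrable_const this
 from Np_incr_integrable[OF l] Np_incr_mean[OF l] show "integrable M (N p i)" "expectation (N p i) = 0" by (simp_all only: mult_1)
qed

text \<open>The moment of the increment has order \<tau>^(p/2) and is weighted by 1 +
  \<tau>^(-(p/2-1)). One factor \<tau> is taken out, and the rest is bounded through \<tau> \<le>
  T.\<close>

definition "noise_const = moment_const (p div 2) * (T ^ (p div 2 - 1) + 1)"

lemma noise_const_nonneg: "0 \<le> noise_const"
 unfolding noise_const_def using \<tau> by (simp add: moment_const_nonneg)

lemma noise_le: "expectation (\<lambda>w. (1 + (1 / \<tau>) ^ (p div 2 - 1)) * Ip p (b i w)) \<le> \<tau> * noise_const"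
proof -
 obtain m where m: "p div 2 = Suc m" using p by (cases "p div 2") auto
 have e: "(1 + (1 / \<tau>) ^ m) * \<tau> ^ Suc m = \<tau> * (\<tau> ^ m + 1)"
  using \<tau> by (simp add: power_one_over distrib_right distrib_left)
 have "expectation (\<lambda>w. (1 + (1 / \<tau>) ^ m) * Ip p (b i w)) = (1 + (1 / \<tau>) ^ m) * expectation (\<lambda>w. Ip p (b i w))" by simp
 also have "\<dots> \<le> (1 + (1 / \<tau>) ^ m) * (moment_const (Suc m) * \<tau> ^ Suc m)"
  using b_Ip(2)[OF p, of i] \<tau> unfolding m by (intro mult_left_mono) auto
 also have "\<dots> = moment_const (Suc m) * ((1 + (1 / \<tau>) ^ m) * \<tau> ^ Suc m)" by (simp only: mult_ac)
 also have "\<dots> \<le> moment_const (Suc m) * (\<tau> * (T ^ m + 1))"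
  unfolding e using \<tau> by (intro mult_left_mono add_right_mono power_mono moment_const_nonneg) auto
 finally show ?thesis unfolding noise_const_def m by (simp add: mult_ac)
qed

text \<open>Discrete Gronwall: adding \<open>noise_const\<close> to the mean absorbs the
  inhomogeneous term, so that each step multiplies by at most 1 + 2^p \<tau>.\<close>

lemma X_mean_le:
 assumes iT: "t i \<le> T"
 shows "expectation (\<lambda>w. Ip p (X i w)) \<le> exp (2 ^ p * T) * (expectation (\<lambda>w. Ip p (\<xi> w)) + noise_const)"
proof -
 let ?e = "\<lambda>i. expectation (\<lambda>w. Ip p (X i w))"
 have step: "?e (Suc i) \<le> ?e i + 2 ^ p * (\<tau> * ?e i + \<tau> * noise_const)" for i
 proof -
  let ?B = "\<lambda>w. (1 + (1 / \<tau>) ^ (p div 2 - 1)) * Ip p (b i w)"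
  have iB: "integrable M ?B" by (rule integrable_mult_right[OF b_Ip(1)[OF p]])
  note ii = X_Ip_integrable[of i] N_mean(1)[of i] iB
  have "?e (Suc i) \<le> expectation (\<lambda>w. Ip p (X i w) + real p * N p i w + 2 ^ p * (\<tau> * Ip p (X i w) + ?B w))"
   by (rule integral_mono_AE[OF X_Ip_integrable _ X_step])
     (intro bochner_integrable_add integrable_mult_right ii)
  also have "\<dots> = ?e i + 2 ^ p * (\<tau> * ?e i + expectation ?B)"
   using ii N_mean(2)[of i] by (simp del: distrib_right_numeral)
  also have "\<dots> \<le> ?e i + 2 ^ p * (\<tau> * ?e i + \<tau> * noise_const)" using noise_le[of i] by simp
  finally show ?thesis .
 qed
 have "?e i + noise_const \<le> (1 + 2 ^ p * \<tau>) ^ i * (?e 0 + noise_const)" for i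
 proof (induction i)
  case (Suc i)
  have "?e (Suc i) + noise_const \<le> (1 + 2 ^ p * \<tau>) * (?e i + noise_const)" using step[of i] by (simp add: algebra_simps)
  also have "\<dots> \<le> (1 + 2 ^ p * \<tau>) * ((1 + 2 ^ p * \<tau>) ^ i * (?e 0 + noise_const))" using Suc \<tau> by (intro mult_left_mono) auto
  finally show ?case by simp
 qed simp
 from this[of i] noise_const_nonneg have "?e i \<le> (1 + 2 ^ p * \<tau>) ^ i * (?e 0 + noise_const)" by linarith
 also have "\<dots> \<le> exp (2 ^ p * T) * (?e 0 + noise_const)"
 proof (rule mult_right_mono)
  have "(1 + 2 ^ p * \<tau>) ^ i \<le> exp (real i * (2 ^ p * \<tau>))" by (rule one_plus_power_le_exp) (use \<tau> in simp)
  also have "\<dots> \<le> exp (2 ^ p * T)" using mult_left_mono[OF iT, of "2 ^ p"] by (simp add: mult_ac)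
  finally show "(1 + 2 ^ p * \<tau>) ^ i \<le> exp (2 ^ p * T)" .
  show "0 \<le> ?e 0 + noise_const" using noise_const_nonneg by (simp add: Ip_nonneg p)
 qed
 finally show ?thesis by simp
qed

end

section \<open>The martingale part and maxima over time\<close>

context
 fixes p :: nat
 assumes p: "even p" "2 \<le> p" and \<xi>p: "AE w in M. \<xi> w \<in> ELp p" "integrable M (\<lambda>w. Ip p (\<xi> w))"
  and \<xi>2p: "AE w in M. \<xi> w \<in> ELp (2 * p)" "integrable M (\<lambda>w. Ip (2 * p) (\<xi> w))"
begin

lemma p2: "even (2 * p)" "2 \<le> 2 * p" using p by auto

lemma N_measurable: "N p i \<in> borel_measurable (F (t (Suc i)))"
 using a_ELp[OF p \<xi>p] b_ELp[OF p]
 by (intro Np_F_measurable' t(1) p coefmeas_F_mono[OF t(1,3) a_coefmeas[OF p \<xi>p]] incr_coefmeas[OF t(1,3)])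

lemma N_measurable_M: "N p i \<in> borel_measurable M"
 by (rule measurable_F_M[OF t(1) N_measurable])

text \<open>Young's inequality with weight sqrt \<tau>. After squaring, the weights are \<tau> and
  \<tau>^(-(p-1)); since the increment has moment of order \<tau>^p for the exponent 2p, both terms
  have mean of order \<tau>.\<close>

lemma N_square_le:
 "AE w in M. (N p i w)^2 \<le> 2 * (\<tau> * Ip (2 * p) (X i w)) + 2 * ((1 / \<tau>) ^ (p - 1) * Ip (2 * p) (b i w))"
 using a_ELp[OF p \<xi>p, of i] b_ELp[OF p, of i] a_ELp[OF p2 \<xi>2p, of i] b_ELp[OF p2, of i] a_Ip_le[OF p2 \<xi>2p, of i]
proof eventually_elim
 case (elim w)
 let ?A = "Ip p (Phi \<tau> (X i w))" and ?B = "Ip p (b i w)"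
 let ?x = "sqrt \<tau> * ?A" and ?y = "(1 / sqrt \<tau>) ^ (p - 1) * ?B"
 have "\<bar>N p i w\<bar> \<le> ?x + ?y" by (rule Np_abs_le[OF p elim(1,2)]) (use \<tau> in simp)
 then have "(N p i w)^2 \<le> (?x + ?y)^2" by (rule abs_le_square_iff[THEN iffD1, OF order_trans]) simp
 also have "\<dots> \<le> 2 * ?x\<^sup>2 + 2 * ?y\<^sup>2"
  using zero_le_power2[of "?x - ?y"] by (simp add: power2_eq_square algebra_simps)
 also have "?x\<^sup>2 = \<tau> * ?A\<^sup>2" using \<tau> by (simp add: power_mult_distrib)
 also have "?y\<^sup>2 = (1 / \<tau>) ^ (p - 1) * ?B\<^sup>2"
  using \<tau> by (simp only: power_mult_distrib power_mult[symmetric] mult.commute[of _ 2]) (simp add: power_mult power_divide)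
 also have "2 * (\<tau> * ?A\<^sup>2) + 2 * ((1 / \<tau>) ^ (p - 1) * ?B\<^sup>2)
   \<le> 2 * (\<tau> * Ip (2 * p) (X i w)) + 2 * ((1 / \<tau>) ^ (p - 1) * Ip (2 * p) (b i w))"
  using \<tau> Ip_square_le[OF elim(3) p] Ip_square_le[OF elim(4) p] elim(5)
  by (intro add_mono mult_left_mono) auto
 finally show ?case .
qed

definition "second_const = 2 * (exp (2 ^ (2 * p) * T) * (expectation (\<lambda>w. Ip (2 * p) (\<xi> w)) + noise_const (2 * p)) + moment_const p)"

lemma N_square:
 shows "integrable M (\<lambda>w. (N p i w)^2)" "t i \<le> T ==> expectation (\<lambda>w. (N p i w)^2) \<le> \<tau> * second_const"
proof -
 let ?w = "\<lambda>w. 2 * (\<tau> * Ip (2 * p) (X i w)) + 2 * ((1 / \<tau>) ^ (p - 1) * Ip (2 * p) (b i w))"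
 have w: "integrable M ?w" using X_Ip_integrable[OF p2 \<xi>2p, of i] b_Ip(1)[OF p2, of i] by simp
 show i: "integrable M (\<lambda>w. (N p i w)^2)"
 proof (rule bochner_bound[OF w])
  show "(\<lambda>w. (N p i w)^2) \<in> borel_measurable M" by (rule borel_measurable_power[OF N_measurable_M])
  show "AE w in M. norm ((N p i w)^2) \<le> norm (?w w)" using N_square_le[of i] by eventually_elim simp
 qed
 assume iT: "t i \<le> T"
 have "expectation (\<lambda>w. (N p i w)^2) \<le> expectation ?w" by (rule integral_mono_AE[OF i w N_square_le])
 also have "\<dots> = 2 * (\<tau> * expectation (\<lambda>w. Ip (2 * p) (X i w))) + 2 * ((1 / \<tau>) ^ (p - 1) * expectation (\<lambda>w. Ip (2 * p) (b i w)))"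
  using X_Ip_integrable[OF p2 \<xi>2p, of i] b_Ip(1)[OF p2, of i] by simp
 also have "\<dots> \<le> 2 * (\<tau> * (exp (2 ^ (2 * p) * T) * (expectation (\<lambda>w. Ip (2 * p) (\<xi> w)) + noise_const (2 * p))))
   + 2 * ((1 / \<tau>) ^ (p - 1) * (moment_const p * \<tau> ^ p))"
  using X_mean_le[OF p2 \<xi>2p iT] b_Ip(2)[OF p2, of i] \<tau> by (intro add_mono mult_left_mono) auto
 also have "(1 / \<tau>) ^ (p - 1) * (moment_const p * \<tau> ^ p) = \<tau> * moment_const p"
 proof -
  obtain m where "p = Suc m" using p by (cases p) auto
  then show ?thesis using \<tau> by (simp add: power_one_over)
 qed
 finally show "expectation (\<lambda>w. (N p i w)^2) \<le> \<tau> * second_const" unfolding second_const_def by (simp add: algebra_simps)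
qed

lemma square_integrable:
 assumes "integrable M (\<lambda>w. Ip (2 * p) (Z w))" "(\<lambda>w. Ip p (Z w)) \<in> borel_measurable M" "AE w in M. Z w \<in> ELp (2 * p)"
 shows "integrable M (\<lambda>w. (Ip p (Z w))^2)"
proof (rule bochner_bound[OF assms(1)])
 show "(\<lambda>w. (Ip p (Z w))^2) \<in> borel_measurable M" by (rule borel_measurable_power[OF assms(2)])
 show "AE w in M. norm ((Ip p (Z w))^2) \<le> norm (Ip (2 * p) (Z w))"
  using assms(3)
 proof eventually_elim
  case (elim w)
  show ?case using Ip_square_le[OF elim p] by simp
 qed
qed

text \<open>Moments of order 2p make the p-th power integrals square integrable, so their products
  with a square integrable G are integrable.\<close>

lemma N_orthogonal:
 assumes G: "G \<in> borel_measurable (F (t i))" "integrable M (\<lambda>w. (G w)^2)"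
 shows "integrable M (\<lambda>w. G w * N p i w)" "expectation (\<lambda>w. G w * N p i w) = 0"
proof -
 have Gm: "G \<in> borel_measurable M" by (rule measurable_F_M[OF t(1) G(1)])
 have Gi: "integrable M G" by (rule integrable_of_power[OF Gm _ _ G(2)]) simp_all
 have mb: "(\<lambda>w. Ip p (b i w)) \<in> borel_measurable M" using b_Ip(1)[OF p, of i] by simp
 note ma = a_Ip_measurable[OF p \<xi>p, of i]
 have "integrable M (\<lambda>w. (Ip p (Phi \<tau> (X i w)))^2)"
  by (rule square_integrable[OF a_Ip_integrable[OF p2 \<xi>2p, of i] ma a_ELp[OF p2 \<xi>2p]])
 from integrable_mult_squares[OF Gm G(2) ma this]
 have Ga: "integrable M (\<lambda>w. G w * Ip p (Phi \<tau> (X i w)))" .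
 have "integrable M (\<lambda>w. (Ip p (b i w))^2)"
  by (rule square_integrable[OF b_Ip(1)[OF p2, of i] mb b_ELp[OF p2]])
 from integrable_mult_squares[OF Gm G(2) mb this]
 have Gb: "integrable M (\<lambda>w. G w * Ip p (b i w))" .
 note l = t(1,2) p a_coefmeas[OF p \<xi>p] a_ELp[OF p \<xi>p] G(1) Gi Ga Gb
 show "integrable M (\<lambda>w. G w * N p i w)" "expectation (\<lambda>w. G w * N p i w) = 0"
  by (rule Np_incr_integrable[OF l], rule Np_incr_mean[OF l])
qed

abbreviation Y :: "'w => nat => real" where "Y w i \<equiv> \<Sum>j<i. N p j w"

lemma Y_measurable: "(\<lambda>w. Y w i) \<in> borel_measurable (F (t i))"
proof (induction i)
 case (Suc i)
 show ?case unfolding sum.lessThan_Suc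
  by (intro borel_measurable_add measurable_F_mono[OF t(1,3) Suc] N_measurable)
qed simp

text \<open>Orthogonality of increments: the cross term has mean zero because the partial sum is
  known at time \<open>t i\<close>.\<close>

lemma Y_square: "integrable M (\<lambda>w. (Y w i)^2)" "t i \<le> T ==> expectation (\<lambda>w. (Y w i)^2) \<le> t i * second_const"
proof -
 have "integrable M (\<lambda>w. (Y w i)^2) \<and> (t i \<le> T \<longrightarrow> expectation (\<lambda>w. (Y w i)^2) \<le> t i * second_const)"
 proof (induction i)
  case (Suc i)
  note IH = Suc[THEN conjunct1] and o = N_orthogonal[OF Y_measurable Suc[THEN conjunct1]] and n = N_square(1)[of i]
  have eq: "(Y w (Suc i))^2 = (Y w i)^2 + (2 * (Y w i * N p i w) + (N p i w)^2)" for w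
   by (simp add: power2_eq_square algebra_simps)
  have "expectation (\<lambda>w. (Y w (Suc i))^2) = expectation (\<lambda>w. (Y w i)^2) + (2 * expectation (\<lambda>w. Y w i * N p i w) + expectation (\<lambda>w. (N p i w)^2))"
   unfolding eq using IH o(1) n
   by (simp only: bochner_add bochner_integrable_add integrable_mult_right integral_mult_right_zero)
  then have "expectation (\<lambda>w. (Y w (Suc i))^2) \<le> t (Suc i) * second_const" if "t (Suc i) \<le> T"
   using Suc[THEN conjunct2] N_square(2)[of i] o(2) that \<tau> by (simp add: algebra_simps)
  moreover have "integrable M (\<lambda>w. (Y w (Suc i))^2)"
   unfolding eq by (intro bochner_integrable_add IH integrable_mult_right o(1) n)
  ultimately show ?case by blast
 qed simp
 then show "integrable M (\<lambda>w. (Y w i)^2)" "t i \<le> T ==> expectation (\<lambda>w. (Y w i)^2) \<le> t i * second_const" by auto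
qed

lemma rmax_measurable: "(\<lambda>w. rmax (Y w) i) \<in> borel_measurable (F (t i))"
proof (induction i)
 case (Suc i)
 show ?case unfolding rmax.simps
  by (intro borel_measurable_max measurable_F_mono[OF t(1,3) Suc] Y_measurable)
qed simp

lemma rmax_square: "integrable M (\<lambda>w. (rmax (Y w) i)^2)"
proof (induction i)
 case (Suc i)
 show ?case
 proof (rule bochner_bound)
  show "integrable M (\<lambda>w. (rmax (Y w) i)^2 + (Y w (Suc i))^2)" by (intro bochner_integrable_add Suc Y_square)
  show "(\<lambda>w. (rmax (Y w) (Suc i))^2) \<in> borel_measurable M"
   by (intro borel_measurable_power measurable_F_M[OF t(1) rmax_measurable])
 qed (simp add: max_def)
qed simp

lemma Doob: "t n \<le> T ==> expectation (\<lambda>w. (rmax (Y w) n)^2) \<le> 4 * (t n * second_const)"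
proof -
 assume n: "t n \<le> T"
 note o = N_orthogonal[OF rmax_measurable rmax_square]
 have s: "integrable M (\<lambda>w. \<Sum>i<n. rmax (Y w) i * N p i w)" by (intro Bochner_Integration.integrable_sum o)
 have "expectation (\<lambda>w. (rmax (Y w) n)^2) \<le> expectation (\<lambda>w. 4 * (Y w n)^2 - 4 * (\<Sum>i<n. rmax (Y w) i * N p i w))"
 proof (rule integral_mono[OF rmax_square])
  show "integrable M (\<lambda>w. 4 * (Y w n)^2 - 4 * (\<Sum>i<n. rmax (Y w) i * N p i w))"
   by (intro Bochner_Integration.integrable_diff integrable_mult_right Y_square s)
  show "(rmax (Y w) n)^2 \<le> 4 * (Y w n)^2 - 4 * (\<Sum>i<n. rmax (Y w) i * N p i w)" for w
   using pathwise_Doob[of "Y w" n] by simp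
 qed
 also have "\<dots> = 4 * expectation (\<lambda>w. (Y w n)^2) - 4 * (\<Sum>i<n. expectation (\<lambda>w. rmax (Y w) i * N p i w))"
  using Y_square(1)[of n] s
  by (simp only: Bochner_Integration.integral_diff integrable_mult_right integral_mult_right_zero bochner_sum[OF o(1)])
 also have "\<dots> \<le> 4 * (t n * second_const)" unfolding o(2) using Y_square(2)[OF n] by simp
 finally show ?thesis .
qed

definition "max_const = expectation (\<lambda>w. Ip p (\<xi> w)) + real p * (1 + 4 * (T * second_const))
  + 2 ^ p * (T * (exp (2 ^ p * T) * (expectation (\<lambda>w. Ip p (\<xi> w)) + noise_const p) + noise_const p))"

lemma second_const_nonneg: "0 \<le> second_const"
 unfolding second_const_def using noise_const_nonneg[OF p2 \<xi>2p] \<tau>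
 by (simp add: moment_const_nonneg Ip_nonneg p)

text \<open>The step inequality is summed along a path instead of being taken in mean. The linear
  terms become the partial sums \<open>Y\<close>, bounded by their running maximum, and all other
  terms are nonnegative; so a single integrable majorant Q serves for all times up to n.\<close>

lemma X_max:
 assumes n: "t n \<le> T"
 obtains Q where "integrable M Q" "AE w in M. \<forall>j\<le>n. Ip p (X j w) \<le> Q w" "expectation Q \<le> max_const"
proof -
 let ?r = "\<lambda>i w. 2 ^ p * (\<tau> * Ip p (X i w) + (1 + (1 / \<tau>) ^ (p div 2 - 1)) * Ip p (b i w))"
 let ?m = "\<lambda>w. (rmax (Y w) n)^2"
 let ?Q = "\<lambda>w. Ip p (\<xi> w) + real p * (1 + ?m w) + (\<Sum>i<n. ?r i w)"
 have ri: "integrable M (?r i)" for i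
  by (intro integrable_mult_right bochner_integrable_add X_Ip_integrable[OF p \<xi>p] b_Ip(1)[OF p])
 have Qi: "integrable M ?Q"
  by (intro bochner_integrable_add Bochner_Integration.integrable_sum integrable_mult_right ri \<xi>p rmax_square integrable_const)
 \<comment> \<open>Only the second moment of the running maximum is controlled, hence the maximum is
   replaced by 1 plus its square.\<close>
 have sq: "z \<le> 1 + z^2" for z :: real
  using zero_le_power2[of "z - 1 / 2"] by (simp add: power2_eq_square algebra_simps)
 have r0: "0 \<le> ?r i w" for i w using \<tau> by (simp add: Ip_nonneg p)
 have "AE w in M. \<forall>i. Ip p (X (Suc i) w) \<le> Ip p (X i w) + real p * N p i w + ?r i w"
  unfolding AE_all_countable using X_step[OF p \<xi>p] by blast
 then have Qb: "AE w in M. \<forall>j\<le>n. Ip p (X j w) \<le> ?Q w"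
 proof eventually_elim
  case (elim w)
  have S: "Ip p (X j w) \<le> Ip p (\<xi> w) + real p * Y w j + (\<Sum>i<j. ?r i w)" for j
  proof (induction j)
   case (Suc j)
   with elim[rule_format, of j] show ?case unfolding sum.lessThan_Suc distrib_left[of "real p"] by linarith
  qed simp
  show ?case
  proof (intro allI impI)
   fix j assume j: "j \<le> n"
   have "Y w j \<le> rmax (Y w) n" by (rule rmax_ge[OF j])
   also have "\<dots> \<le> 1 + ?m w" by (rule sq)
   finally have "real p * Y w j \<le> real p * (1 + ?m w)" by (rule mult_left_mono) simp
   moreover have "(\<Sum>i<j. ?r i w) \<le> (\<Sum>i<n. ?r i w)" using j by (intro sum_mono2 r0) auto
   ultimately show "Ip p (X j w) \<le> ?Q w" using S[of j] by linarith
  qed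
 qed
 let ?E = "exp (2 ^ p * T) * (expectation (\<lambda>w. Ip p (\<xi> w)) + noise_const p)"
 have E0: "0 \<le> ?E" using noise_const_nonneg[OF p \<xi>p] by (simp add: Ip_nonneg p)
 have rE: "expectation (?r i) \<le> 2 ^ p * (\<tau> * (?E + noise_const p))" if "i < n" for i
 proof -
  have "t i \<le> t n" using that \<tau> by (intro mult_right_mono) auto
  then have iT: "t i \<le> T" using n by simp
  have "expectation (?r i) = 2 ^ p * (\<tau> * expectation (\<lambda>w. Ip p (X i w)) + expectation (\<lambda>w. (1 + (1 / \<tau>) ^ (p div 2 - 1)) * Ip p (b i w)))"
   using X_Ip_integrable[OF p \<xi>p, of i] integrable_mult_right[OF b_Ip(1)[OF p, of i]]
   by (simp only: integral_mult_right_zero bochner_add integrable_mult_right)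
  also have "\<dots> \<le> 2 ^ p * (\<tau> * ?E + \<tau> * noise_const p)"
   using X_mean_le[OF p \<xi>p iT] noise_le[OF p \<xi>p, of i] \<tau> by (intro mult_left_mono add_mono) auto
  finally show ?thesis by (simp add: distrib_left)
 qed
 have "expectation ?Q = expectation (\<lambda>w. Ip p (\<xi> w)) + real p * (1 + expectation ?m) + (\<Sum>i<n. expectation (?r i))"
  using ri \<xi>p(2) rmax_square[of n]
  by (simp only: bochner_add bochner_integrable_add integral_mult_right_zero integrable_mult_right integrable_const
    bochner_sum Bochner_Integration.integrable_sum) (simp add: prob_space)
 also have "\<dots> \<le> expectation (\<lambda>w. Ip p (\<xi> w)) + real p * (1 + 4 * (T * second_const)) + 2 ^ p * (T * (?E + noise_const p))"
 proof (intro add_mono mult_left_mono order_refl)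
  have "t n * second_const \<le> T * second_const" by (intro mult_right_mono n second_const_nonneg)
  then show "expectation ?m \<le> 4 * (T * second_const)" using Doob[OF n] by linarith
  have "(\<Sum>i<n. expectation (?r i)) \<le> (\<Sum>i<n. 2 ^ p * (\<tau> * (?E + noise_const p)))" using rE by (intro sum_mono) simp
  also have "\<dots> = 2 ^ p * (t n * (?E + noise_const p))" by simp
  also have "\<dots> \<le> 2 ^ p * (T * (?E + noise_const p))"
   using E0 noise_const_nonneg[OF p \<xi>p] by (intro mult_left_mono mult_right_mono n) auto
  finally show "(\<Sum>i<n. expectation (?r i)) \<le> 2 ^ p * (T * (?E + noise_const p))" .
 qed simp
 finally show ?thesis using that[OF Qi Qb] by (simp add: max_const_def)
qed

end

end

end

lemma Lp_norm_measurable: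
 assumes q: "1 \<le> q" shows "Lp_norm q \<in> borel_measurable (Lp_borel q)"
proof (rule Lp_borel_continuous_measurable)
 fix f and d :: real assume f: "f \<in> Lp_space q" and d: "0 < d"
 have q0: "0 \<le> q" using q by simp
 have "\<bar>Lp_norm q g - Lp_norm q f\<bar> \<le> Lp_norm q (g -. f)" if g: "g \<in> Lp_space q" for g
  using Minkowski_powr[OF q Lp_space_diff[OF q0 g f] f] Minkowski_powr[OF q Lp_space_diff[OF q0 f g] g]
   Lp_norm_minus_commute[of q f g] by simp
 with d show "\<exists>e>0. \<forall>g\<in>Lp_space q. Lp_norm q (g -. f) < e \<longrightarrow> \<bar>Lp_norm q g - Lp_norm q f\<bar> < d"
  by (meson order_le_less_trans)
qed

section \<open>Uniform bounds\<close>

text \<open>The scheme acts separately at each sample point, so a change of the initial value on a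
  null set affects the iterates of all step sizes on that same null set only.\<close>

lemma split_euler_cong: "\<xi> w = \<eta> w ==> split_euler \<tau> W \<xi> i w = split_euler \<tau> W \<eta> i w"
proof (induction i)
 case (Suc i)
 show ?case unfolding split_euler.simps Suc.IH[OF Suc.prems] ..
qed (unfold split_euler.simps)

text \<open>The series of h n / n^2 has finite mean, hence a finite sum almost surely, and the sum
  bounds each of its terms.\<close>

lemma (in prob_space) AE_quadratic_growth:
 fixes h :: "nat => 'a => real"
 assumes h: "\<And>n. 1 \<le> n ==> integrable M (h n)" "\<And>n. 1 \<le> n ==> expectation (h n) \<le> C" "\<And>n w. 1 \<le> n ==> 0 \<le> h n w"
 obtains K where "K \<in> borel_measurable M" "AE w in M. \<forall>n\<ge>1. h n w \<le> (real n)^2 * K w" "\<And>w. 0 \<le> K w"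
proof -
 let ?f = "\<lambda>n w. h (Suc n) w / (real (Suc n))^2"
 have f0: "0 \<le> ?f n w" for n w using h(3)[of "Suc n" w] by simp
 have fm: "?f n \<in> borel_measurable M" for n using h(1)[of "Suc n"] by simp
 have C0: "0 \<le> C" using order_trans[OF integral_nonneg_AE h(2)[of 1]] h(3)[of 1] by simp
 have sm: "summable (\<lambda>n. C / (real (Suc n))^2)"
  using summable_mult[OF summable_Suc_iff[THEN iffD2, OF inverse_power_summable[of 2, where 'a=real]], of C] by (simp add: divide_inverse)
 have "(\<integral>\<^sup>+w. (\<Sum>n. ennreal (?f n w)) \<partial>M) = (\<Sum>n. \<integral>\<^sup>+w. ennreal (?f n w) \<partial>M)"
  by (rule nn_integral_suminf) (use fm in simp)
 also have "\<dots> \<le> (\<Sum>n. ennreal (C / (real (Suc n))^2))"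
 proof (rule suminf_le)
  fix n
  have "(\<integral>\<^sup>+w. ennreal (?f n w) \<partial>M) = ennreal (expectation (?f n))"
   by (rule nn_integral_eq_integral) (use h(1)[of "Suc n"] f0 in simp_all)
  also have "\<dots> \<le> ennreal (C / (real (Suc n))^2)"
   using h(2)[of "Suc n"] by (intro ennreal_leI) (simp add: divide_right_mono)
  finally show "(\<integral>\<^sup>+w. ennreal (?f n w) \<partial>M) \<le> ennreal (C / (real (Suc n))^2)" .
 qed simp_all
 also have "\<dots> < \<infinity>"
  unfolding infinity_ennreal_def less_top[symmetric] by (rule ennreal_suminf_neq_top[OF sm]) (use C0 in simp)
 finally have "(\<integral>\<^sup>+w. (\<Sum>n. ennreal (?f n w)) \<partial>M) \<noteq> \<infinity>" by simp
 then have "AE w in M. (\<Sum>n. ennreal (?f n w)) \<noteq> \<infinity>"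
  by (intro nn_integral_PInf_AE borel_measurable_suminf_order measurable_compose[OF fm measurable_ennreal])
 \<comment> \<open>The absolute value makes the bound nonnegative also where the series diverges and
   its sum is an unspecified number.\<close>
 then have "AE w in M. \<forall>n\<ge>1. h n w \<le> (real n)^2 * \<bar>\<Sum>n. ?f n w\<bar>"
 proof eventually_elim
  case (elim w)
  have s: "summable (\<lambda>n. ?f n w)" by (rule summable_suminf_not_top) (use f0 elim in auto)
  show ?case
  proof (intro allI impI)
   fix n :: nat assume n: "1 \<le> n"
   then obtain m where m: "n = Suc m" by (cases n) auto
   have "?f m w \<le> (\<Sum>n. ?f n w)" using sum_le_suminf[OF s, of "{m}"] f0 by simp
   also have "\<dots> \<le> \<bar>\<Sum>n. ?f n w\<bar>" by simp
   finally show "h n w \<le> (real n)^2 * \<bar>\<Sum>n. ?f n w\<bar>" unfolding m by (subst (asm) pos_divide_le_eq) (simp_all add: mult.commute)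
  qed
 qed
 then show ?thesis by (rule that[rotated]) (use fm in simp_all)
qed

lemma power_le_one_plus: "0 \<le> (u::real) ==> r \<le> P ==> u ^ r \<le> 1 + u ^ P"
 using power_le_one[of u r] power_increasing[of r P u] by (cases "u \<le> 1") (auto simp: add_increasing add_increasing2)

context complete_filtered_prob_space begin

text \<open>Completeness of the measure supplies the measurability of f.\<close>

lemma integral_AE_cong:
 fixes f h :: "'w => real"
 assumes "integrable M h" "AE w in M. f w = h w" shows "integrable M f" "expectation f = expectation h"
proof -
 have f: "f \<in> borel_measurable M" by (rule M_measurable_AE[OF borel_measurable_integrable[OF assms(1)] assms(2)])
 show "integrable M f" by (subst integrable_cong_AE[OF f borel_measurable_integrable[OF assms(1)] assms(2)]) (rule assms(1))
 show "expectation f = expectation h" by (rule integral_cong_AE[OF f borel_measurable_integrable[OF assms(1)] assms(2)])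
qed

lemma in_Lq_LqD:
 assumes X: "in_Lq_Lq M (real p) X" and p: "even p" "0 < p"
 shows "AE w in M. X w \<in> ELp p" "integrable M (\<lambda>w. Ip p (X w))"
proof -
 obtain Y where Y: "Y \<in> measurable M (Lp_borel (real p))" "AE w in M. X w = Y w" using X unfolding in_Lq_Lq_def by blast
 show "AE w in M. X w \<in> ELp p"
  using Y(2) AE_space
 proof eventually_elim
  case (elim w)
  show ?case using measurable_space[OF Y(1) elim(2)] unfolding elim(1) space_Lp_borel Lp_space_even[OF p] .
 qed
 show "integrable M (\<lambda>w. Ip p (X w))" using X unfolding in_Lq_Lq_def Lp_norm_powr[OF p] by (rule conjunct2)
qed

text \<open>A version that lies in L^p at every sample point is a Borel random variable by
  \<open>coefmeas_Lp_borel\<close>. The exponent is lowered from p to q twice, on the torus and on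
  the sample space.\<close>

lemma
 assumes t: "0 \<le> t" and X: "coefmeas (F t) X" "AE w in M. X w \<in> ELp p" "integrable M (\<lambda>w. Ip p (X w))"
  and p: "even p" "2 \<le> p" and q: "1 \<le> q" "q \<le> real p" and Z: "AE w in M. Z w = X w"
 shows in_Lq_LqI: "in_Lq_Lq M q Z"
  and Lq_Lq_norm_le: "Lq_Lq_norm M q Z \<le> expectation (\<lambda>w. Ip p (X w)) powr (1 / real p)"
  and Lp_norm_measurable_AE: "(\<lambda>w. Lp_norm q (Z w)) \<in> borel_measurable M"
proof -
 have p0: "0 < p" using p by simp
 obtain Y where Y: "coefmeas (F t) Y" "\<And>w. w \<in> space (F t) ==> Y w \<in> ELp p" "AE w in M. X w = Y w"
  by (rule coefmeas_modification[OF t X(1,2)]) blast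
 have "Y \<in> measurable (F t) (Lp_borel (real p))" by (rule coefmeas_Lp_borel[OF Y(1,2) p])
 then have Yq: "Y \<in> measurable M (Lp_borel q)"
  by (intro measurable_F_M[OF t] Lp_borel_mono[of q "real p"]) (use q in auto)
 have ZY: "AE w in M. Z w = Y w" using Z Y(3) by eventually_elim simp
 let ?f = "\<lambda>w. Lp_norm q (Y w)"
 have fm: "?f \<in> borel_measurable M" by (rule measurable_compose[OF Yq Lp_norm_measurable[OF q(1)]])
 have fm': "(\<lambda>w. \<bar>?f w\<bar> powr real p) \<in> borel_measurable M" using fm by simp
 have le: "AE w in M. \<bar>?f w\<bar> powr real p \<le> Ip p (X w)"
  using X(2) Y(3)
 proof eventually_elim
  case (elim w)
  have "?f w \<le> Lp_norm (real p) (Y w)" by (rule Lp_norm_mono) (use q elim in \<open>auto simp: Lp_space_even[OF p(1) p0]\<close>)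
  then have "\<bar>?f w\<bar> powr real p \<le> Lp_norm (real p) (Y w) powr real p" by (intro powr_mono2) (auto simp: Lp_norm_nonneg)
  then show ?case using elim(2) by (simp add: Lp_norm_powr[OF p(1) p0])
 qed
 have i: "integrable M (\<lambda>w. \<bar>?f w\<bar> powr real p)"
  by (rule bochner_bound[OF X(3) fm']) (use le in \<open>eventually_elim, simp\<close>)
 have q0: "0 < q" using q by simp
 have "integrable M (\<lambda>w. ?f w powr q)" using integrable_powr_mono[OF fm q0 q(2) i] by (simp add: Lp_norm_nonneg)
 note c = integral_AE_cong[OF this, of "\<lambda>w. Lp_norm q (Z w) powr q"]
 have eq: "AE w in M. Lp_norm q (Z w) powr q = ?f w powr q" using ZY by eventually_elim simp
 show "in_Lq_Lq M q Z" unfolding in_Lq_Lq_def using Yq ZY c(1)[OF eq] by blast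
 have "Lq_Lq_norm M q Z = expectation (\<lambda>w. \<bar>?f w\<bar> powr q) powr (1 / q)"
  unfolding Lq_Lq_norm_def c(2)[OF eq] by (simp add: Lp_norm_nonneg)
 also have "\<dots> \<le> expectation (\<lambda>w. \<bar>?f w\<bar> powr real p) powr (1 / real p)" by (rule Lyapunov[OF fm q0 q(2) i])
 also have "\<dots> \<le> expectation (\<lambda>w. Ip p (X w)) powr (1 / real p)"
  by (intro powr_mono2 integral_mono_AE i X(3) le) simp_all
 finally show "Lq_Lq_norm M q Z \<le> expectation (\<lambda>w. Ip p (X w)) powr (1 / real p)" .
 show "(\<lambda>w. Lp_norm q (Z w)) \<in> borel_measurable M"
  by (rule M_measurable_AE[OF fm]) (use ZY in \<open>eventually_elim, simp\<close>)
qed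

end

text \<open>For even P not below 4 and r, the r-th power of the L^4 norm is at most 1 plus the P-th
  power integral, and \<open>X_max\<close> bounds the latter over all times by one integrable
  function.\<close>

lemma (in curl_noise) euler_max_moment:
 assumes \<xi>: "coefmeas (F 0) \<xi>" and T: "0 < T" and P: "even P" "4 \<le> P" "r \<le> P"
  and mP: "AE w in M. \<xi> w \<in> ELp P" "integrable M (\<lambda>w. Ip P (\<xi> w))"
  and m2P: "AE w in M. \<xi> w \<in> ELp (2 * P)" "integrable M (\<lambda>w. Ip (2 * P) (\<xi> w))"
  and Z: "AE w in M. \<forall>\<tau> i. Z \<tau> i w = split_euler \<tau> W \<xi> i w"
 shows "\<exists>C. \<forall>n\<ge>1. (AE w in M. \<forall>i\<in>{1..n}. Z (T / real n) i w \<in> Lp_space 4) \<and>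
      integrable M (\<lambda>w. MAX i\<in>{1..n}. Lp_norm 4 (Z (T / real n) i w) ^ r) \<and>
      (\<integral>w. (MAX i\<in>{1..n}. Lp_norm 4 (Z (T / real n) i w) ^ r) \<partial>M) \<le> C"
proof (intro exI[of _ "1 + max_const \<xi> T P"] allI impI)
 fix n :: nat assume n: "1 \<le> n"
 let ?\<tau> = "T / real n"
 have \<tau>: "0 < ?\<tau>" "?\<tau> \<le> T" using T n by (auto simp: divide_le_eq)
 have nT: "real n * ?\<tau> \<le> T" using n by simp
 have P2: "2 \<le> P" and P0: "0 < P" using P by auto
 let ?X = "split_euler ?\<tau> W \<xi>"
 let ?h = "\<lambda>w. MAX i\<in>{1..n}. Lp_norm 4 (Z ?\<tau> i w) ^ r"
 obtain Q where Q: "integrable M Q" "AE w in M. \<forall>j\<le>n. Ip P (?X j w) \<le> Q w" "expectation Q \<le> max_const \<xi> T P"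
  by (rule X_max[OF \<xi> \<tau> P(1) P2 mP m2P nT]) blast
 have XE: "AE w in M. \<forall>i. ?X i w \<in> ELp P"
  unfolding AE_all_countable using X_ELp[OF \<xi> \<tau> P(1) P2 mP] by blast
 have L4: "f \<in> ELp P ==> f \<in> Lp_space 4" "f \<in> ELp P ==> Lp_norm 4 f \<le> Lp_norm (real P) f" for f
  using Lp_space_mono[of 4 "real P" f] Lp_norm_mono[of 4 "real P" f] P(2) by (simp_all add: Lp_space_even[OF P(1) P0])
 have Zm: "(\<lambda>w. Lp_norm 4 (Z ?\<tau> i w)) \<in> borel_measurable M" for i
 proof (rule Lp_norm_measurable_AE[OF _ X_coefmeas[OF \<xi> \<tau>] X_ELp[OF \<xi> \<tau> P(1) P2 mP] X_Ip_integrable[OF \<xi> \<tau> P(1) P2 mP] P(1) P2])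
  show "0 \<le> real i * ?\<tau>" using \<tau> by simp
  show "AE w in M. Z ?\<tau> i w = ?X i w" using Z by eventually_elim blast
 qed (use P in auto)
 have hm: "?h \<in> borel_measurable M"
  by (rule borel_measurable_Max) (use Zm in simp_all)
 have h0: "0 \<le> ?h w" for w
 proof -
  have "0 \<le> Lp_norm 4 (Z ?\<tau> 1 w) ^ r" by (simp add: Lp_norm_nonneg)
  also have "\<dots> \<le> ?h w" using n by (intro Max_ge) auto
  finally show ?thesis .
 qed
 have hQ: "AE w in M. ?h w \<le> 1 + Q w"
  using Q(2) XE Z
 proof eventually_elim
  case (elim w)
  have "Lp_norm 4 (Z ?\<tau> i w) ^ r \<le> 1 + Q w" if i: "i \<in> {1..n}" for i
  proof -
   have "Lp_norm 4 (?X i w) ^ r \<le> Lp_norm (real P) (?X i w) ^ r"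
    using elim(2) L4(2) by (intro power_mono Lp_norm_nonneg) blast
   also have "\<dots> \<le> 1 + Lp_norm (real P) (?X i w) ^ P" by (rule power_le_one_plus[OF Lp_norm_nonneg P(3)])
   also have "\<dots> \<le> 1 + Q w" using elim(1) i by (simp add: Lp_norm_power[OF P(1) P0])
   finally show ?thesis using elim(3) by simp
  qed
  then show ?case using n by (intro Max.boundedI) auto
 qed
 have iQ: "integrable M (\<lambda>w. 1 + Q w)" using Q(1) by simp
 have ih: "integrable M ?h"
  by (rule bochner_bound[OF iQ hm]) (use hQ in \<open>eventually_elim, use h0 in force\<close>)
 have "expectation ?h \<le> expectation (\<lambda>w. 1 + Q w)" by (rule integral_mono_AE[OF ih iQ hQ])
 also have "\<dots> \<le> 1 + max_const \<xi> T P" using Q(1,3) by (simp add: prob_space)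
 finally have le: "expectation ?h \<le> 1 + max_const \<xi> T P" .
 have "AE w in M. \<forall>i\<in>{1..n}. Z ?\<tau> i w \<in> Lp_space 4"
  using XE Z
 proof eventually_elim
  case (elim w)
  then show ?case using L4(1) by simp
 qed
 with ih le show "(AE w in M. \<forall>i\<in>{1..n}. Z ?\<tau> i w \<in> Lp_space 4) \<and> integrable M ?h \<and> expectation ?h \<le> 1 + max_const \<xi> T P" by blast
qed

lemma (in prob_space) pathwise_rate:
 fixes L :: "nat => nat => 'a => real"
 assumes T: "0 < T" and \<epsilon>: "0 < \<epsilon>" and L0: "\<And>n i w. 0 \<le> L n i w"
  and m: "\<And>r. \<exists>C. \<forall>n\<ge>1. integrable M (\<lambda>w. MAX i\<in>{1..n}. L n i w ^ r) \<and> (\<integral>w. (MAX i\<in>{1..n}. L n i w ^ r) \<partial>M) \<le> C"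
 shows "\<exists>C. C \<in> borel_measurable M \<and> (AE w in M. \<forall>n\<ge>1. (MAX i\<in>{1..n}. L n i w) \<le> C w * (T / real n) powr (- \<epsilon>))"
proof -
 \<comment> \<open>r is so large that n^(2/r) \<le> n^\<epsilon>; the 2 is the exponent in
   \<open>AE_quadratic_growth\<close>.\<close>
 obtain r :: nat where r: "max 1 (2 / \<epsilon>) \<le> real r" using real_arch_simple by blast
 then have r1: "0 < r" and r\<epsilon>: "2 / real r \<le> \<epsilon>" using \<epsilon> by (auto simp: field_simps)
 let ?h = "\<lambda>n w. MAX i\<in>{1..n}. L n i w ^ r"
 obtain C where C: "\<And>n. 1 \<le> n ==> integrable M (?h n)" "\<And>n. 1 \<le> n ==> expectation (?h n) \<le> C" using m[of r] by blast
 have le: "L n i w ^ r \<le> ?h n w" if "i \<in> {1..n}" for n i w using that by (intro Max_ge) auto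
 have h0: "0 \<le> ?h n w" if "1 \<le> n" for n w
  by (rule order_trans[OF zero_le_power[OF L0[of n 1 w]] le]) (use that in simp)
 obtain K where K: "K \<in> borel_measurable M" "AE w in M. \<forall>n\<ge>1. ?h n w \<le> (real n)^2 * K w" "\<And>w. 0 \<le> K w"
  by (rule AE_quadratic_growth[of ?h C, OF C h0]) blast+
 \<comment> \<open>The factor \<open>T powr \<epsilon>\<close> converts n^\<epsilon> into the power
   of the step size T / n.\<close>
 let ?R = "\<lambda>w n. K w powr (1 / real r) * T powr \<epsilon> * (T / real n) powr (- \<epsilon>)"
 show ?thesis
 proof (intro exI[of _ "\<lambda>w. K w powr (1 / real r) * T powr \<epsilon>"] conjI)
  show "(\<lambda>w. K w powr (1 / real r) * T powr \<epsilon>) \<in> borel_measurable M" using K(1) by simp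
  show "AE w in M. \<forall>n\<ge>1. (MAX i\<in>{1..n}. L n i w) \<le> ?R w n"
   using K(2)
  proof eventually_elim
   case (elim w)
   show ?case
   proof (intro allI impI)
    fix n :: nat assume n: "1 \<le> n"
    have "L n i w \<le> ?R w n" if i: "i \<in> {1..n}" for i
    proof -
     have "L n i w = (L n i w ^ r) powr (1 / real r)"
      using L0[of n i w] r1 by (cases "L n i w = 0") (simp_all add: powr_realpow[symmetric] powr_powr)
     also have "\<dots> \<le> ((real n)^2 * K w) powr (1 / real r)"
      using le[OF i, of w] elim n L0[of n i w] by (intro powr_mono2) (auto intro: order_trans)
     also have "\<dots> = real n powr (2 / real r) * K w powr (1 / real r)"
      using n by (simp add: powr_mult powr_powr flip: powr_numeral)
     also have "\<dots> \<le> real n powr \<epsilon> * K w powr (1 / real r)"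
      using n by (intro mult_right_mono powr_mono r\<epsilon>) auto
     also have "\<dots> = ?R w n"
      using n T by (simp add: powr_divide powr_minus field_simps)
     finally show ?thesis .
    qed
    then show "(MAX i\<in>{1..n}. L n i w) \<le> ?R w n"
     using n by (intro Max.boundedI) auto
   qed
  qed
 qed
qed

theorem proposition3p6:
  fixes M :: "'w measure" and F :: "real \<Rightarrow> 'w measure"
    and \<beta> :: "int \<times> int \<Rightarrow> real \<Rightarrow> 'w \<Rightarrow> real" and c :: "int \<times> int \<Rightarrow> real"
    and W :: "real \<Rightarrow> 'w \<Rightarrow> plane \<Rightarrow> real" and \<xi>0 :: "'w \<Rightarrow> plane \<Rightarrow> real"
    and T :: real and p :: nat
  assumes "complete_filtered_prob_space M F"
    and "independent_wiener_family M F \<beta> Z0"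
    and "\<And>k. k \<in> Z0 \<Longrightarrow> c k \<ge> 0"
    and "is_W_curl M c \<beta> W"
    and "T > 0"
    and "p \<ge> 2" and "even p"
    and "\<xi>0 \<in> F 0 \<rightarrow>\<^sub>M Lp_borel p"
    and "in_Lq_Lq M p \<xi>0"
    and "AE \<omega> in M. \<xi>0 \<omega> \<in> \<E>"
    and "(\<lambda>k. (norm (kvec k))\<^sup>2 * (c (- k))\<^sup>2 * (Lp_norm p (e_basis k))\<^sup>2) summable_on Z0"
  shows
    "(\<exists>C::real. \<forall>n\<ge>1. \<forall>q::real. 1 \<le> q \<and> q \<le> p \<longrightarrow>
        (\<forall>i\<in>{1..n}. in_Lq_Lq M q (split_euler (T / real n) W \<xi>0 i)) \<and>
        (MAX i\<in>{1..n}. Lq_Lq_norm M q (split_euler (T / real n) W \<xi>0 i)) \<le> C)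
     \<and>
     ((\<exists>R::nat. \<forall>r\<ge>R. in_Lq_Lq M r \<xi>0) \<longrightarrow>
        (\<forall>r::nat. \<exists>C::real. \<forall>n\<ge>1.
           (AE \<omega> in M. \<forall>i\<in>{1..n}. split_euler (T / real n) W \<xi>0 i \<omega> \<in> Lp_space 4) \<and>
           integrable M (\<lambda>\<omega>. MAX i\<in>{1..n}. Lp_norm 4 (split_euler (T / real n) W \<xi>0 i \<omega>) ^ r) \<and>
           (\<integral>\<omega>. (MAX i\<in>{1..n}. Lp_norm 4 (split_euler (T / real n) W \<xi>0 i \<omega>) ^ r) \<partial>M) \<le> C)
        \<and>
        (\<forall>\<epsilon>>0. \<exists>C::'w \<Rightarrow> real. C \<in> borel_measurable M \<and>
           (AE \<omega> in M. \<forall>n\<ge>1.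
              (\<forall>i\<in>{1..n}. split_euler (T / real n) W \<xi>0 i \<omega> \<in> Lp_space 4) \<and>
              (MAX i\<in>{1..n}. Lp_norm 4 (split_euler (T / real n) W \<xi>0 i \<omega>))
                \<le> C \<omega> * (T / real n) powr (- \<epsilon>))))"
proof -
 note T = \<open>T > 0\<close> and p = \<open>even p\<close> \<open>p \<ge> 2\<close>
 have p0: "0 < p" using p by simp
 interpret complete_filtered_prob_space M F by fact
 let ?s = "\<lambda>k. (norm (kvec k))^2 * (c (- k))^2 * (Lp_norm p (eb k))^2"
 have S: "(\<Sum>k\<in>K. (norm (kvec k) * c (- k))^2) \<le> infsum ?s Z0" if K: "finite K" "K \<subseteq> Z0" for K
 proof -
  \<comment> \<open>The modes have L^2 norm 1 and the L^p norm is not smaller, so the summability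
    hypothesis bounds the plain sums of squared weights.\<close>
  have "1 \<le> Lp_norm p (eb k)" if "k \<in> K" for k
  proof -
   have k: "k \<in> Z0" using that K(2) by (rule subsetD[rotated])
   have "n2 (eb k) = 1" using e_basis_orthonormal[OF k k] by (simp add: n2_def L2_inner_def power2_eq_square)
   with n2_le_Lp_norm[OF p TP_ELp[OF e_basis_TP]] show ?thesis by metis
  qed
  then have "(\<Sum>k\<in>K. (norm (kvec k) * c (- k))^2 * 1) \<le> (\<Sum>k\<in>K. ?s k)"
   unfolding power_mult_distrib by (intro sum_mono mult_left_mono one_le_power) simp_all
  then have "(\<Sum>k\<in>K. (norm (kvec k) * c (- k))^2) \<le> (\<Sum>k\<in>K. ?s k)" by (simp only: mult_1_right)
  also have "\<dots> \<le> infsum ?s Z0" by (rule finite_sum_le_infsum) (use assms(11) K in auto)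
  finally show ?thesis .
 qed
 interpret curl_noise M F \<beta> c W "infsum ?s Z0" by unfold_locales (use assms(2,4) S in blast)+
 let ?Z = "\<lambda>\<tau> i. split_euler \<tau> W \<xi>0 i"
 let ?Y = "\<lambda>n. ?Z (T / real n)"
 obtain N where N: "N \<in> null_sets M" "\<And>w. w \<in> space M ==> w \<notin> N ==> \<xi>0 w \<in> \<E>"
  using assms(10) unfolding eventually_ae_filter by blast
 \<comment> \<open>A version of the initial value with values in \<open>\<E>\<close> at every sample
   point, as \<open>coefmeas\<close> demands; \<open>Zeq\<close> transfers the results back.\<close>
 define \<xi> where "\<xi> w = (if w \<in> N then (\<lambda>x. 0) else \<xi>0 w)" for w
 have eq: "AE w in M. \<xi>0 w = \<xi> w" using AE_not_in[OF N(1)] by eventually_elim (unfold \<xi>_def if_not_P, rule refl)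
 have Zeq: "AE w in M. \<forall>\<tau> i. ?Z \<tau> i w = split_euler \<tau> W \<xi> i w"
  using eq
 proof eventually_elim
  case (elim w)
  show ?case by (intro allI) (rule split_euler_cong[of \<xi>0 w \<xi>, OF elim])
 qed
 have \<xi>: "coefmeas (F 0) \<xi>"
  unfolding coefmeas_def
 proof (intro conjI ballI)
  fix w assume "w \<in> space (F 0)"
  then have w: "w \<in> space M" by (simp add: space_F)
  show "\<xi> w \<in> \<E>"
  proof (cases "w \<in> N")
   case True
   then show ?thesis using zero_mean_cmult[OF hk_zero_mean[of "(1, 0)" 0], of 0] by (simp add: \<xi>_def Z0_def)
  next
   case False
   from N(2)[OF w False] show ?thesis unfolding \<xi>_def if_not_P[OF False] .
  qed
 next
  fix k assume "k \<in> Z0"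
  have "AE w in M. ip (\<xi> w) (eb k) = ip (\<xi>0 w) (eb k)"
   using eq
  proof eventually_elim
   case (elim w) show ?case unfolding elim ..
  qed
  from F_measurable_AE[OF _ measurable_compose[OF assms(8) coef_Lp_borel_measurable[OF p]] this]
  show "(\<lambda>w. ip (\<xi> w) (eb k)) \<in> borel_measurable (F 0)" by simp
 qed
 have mom: "AE w in M. \<xi> w \<in> ELp P" "integrable M (\<lambda>w. Ip P (\<xi> w))"
  if X: "in_Lq_Lq M (real P) \<xi>0" and P: "even P" "0 < P" for P
 proof -
  show "AE w in M. \<xi> w \<in> ELp P"
   using in_Lq_LqD(1)[OF X P] eq
  proof eventually_elim
   case (elim w) show ?case using elim(1) unfolding elim(2) .
  qed
  have "AE w in M. Ip P (\<xi> w) = Ip P (\<xi>0 w)"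
   using eq
  proof eventually_elim
   case (elim w) show ?case unfolding elim ..
  qed
  from integral_AE_cong(1)[OF in_Lq_LqD(2)[OF X P] this] show "integrable M (\<lambda>w. Ip P (\<xi> w))" .
 qed
 note mp = mom[OF assms(9) p(1) p0]
 let ?B = "exp (2 ^ p * T) * (expectation (\<lambda>w. Ip p (\<xi> w)) + noise_const T p)"
 have part1: "in_Lq_Lq M q (?Y n i) \<and> Lq_Lq_norm M q (?Y n i) \<le> ?B powr (1 / real p)"
  if n: "1 \<le> n" and q: "1 \<le> q" "q \<le> real p" and i: "i \<in> {1..n}" for n q i
 proof -
  let ?\<tau> = "T / real n"
  have \<tau>: "0 < ?\<tau>" "?\<tau> \<le> T" using T n by (auto simp: divide_le_eq)
  have iT: "real i * ?\<tau> \<le> T" using i n T by (simp add: divide_le_eq)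
  have i0: "0 \<le> real i * ?\<tau>" using \<tau> by simp
  note l = i0 X_coefmeas[OF \<xi> \<tau>] X_ELp[OF \<xi> \<tau> p mp] X_Ip_integrable[OF \<xi> \<tau> p mp] p q
  have ae: "AE w in M. ?Z ?\<tau> i w = split_euler ?\<tau> W \<xi> i w" using Zeq by eventually_elim blast
  have "Lq_Lq_norm M q (?Z ?\<tau> i) \<le> expectation (\<lambda>w. Ip p (split_euler ?\<tau> W \<xi> i w)) powr (1 / real p)"
   by (rule Lq_Lq_norm_le[OF l ae])
  also have "\<dots> \<le> ?B powr (1 / real p)"
   by (intro powr_mono2 X_mean_le[OF \<xi> \<tau> p mp iT]) (simp_all add: Ip_nonneg p)
  finally show ?thesis using in_Lq_LqI[OF l ae] by blast
 qed
 have P1: "\<exists>C::real. \<forall>n\<ge>1. \<forall>q::real. 1 \<le> q \<and> q \<le> p \<longrightarrow>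
    (\<forall>i\<in>{1..n}. in_Lq_Lq M q (?Y n i)) \<and> (MAX i\<in>{1..n}. Lq_Lq_norm M q (?Y n i)) \<le> C"
 proof (intro exI[of _ "?B powr (1 / real p)"] allI impI conjI ballI)
  fix n :: nat and q :: real assume n: "1 \<le> n" and q: "1 \<le> q \<and> q \<le> real p"
  show "in_Lq_Lq M q (?Y n i)" if "i \<in> {1..n}" for i using part1[OF n _ _ that] q by blast
  show "(MAX i\<in>{1..n}. Lq_Lq_norm M q (?Y n i)) \<le> ?B powr (1 / real p)"
  proof (rule Max.boundedI)
   fix y assume "y \<in> (\<lambda>i. Lq_Lq_norm M q (?Y n i)) ` {1..n}"
   then obtain i where "i \<in> {1..n}" "y = Lq_Lq_norm M q (?Y n i)" by blast
   with part1[OF n, of q i] q show "y \<le> ?B powr (1 / real p)" by blast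
  qed (use n in auto)
 qed
 have P2: "\<exists>C::real. \<forall>n\<ge>1.
      (AE w in M. \<forall>i\<in>{1..n}. ?Y n i w \<in> Lp_space 4) \<and>
      integrable M (\<lambda>w. MAX i\<in>{1..n}. Lp_norm 4 (?Y n i w) ^ r) \<and>
      (\<integral>w. (MAX i\<in>{1..n}. Lp_norm 4 (?Y n i w) ^ r) \<partial>M) \<le> C"
  if R: "\<forall>r\<ge>R. in_Lq_Lq M (real r) \<xi>0" for R r :: nat
 proof -
  \<comment> \<open>An even exponent not below 4, r and R, so that the moment hypothesis applies to
    P and to 2 P.\<close>
  define P where "P = 2 * (R + r + 2)"
  have P: "even P" "4 \<le> P" "r \<le> P" "R \<le> P" "0 < P" "R \<le> 2 * P" "even (2 * P)" "0 < 2 * P" by (auto simp: P_def)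
  show ?thesis
   by (rule euler_max_moment[OF \<xi> T P(1-3) mom[OF R[rule_format, OF P(4)] P(1,5)] mom[OF R[rule_format, OF P(6)] P(7,8)] Zeq])
 qed
 have P3: "\<exists>C::'w => real. C \<in> borel_measurable M \<and>
      (AE w in M. \<forall>n\<ge>1. (\<forall>i\<in>{1..n}. ?Y n i w \<in> Lp_space 4) \<and>
       (MAX i\<in>{1..n}. Lp_norm 4 (?Y n i w)) \<le> C w * (T / real n) powr (- \<epsilon>))"
  if R: "\<forall>r\<ge>R. in_Lq_Lq M (real r) \<xi>0" and \<epsilon>: "0 < \<epsilon>" for R :: nat and \<epsilon> :: real
 proof -
  have m: "\<exists>C. \<forall>n\<ge>1. integrable M (\<lambda>w. MAX i\<in>{1..n}. Lp_norm 4 (?Y n i w) ^ r)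
    \<and> (\<integral>w. (MAX i\<in>{1..n}. Lp_norm 4 (?Y n i w) ^ r) \<partial>M) \<le> C" for r
   using P2[OF R, of r] by blast
  obtain C where C: "C \<in> borel_measurable M"
   "AE w in M. \<forall>n\<ge>1. (MAX i\<in>{1..n}. Lp_norm 4 (?Y n i w)) \<le> C w * (T / real n) powr (- \<epsilon>)"
   using pathwise_rate[OF T \<epsilon> _ m] Lp_norm_nonneg by blast
  \<comment> \<open>Membership for each single n is part of the moment bound with r = 1; countably
    many n share one null set.\<close>
  have "AE w in M. \<forall>n\<in>{1..}. \<forall>i\<in>{1..n}. ?Y n i w \<in> Lp_space 4"
   using P2[OF R, of 1] by (subst AE_ball_countable) (auto simp del: split_paired_All)
  with C(2) have "AE w in M. \<forall>n\<ge>1. (\<forall>i\<in>{1..n}. ?Y n i w \<in> Lp_space 4) \<and>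
       (MAX i\<in>{1..n}. Lp_norm 4 (?Y n i w)) \<le> C w * (T / real n) powr (- \<epsilon>)"
  proof eventually_elim
   case (elim w)
   show ?case
   proof (intro allI impI)
    fix n :: nat assume n: "1 \<le> n"
    then have "n \<in> {1..}" by simp
    from elim(1)[rule_format, OF n] bspec[OF elim(2) this]
    show "(\<forall>i\<in>{1..n}. ?Y n i w \<in> Lp_space 4) \<and>
       (MAX i\<in>{1..n}. Lp_norm 4 (?Y n i w)) \<le> C w * (T / real n) powr (- \<epsilon>)" by (rule conjI[rotated])
   qed
  qed
  with C(1) show ?thesis by blast
 qed
 show ?thesis by (intro conjI impI allI P1; elim exE) (erule P2, erule P3, assumption)
qed

end
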